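(* Let $\theta\in(0,\pi/2)$ and let $\Sigma_t$, $t\in[0,+\infty)$, be strictly convex capillary hypersurfaces solving the normalized capillary Gauss curvature flow, with $\mathrm{Vol}(\widehat{\Sigma_0})=\mathrm{Vol}(\widehat{\mathcal{C}_\theta})$, whose capillary support function $u(\xi,t)$ with respect to the origin is positive; that is, $u>0$ solves $$\partial_tu=u-\frac1{\det(\nabla^2(\ell u)+\ell u\,\sigma)}\ \text{ in }\mathcal{C}_\theta\times[0,+\infty),\qquad \nabla_\mu u=0\ \text{ on }\partial\mathcal{C}_\theta\times[0,+\infty),\qquad u(\cdot,0)=u_0 .$$ Then there exist positive constants $C=C(n,\Sigma_0)$ and $T_0=T_0(\Sigma_0)$ such that $$\frac1C\le u(\xi,t)\le C\qquad\text{for all }\xi\in\mathcal{C}_\theta,\ t\ge T_0 .$$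
   Context: $\mathbb{R}^{n+1}_+=\{x\in\mathbb{R}^{n+1}: x_{n+1}>0\}$, $e:=-E_{n+1}$ with $E_{n+1}$ the $(n+1)$-th coordinate vector. A capillary hypersurface with contact angle $\theta$ is a properly embedded, smooth, compact hypersurface $\Sigma\subset\overline{\mathbb{R}^{n+1}_+}$ with $\partial\Sigma\subset\partial\mathbb{R}^{n+1}_+$ such that $\langle\nu,e\rangle=-\cos\theta$ along $\partial\Sigma$, $\nu$ being the unit outward normal; it is strictly convex if all principal curvatures are positive. $\widehat\Sigma$ is the bounded closed region enclosed by $\Sigma$ and $\partial\mathbb{R}^{n+1}_+$. Unit spherical cap: $\mathcal{C}_\theta:=\{\xi\in\overline{\mathbb{R}^{n+1}_+}:|\xi-\cos\theta\, e|=1\}$ with round metric $\sigma$, Levi-Civita connection $\nabla$, and unit outward conormal $\mu$ along $\partial\mathcal{C}_\theta$; $\ell(\xi):=\sin^2\theta+\cos\theta\langle\xi,e\rangle$. The capillary support function of $\Sigma$ with respect to the origin is $u(\xi):=\ell(\xi)^{-1}\max_{X\in\Sigma}\langle\xi-\cos\theta\, e,X\rangle$; $u_0$ is that of $\Sigma_0$. The normalized capillary Gauss curvature flow is $\partial_tX=X-K\tilde\nu$ with $\langle\tilde\nu,e\rangle=0$ on the boundary, where $K$ is the Gauss curvature and $\tilde\nu=\nu+\cos\theta\, e$; equivalently, the displayed equation for $u$ (with $\nabla^2(\ell u)+\ell u\,\sigma>0$). It arises as $X(\cdot,t)=e^t\widetilde X(\cdot,\tau)$ from a solution $\widetilde X$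 of $\partial_\tau\widetilde X=-\widetilde K\tilde\nu$ that shrinks to the origin in finite time, where $t=\frac1{n+1}\log\big(\mathrm{Vol}(\widehat{\mathcal{C}_\theta})/\mathrm{Vol}(\widehat{\widetilde\Sigma_\tau})\big)$. *)

theory Defs
  imports "HOL-Analysis.Analysis"
begin

text \<open>
  The ambient space of dimension \<open>n + 1\<close> is \<open>(real ^ 'n) \<times> real\<close> with \<open>n = CARD('n)\<close>; the second
  component is the last coordinate.
\<close>

type_synonym 'n ambient = "(real ^ 'n) \<times> real"

definition evec :: "'n::finite ambient"
  where "evec = (0, -1)"

definition open_halfspace :: "'n::finite ambient set"
  where "open_halfspace = {x. snd x > 0}"

definition closed_halfspace :: "'n::finite ambient set"
  where "closed_halfspace = {x. snd x \<ge> 0}"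

definition boundary_plane :: "'n::finite ambient set"
  where "boundary_plane = {x. snd x = 0}"


subsection \<open>Smooth maps\<close>

text \<open>Meant for open \<open>U\<close>: all partial derivatives up to order \<open>k\<close> exist and are continuous.\<close>

primrec Ck_on :: "nat \<Rightarrow> 'a::euclidean_space set \<Rightarrow> ('a \<Rightarrow> 'b::euclidean_space) \<Rightarrow> bool"
  where
    "Ck_on 0 U f \<longleftrightarrow> continuous_on U f"
  | "Ck_on (Suc k) U f \<longleftrightarrow>
       (\<exists>f'. (\<forall>x\<in>U. (f has_derivative f' x) (at x)) \<and> (\<forall>v. Ck_on k U (\<lambda>x. f' x v)))"

text \<open>On an arbitrary set, smooth means locally the restriction of a \<open>C\<^sup>\<infinity>\<close> map on an open set.\<close>

definition smooth_on :: "'a::euclidean_space set \<Rightarrow> ('a \<Rightarrow> 'b::euclidean_space) \<Rightarrow> bool"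
  where "smooth_on S f \<longleftrightarrow>
    (\<forall>x\<in>S. \<exists>U g. open U \<and> x \<in> U \<and> (\<forall>k. Ck_on k U g) \<and> (\<forall>y\<in>U \<inter> S. g y = f y))"

definition smooth_diffeo_on :: "'a::euclidean_space set \<Rightarrow> ('a \<Rightarrow> 'a) \<Rightarrow> bool"
  where "smooth_diffeo_on U \<phi> \<longleftrightarrow>
    open U \<and> open (\<phi> ` U) \<and> inj_on \<phi> U \<and> smooth_on U \<phi> \<and> smooth_on (\<phi> ` U) (inv_into U \<phi>)"


subsection \<open>Embedded hypersurfaces with boundary\<close>

definition interior_points :: "'n::finite ambient set \<Rightarrow> 'n ambient set"
  where "interior_points S =
    {x \<in> S. \<exists>U \<phi>. x \<in> U \<and> smooth_diffeo_on U \<phi> \<and> \<phi> ` (U \<inter> S) = \<phi> ` U \<inter> {y. snd y = 0}}"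

definition boundary_points :: "'n::finite ambient set \<Rightarrow> 'n ambient set"
  where "boundary_points S =
    {x \<in> S. \<exists>U \<phi> k. x \<in> U \<and> smooth_diffeo_on U \<phi> \<and> fst (\<phi> x) $ k = 0 \<and>
       \<phi> ` (U \<inter> S) = \<phi> ` U \<inter> {y. snd y = 0 \<and> fst y $ k \<ge> 0}}"

definition embedded_hypersurface :: "'n::finite ambient set \<Rightarrow> bool"
  where "embedded_hypersurface S \<longleftrightarrow> S = interior_points S \<union> boundary_points S"

text \<open>
  One-sided velocities are used, and their span taken, so that at a boundary point the whole
  tangent space of the manifold with boundary results.
\<close>

definition tangent_space :: "'a::euclidean_space set \<Rightarrow> 'a \<Rightarrow> 'a set"
  where "tangent_space S x =
    span {v. \<exists>c. c 0 = x \<and> (\<forall>\<^sub>F s in at_right 0. c s \<in> S) \<and>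
                 (c has_vector_derivative v) (at (0::real) within {0..})}"

text \<open>
  Calculus of the induced metric. A derivative within \<open>S\<close> is determined on the tangent space only;
  for the gradient the representative in the tangent space is taken, and the Frechet derivatives
  below are only ever applied to tangent vectors. The Levi-Civita connection of the
  induced metric is the tangential part of the ambient derivative.
\<close>

definition grad_on :: "'a::euclidean_space set \<Rightarrow> ('a \<Rightarrow> real) \<Rightarrow> 'a \<Rightarrow> 'a"
  where "grad_on S f x =
    (THE w. w \<in> tangent_space S x \<and> (f has_derivative (\<lambda>v. w \<bullet> v)) (at x within S))"

definition cov_deriv :: "'a::euclidean_space set \<Rightarrow> ('a \<Rightarrow> 'a) \<Rightarrow> 'a \<Rightarrow> 'a \<Rightarrow> 'a"
  where "cov_deriv S V x v =
    closest_point (tangent_space S x) (frechet_derivative V (at x within S) v)"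

definition hess_on :: "'a::euclidean_space set \<Rightarrow> ('a \<Rightarrow> real) \<Rightarrow> 'a \<Rightarrow> 'a \<Rightarrow> 'a \<Rightarrow> real"
  where "hess_on S f x v w = cov_deriv S (grad_on S f) x v \<bullet> w"

text \<open>
  Determinant, with respect to the inner product, of a bilinear form on an \<open>n\<close>-dimensional
  subspace; it does not depend on the orthonormal basis chosen.
\<close>

definition orthonormal_basis :: "'n::finite ambient set \<Rightarrow> ('n \<Rightarrow> 'n ambient) \<Rightarrow> bool"
  where "orthonormal_basis T b \<longleftrightarrow>
    (\<forall>i j. b i \<bullet> b j = (if i = j then 1 else 0)) \<and> span (range b) = T"

definition det_form :: "'n::finite ambient set \<Rightarrow> ('n ambient \<Rightarrow> 'n ambient \<Rightarrow> real) \<Rightarrow> real"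
  where "det_form T B =
    (let b = (SOME b. orthonormal_basis T b) in det (\<chi> i j. B (b i) (b j)))"


subsection \<open>Capillary hypersurfaces\<close>

definition enclosed_region :: "'n::finite ambient set \<Rightarrow> 'n ambient set"
  where "enclosed_region S = closure (inside (S \<union> boundary_plane))"

text \<open>
  Outwardness is tested off the boundary plane only; along the boundary of \<open>S\<close> the
  normal is then determined by continuity.
\<close>

definition outward_unit_normal :: "'n::finite ambient set \<Rightarrow> ('n ambient \<Rightarrow> 'n ambient) \<Rightarrow> bool"
  where "outward_unit_normal S \<nu> \<longleftrightarrow>
    continuous_on S \<nu> \<and>
    (\<forall>x\<in>S. norm (\<nu> x) = 1 \<and> (\<forall>v\<in>tangent_space S x. \<nu> x \<bullet> v = 0)) \<and>
    (\<forall>x\<in>S \<inter> open_halfspace. \<forall>\<^sub>F s in at_right 0. x + s *\<^sub>R \<nu> x \<notin> enclosed_region S)"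

definition normal_of :: "'n::finite ambient set \<Rightarrow> 'n ambient \<Rightarrow> 'n ambient"
  where "normal_of S = (SOME \<nu>. outward_unit_normal S \<nu>)"

text \<open>
  Properly embedded in the closed half-space: the boundary of \<open>S\<close> is exactly where \<open>S\<close> meets the
  boundary plane. Hypersurfaces are connected, and have nonempty boundary.
\<close>

definition capillary_hypersurface :: "real \<Rightarrow> 'n::finite ambient set \<Rightarrow> bool"
  where "capillary_hypersurface \<theta> S \<longleftrightarrow>
    compact S \<and> connected S \<and> embedded_hypersurface S \<and>
    S \<subseteq> closed_halfspace \<and> boundary_points S = S \<inter> boundary_plane \<and> boundary_points S \<noteq> {} \<and>
    outward_unit_normal S (normal_of S) \<and>
    (\<forall>x\<in>boundary_points S. normal_of S x \<bullet> evec = - cos \<theta>)"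

definition shape_operator :: "'n::finite ambient set \<Rightarrow> 'n ambient \<Rightarrow> 'n ambient \<Rightarrow> 'n ambient"
  where "shape_operator S x = frechet_derivative (normal_of S) (at x within S)"

definition principal_curvature :: "'n::finite ambient set \<Rightarrow> 'n ambient \<Rightarrow> real \<Rightarrow> bool"
  where "principal_curvature S x \<kappa> \<longleftrightarrow>
    (\<exists>v\<in>tangent_space S x. v \<noteq> 0 \<and> shape_operator S x v = \<kappa> *\<^sub>R v)"

definition gauss_curvature :: "'n::finite ambient set \<Rightarrow> 'n ambient \<Rightarrow> real"
  where "gauss_curvature S x = det_form (tangent_space S x) (\<lambda>v w. shape_operator S x v \<bullet> w)"

definition strictly_convex_capillary :: "real \<Rightarrow> 'n::finite ambient set \<Rightarrow> bool"
  where "strictly_convex_capillary \<theta> S \<longleftrightarrow>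
    capillary_hypersurface \<theta> S \<and> (\<forall>x\<in>S. \<forall>\<kappa>. principal_curvature S x \<kappa> \<longrightarrow> \<kappa> > 0)"


subsection \<open>The unit spherical cap and the capillary support function\<close>

definition cap :: "real \<Rightarrow> 'n::finite ambient set"
  where "cap \<theta> = {\<xi> \<in> closed_halfspace. norm (\<xi> - cos \<theta> *\<^sub>R evec) = 1}"

definition cap_boundary :: "real \<Rightarrow> 'n::finite ambient set"
  where "cap_boundary \<theta> = cap \<theta> \<inter> boundary_plane"

text \<open>The outward direction at the boundary of the cap is the one leaving the half-space.\<close>

definition conormal :: "real \<Rightarrow> 'n::finite ambient \<Rightarrow> 'n ambient"
  where "conormal \<theta> \<xi> =
    (THE w. w \<in> tangent_space (cap \<theta>) \<xi> \<and> norm w = 1 \<and>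
            (\<forall>v\<in>tangent_space (cap_boundary \<theta>) \<xi>. w \<bullet> v = 0) \<and> w \<bullet> evec > 0)"

definition ell :: "real \<Rightarrow> 'n::finite ambient \<Rightarrow> real"
  where "ell \<theta> \<xi> = (sin \<theta>)\<^sup>2 + cos \<theta> * (\<xi> \<bullet> evec)"

definition capillary_support :: "real \<Rightarrow> 'n::finite ambient set \<Rightarrow> 'n ambient \<Rightarrow> real"
  where "capillary_support \<theta> S \<xi> = (SUP X\<in>S. (\<xi> - cos \<theta> *\<^sub>R evec) \<bullet> X) / ell \<theta> \<xi>"


subsection \<open>The normalized capillary Gauss curvature flow\<close>

definition capillary_normal :: "real \<Rightarrow> 'n::finite ambient set \<Rightarrow> 'n ambient \<Rightarrow> 'n ambient"
  where "capillary_normal \<theta> S x = normal_of S x + cos \<theta> *\<^sub>R evec"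

text \<open>
  The flow is parametrized over the initial hypersurface. The motion \<open>X\<close> is only required to be
  continuous up to \<open>t = 0\<close> and pointwise differentiable in time: smoothness in space is that of
  each \<open>\<Sigma> t\<close>.
\<close>

definition normalized_capillary_gauss_flow :: "real \<Rightarrow> (real \<Rightarrow> 'n::finite ambient set) \<Rightarrow> bool"
  where "normalized_capillary_gauss_flow \<theta> \<Sigma> \<longleftrightarrow>
    (\<forall>t\<ge>0. strictly_convex_capillary \<theta> (\<Sigma> t)) \<and>
    (\<exists>X. continuous_on (\<Sigma> 0 \<times> {0..}) (\<lambda>(p, t). X p t) \<and>
         (\<forall>p\<in>\<Sigma> 0. X p 0 = p) \<and>
         (\<forall>t\<ge>0. bij_betw (\<lambda>p. X p t) (\<Sigma> 0) (\<Sigma> t)) \<and>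
         (\<forall>p\<in>\<Sigma> 0. \<forall>t\<ge>0.
            (X p has_vector_derivative
               X p t - gauss_curvature (\<Sigma> t) (X p t) *\<^sub>R capillary_normal \<theta> (\<Sigma> t) (X p t))
            (at t within {0..}))) \<and>
    (\<forall>t\<ge>0. \<forall>x\<in>boundary_points (\<Sigma> t). capillary_normal \<theta> (\<Sigma> t) x \<bullet> evec = 0)"

definition support_form :: "real \<Rightarrow> ('n::finite ambient \<Rightarrow> real) \<Rightarrow> 'n ambient \<Rightarrow> 'n ambient \<Rightarrow> 'n ambient \<Rightarrow> real"
  where "support_form \<theta> u \<xi> v w =
    hess_on (cap \<theta>) (\<lambda>\<eta>. ell \<theta> \<eta> * u \<eta>) \<xi> v w + ell \<theta> \<xi> * u \<xi> * (v \<bullet> w)"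

text \<open>
  Solutions are smooth for positive times and continuous up to \<open>t = 0\<close>; the time derivative is
  one-sided at \<open>t = 0\<close>.
\<close>

definition solves_normalized_equation :: "real \<Rightarrow> ('n::finite ambient \<Rightarrow> real \<Rightarrow> real) \<Rightarrow> bool"
  where "solves_normalized_equation \<theta> u \<longleftrightarrow>
    continuous_on (cap \<theta> \<times> {0..}) (\<lambda>(\<xi>, t). u \<xi> t) \<and>
    smooth_on (cap \<theta> \<times> {0<..}) (\<lambda>(\<xi>, t). u \<xi> t) \<and>
    (\<forall>t\<ge>0. smooth_on (cap \<theta>) (\<lambda>\<xi>. u \<xi> t)) \<and>
    (\<forall>t\<ge>0. \<forall>\<xi>\<in>cap \<theta>. \<forall>v\<in>tangent_space (cap \<theta>) \<xi>. v \<noteq> 0 \<longrightarrow>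
        support_form \<theta> (\<lambda>\<eta>. u \<eta> t) \<xi> v v > 0) \<and>
    (\<forall>t\<ge>0. \<forall>\<xi>\<in>cap \<theta>.
        (u \<xi> has_real_derivative
           u \<xi> t - 1 / det_form (tangent_space (cap \<theta>) \<xi>) (support_form \<theta> (\<lambda>\<eta>. u \<eta> t) \<xi>))
        (at t within {0..})) \<and>
    (\<forall>t\<ge>0. \<forall>\<xi>\<in>cap_boundary \<theta>. grad_on (cap \<theta>) (\<lambda>\<eta>. u \<eta> t) \<xi> \<bullet> conormal \<theta> \<xi> = 0)"

end

(*
Write a unit normal of the cap as Y / |Y| with Y = (y, 1). Then y runs over the ball of radius
R = tan theta, the support function of the hypersurface becomes H(y, t) = |Y| ell u, and the flow
becomes dH/dt = H - rho(y) / det D^2 H with the boundary condition y . DH = H on |y| = R, for a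
rotationally symmetric weight rho. The volume stays equal to the total mass of rho divided by n + 1.

Since rho^2 / (L det) >= 2 rho - L det, with L = H - z . y, and int L det D^2 H is the constant volume
times n + 1, the entropy F(z, t) = int rho ln(H(y, t) - z . y) dy does not increase along z exp(t), while a slab of width w about a midpoint of two admissible centres bounds the maximal
entropy below by ln w up to constants. This bounds the diameter, hence H and DH from above.
A centre that stays admissible up to a late time has drifted from near the origin, so the origin
almost maximizes the entropy. If H came close to zero at some boundary point R u, then a limit profile
g would vanish there; the first variation of the entropy at the origin and the reflection in the
hyperplane orthogonal to u, for which g(reflected y) >= g(y), give opposite signs.

The constants depend only on the initial hypersurface because a comparison principle for the flow
makes H unique.
*)
theory Submission
  imports Defs "HOL-Complex_Analysis.Great_Picard" "HOL-Real_Asymp.Real_Asymp"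
begin

text \<open>No estimate uniform in time is given for derivatives of a solution, so every bound must
  come from \<open>H\<close>, its gradient and the geometry of \<open>body R H\<close>. Volume
  identities rest on a change of variables: the contact points of a strictly decreasing family of
  support functions sweep the difference of two bodies once, and for \<open>exp (- t) * H\<close>
  along the flow the Jacobian is a function of time times one of \<open>y\<close>. The same sweep of
  a shrinking homothety gives the cone formula about any centre. The limit profile \<open>g\<close>
  is only Lipschitz and \<open>1 / g\<close> need not be integrable, so the first variation uses
  \<open>g + \<eta>\<close>; the error vanishes with \<open>\<eta>\<close> because the entropy at
  the origin stays bounded below. The boundary condition says that contact points of the rim
  \<open>norm y = R\<close> lie in the boundary plane. Hence the body projects onto its bottom face,
  whose size controls the gradient, and the maximum principle treats rim points like interior
  ones.\<close>

section \<open>Block determinants\<close>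

text \<open>The library's change of variables for \<open>real ^ 'n\<close> needs a well-ordered index type.\<close>

typedef (overloaded) ('a::finite) wo = "{..<CARD('a)}"
  by (auto intro!: exI[of _ 0])

instantiation wo :: (finite) linorder
begin
definition "x \<le> y \<longleftrightarrow> Rep_wo x \<le> Rep_wo y"
definition "x < y \<longleftrightarrow> Rep_wo x < Rep_wo y"
instance
  by standard (auto simp: less_eq_wo_def less_wo_def Rep_wo_inject)
end

instance wo :: (finite) wellorder
proof
  fix P :: "'a wo \<Rightarrow> bool" and a :: "'a wo"
  assume *: "\<And>x. (\<And>y. y < x \<Longrightarrow> P y) \<Longrightarrow> P x"
  show "P a"
  proof (induction "Rep_wo a" arbitrary: a rule: less_induct)
    case less
    then show ?case using * by (metis less_wo_def)
  qed
qed

instance wo :: (finite) finite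
proof
  have "(UNIV :: 'a wo set) = Abs_wo ` {..<CARD('a)}"
    by (simp add: type_definition.Abs_image[OF type_definition_wo])
  then show "finite (UNIV :: 'a wo set)" by (metis finite_imageI finite_lessThan)
qed

lemma card_wo: "CARD('a::finite wo) = CARD('a)"
  using type_definition.card[OF type_definition_wo] by simp

lemma ex_bij_wo: "\<exists>g::'a::finite \<Rightarrow> 'a wo. bij g"
  by (simp add: finite_same_card_bij card_wo)

lemma permutes_UNIV_iff: "p permutes UNIV \<longleftrightarrow> bij p"
  by (auto intro: permutes_bij bij_imp_permutes)

text \<open>Relabelling carries transpositions to transpositions, so a word of transpositions for
  \<open>p\<close> gives one of the same length for its conjugate.\<close>

lemma sign_conj:
  assumes f: "bij (f :: 'a \<Rightarrow> 'b)" and p: "permutation p"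
  shows "sign (f \<circ> p \<circ> inv f) = sign p"
proof -
  have *: "swapidseq n p \<Longrightarrow> swapidseq n (f \<circ> p \<circ> inv f)" for n p
  proof (induction rule: swapidseq.induct)
    case id
    have "f \<circ> id \<circ> inv f = id" using f by (metis bij_is_surj comp_id surj_iff)
    then show ?case by (metis swapidseq.id)
  next
    case (comp_Suc n p a b)
    have "f \<circ> (Transposition.transpose a b \<circ> p) \<circ> inv f
        = Transposition.transpose (f a) (f b) \<circ> (f \<circ> p \<circ> inv f)"
      using f by (auto simp: fun_eq_iff Transposition.transpose_def bij_is_inj inj_eq)
    then show ?case
      using comp_Suc f by (metis bij_is_inj inj_eq swapidseq.comp_Suc)
  qed
  obtain n where n: "swapidseq n p" using p by (auto simp: permutation_def)
  show ?thesis
    unfolding sign_def using evenperm_unique[OF n refl] evenperm_unique[OF *[OF n] refl] by simp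
qed

text \<open>Conjugation by \<open>f\<close> matches the permutations of the two Leibniz sums and
  keeps signs and products. It moves Jacobians to and from a well-ordered index type.\<close>

lemma det_reindex:
  fixes M :: "real^'a^'a" and f :: "'b::finite \<Rightarrow> 'a::finite"
  assumes f: "bij f"
  shows "det (\<chi> i j. M $ f i $ f j) = det M"
proof -
  have i: "inv f (f x) = x" "f (inv f y) = y" for x y
    using f by (auto simp: bij_is_inj bij_is_surj surj_f_inv_f)
  let ?c = "\<lambda>p. inv f \<circ> p \<circ> f"
  have bp: "bij_betw ?c {p. p permutes UNIV} {p. p permutes (UNIV::'b set)}"
  proof (rule bij_betwI[where g = "\<lambda>p. f \<circ> p \<circ> inv f"])
    show "?c \<in> {p. p permutes UNIV} \<rightarrow> {p. p permutes (UNIV::'b set)}"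
      using f by (auto simp: permutes_UNIV_iff intro!: bij_comp bij_imp_bij_inv)
    show "(\<lambda>p. f \<circ> p \<circ> inv f) \<in> {p. p permutes (UNIV::'b set)} \<rightarrow> {p. p permutes UNIV}"
      using f by (auto simp: permutes_UNIV_iff intro!: bij_comp bij_imp_bij_inv)
  qed (auto simp: i fun_eq_iff)
  have *: "of_int (sign (?c p)) * (\<Prod>i\<in>UNIV. M $ f i $ f (?c p i)) = of_int (sign p) * (\<Prod>i\<in>UNIV. M $ i $ p i)"
    if "p permutes UNIV" for p
  proof -
    have "permutation p" using that by (auto simp: permutation_permutes)
    from sign_conj[OF bij_imp_bij_inv[OF f] this] have "sign (?c p) = sign p"
      using f by (simp add: inv_inv_eq)
    moreover have "(\<Prod>i\<in>UNIV. M $ f i $ f (?c p i)) = (\<Prod>i\<in>UNIV. M $ i $ p i)"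
      using prod.reindex_bij_betw[of f UNIV UNIV "\<lambda>i. M $ i $ p i"] f by (simp add: i)
    ultimately show ?thesis by simp
  qed
  have "det M = (\<Sum>p | p permutes UNIV. of_int (sign p) * (\<Prod>i\<in>UNIV. M $ i $ p i))"
    by (simp add: det_def)
  also have "\<dots> = (\<Sum>p | p permutes UNIV. of_int (sign (?c p)) * (\<Prod>i\<in>UNIV. M $ f i $ f (?c p i)))"
    using * by (intro sum.cong) auto
  also have "\<dots> = (\<Sum>p | p permutes (UNIV::'b set). of_int (sign p) * (\<Prod>i\<in>UNIV. M $ f i $ f (p i)))"
    by (rule sum.reindex_bij_betw[OF bp])
  finally show ?thesis by (simp add: det_def)
qed

definition option_block :: "real^'n^'n \<Rightarrow> real \<Rightarrow> real^('n::finite option)^('n option)"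
  where "option_block A g = (\<chi> i j. case (i, j) of (Some i, Some j) \<Rightarrow> A $ i $ j | (None, None) \<Rightarrow> g | _ \<Rightarrow> 0)"

lemma prod_option: "(\<Prod>i\<in>(UNIV::'n::finite option set). f i) = f None * (\<Prod>i\<in>UNIV. f (Some i))" for f :: "_ \<Rightarrow> real"
  by (simp add: UNIV_option_conv prod.reindex)

lemma sum_option: "(\<Sum>i\<in>(UNIV::'n::finite option set). f i) = f None + (\<Sum>i\<in>UNIV. f (Some i))" for f :: "_ \<Rightarrow> real"
  by (simp add: UNIV_option_conv sum.reindex)

text \<open>A decomposition of \<open>p\<close> into transpositions lifts to the \<open>Some\<close>
  points, with \<open>None\<close> fixed throughout.\<close>

lemma sign_map_option:
  assumes "permutation p" shows "sign (map_option p) = sign p"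
proof -
  have *: "swapidseq n p \<Longrightarrow> swapidseq n (map_option p)" for n and p :: "'a \<Rightarrow> 'a"
  proof (induction rule: swapidseq.induct)
    case id
    have "map_option id = (id :: 'a option \<Rightarrow> _)" by (rule option.map_id0)
    then show ?case by (metis swapidseq.id)
  next
    case (comp_Suc n p a b)
    have "map_option (Transposition.transpose a b \<circ> p)
        = Transposition.transpose (Some a) (Some b) \<circ> map_option p"
      by (auto simp: fun_eq_iff Transposition.transpose_def map_option_case split: option.splits)
    then show ?case
      using comp_Suc by (metis option.inject swapidseq.comp_Suc)
  qed
  obtain n where n: "swapidseq n p" using assms by (auto simp: permutation_def)
  show ?thesis
    unfolding sign_def using evenperm_unique[OF n refl] evenperm_unique[OF *[OF n] refl] by simp
qed

text \<open>Leibniz permutations that move \<open>None\<close> meet a zero entry; the others are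
  exactly the \<open>map_option q\<close>, with the sign of \<open>q\<close>.\<close>

lemma det_option_block: "det (option_block A g) = g * det (A :: real^'n::finite^'n)"
proof -
  let ?P = "{p. p permutes (UNIV::'n option set)}" and ?Q = "{p. p permutes (UNIV::'n set)}"
  let ?t = "\<lambda>p. of_int (sign p) * (\<Prod>i\<in>UNIV. option_block A g $ i $ p i)"
  have inj: "inj_on map_option ?Q"
    proof (rule inj_onI)
    fix p q :: "'n \<Rightarrow> 'n" assume "map_option p = map_option q"
    then have "map_option p (Some x) = map_option q (Some x)" for x by simp
    then show "p = q" by (simp add: fun_eq_iff)
  qed
  have sub: "map_option ` ?Q \<subseteq> ?P"
  proof
    fix r assume "r \<in> map_option ` ?Q"
    then obtain p where p: "r = map_option p" "bij p" by (auto simp: permutes_UNIV_iff)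
    have "bij r"
      unfolding p(1)
    proof (rule o_bij)
      show "map_option (inv p) \<circ> map_option p = id" "map_option p \<circ> map_option (inv p) = id"
        using p(2) by (auto simp: fun_eq_iff map_option_case bij_is_inj bij_is_surj surj_f_inv_f split: option.splits)
    qed
    then show "r \<in> ?P" by (simp add: permutes_UNIV_iff)
  qed
  have zero: "?t p = 0" if "p \<in> ?P - map_option ` ?Q" for p
  proof -
    have p: "bij p" using that by (auto simp: permutes_UNIV_iff)
    have "p None \<noteq> None"
    proof
      assume n: "p None = None"
      define q where "q = (\<lambda>i. the (p (Some i)))"
      have q: "p (Some i) = Some (q i)" for i
        using p n by (metis bij_is_inj injD option.collapse option.distinct(1) q_def)
      have "p = map_option q" using n q by (auto simp: fun_eq_iff map_option_case split: option.splits)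
      moreover have "bij q"
      proof (rule bijI)
        show "inj q" using p q by (metis bij_is_inj injD injI option.inject)
        show "surj q" 
        proof -
          have "\<exists>x. y = q x" for y
          proof -
            obtain z where "p z = Some y" using p by (metis bij_is_surj surjD)
            then show ?thesis using n q by (cases z) auto
          qed
          then show ?thesis by (simp add: surj_def)
        qed
      qed
      then have "q permutes UNIV" by (simp add: permutes_UNIV_iff)
      ultimately show False using that by blast
    qed
    then have "option_block A g $ None $ p None = 0"
      by (auto simp: option_block_def split: option.splits)
    then show ?thesis by (simp add: prod_option)
  qed
  have "det (option_block A g) = (\<Sum>p\<in>?P. ?t p)" by (simp add: det_def)
  also have "\<dots> = (\<Sum>p\<in>map_option ` ?Q. ?t p)"
    using zero sub by (intro sum.mono_neutral_right) (auto simp: finite_permutations)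
  also have "\<dots> = (\<Sum>p\<in>?Q. ?t (map_option p))" by (rule sum.reindex[OF inj, unfolded o_def])
  also have "\<dots> = (\<Sum>p\<in>?Q. g * (of_int (sign p) * (\<Prod>i\<in>UNIV. A $ i $ p i)))"
  proof (rule sum.cong[OF refl])
    fix p assume p: "p \<in> ?Q"
    have "permutation p" using p by (auto simp: permutation_permutes)
    then show "?t (map_option p) = g * (of_int (sign p) * (\<Prod>i\<in>UNIV. A $ i $ p i))"
      by (simp add: sign_map_option prod_option option_block_def)
  qed
  finally show ?thesis by (simp add: det_def sum_distrib_left)
qed

section \<open>Linear change of variables\<close>

text \<open>Such a map only relabels coordinates, so boxes pull back to boxes with the same side
  lengths, and boxes determine the measure.\<close>

lemma lborel_distr_basis:
  fixes \<Psi> :: "'a::euclidean_space \<Rightarrow> 'b::euclidean_space"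
  assumes lin: "linear \<Psi>" and bas: "bij_betw \<Psi> Basis Basis"
  shows "distr lborel borel \<Psi> = lborel"
proof (rule lborel_eqI[symmetric])
  have inn: "\<Psi> x \<bullet> \<Psi> b = x \<bullet> b" if "b \<in> Basis" for x b
  proof -
    have "\<Psi> x = (\<Sum>c\<in>Basis. (x \<bullet> c) *\<^sub>R \<Psi> c)"
      by (subst euclidean_representation[of x, symmetric]) (simp add: linear_sum[OF lin] linear_cmul[OF lin])
    then have "\<Psi> x \<bullet> \<Psi> b = (\<Sum>c\<in>Basis. (x \<bullet> c) * (\<Psi> c \<bullet> \<Psi> b))" by (simp add: inner_sum_left)
    also have "\<dots> = (\<Sum>c\<in>Basis. if c = b then x \<bullet> c else 0)"
    proof (rule sum.cong[OF refl])
      fix c :: 'a assume "c \<in> Basis"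
      then show "(x \<bullet> c) * (\<Psi> c \<bullet> \<Psi> b) = (if c = b then x \<bullet> c else 0)"
        using bas that bij_betw_apply[OF bas, of c] bij_betw_apply[OF bas, of b]
        by (auto simp: inner_Basis bij_betw_def dest: inj_onD)
    qed
    finally show ?thesis using that by simp
  qed
  fix l u :: 'b
  assume le: "\<And>b. b \<in> Basis \<Longrightarrow> l \<bullet> b \<le> u \<bullet> b"
  define l' u' where "l' = (\<Sum>b\<in>Basis. (l \<bullet> \<Psi> b) *\<^sub>R b)" "u' = (\<Sum>b\<in>Basis. (u \<bullet> \<Psi> b) *\<^sub>R b)"
  have B: "\<Psi> ` Basis = Basis" using bas by (simp add: bij_betw_def)
  have "\<Psi> -` box l u = box l' u'"
    unfolding box_def l'_u'_def B[symmetric] by (auto simp: inn)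
  moreover have "\<Psi> \<in> borel_measurable borel"
    using lin by (intro borel_measurable_continuous_onI linear_continuous_on) (simp add: linear_conv_bounded_linear)
  ultimately have "emeasure (distr lborel borel \<Psi>) (box l u) = emeasure lborel (box l' u')"
    by (simp add: emeasure_distr)
  also have "\<dots> = (\<Prod>b\<in>Basis. (u' - l') \<bullet> b)"
    using le B by (subst emeasure_lborel_box) (auto simp: l'_u'_def)
  also have "\<dots> = (\<Prod>b\<in>Basis. (u - l) \<bullet> \<Psi> b)"
    by (intro arg_cong[where f = ennreal] prod.cong) (auto simp: l'_u'_def inner_diff_left)
  also have "\<dots> = (\<Prod>b\<in>Basis. (u - l) \<bullet> b)"
    by (intro arg_cong[where f = ennreal] prod.reindex_bij_betw[OF bas])
  finally show "emeasure (distr lborel borel \<Psi>) (box l u) = (\<Prod>b\<in>Basis. (u - l) \<bullet> b)" .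
qed simp

text \<open>The change of variables below yields Lebesgue measurable images, so the invariance has
  to be carried over to the completed measure.\<close>

lemma lebesgue_distr_eq:
  fixes \<Psi> :: "'a::euclidean_space \<Rightarrow> 'b::euclidean_space"
  assumes d: "distr lborel borel \<Psi> = lborel" and m: "\<Psi> \<in> borel_measurable borel"
  shows "distr lebesgue lebesgue \<Psi> = lebesgue" "\<Psi> \<in> lebesgue \<rightarrow>\<^sub>M lebesgue"
proof -
  have m': "\<Psi> \<in> lebesgue \<rightarrow>\<^sub>M lborel" using m by (simp add: measurable_completion)
  have d': "distr lebesgue lborel \<Psi> = lborel"
    using d m by (simp add: distr_completion cong: distr_cong)
  show "distr lebesgue lebesgue \<Psi> = lebesgue"
    using completion.completion_distr_eq[OF m'] d' by simp
  show "\<Psi> \<in> lebesgue \<rightarrow>\<^sub>M lebesgue"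
    using completion.measurable_completion2[OF m'] d' by simp
qed

lemma det_row_shear:
  fixes p :: "real^'n::finite"
  shows "det (\<chi> i j. (if i = j then 1 else 0) + (case (i, j) of (None, Some k) \<Rightarrow> p $ k | _ \<Rightarrow> 0) :: real^('n option)^('n option)) = 1"
proof -
  let ?I = "mat 1 :: real^('n option)^('n option)"
  define x where "x = (\<Sum>k\<in>UNIV. p $ k *\<^sub>R row (Some k) ?I)"
  have "x \<in> span {row j ?I | j. j \<noteq> None}"
    unfolding x_def by (intro span_sum span_scale span_base) blast
  then have "det (\<chi> k. if k = None then row None ?I + x else row k ?I) = 1"
    using det_row_span[of x ?I None] by (simp add: span_vec_eq)
  moreover have "(\<chi> k. if k = None then row None ?I + x else row k ?I)
     = (\<chi> i j. (if i = j then 1 else 0) + (case (i, j) of (None, Some k) \<Rightarrow> p $ k | _ \<Rightarrow> 0))"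
    by (auto simp: vec_eq_iff x_def row_def mat_def sum_component if_distrib cong: if_cong split: option.split)
  ultimately show ?thesis by simp
qed

text \<open>The matrix factors into two shears of determinant 1 and the blocks
  \<open>diag(1, c)\<close> and \<open>diag(A, 1)\<close>. It is the Jacobian of a contact-point
  map.\<close>

lemma det_shear_block:
  fixes A :: "real^'n::finite^'n"
  shows "det (\<chi> i j. case (i, j) of
            (Some i, Some j) \<Rightarrow> A $ i $ j | (Some i, None) \<Rightarrow> a $ i
          | (None, Some j) \<Rightarrow> - (\<Sum>k\<in>UNIV. p $ k * A $ k $ j)
          | (None, None) \<Rightarrow> c - (\<Sum>k\<in>UNIV. p $ k * a $ k)) = c * det A" (is "det ?N = _")
proof -
  define L :: "real^('n option)^('n option)" where
    "L = (\<chi> i j. (if i = j then 1 else 0) + (case (i, j) of (None, Some k) \<Rightarrow> (- p) $ k | _ \<Rightarrow> 0))"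
  define U :: "real^('n option)^('n option)" where
    "U = transpose (\<chi> i j. (if i = j then 1 else 0) + (case (i, j) of (None, Some k) \<Rightarrow> a $ k | _ \<Rightarrow> 0))"
  have "?N = L ** (option_block (mat 1) c ** (U ** option_block A 1))"
    by (auto simp: vec_eq_iff L_def U_def matrix_matrix_mult_def option_block_def sum_option mat_def transpose_def
          if_distrib if_distribR sum.delta sum_negf cong: if_cong split: option.split)
  moreover have "det L = 1" "det U = 1"
    unfolding L_def U_def det_transpose by (rule det_row_shear)+
  ultimately show ?thesis by (simp add: det_mul det_option_block)
qed

lemma set_integrable_lborel_distr:
  fixes \<Psi> :: "'a::euclidean_space \<Rightarrow> 'b::euclidean_space" and f :: "'b \<Rightarrow> real"
  assumes d: "distr lborel borel \<Psi> = lborel" and m: "\<Psi> \<in> borel_measurable borel"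
    and f: "integrable lborel f"
  shows "integrable lborel (\<lambda>x. f (\<Psi> x))" "(LINT x|lborel. f (\<Psi> x)) = (LINT x|lborel. f x)"
proof -
  have f': "integrable (distr lborel borel \<Psi>) f" using f d by simp
  show "integrable lborel (\<lambda>x. f (\<Psi> x))" using integrable_distr[OF _ f'] m by simp
  show "(LINT x|lborel. f (\<Psi> x)) = (LINT x|lborel. f x)"
    using integral_distr[of \<Psi> lborel borel f] m f d by (simp add: borel_measurable_integrable)
qed

text \<open>The derivative has the shape occurring for contact points: the last component changes by
  \<open>c x * s\<close> minus \<open>p x\<close> paired with the change of the first. By
  \<open>det_shear_block\<close> its determinant is \<open>c x * det (A x)\<close>, and injectivity
  turns the change-of-variables integral into the measure of the image.\<close>

lemma measure_shear_image:
  fixes g :: "(real^'n::finite) \<times> real \<Rightarrow> (real^'n) \<times> real"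
  assumes S: "S \<in> sets borel"
    and der: "\<And>x. x \<in> S \<Longrightarrow> (g has_derivative (\<lambda>(v, s). (A x *v v + s *\<^sub>R a x, c x * s - p x \<bullet> (A x *v v + s *\<^sub>R a x)))) (at x within S)"
    and inj: "inj_on g S"
    and int: "integrable lborel (\<lambda>x. indicator S x * \<bar>c x * det (A x)\<bar>)"
  shows "g ` S \<in> lmeasurable" "measure lebesgue (g ` S) = (LINT x|lborel. indicator S x * \<bar>c x * det (A x)\<bar>)"
proof -
  obtain h :: "'n option \<Rightarrow> 'n option wo" where h: "bij h" using ex_bij_wo by blast
  define k where "k = inv h"
  have hk: "k (h i) = i" "h (k j) = j" for i j
    using h by (auto simp: k_def bij_is_inj bij_is_surj surj_f_inv_f)
  have heq: "h i = h j \<longleftrightarrow> i = j" for i j by (metis hk(1))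
  \<comment> \<open>\<open>\<Psi>\<close> and its inverse \<open>\<Phi>\<close> only relabel
    coordinates; the extra index \<open>None\<close> carries the last component.\<close>
  define \<Psi> :: "real^('n option wo) \<Rightarrow> (real^'n) \<times> real" where "\<Psi> = (\<lambda>x. (\<chi> i. x $ h (Some i), x $ h None))"
  define \<Phi> :: "(real^'n) \<times> real \<Rightarrow> real^('n option wo)" where
    "\<Phi> = (\<lambda>(v, s). \<chi> j. case k j of Some i \<Rightarrow> v $ i | None \<Rightarrow> s)"
  have \<Phi>h: "\<Phi> (v, s) $ h i = (case i of Some i \<Rightarrow> v $ i | None \<Rightarrow> s)" for v s i by (simp add: \<Phi>_def hk)
  have PP: "\<Psi> (\<Phi> x) = x" for x by (cases x) (simp add: \<Psi>_def \<Phi>h vec_eq_iff)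
  have all_h: "(\<forall>j. P j) \<longleftrightarrow> (\<forall>i. P (h i))" for P by (metis hk(2))
  have PP': "\<Phi> (\<Psi> x) = x" for x
    unfolding vec_eq_iff by (subst all_h) (auto simp: \<Psi>_def \<Phi>h split: option.split)
  have lP: "linear \<Psi>" by (rule linearI) (auto simp: \<Psi>_def vec_eq_iff)
  have lF: "linear \<Phi>"
    by (rule linearI) (auto simp: \<Phi>_def vec_eq_iff split: option.split prod.splits)
  have ax: "\<Psi> (axis (h i) 1) = (case i of Some i \<Rightarrow> (axis i 1, 0) | None \<Rightarrow> (0, 1))" for i
    by (auto simp: \<Psi>_def vec_eq_iff axis_def heq split: option.split)
  have bas: "bij_betw \<Psi> Basis Basis"
  proof -
    have "\<Psi> ` Basis = \<Psi> ` (\<lambda>i. axis (h i) 1) ` UNIV"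
      using hk(2) by (auto simp: Basis_vec_def image_iff) (metis hk(2))
    also have "\<dots> = Basis"
      by (auto simp: ax image_image Basis_prod_def Basis_vec_def UNIV_option_conv)
    finally show ?thesis
      using PP' by (simp add: bij_betw_def inj_on_def) (metis PP')
  qed
  have dist: "distr lborel borel \<Psi> = lborel" by (rule lborel_distr_basis[OF lP bas])
  have bP: "bounded_linear \<Psi>" "bounded_linear \<Phi>" using lP lF by (simp_all add: linear_conv_bounded_linear)
  have mP: "\<Psi> \<in> borel_measurable borel"
    using bP by (intro borel_measurable_continuous_onI linear_continuous_on)
  define S' where "S' = \<Phi> ` S"
  have S'_eq: "S' = \<Psi> -` S" unfolding S'_def using PP PP' by (auto simp: image_iff) (metis PP')
  have "S' \<in> sets borel" using measurable_sets[OF mP S] by (simp add: S'_eq)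
  then have S'l: "S' \<in> sets lebesgue" by simp
  let ?f = "\<Phi> \<circ> g \<circ> \<Psi>"
  define L where "L = (\<lambda>x (v, s). (A x *v v + s *\<^sub>R a x, c x * s - p x \<bullet> (A x *v v + s *\<^sub>R a x)))"
  define f' where "f' = (\<lambda>x. \<Phi> \<circ> L (\<Psi> x) \<circ> \<Psi>)"
  have derf: "(?f has_derivative f' x) (at x within S')" if "x \<in> S'" for x
  proof -
    have "(g has_derivative L (\<Psi> x)) (at (\<Psi> x) within \<Psi> ` S')"
      using der[of "\<Psi> x"] that by (auto simp: S'_eq L_def intro: has_derivative_subset)
    then have "((g \<circ> \<Psi>) has_derivative (L (\<Psi> x) \<circ> \<Psi>)) (at x within S')"
      by (rule diff_chain_within[OF bounded_linear_imp_has_derivative[OF bP(1)]])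
    then have "((\<lambda>y. \<Phi> ((g \<circ> \<Psi>) y)) has_derivative (\<lambda>y. \<Phi> ((L (\<Psi> x) \<circ> \<Psi>) y))) (at x within S')"
      by (rule bounded_linear.has_derivative[OF bP(2)])
    then show ?thesis by (simp add: f'_def o_def)
  qed
  have injf: "inj_on ?f S'"
  proof (rule inj_onI)
    fix x y assume xy: "x \<in> S'" "y \<in> S'" "?f x = ?f y"
    have "g (\<Psi> x) = g (\<Psi> y)" using xy(3) PP by (metis comp_apply)
    then have "\<Psi> x = \<Psi> y" using inj xy by (auto simp: S'_eq inj_on_def)
    then show "x = y" by (metis PP')
  qed
  have axs: "(\<Sum>i\<in>UNIV. B i * axis k (1::real) $ i) = B k" for B and k :: 'n
    by (simp add: axis_def if_distrib cong: if_cong)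
  have detf: "det (matrix (f' x)) = c (\<Psi> x) * det (A (\<Psi> x))" for x
  proof -
    have "det (matrix (f' x)) = det (\<chi> i j. matrix (f' x) $ h i $ h j)" by (rule det_reindex[OF h, symmetric])
    also have "(\<chi> i j. matrix (f' x) $ h i $ h j) = (\<chi> i j. case (i, j) of
            (Some i, Some j) \<Rightarrow> A (\<Psi> x) $ i $ j | (Some i, None) \<Rightarrow> a (\<Psi> x) $ i
          | (None, Some j) \<Rightarrow> - (\<Sum>k\<in>UNIV. p (\<Psi> x) $ k * A (\<Psi> x) $ k $ j)
          | (None, None) \<Rightarrow> c (\<Psi> x) - (\<Sum>k\<in>UNIV. p (\<Psi> x) $ k * a (\<Psi> x) $ k))"
      by (auto simp: vec_eq_iff matrix_def f'_def L_def ax \<Phi>h inner_vec_def matrix_vector_mul_component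
          matrix_vector_mult_basis column_def axs split: option.split)
    finally show ?thesis by (simp only: det_shear_block)
  qed
  define m where "m = (LINT x|lborel. indicator S x * \<bar>c x * det (A x)\<bar>)"
  have "integrable lborel (\<lambda>x. indicator S (\<Psi> x) * \<bar>c (\<Psi> x) * det (A (\<Psi> x))\<bar>)"
    and "(LINT x|lborel. indicator S (\<Psi> x) * \<bar>c (\<Psi> x) * det (A (\<Psi> x))\<bar>) = m"
    using set_integrable_lborel_distr[OF dist mP int] by (simp_all add: m_def)
  then have "((\<lambda>x. indicator S (\<Psi> x) * \<bar>c (\<Psi> x) * det (A (\<Psi> x))\<bar>) has_integral m) UNIV"
    using has_integral_integral_lborel by force
  also have "(\<lambda>x. indicator S (\<Psi> x) * \<bar>c (\<Psi> x) * det (A (\<Psi> x))\<bar>)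
      = (\<lambda>x. if x \<in> S' then \<bar>det (matrix (f' x))\<bar> else 0)"
    by (auto simp: fun_eq_iff detf S'_eq)
  finally have "((\<lambda>x. \<bar>det (matrix (f' x))\<bar>) has_integral m) S'"
    by (simp only: has_integral_restrict_UNIV)
  then have *: "?f ` S' \<in> lmeasurable \<and> measure lebesgue (?f ` S') = m"
    using has_measure_differentiable_image[OF S'l derf injf] by blast
  note leb = lebesgue_distr_eq[OF dist mP]
  have im: "?f ` S' = \<Psi> -` (g ` S)"
  proof -
    have "\<Psi> ` S' = S" unfolding S'_def using PP by (auto simp: image_image)
    then have "?f ` S' = \<Phi> ` g ` S" by (metis image_comp)
    also have "\<dots> = \<Psi> -` (g ` S)" using PP PP' by (auto simp: image_iff) (metis PP')+
    finally show ?thesis .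
  qed
  have meas\<Phi>: "distr lborel borel \<Phi> = lborel"
  proof (rule lborel_distr_basis[OF lF])
    have "\<Phi> ` Basis = \<Phi> ` \<Psi> ` Basis" using bas by (simp add: bij_betw_def)
    also have "\<dots> = Basis" using PP' by (simp add: image_image)
    finally show "bij_betw \<Phi> Basis Basis" using PP by (simp add: bij_betw_def inj_on_def) (metis PP)
  qed
  have mF: "\<Phi> \<in> borel_measurable borel"
    using bP by (intro borel_measurable_continuous_onI linear_continuous_on)
  \<comment> \<open>The set known to be measurable is the preimage of the image under
    \<open>\<Psi>\<close>, so measurability is pulled back once more along
    \<open>\<Phi>\<close>.\<close>
  have gS: "g ` S \<in> sets lebesgue"
  proof -
    have "\<Phi> -` (\<Psi> -` (g ` S)) \<in> sets lebesgue"
      using measurable_sets[OF lebesgue_distr_eq(2)[OF meas\<Phi> mF], of "\<Psi> -` (g ` S)"] * im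
      by (auto simp: fmeasurable_def)
    moreover have "\<Phi> -` (\<Psi> -` (g ` S)) = g ` S" using PP by (auto simp: vimage_def)
    ultimately show ?thesis by simp
  qed
  have "emeasure lebesgue (g ` S) = emeasure (distr lebesgue lebesgue \<Psi>) (g ` S)" using leb by simp
  also have "\<dots> = emeasure lebesgue (\<Psi> -` (g ` S))"
    using gS leb(2) by (simp add: emeasure_distr)
  finally have e: "emeasure lebesgue (g ` S) = emeasure lebesgue (?f ` S')" using im by simp
  then show "g ` S \<in> lmeasurable" using * gS by (auto simp: fmeasurable_def)
  show "measure lebesgue (g ` S) = (LINT x|lborel. indicator S x * \<bar>c x * det (A x)\<bar>)"
    using e * by (simp add: measure_def m_def)
qed

text \<open>Conjugation by a relabelling of coordinates turns \<open>T\<close> into an orthogonal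
  map over a well-ordered index type, where images of boxes keep their measure.\<close>

lemma lborel_distr_orthogonal:
  fixes T :: "real^'n::finite \<Rightarrow> real^'n"
  assumes T: "orthogonal_transformation T"
  shows "distr lborel borel T = lborel"
proof -
  obtain h :: "'n \<Rightarrow> 'n wo" where h: "bij h" using ex_bij_wo by blast
  define k where "k = inv h"
  have hk: "k (h i) = i" "h (k j) = j" for i j
    using h by (auto simp: k_def bij_is_inj bij_is_surj surj_f_inv_f)
  have heq: "h i = h j \<longleftrightarrow> i = j" for i j by (metis hk(1))
  define \<Psi> :: "real^('n wo) \<Rightarrow> real^'n" where "\<Psi> = (\<lambda>x. \<chi> i. x $ h i)"
  define \<Phi> :: "real^'n \<Rightarrow> real^('n wo)" where "\<Phi> = (\<lambda>x. \<chi> i. x $ k i)"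
  have PP: "\<Psi> (\<Phi> x) = x" "\<Phi> (\<Psi> y) = y" for x y by (simp_all add: \<Psi>_def \<Phi>_def hk)
  have lP: "linear \<Psi>" "linear \<Phi>" by (auto intro!: linearI simp: \<Psi>_def \<Phi>_def vec_eq_iff)
  have ax: "\<Psi> (axis (h i) 1) = axis i 1" for i
    by (auto simp: \<Psi>_def vec_eq_iff axis_def heq)
  have bas: "bij_betw \<Psi> Basis Basis"
  proof -
    have "\<Psi> ` Basis = \<Psi> ` (\<lambda>i. axis (h i) 1) ` UNIV"
      using hk(2) by (auto simp: Basis_vec_def image_iff) (metis hk(2))
    also have "\<dots> = Basis"
      by (auto simp: ax image_image Basis_vec_def)
    finally show ?thesis
      using PP by (simp add: bij_betw_def inj_on_def) (metis PP(2))
  qed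
  have dist: "distr lborel borel \<Psi> = lborel" by (rule lborel_distr_basis[OF lP(1) bas])
  have bP: "bounded_linear \<Psi>" "bounded_linear \<Phi>" using lP by (simp_all add: linear_conv_bounded_linear)
  have mP: "\<Psi> \<in> borel_measurable borel" "\<Phi> \<in> borel_measurable borel"
    using bP by (auto intro!: borel_measurable_continuous_onI linear_continuous_on)
  have mT: "T \<in> borel_measurable borel"
    using T by (intro borel_measurable_continuous_onI linear_continuous_on)
      (auto simp: orthogonal_transformation_def linear_conv_bounded_linear)
  have inn: "\<Psi> x \<bullet> \<Psi> y = x \<bullet> y" for x y
    unfolding inner_vec_def \<Psi>_def using sum.reindex_bij_betw[of h UNIV UNIV "\<lambda>i. x $ i * y $ i"] h by simp
  define T' where "T' = \<Phi> \<circ> T \<circ> \<Psi>"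
  have T': "orthogonal_transformation T'"
    unfolding orthogonal_transformation_def
  proof
    show "linear T'" unfolding T'_def
      using lP T by (intro linear_compose) (auto simp: orthogonal_transformation_def)
    show "\<forall>v w. T' v \<bullet> T' w = v \<bullet> w"
      using T inn by (simp add: T'_def orthogonal_transformation_def flip: inn) (simp add: PP inn)
  qed
  have mT': "T' \<in> borel_measurable borel"
    using T' by (intro borel_measurable_continuous_onI linear_continuous_on)
      (auto simp: orthogonal_transformation_def linear_conv_bounded_linear)
  have dT': "distr lborel borel T' = lborel"
  proof (rule lborel_eqI[symmetric])
    fix l u :: "real^('n wo)"
    assume le: "\<And>b. b \<in> Basis \<Longrightarrow> l \<bullet> b \<le> u \<bullet> b"
    have "T' -` box l u = inv T' ` box l u"
      using orthogonal_transformation_bij[OF T'] by (simp add: bij_vimage_eq_inv_image)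
    moreover have "inv T' ` box l u \<in> lmeasurable" "measure lebesgue (inv T' ` box l u) = measure lebesgue (box l u)"
      using measurable_orthogonal_image[OF orthogonal_transformation_inv[OF T'], of "box l u"]
        measure_orthogonal_image[OF orthogonal_transformation_inv[OF T'], of "box l u"] by auto
    ultimately have "emeasure lebesgue (T' -` box l u) = emeasure lebesgue (box l u)"
      by (simp add: emeasure_eq_measure2)
    moreover have "T' -` box l u \<in> sets borel" using measurable_sets[OF mT', of "box l u"] by simp
    ultimately show "emeasure (distr lborel borel T') (box l u) = (\<Prod>b\<in>Basis. (u - l) \<bullet> b)"
      using mT' le by (simp add: emeasure_distr)
  qed simp
  have "distr lborel borel T = distr (distr lborel borel \<Psi>) borel T" using dist by simp
  also have "\<dots> = distr lborel borel (T \<circ> \<Psi>)" using mP mT by (intro distr_distr) auto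
  also have "T \<circ> \<Psi> = \<Psi> \<circ> T'" by (simp add: T'_def o_def PP)
  also have "distr lborel borel (\<Psi> \<circ> T') = distr (distr lborel borel T') borel \<Psi>"
    using mP mT' by (intro distr_distr[symmetric]) auto
  finally show ?thesis using dT' dist by simp
qed

section \<open>Convex bodies given by support functions\<close>

lemma continuous_on_det [continuous_intros]:
  fixes A :: "'a::topological_space \<Rightarrow> real^'n::finite^'n"
  assumes "continuous_on S A"
  shows "continuous_on S (\<lambda>x. det (A x))"
  unfolding det_def by (intro continuous_intros assms)

text \<open>All matrices on the segment from the identity to \<open>A\<close> have positive forms,
  hence trivial kernels, so the determinant cannot change sign along it.\<close>

lemma det_pos_of_pos_form:
  fixes A :: "real^'n::finite^'n"
  assumes A: "\<And>v. v \<noteq> 0 \<Longrightarrow> 0 < v \<bullet> (A *v v)"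
  shows "0 < det A"
proof (rule ccontr)
  assume "\<not> 0 < det A"
  define B where "B = (\<lambda>t::real. t *\<^sub>R A + (1 - t) *\<^sub>R mat 1)"
  have "continuous_on {0..1} (\<lambda>t. det (B t))" unfolding B_def by (intro continuous_intros)
  moreover have "det (B 1) \<le> 0" "0 \<le> det (B 0)" using \<open>\<not> 0 < det A\<close> by (auto simp: B_def)
  ultimately obtain t where t: "0 \<le> t" "t \<le> 1" "det (B t) = 0"
    using IVT2'[of "\<lambda>t. det (B t)" 1 0 0] by auto
  then obtain v where v: "v \<noteq> 0" "B t *v v = 0"
    using matrix_left_invertible_ker[of "B t"] invertible_det_nz[of "B t"] invertible_left_inverse[of "B t"] by auto
  have "0 = v \<bullet> (B t *v v)" using v by simp
  also have "\<dots> = t * (v \<bullet> (A *v v)) + (1 - t) * (v \<bullet> v)"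
    by (simp add: B_def matrix_vector_mult_add_rdistrib scaleR_matrix_vector_assoc[symmetric] inner_add_right)
  also have "\<dots> > 0"
  proof (cases "t = 0")
    case True then show ?thesis using v by simp
  next
    case False
    then have "0 < t * (v \<bullet> (A *v v))" using A[OF v(1)] t by simp
    moreover have "0 \<le> (1 - t) * (v \<bullet> v)" using t by simp
    ultimately show ?thesis by linarith
  qed
  finally show False by simp
qed

lemma matrix_vector_inner_transpose:
  fixes A :: "real^'n::finite^'n"
  shows "v \<bullet> (A *v w) = (transpose A *v v) \<bullet> w"
  by (simp add: dot_lmul_matrix flip: vector_transpose_matrix)

text \<open>The quadratic form of \<open>A\<close> does not grow under \<open>B\<^sup>-\<^sup>1A\<close>, so the powers of that matrix stay bounded.\<close>

lemma det_mono_form: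
  fixes A B :: "real^'n::finite^'n"
  assumes sym: "transpose A = A"
    and A: "\<And>v. v \<noteq> 0 \<Longrightarrow> 0 < v \<bullet> (A *v v)"
    and AB: "\<And>v. v \<bullet> (A *v v) \<le> v \<bullet> (B *v v)"
  shows "det A \<le> det B"
proof -
  have B: "0 < v \<bullet> (B *v v)" if "v \<noteq> 0" for v using A[OF that] AB[of v] by linarith
  have pos: "0 < det A" "0 < det B" using det_pos_of_pos_form A B by blast+
  then have "invertible B" by (simp add: invertible_det_nz)
  then have BI: "B ** matrix_inv B = mat 1"
    unfolding invertible_def matrix_inv_def by (rule someI2_ex) auto
  define N where "N = matrix_inv B ** A"
  have BN: "B ** N = A" by (simp add: N_def matrix_mul_assoc BI)
  define q where "q = (\<lambda>v. v \<bullet> (A *v v))"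
  have q0: "0 \<le> q v" for v using A[of v] by (cases "v = 0") (auto simp: q_def)
  \<comment> \<open>With \<open>w = N v\<close> one has \<open>B w = A v\<close>. Expanding
    \<open>q (w - v) \<ge> 0\<close> bounds \<open>2 w . A v\<close> by \<open>q w + q v\<close>,
    while \<open>q w \<le> w . B w = w . A v\<close>.\<close>
  have qN: "q (N *v v) \<le> q v" for v
  proof -
    let ?w = "N *v v"
    have Bw: "B *v ?w = A *v v" by (simp add: matrix_vector_mul_assoc BN)
    have "0 \<le> q (?w - v)" by (rule q0)
    also have "q (?w - v) = q ?w - 2 * (?w \<bullet> (A *v v)) + q v"
      using matrix_vector_inner_transpose[of v A ?w] sym
      by (simp add: q_def algebra_simps inner_diff_right inner_diff_left inner_commute)
    finally have "2 * (?w \<bullet> (A *v v)) \<le> q ?w + q v" by simp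
    moreover have "q ?w \<le> ?w \<bullet> (A *v v)" using AB[of ?w] Bw by (simp add: q_def)
    ultimately show ?thesis by simp
  qed
  define P where "P = (\<lambda>k. ((**) N ^^ k) (mat 1))"
  have Ps: "P 0 = mat 1" "P (Suc k) = N ** P k" for k by (simp_all add: P_def)
  have qP: "q (P k *v v) \<le> q v" for k v
    by (induction k) (use qN order_trans in \<open>auto simp: Ps simp flip: matrix_vector_mul_assoc\<close>)
  have detP: "det (P k) = det N ^ k" for k by (induction k) (simp_all add: Ps det_mul)
  obtain u :: "real^'n" where u: "norm u = 1" "\<And>v. norm v = 1 \<Longrightarrow> q u \<le> q v"
  proof -
    have "continuous_on (sphere 0 1) q" unfolding q_def
      by (intro continuous_intros matrix_vector_mult_linear_continuous_on)
    moreover have "sphere (0::real^'n) 1 \<noteq> {}" by simp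
    ultimately obtain u where "u \<in> sphere 0 1" "\<And>v. v \<in> sphere 0 1 \<Longrightarrow> q u \<le> q v"
      using continuous_attains_inf[of "sphere (0::real^'n) 1" q] by auto
    then show ?thesis using that by simp
  qed
  have u0: "0 < q u" unfolding q_def using A[of u] u(1) by fastforce
  have qlow: "q u * (norm v)\<^sup>2 \<le> q v" for v
  proof (cases "v = 0")
    case False
    have "q u \<le> q (v /\<^sub>R norm v)" using False by (intro u(2)) simp
    also have "\<dots> = q v / (norm v)\<^sup>2"
      by (simp add: q_def matrix_vector_mult_scaleR power2_eq_square divide_inverse)
    finally show ?thesis using False by (simp add: field_simps)
  qed (simp add: q_def)
  define M where "M = Max (range (\<lambda>j. sqrt (q (axis j 1 :: real^'n) / q u)))"
  have ent: "\<bar>P k $ i $ j\<bar> \<le> M" for k i j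
  proof -
    have "P k $ i $ j = (P k *v axis j 1) $ i" by (simp add: matrix_vector_mult_basis column_def)
    then have "\<bar>P k $ i $ j\<bar> \<le> norm (P k *v axis j 1)" by (metis component_le_norm_cart)
    moreover have "(norm (P k *v axis j 1))\<^sup>2 \<le> q (axis j 1) / q u"
      using qlow[of "P k *v axis j 1"] qP[of k "axis j 1"] u0 by (simp add: field_simps)
    ultimately have "\<bar>P k $ i $ j\<bar> \<le> sqrt (q (axis j 1) / q u)"
      by (meson order_trans real_le_rsqrt)
    also have "\<dots> \<le> M" unfolding M_def by (intro Max_ge) auto
    finally show ?thesis .
  qed
  define C where "C = (\<Sum>p\<in>{p. p permutes (UNIV::'n set)}. M ^ CARD('n))"
  have bnd: "\<bar>det (P k)\<bar> \<le> C" for k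
  proof -
    have "\<bar>det (P k)\<bar> \<le> (\<Sum>p\<in>{p. p permutes (UNIV::'n set)}. \<bar>of_int (sign p) * (\<Prod>i\<in>UNIV. P k $ i $ p i)\<bar>)"
      unfolding det_def by (rule sum_abs)
    also have "\<dots> \<le> C" unfolding C_def
    proof (rule sum_mono)
      fix p :: "'n \<Rightarrow> 'n"
      have "\<bar>of_int (sign p) * (\<Prod>i\<in>UNIV. P k $ i $ p i)\<bar> = (\<Prod>i\<in>UNIV. \<bar>P k $ i $ p i\<bar>)"
        by (simp add: abs_mult abs_prod flip: of_int_abs)
      also have "\<dots> \<le> (\<Prod>i\<in>(UNIV::'n set). M)" by (intro prod_mono) (auto intro: ent)
      finally show "\<bar>of_int (sign p) * (\<Prod>i\<in>UNIV. P k $ i $ p i)\<bar> \<le> M ^ CARD('n)" by simp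
    qed
    finally show ?thesis .
  qed
  have "\<not> 1 < det N"
  proof
    assume "1 < det N"
    then obtain k where "C < det N ^ k" using real_arch_pow by blast
    then show False using bnd[of k] by (simp add: detP)
  qed
  moreover have "det A = det B * det N" by (metis BN det_mul)
  ultimately show ?thesis using pos by (metis mult.right_neutral mult_le_cancel_left_pos not_less)
qed

section \<open>Bodies cut out by support inequalities\<close>

text \<open>Only normals \<open>(y, 1)\<close> over the ball are tested, as these are the normals
  occurring for an acute contact angle; the half-space supplies the flat bottom face.\<close>

definition body :: "real \<Rightarrow> (real^'n::finite \<Rightarrow> real) \<Rightarrow> ((real^'n) \<times> real) set"
  where "body R H = {(x, s). 0 \<le> s \<and> (\<forall>y\<in>cball 0 R. x \<bullet> y + s \<le> H y)}"

lemma body_mono: "(\<And>y. norm y \<le> R \<Longrightarrow> H y \<le> H' y) \<Longrightarrow> body R H \<subseteq> body R H'"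
  unfolding body_def by (auto intro: order_trans)

lemma closed_body: "closed (body R H)"
proof -
  have "body R H = {p. 0 \<le> snd p} \<inter> (\<Inter>y\<in>cball 0 R. {p. fst p \<bullet> y + snd p \<le> H y})"
    by (auto simp: body_def)
  also have "closed \<dots>"
    by (intro closed_Int closed_INT ballI closed_Collect_le continuous_intros)
  finally show ?thesis .
qed

lemma convex_body: "convex (body R H)"
proof -
  have "body R H = {p. (0, -1) \<bullet> p \<le> 0} \<inter> (\<Inter>y\<in>cball 0 R. {p. (y, 1) \<bullet> p \<le> H y})"
    by (auto simp: body_def inner_commute)
  also have "convex \<dots>"
    by (intro convex_Int convex_INT convex_halfspace_le)
  finally show ?thesis .
qed

text \<open>The slope \<open>0\<close> bounds the height, and the rim slope in the direction of
  \<open>x\<close> bounds the horizontal part.\<close>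

lemma body_bound:
  assumes R: "0 < R" and h: "\<And>y. norm y \<le> R \<Longrightarrow> H y \<le> h" and p: "(x, s) \<in> body R H"
  shows "norm x \<le> h / R" "0 \<le> s" "s \<le> h"
proof -
  show "0 \<le> s" using p by (simp add: body_def)
  have *: "x \<bullet> y + s \<le> h" if "norm y \<le> R" for y proof -
    have "x \<bullet> y + s \<le> H y" using p that by (simp add: body_def)
    then show ?thesis using h[OF that] by simp
  qed
  show "s \<le> h" using *[of 0] R by simp
  show "norm x \<le> h / R"
  proof (cases "x = 0")
    case False
    then have "x \<bullet> ((R / norm x) *\<^sub>R x) = norm x * R"
      by (simp add: power2_norm_eq_inner[symmetric] power2_eq_square)
    then show ?thesis using *[of "(R / norm x) *\<^sub>R x"] False R \<open>0 \<le> s\<close> by (simp add: field_simps)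
  next
    case True
    then show ?thesis using *[of 0] R \<open>0 \<le> s\<close> by simp
  qed
qed

lemma compact_body:
  assumes R: "0 < R" and H: "continuous_on (cball 0 R) H"
  shows "compact (body R H)"
proof -
  have "bounded (H ` cball 0 R)"
    using compact_continuous_image[OF H] by (simp add: compact_imp_bounded)
  then obtain h where h: "\<And>y. norm y \<le> R \<Longrightarrow> \<bar>H y\<bar> \<le> h"
    unfolding bounded_iff by (metis image_eqI mem_cball_0 real_norm_def)
  have "body R H \<subseteq> cball 0 (h / R) \<times> {0..h}"
    using body_bound[OF R, of H h] h by (fastforce simp: abs_le_iff)
  then have "bounded (body R H)"
    by (rule bounded_subset[OF bounded_Times[OF bounded_cball bounded_closed_interval]])
  then show ?thesis by (simp add: closed_body compact_eq_bounded_closed)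
qed

text \<open>The contact point for slope \<open>y\<close> is \<open>(D y, H y - y . D y)\<close>, so
  \<open>neumann\<close> puts the contact points of rim slopes into the boundary plane. This is the
  contact angle condition in homogeneous coordinates.\<close>

locale support_fn =
  fixes R :: real and H :: "real^'n::finite \<Rightarrow> real" and D :: "real^'n \<Rightarrow> real^'n"
  assumes R_pos: "0 < R"
    and deriv: "\<And>y. norm y \<le> R \<Longrightarrow> (H has_derivative (\<lambda>v. D y \<bullet> v)) (at y within cball 0 R)"
    and neumann: "\<And>y. norm y = R \<Longrightarrow> y \<bullet> D y = H y"
begin

lemma continuous: "continuous_on (cball 0 R) H"
  using deriv by (intro has_derivative_continuous_on) auto

text \<open>A one-sided difference quotient of \<open>H y - x . y\<close> along the segment starting
  at its minimum point \<open>y0\<close>; convexity of the ball keeps the segment available when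
  \<open>y0\<close> lies on the rim.\<close>

lemma min_condition:
  assumes y0: "norm y0 \<le> R" and y: "norm y \<le> R"
    and min: "\<And>y. norm y \<le> R \<Longrightarrow> x \<bullet> y + s \<le> H y" and eq: "x \<bullet> y0 + s = H y0"
  shows "0 \<le> (D y0 - x) \<bullet> (y - y0)"
proof -
  let ?c = "\<lambda>r. y0 + r *\<^sub>R (y - y0)"
  have sub: "?c ` {0..1} \<subseteq> cball 0 R"
    using convexD_alt[OF convex_cball[of 0 R], of y0 y] y0 y by (auto simp: algebra_simps)
  have "((\<lambda>z. H z - x \<bullet> z) has_derivative (\<lambda>v. D y0 \<bullet> v - x \<bullet> v)) (at (?c 0) within cball 0 R)"
    using y0 by (auto intro!: derivative_intros deriv)
  from has_derivative_subset[OF this sub]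
  have "((\<lambda>z. H z - x \<bullet> z) \<circ> ?c has_derivative
      (\<lambda>v. D y0 \<bullet> v - x \<bullet> v) \<circ> (\<lambda>r. r *\<^sub>R (y - y0))) (at 0 within {0..1})"
    by (intro diff_chain_within) (auto intro!: derivative_eq_intros)
  then have d: "((\<lambda>r. H (?c r) - x \<bullet> ?c r) has_real_derivative (D y0 - x) \<bullet> (y - y0)) (at 0 within {0..1})"
    unfolding has_field_derivative_def o_def
    by (rule has_derivative_eq_rhs) (simp add: fun_eq_iff inner_diff_left algebra_simps)
  have m: "H (?c 0) - x \<bullet> ?c 0 \<le> H (?c r) - x \<bullet> ?c r" if "r \<in> {0..1}" for r
    using min[of "?c r"] eq sub that by (auto simp: image_subset_iff)
  show ?thesis
  proof -
    let ?f = "\<lambda>r. H (?c r) - x \<bullet> ?c r"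
    have "((\<lambda>r. (?f r - ?f 0) / (r - 0)) \<longlongrightarrow> (D y0 - x) \<bullet> (y - y0)) (at 0 within {0..1})"
      using d by (simp add: has_field_derivative_iff)
    moreover have "eventually (\<lambda>r. 0 \<le> (?f r - ?f 0) / (r - 0)) (at 0 within {0..1})"
      unfolding eventually_at_filter using m by (auto intro!: always_eventually divide_nonneg_nonneg)
    moreover have "at (0::real) within {0..1} \<noteq> bot" by (simp add: at_within_Icc_at_right)
    ultimately show ?thesis by (intro tendsto_lowerbound) auto
  qed
qed

text \<open>On the rim, \<open>min_condition\<close> towards \<open>0\<close> together with
  \<open>neumann\<close> forces \<open>s \<le> 0\<close>. So a contact at positive height has an
  interior slope, where the first-order condition holds in all directions.\<close>

lemma contact:
  assumes y0: "norm y0 \<le> R" and s: "0 < s \<or> norm y0 < R"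
    and min: "\<And>y. norm y \<le> R \<Longrightarrow> x \<bullet> y + s \<le> H y" and eq: "x \<bullet> y0 + s = H y0"
  shows "norm y0 < R" "x = D y0" "s = H y0 - y0 \<bullet> D y0"
proof -
  show lt: "norm y0 < R"
  proof (rule ccontr)
    assume "\<not> norm y0 < R"
    then have R: "norm y0 = R" and "0 < s" using y0 s by auto
    have "0 \<le> (D y0 - x) \<bullet> (0 - y0)" using R_pos by (intro min_condition[OF y0 _ min eq]) auto
    then have "y0 \<bullet> D y0 \<le> x \<bullet> y0" by (simp add: inner_diff_left inner_diff_right inner_commute)
    then show False using neumann[OF R] eq \<open>0 < s\<close> by simp
  qed
  show x: "x = D y0"
  proof (rule ccontr)
    assume "x \<noteq> D y0"
    define w where "w = D y0 - x"
    define e where "e = (R - norm y0) / norm w"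
    have w: "w \<noteq> 0" "0 < e" using \<open>x \<noteq> D y0\<close> lt by (auto simp: w_def e_def)
    have "norm (y0 - e *\<^sub>R w) \<le> R"
      using norm_triangle_ineq4[of y0 "e *\<^sub>R w"] w lt by (simp add: e_def)
    then have "0 \<le> w \<bullet> (y0 - e *\<^sub>R w - y0)" unfolding w_def using min_condition[OF y0 _ min eq] by blast
    then have "e * (w \<bullet> w) \<le> 0" by simp
    then show False using w by (simp add: mult_le_0_iff not_le flip: inner_gt_zero_iff)
  qed
  show "s = H y0 - y0 \<bullet> D y0" using eq x by (simp add: inner_commute)
qed

end

locale strict_support_fn = support_fn R H D
  for R and H :: "real^'n::finite \<Rightarrow> real" and D +
  fixes D2 :: "real^'n \<Rightarrow> real^'n^'n"
  assumes deriv2: "\<And>y. norm y \<le> R \<Longrightarrow> (D has_derivative (\<lambda>v. D2 y *v v)) (at y within cball 0 R)"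
    and posdef: "\<And>y v. norm y \<le> R \<Longrightarrow> v \<noteq> 0 \<Longrightarrow> 0 < v \<bullet> (D2 y *v v)"
begin

lemma segment:
  assumes "norm y \<le> R" "norm z \<le> R" "0 \<le> r" "r \<le> 1"
  shows "norm (y + r *\<^sub>R (z - y)) \<le> R"
  using convexD_alt[OF convex_cball[of 0 R], of y z r] assms by (simp add: algebra_simps)

lemma segment_deriv:
  assumes yz: "norm y \<le> R" "norm z \<le> R" and r: "0 \<le> r" "r \<le> 1"
  shows "((\<lambda>r. H (y + r *\<^sub>R (z - y))) has_real_derivative D (y + r *\<^sub>R (z - y)) \<bullet> (z - y)) (at r within {0..1})"
    and "((\<lambda>r. D (y + r *\<^sub>R (z - y)) \<bullet> (z - y)) has_real_derivative
            (z - y) \<bullet> (D2 (y + r *\<^sub>R (z - y)) *v (z - y))) (at r within {0..1})"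
proof -
  let ?c = "\<lambda>r. y + r *\<^sub>R (z - y)"
  have c: "(?c has_derivative (\<lambda>r. r *\<^sub>R (z - y))) (at r within {0..1})"
    by (auto intro!: derivative_eq_intros)
  have sub: "?c ` {0..1} \<subseteq> cball 0 R" using segment[OF yz] by auto
  have "(H \<circ> ?c has_derivative (\<lambda>v. D (?c r) \<bullet> v) \<circ> (\<lambda>r. r *\<^sub>R (z - y))) (at r within {0..1})"
    by (intro diff_chain_within c has_derivative_subset[OF deriv sub] segment assms)
  then show "((\<lambda>r. H (?c r)) has_real_derivative D (?c r) \<bullet> (z - y)) (at r within {0..1})"
    by (simp add: has_field_derivative_def o_def mult_commute_abs)
  have "(D \<circ> ?c has_derivative (\<lambda>v. D2 (?c r) *v v) \<circ> (\<lambda>r. r *\<^sub>R (z - y))) (at r within {0..1})"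
    by (intro diff_chain_within c has_derivative_subset[OF deriv2 sub] segment assms)
  then have "((\<lambda>r. D (?c r)) has_derivative (\<lambda>t. t *\<^sub>R (D2 (?c r) *v (z - y)))) (at r within {0..1})"
    by (simp add: o_def matrix_vector_mult_scaleR)
  then have "((\<lambda>r. D (?c r) \<bullet> (z - y)) has_derivative (\<lambda>t. t *\<^sub>R (D2 (?c r) *v (z - y)) \<bullet> (z - y))) (at r within {0..1})"
    by (rule has_derivative_inner_left)
  then show "((\<lambda>r. D (?c r) \<bullet> (z - y)) has_real_derivative (z - y) \<bullet> (D2 (?c r) *v (z - y))) (at r within {0..1})"
    by (simp add: has_field_derivative_def mult_commute_abs inner_commute)
qed

lemma gradient_strict_mono:
  assumes yz: "norm y \<le> R" "norm z \<le> R" "y \<noteq> z" and r: "0 \<le> r" "r < t" "t \<le> 1"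
  shows "D (y + r *\<^sub>R (z - y)) \<bullet> (z - y) < D (y + t *\<^sub>R (z - y)) \<bullet> (z - y)"
proof -
  let ?g = "\<lambda>r. D (y + r *\<^sub>R (z - y)) \<bullet> (z - y)"
  have d: "(?g has_real_derivative (z - y) \<bullet> (D2 (y + x *\<^sub>R (z - y)) *v (z - y))) (at x within {r..t})"
    if "r \<le> x" "x \<le> t" for x
    by (rule DERIV_subset[OF segment_deriv(2)[OF yz(1,2)]]) (use that r in auto)
  show ?thesis
  proof (rule DERIV_pos_imp_increasing_open[OF r(2)])
    show "continuous_on {r..t} ?g" using d by (auto intro!: DERIV_continuous_on)
    fix x assume x: "r < x" "x < t"
    have "(?g has_real_derivative (z - y) \<bullet> (D2 (y + x *\<^sub>R (z - y)) *v (z - y))) (at x)"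
      using d[of x] x by (simp add: at_within_Icc_at)
    moreover have "0 < (z - y) \<bullet> (D2 (y + x *\<^sub>R (z - y)) *v (z - y))"
      using yz x r by (intro posdef segment) auto
    ultimately show "\<exists>d. (?g has_real_derivative d) (at x) \<and> 0 < d" by blast
  qed
qed

lemma above_tangent:
  assumes yz: "norm y \<le> R" "norm z \<le> R" "y \<noteq> z"
  shows "H y + D y \<bullet> (z - y) < H z"
proof -
  let ?f = "\<lambda>r. H (y + r *\<^sub>R (z - y)) - r * (D y \<bullet> (z - y))"
  have d: "(?f has_real_derivative D (y + x *\<^sub>R (z - y)) \<bullet> (z - y) - D y \<bullet> (z - y)) (at x within {0..1})"
    if "0 \<le> x" "x \<le> 1" for x
    using segment_deriv(1)[OF yz(1,2) that] by (auto intro!: derivative_eq_intros)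
  have "?f 0 < ?f 1"
  proof (rule DERIV_pos_imp_increasing_open[where f = ?f])
    show "continuous_on {0..1} ?f" using d by (intro DERIV_continuous_on) auto
    fix x :: real assume x: "0 < x" "x < 1"
    have "(?f has_real_derivative D (y + x *\<^sub>R (z - y)) \<bullet> (z - y) - D y \<bullet> (z - y)) (at x)"
      using d[of x] x by (simp add: at_within_Icc_at)
    moreover have "0 < D (y + x *\<^sub>R (z - y)) \<bullet> (z - y) - D y \<bullet> (z - y)"
      using gradient_strict_mono[OF yz, of 0 x] x by simp
    ultimately show "\<exists>d. (?f has_real_derivative d) (at x) \<and> 0 < d" by blast
  qed simp
  then show ?thesis by simp
qed

lemma gradient_inj:
  assumes yz: "norm y \<le> R" "norm z \<le> R" "D y = D z"
  shows "y = z"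
  using above_tangent[OF yz(1,2)] above_tangent[OF yz(2,1)] yz(3)
  by (cases "y = z") (auto simp: inner_diff_right)

text \<open>Let \<open>z\<close> be the rim point on the ray through \<open>y\<close>. By
  \<open>neumann\<close> the tangent plane at \<open>z\<close> passes through the origin, so strict
  convexity gives \<open>D z . y < H y\<close>; monotonicity of the gradient along the ray gives
  \<open>D y . y \<le> D z . y\<close>.\<close>

lemma height_pos:
  assumes y: "norm y < R"
  shows "0 < H y - y \<bullet> D y"
proof -
  obtain u :: "real^'n" where u: "norm u = 1" using vector_choose_size[of 1] by auto
  define z where "z = (if y = 0 then R *\<^sub>R u else (R / norm y) *\<^sub>R y)"
  have z: "norm z = R" using R_pos u by (simp add: z_def)
  then have ne: "y \<noteq> z" using y by auto
  have "H z + D z \<bullet> (y - z) < H y" using above_tangent[of z y] z y ne by simp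
  then have 1: "D z \<bullet> y < H y" using neumann[OF z] by (simp add: inner_diff_right inner_commute)
  have 2: "D y \<bullet> y \<le> D z \<bullet> y"
  proof (cases "y = 0")
    case False
    have "D y \<bullet> (z - y) < D z \<bullet> (z - y)" using gradient_strict_mono[of y z 0 1] y z ne by simp
    moreover have "z - y = (R / norm y - 1) *\<^sub>R y" using False by (simp add: z_def algebra_simps)
    moreover have "0 < R / norm y - 1" using False y by (simp add: field_simps)
    ultimately show ?thesis by (simp add: mult_less_cancel_left)
  qed simp
  show ?thesis using 1 2 by (simp add: inner_commute)
qed

lemma contact_point_in_body:
  assumes "norm y \<le> R"
  shows "(D y, H y - y \<bullet> D y) \<in> body R H"
proof -
  have "0 \<le> H y - y \<bullet> D y" using height_pos[of y] neumann[of y] assms by (cases "norm y = R") auto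
  moreover have "D y \<bullet> z + (H y - y \<bullet> D y) \<le> H z" if "norm z \<le> R" for z
    using above_tangent[OF assms that] by (cases "y = z") (auto simp: inner_diff_right inner_commute)
  ultimately show ?thesis by (auto simp: body_def)
qed

end

section \<open>Evolution of volume\<close>

lemma set_integrable_compact:
  fixes f :: "'a::euclidean_space \<Rightarrow> real"
  assumes "compact S" "continuous_on S f"
  shows "set_integrable lborel S f"
  unfolding set_integrable_def using borel_integrable_compact[OF assms] .

lemma set_integral_Times_swap:
  fixes q :: "'a::euclidean_space \<Rightarrow> 'b::euclidean_space \<Rightarrow> real"
  assumes K: "compact K" "compact L" and q: "continuous_on (K \<times> L) (\<lambda>(y, s). q y s)"
  shows "(LINT p:K\<times>L|lborel. q (fst p) (snd p)) = (LINT y:K|lborel. LINT s:L|lborel. q y s)"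
    and "(LINT p:K\<times>L|lborel. q (fst p) (snd p)) = (LINT s:L|lborel. LINT y:K|lborel. q y s)"
    and "set_integrable lborel K (\<lambda>y. LINT s:L|lborel. q y s)"
    and "set_integrable lborel L (\<lambda>s. LINT y:K|lborel. q y s)"
proof -
  define f where "f = (\<lambda>y s. indicator K y * indicator L s * q y s :: real)"
  have "integrable lborel (\<lambda>p. indicator (K \<times> L) p *\<^sub>R (case p of (y, s) \<Rightarrow> q y s))"
    by (intro borel_integrable_compact compact_Times K q)
  then have "integrable lborel (case_prod f)"
    by (simp add: f_def case_prod_beta' indicator_times mult.assoc)
  then have int: "integrable (lborel \<Otimes>\<^sub>M lborel) (case_prod f)" by (simp add: lborel_prod)
  have eq: "(LINT p:K\<times>L|lborel. q (fst p) (snd p)) = integral\<^sup>L (lborel \<Otimes>\<^sub>M lborel) (case_prod f)"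
    unfolding set_lebesgue_integral_def lborel_prod
    by (intro Bochner_Integration.integral_cong) (auto simp: f_def indicator_times mult.assoc)
  have f1: "(LINT s|lborel. f y s) = indicator K y * (LINT s:L|lborel. q y s)" for y
    by (simp add: f_def set_lebesgue_integral_def mult.assoc)
  have f2: "(LINT y|lborel. f y s) = indicator L s * (LINT y:K|lborel. q y s)" for s
    by (simp add: f_def set_lebesgue_integral_def mult.assoc mult.left_commute flip: integral_mult_right_zero)
  show "(LINT p:K\<times>L|lborel. q (fst p) (snd p)) = (LINT y:K|lborel. LINT s:L|lborel. q y s)"
    unfolding eq using lborel_pair.integral_fst'[OF int] f1 by (simp add: set_lebesgue_integral_def)
  show "(LINT p:K\<times>L|lborel. q (fst p) (snd p)) = (LINT s:L|lborel. LINT y:K|lborel. q y s)"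
    unfolding eq using lborel_pair.integral_snd[OF int] f2 by (simp add: set_lebesgue_integral_def)
  show "set_integrable lborel K (\<lambda>y. LINT s:L|lborel. q y s)"
    using lborel_pair.integrable_fst'[OF int] f1 by (simp add: set_integrable_def)
  show "set_integrable lborel L (\<lambda>s. LINT y:K|lborel. q y s)"
    using lborel_pair.integrable_snd[OF int] f2 by (simp add: set_integrable_def)
qed

text \<open>As the support function decreases, each point of positive height that leaves the body is
  a contact point at exactly one time and slope. The contact-point map is therefore a bijection onto
  the lost region up to null sets, with Jacobian \<open>Gs * det D2\<close>.\<close>

lemma sweep_volume:
  fixes G Gs :: "real^'n::finite \<Rightarrow> real \<Rightarrow> real" and D e :: "real^'n \<Rightarrow> real \<Rightarrow> real^'n"
    and D2 :: "real^'n \<Rightarrow> real \<Rightarrow> real^'n^'n"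
  assumes R: "0 < R" and ab: "a < b"
    and dG: "\<And>y s. norm y \<le> R \<Longrightarrow> s \<in> {a..b} \<Longrightarrow> ((\<lambda>p. G (fst p) (snd p)) has_derivative
              (\<lambda>(v, r). D y s \<bullet> v + r * Gs y s)) (at (y, s) within cball 0 R \<times> {a..b})"
    and dD: "\<And>y s. norm y \<le> R \<Longrightarrow> s \<in> {a..b} \<Longrightarrow> ((\<lambda>p. D (fst p) (snd p)) has_derivative
              (\<lambda>(v, r). D2 y s *v v + r *\<^sub>R e y s)) (at (y, s) within cball 0 R \<times> {a..b})"
    and pos: "\<And>y s v. norm y \<le> R \<Longrightarrow> s \<in> {a..b} \<Longrightarrow> v \<noteq> 0 \<Longrightarrow> 0 < v \<bullet> (D2 y s *v v)"
    and neumann: "\<And>y s. norm y = R \<Longrightarrow> s \<in> {a..b} \<Longrightarrow> y \<bullet> D y s = G y s"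
    and neg: "\<And>y s. norm y \<le> R \<Longrightarrow> s \<in> {a..b} \<Longrightarrow> Gs y s < 0"
    and cont: "continuous_on (cball 0 R \<times> {a..b}) (\<lambda>p. Gs (fst p) (snd p) * det (D2 (fst p) (snd p)))"
  shows "measure lebesgue (body R (\<lambda>y. G y a)) - measure lebesgue (body R (\<lambda>y. G y b))
    = (LINT p:cball 0 R \<times> {a..b}|lborel. - (Gs (fst p) (snd p) * det (D2 (fst p) (snd p))))"
proof -
  let ?Q = "cball (0::real^'n) R \<times> {a..b}"
  \<comment> \<open>Rim slopes are left out because their contact points have height zero, and the
    end time because its contact points still belong to the smaller body. The omitted part of
    \<open>?Q\<close> is null.\<close>
  define S where "S = ball (0::real^'n) R \<times> {a..<b}"
  have SQ: "S \<subseteq> ?Q" by (auto simp: S_def)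
  have str: "strict_support_fn R (\<lambda>y. G y s) (\<lambda>y. D y s) (\<lambda>y. D2 y s)" if s: "s \<in> {a..b}" for s
  proof
    have i: "((\<lambda>y. (y, s)) has_derivative (\<lambda>v. (v, 0))) (at y within cball 0 R)" for y
      by (auto intro!: derivative_eq_intros)
    have sub: "(\<lambda>y. (y, s)) ` cball 0 R \<subseteq> ?Q" using s by auto
    fix y :: "real^'n" assume y: "norm y \<le> R"
    show "((\<lambda>y. G y s) has_derivative (\<lambda>v. D y s \<bullet> v)) (at y within cball 0 R)"
      using diff_chain_within[OF i has_derivative_subset[OF dG[OF y s] sub]] by (simp add: o_def)
    show "((\<lambda>y. D y s) has_derivative (\<lambda>v. D2 y s *v v)) (at y within cball 0 R)"
      using diff_chain_within[OF i has_derivative_subset[OF dD[OF y s] sub]] by (simp add: o_def)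
  qed (use R s neumann pos in auto)
  have cG: "continuous_on ?Q (\<lambda>p. G (fst p) (snd p))"
    proof (rule has_derivative_continuous_on)
    fix p assume "p \<in> ?Q"
    then show "((\<lambda>p. G (fst p) (snd p)) has_derivative (\<lambda>(v, r). D (fst p) (snd p) \<bullet> v + r * Gs (fst p) (snd p))) (at p within ?Q)"
      using dG[of "fst p" "snd p"] by (simp add: mem_Times_iff)
  qed
  have dec: "G y t < G y s" if y: "norm y \<le> R" and st: "a \<le> s" "s < t" "t \<le> b" for y s t
  proof -
    have d: "((\<lambda>r. G y r) has_real_derivative Gs y r) (at r within {a..b})" if r: "r \<in> {a..b}" for r
    proof -
      have i: "((\<lambda>r. (y, r)) has_derivative (\<lambda>v. (0, v))) (at r within {a..b})"
        by (auto intro!: derivative_eq_intros)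
      have sub: "(\<lambda>r. (y, r)) ` {a..b} \<subseteq> ?Q" using y by auto
      have "((\<lambda>r. G y r) has_derivative (\<lambda>v. v * Gs y r)) (at r within {a..b})"
        using diff_chain_within[OF i has_derivative_subset[OF dG[OF y r] sub]] by (simp add: o_def)
      then show ?thesis by (simp add: has_field_derivative_def mult_commute_abs)
    qed
    show ?thesis
    proof (rule DERIV_neg_imp_decreasing_open[OF st(2)])
      show "continuous_on {s..t} (G y)"
        by (rule continuous_on_subset[OF DERIV_continuous_on[OF d]]) (use st in auto)
      fix r assume "s < r" "r < t"
      then have r: "r \<in> {a<..<b}" using st by auto
      then have "(G y has_real_derivative Gs y r) (at r)" using d[of r] by (auto simp: at_within_Icc_at)
      then show "\<exists>z. (G y has_real_derivative z) (at r) \<and> z < 0" using neg[OF y] r by auto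
    qed
  qed
  define g where "g = (\<lambda>p. (D (fst p) (snd p), G (fst p) (snd p) - fst p \<bullet> D (fst p) (snd p)))"
  let ?A = "\<lambda>p. D2 (fst p) (snd p)" and ?c = "\<lambda>p. Gs (fst p) (snd p)"
  have derg: "(g has_derivative (\<lambda>(v, r). (?A p *v v + r *\<^sub>R e (fst p) (snd p),
      ?c p * r - fst p \<bullet> (?A p *v v + r *\<^sub>R e (fst p) (snd p))))) (at p within S)" if pS: "p \<in> S" for p
  proof -
    obtain y s where p: "p = (y, s)" "norm y \<le> R" "s \<in> {a..b}" using pS SQ by (cases p) auto
    note 1 = has_derivative_subset[OF dG[OF p(2,3)] SQ] and 2 = has_derivative_subset[OF dD[OF p(2,3)] SQ]
    show ?thesis
      unfolding g_def p(1)
      by (rule has_derivative_eq_rhs)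
        (rule has_derivative_Pair[OF 2 has_derivative_diff[OF 1 has_derivative_inner[OF has_derivative_fst[OF has_derivative_ident] 2]]],
         auto simp: fun_eq_iff inner_commute algebra_simps)
  qed
  have img: "g ` S = (body R (\<lambda>y. G y a) - body R (\<lambda>y. G y b)) - {p. snd p = 0}"
  proof (intro set_eqI iffI)
    fix q assume "q \<in> g ` S"
    then obtain y s where ys: "norm y < R" "a \<le> s" "s < b" and q: "q = (D y s, G y s - y \<bullet> D y s)"
      by (auto simp: S_def g_def)
    interpret strict_support_fn R "\<lambda>y. G y s" "\<lambda>y. D y s" "\<lambda>y. D2 y s" using str ys by auto
    have "q \<in> body R (\<lambda>y. G y s)" using contact_point_in_body ys q by simp
    then have "q \<in> body R (\<lambda>y. G y a)"
      using body_mono[of R "\<lambda>y. G y s" "\<lambda>y. G y a"] dec[of _ a s] ys by (cases "a = s") (auto intro: less_imp_le)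
    moreover have "q \<notin> body R (\<lambda>y. G y b)"
      using dec[of y s b] ys by (auto simp: q body_def inner_commute intro!: bexI[of _ y])
    moreover have "snd q \<noteq> 0" using height_pos[OF ys(1)] q by simp
    ultimately show "q \<in> (body R (\<lambda>y. G y a) - body R (\<lambda>y. G y b)) - {p. snd p = 0}" by simp
  next
    fix q assume q': "q \<in> (body R (\<lambda>y. G y a) - body R (\<lambda>y. G y b)) - {p. snd p = 0}"
    obtain x r where q: "q = (x, r)" by (cases q)
    have r: "0 < r" and xa: "\<And>y. norm y \<le> R \<Longrightarrow> x \<bullet> y + r \<le> G y a"
      using q' by (auto simp: q body_def)
    obtain y1 where y1: "norm y1 \<le> R" "G y1 b < x \<bullet> y1 + r" using q' r by (auto simp: q body_def not_le)
    \<comment> \<open>Pairs at which the support plane has come down to \<open>q\<close> or below;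
      one with minimal time marks the moment at which the moving surface passes
      \<open>q\<close>.\<close>
    define Z where "Z = {p \<in> ?Q. G (fst p) (snd p) - x \<bullet> fst p - r \<le> 0}"
    have "Z = ?Q \<inter> (\<lambda>p. G (fst p) (snd p) - x \<bullet> fst p - r) -` {..0}" by (auto simp: Z_def)
    also have "closed \<dots>"
      by (intro continuous_closed_preimage continuous_intros cG closed_Times) auto
    finally have "compact (?Q \<inter> Z)" by (intro compact_Int_closed compact_Times) auto
    moreover have "?Q \<inter> Z = Z" by (auto simp: Z_def)
    ultimately have "compact Z" by simp
    moreover have "(y1, b) \<in> Z" using y1 ab by (auto simp: Z_def)
    ultimately obtain p0 where p0: "p0 \<in> Z" "\<And>p. p \<in> Z \<Longrightarrow> snd p0 \<le> snd p"
      using continuous_attains_inf[of Z snd] continuous_on_snd[OF continuous_on_id, of Z] by fastforce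
    obtain y0 s0 where ys: "p0 = (y0, s0)" by (cases p0)
    have y0: "norm y0 \<le> R" "a \<le> s0" "s0 \<le> b" "G y0 s0 \<le> x \<bullet> y0 + r" using p0(1) by (auto simp: Z_def ys)
    \<comment> \<open>Before the minimal time every support inequality at \<open>q\<close> is
      strict, so all of them persist in the limit from the left.\<close>
    have above: "x \<bullet> y + r \<le> G y s0" if y: "norm y \<le> R" for y
    proof (cases "s0 = a")
      case False
      have "continuous_on {a..b} (\<lambda>s. G y s)"
        using continuous_on_compose2[OF cG continuous_on_Pair[OF continuous_on_const[of _ y] continuous_on_id], of "{a..b}"] y by (simp add: image_subset_iff)
      then have "((\<lambda>s. G y s) \<longlongrightarrow> G y s0) (at s0 within {a..b})" using y0 by (auto simp: continuous_on_def)
      then have "((\<lambda>s. G y s) \<longlongrightarrow> G y s0) (at s0 within {a..<s0})"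
        by (rule tendsto_within_subset) (use y0 in auto)
      moreover have "at s0 within {a..<s0} \<noteq> bot"
        using False y0 by (simp add: at_within_eq_bot_iff)
      moreover have "eventually (\<lambda>s. x \<bullet> y + r \<le> G y s) (at s0 within {a..<s0})"
        unfolding eventually_at_filter
      proof (rule always_eventually, intro allI impI)
        fix s assume "s \<noteq> s0" "s \<in> {a..<s0}"
        then show "x \<bullet> y + r \<le> G y s" using p0(2)[of "(y, s)"] y y0 by (force simp: Z_def ys)
      qed
      ultimately show ?thesis by (intro tendsto_lowerbound)
    qed (use xa y in auto)
    have eq: "x \<bullet> y0 + r = G y0 s0" using above[OF y0(1)] y0(4) by simp
    have "s0 \<noteq> b" using above[OF y1(1)] y1(2) by auto
    interpret strict_support_fn R "\<lambda>y. G y s0" "\<lambda>y. D y s0" "\<lambda>y. D2 y s0" using str y0 by auto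
    have "norm y0 < R" "x = D y0 s0" "r = G y0 s0 - y0 \<bullet> D y0 s0" using contact[OF y0(1) _ above eq] r by auto
    then have "q = g (y0, s0)" "(y0, s0) \<in> S" using y0 \<open>s0 \<noteq> b\<close> by (auto simp: S_def g_def q)
    then show "q \<in> g ` S" by blast
  qed
  have inj: "inj_on g S"
  proof (rule inj_onI)
    \<comment> \<open>A contact point at the later time \<open>t\<close> lies in the body of time
      \<open>t\<close>, whose support value at \<open>y\<close> is already below the value attained
      at time \<open>s\<close>.\<close>
    have key: "\<not> s < t" if "norm y < R" "norm z < R" "a \<le> s" "t < b" "D y s = D z t" "G y s - y \<bullet> D y s = G z t - z \<bullet> D z t" for y z s t
    proof
      assume st: "s < t"
      interpret strict_support_fn R "\<lambda>y. G y t" "\<lambda>y. D y t" "\<lambda>y. D2 y t" using str st that by auto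
      have "D z t \<bullet> y + (G z t - z \<bullet> D z t) \<le> G y t"
        using contact_point_in_body[of z] that by (auto simp: body_def)
      moreover have "G y t < G y s" using dec st that by simp
      ultimately show False using that by (simp add: inner_commute)
    qed
    fix p q assume pq: "p \<in> S" "q \<in> S" "g p = g q"
    obtain y s z t where e: "p = (y, s)" "q = (z, t)" by (cases p, cases q)
    have h: "norm y < R" "norm z < R" "s \<in> {a..<b}" "t \<in> {a..<b}" "D y s = D z t"
      "G y s - y \<bullet> D y s = G z t - z \<bullet> D z t"
      using pq by (auto simp: e S_def g_def)
    have "s = t" using key[of y z s t] key[of z y t s] h by (metis atLeastLessThan_iff linorder_neqE_linordered_idom)
    moreover interpret strict_support_fn R "\<lambda>y. G y s" "\<lambda>y. D y s" "\<lambda>y. D2 y s" using str h by auto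
    have "y = z" using gradient_inj[of y z] h \<open>s = t\<close> by simp
    ultimately show "p = q" by (simp add: e)
  qed
  have Sb: "S \<in> sets borel" unfolding S_def by (intro borel_Times) auto
  have detpos: "0 < det (D2 y s)" if "norm y \<le> R" "s \<in> {a..b}" for y s
    using det_pos_of_pos_form pos[OF that] by blast
  have ind: "indicator S p * \<bar>?c p * det (?A p)\<bar> = indicator S p * - (?c p * det (?A p))" for p
  proof (cases "p \<in> S")
    case True
    then have "?c p * det (?A p) < 0" using neg detpos SQ by (intro mult_neg_pos) auto
    then show ?thesis by simp
  qed simp
  have intQ: "set_integrable lborel ?Q (\<lambda>p. - (?c p * det (?A p)))"
    by (intro set_integrable_compact compact_Times continuous_intros cont) auto
  then have intS: "set_integrable lborel S (\<lambda>p. - (?c p * det (?A p)))"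
    by (rule set_integrable_subset) (use Sb SQ in auto)
  then have int: "integrable lborel (\<lambda>p. indicator S p * \<bar>?c p * det (?A p)\<bar>)"
    by (simp add: set_integrable_def ind)
  note m = measure_shear_image[where g = g and S = S and A = ?A and c = ?c and p = fst and a = "\<lambda>p. e (fst p) (snd p)",
      OF Sb derg inj int]
  have cb: "compact (body R (\<lambda>y. G y s))" if "s \<in> {a..b}" for s
  proof -
    interpret strict_support_fn R "\<lambda>y. G y s" "\<lambda>y. D y s" "\<lambda>y. D2 y s" using str that by auto
    show ?thesis by (rule compact_body[OF R continuous])
  qed
  have lm: "body R (\<lambda>y. G y a) \<in> lmeasurable" "body R (\<lambda>y. G y b) \<in> lmeasurable"
    using cb ab by (auto intro: lmeasurable_compact)
  have neg0: "negligible {p :: (real^'n) \<times> real. snd p = 0}"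
    using negligible_hyperplane[of "(0::real^'n, 1::real)" 0] by (simp add: zero_prod_def inner_prod_def)
  let ?X = "body R (\<lambda>y. G y a)" and ?Y = "body R (\<lambda>y. G y b)"
  have XY: "?Y \<subseteq> ?X" using ab by (intro body_mono less_imp_le[OF dec]) auto
  have "measure lebesgue (g ` S) = measure lebesgue (?X - ?Y)"
  proof (rule measure_negligible_symdiff)
    show "?X - ?Y \<in> lmeasurable" by (rule fmeasurable.Diff[OF lm])
    show "negligible ((?X - ?Y) - g ` S \<union> (g ` S - (?X - ?Y)))"
      by (rule negligible_subset[OF neg0]) (unfold img, blast)
  qed
  also have "\<dots> = measure lebesgue ?X - measure lebesgue ?Y"
    by (rule measurable_measure_Diff[OF lm(1) _ XY]) (rule fmeasurableD[OF lm(2)])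
  finally have "measure lebesgue (body R (\<lambda>y. G y a)) - measure lebesgue (body R (\<lambda>y. G y b)) = measure lebesgue (g ` S)" ..
  also have "\<dots> = (LINT p:S|lborel. - (?c p * det (?A p)))"
    using m(2) by (simp add: set_lebesgue_integral_def ind)
  also have "\<dots> = (LINT p:?Q|lborel. - (?c p * det (?A p)))"
  proof (rule set_integral_cong_set[symmetric])
    have "?Q - S \<subseteq> frontier ?Q"
    proof -
      have "interior ?Q = ball 0 R \<times> {a<..<b}" by (simp add: interior_Times)
      then show ?thesis by (auto simp: frontier_def S_def closed_Times)
    qed
    moreover have "negligible (frontier ?Q)" by (intro negligible_convex_frontier convex_Times) auto
    ultimately have "negligible (?Q - S)" by (rule negligible_subset[rotated])
    moreover have "?Q - S \<in> sets borel" by (intro sets.Diff borel_closed closed_Times Sb) auto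
    ultimately have "?Q - S \<in> null_sets lborel"
      by (simp add: negligible_iff_null_sets null_sets_completion_iff)
    then have "AE p in lborel. p \<notin> ?Q - S" by (rule AE_not_in)
    then show "AE p in lborel. (p \<in> S) = (p \<in> ?Q)" by eventually_elim (use SQ in auto)
    show "set_borel_measurable lborel S (\<lambda>p. - (?c p * det (?A p)))"
      using intS by (auto simp: set_borel_measurable_def set_integrable_def)
    show "set_borel_measurable lborel ?Q (\<lambda>p. - (?c p * det (?A p)))"
      using intQ by (auto simp: set_borel_measurable_def set_integrable_def)
  qed
  finally show ?thesis .
qed

text \<open>When the Jacobian density separates as \<open>exp (- (k * s)) * q y\<close>, the time
  integral is explicit. Both the homothety and the rescaled flow have this form.\<close>

lemma sweep_volume_exp:
  fixes G Gs :: "real^'n::finite \<Rightarrow> real \<Rightarrow> real" and D e :: "real^'n \<Rightarrow> real \<Rightarrow> real^'n"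
    and D2 :: "real^'n \<Rightarrow> real \<Rightarrow> real^'n^'n"
  assumes R: "0 < R" and ab: "a < b" and k: "0 < k"
    and dG: "\<And>y s. norm y \<le> R \<Longrightarrow> s \<in> {a..b} \<Longrightarrow> ((\<lambda>p. G (fst p) (snd p)) has_derivative
              (\<lambda>(v, r). D y s \<bullet> v + r * Gs y s)) (at (y, s) within cball 0 R \<times> {a..b})"
    and dD: "\<And>y s. norm y \<le> R \<Longrightarrow> s \<in> {a..b} \<Longrightarrow> ((\<lambda>p. D (fst p) (snd p)) has_derivative
              (\<lambda>(v, r). D2 y s *v v + r *\<^sub>R e y s)) (at (y, s) within cball 0 R \<times> {a..b})"
    and pos: "\<And>y s v. norm y \<le> R \<Longrightarrow> s \<in> {a..b} \<Longrightarrow> v \<noteq> 0 \<Longrightarrow> 0 < v \<bullet> (D2 y s *v v)"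
    and neumann: "\<And>y s. norm y = R \<Longrightarrow> s \<in> {a..b} \<Longrightarrow> y \<bullet> D y s = G y s"
    and neg: "\<And>y s. norm y \<le> R \<Longrightarrow> s \<in> {a..b} \<Longrightarrow> Gs y s < 0"
    and q: "continuous_on (cball 0 R) q"
    and prod: "\<And>y s. norm y \<le> R \<Longrightarrow> s \<in> {a..b} \<Longrightarrow> - (Gs y s * det (D2 y s)) = exp (- (k * s)) * q y"
  shows "measure lebesgue (body R (\<lambda>y. G y a)) - measure lebesgue (body R (\<lambda>y. G y b))
    = (exp (- (k * a)) - exp (- (k * b))) / k * (LINT y:cball 0 R|lborel. q y)"
proof -
  let ?Q = "cball (0::real^'n) R \<times> {a..b}"
  have pr: "Gs (fst p) (snd p) * det (D2 (fst p) (snd p)) = - (exp (- (k * snd p)) * q (fst p))" if "p \<in> ?Q" for p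
    using prod[of "fst p" "snd p"] that by auto
  have cq: "continuous_on ?Q (\<lambda>p. exp (- (k * snd p)) * q (fst p))"
    by (intro continuous_intros continuous_on_compose2[OF q]) auto
  have c: "continuous_on ?Q (\<lambda>p. Gs (fst p) (snd p) * det (D2 (fst p) (snd p)))"
    by (subst continuous_on_cong[OF refl pr]) (use cq in \<open>auto intro!: continuous_intros\<close>)
  have "measure lebesgue (body R (\<lambda>y. G y a)) - measure lebesgue (body R (\<lambda>y. G y b))
    = (LINT p:?Q|lborel. - (Gs (fst p) (snd p) * det (D2 (fst p) (snd p))))"
    by (rule sweep_volume[OF R ab dG dD pos neumann neg c])
  also have "\<dots> = (LINT p:?Q|lborel. exp (- (k * snd p)) * q (fst p))"
    by (intro set_lebesgue_integral_cong) (auto simp: pr borel_closed closed_Times)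
  also have "\<dots> = (LINT s:{a..b}|lborel. LINT y:cball 0 R|lborel. exp (- (k * s)) * q y)"
    using set_integral_Times_swap(2)[of "cball 0 R" "{a..b}" "\<lambda>y s. exp (- (k * s)) * q y"] cq
    by (simp add: case_prod_beta')
  also have "\<dots> = (LINT s:{a..b}|lborel. exp (- (k * s))) * (LINT y:cball 0 R|lborel. q y)"
    by simp
  also have "(LINT s:{a..b}|lborel. exp (- (k * s))) = (- exp (- (k * b)) / k) - (- exp (- (k * a)) / k)"
  proof -
    have "((\<lambda>s. - exp (- (k * s)) / k) has_vector_derivative exp (- (k * x))) (at x within {a..b})" for x
      unfolding has_real_derivative_iff_has_vector_derivative[symmetric]
      using k by (auto intro!: derivative_eq_intros)
    then show ?thesis
      unfolding set_lebesgue_integral_def using ab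
      by (intro integral_FTC_Icc) (auto intro!: continuous_intros)
  qed
  finally show ?thesis using k by (simp add: field_simps)
qed

section \<open>Scaling, translation and the cone formula\<close>

lemma det_scaleR: "det (c *\<^sub>R A :: real^'n::finite^'n) = c ^ CARD('n) * det A"
  by (simp add: det_def prod.distrib sum_distrib_left algebra_simps)

lemma body_scale:
  assumes c: "0 < c"
  shows "measure lebesgue (body R (\<lambda>y. c * H y)) = c ^ Suc CARD('n) * measure lebesgue (body R (H :: real^'n::finite \<Rightarrow> real))"
proof -
  have "body R (\<lambda>y. c * H y) = (\<lambda>p. c *\<^sub>R p + 0) ` body R H"
  proof (intro set_eqI iffI)
    fix p :: "(real^'n) \<times> real" assume p: "p \<in> body R (\<lambda>y. c * H y)"
    have "(1 / c) *\<^sub>R p \<in> body R H"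
      using p c by (auto simp: body_def field_simps zero_le_mult_iff)
    then show "p \<in> (\<lambda>p. c *\<^sub>R p + 0) ` body R H"
      using c by (intro image_eqI[of _ _ "(1 / c) *\<^sub>R p"]) auto
  next
    fix p assume "p \<in> (\<lambda>p. c *\<^sub>R p + 0) ` body R H"
    then show "p \<in> body R (\<lambda>y. c * H y)"
      using c by (auto simp: body_def simp flip: distrib_left intro!: mult_left_mono)
  qed
  then show ?thesis
    using measure_lebesgue_affine[of c 0 "body R H"] c by simp
qed

lemma body_translate:
  "measure lebesgue (body R (\<lambda>y. H y - z \<bullet> y)) = measure lebesgue (body R (H :: real^'n::finite \<Rightarrow> real))"
proof -
  have "body R (\<lambda>y. H y - z \<bullet> y) = (+) (- z, 0) ` body R H"
  proof (intro set_eqI iffI)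
    fix p assume "p \<in> body R (\<lambda>y. H y - z \<bullet> y)"
    then have "p + (z, 0) \<in> body R H" by (cases p) (auto simp: body_def inner_add_left algebra_simps)
    then show "p \<in> (+) (- z, 0) ` body R H"
      by (intro image_eqI[of _ _ "p + (z, 0)"]) (auto simp: prod_eq_iff)
  qed (auto simp: body_def inner_add_left algebra_simps inner_diff_left)
  then show ?thesis by (simp add: measure_translation)
qed

lemma has_derivative_exp_scaleR:
  fixes g :: "'a::real_normed_vector \<times> real \<Rightarrow> 'b::real_normed_vector"
  assumes "(g has_derivative (\<lambda>(v, r). A v + r *\<^sub>R B)) (at (y, s) within S)"
  shows "((\<lambda>p. exp (- snd p) *\<^sub>R g p) has_derivative
           (\<lambda>(v, r). exp (- s) *\<^sub>R A v + r *\<^sub>R (exp (- s) *\<^sub>R (B - g (y, s))))) (at (y, s) within S)"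
proof -
  have "((\<lambda>p. exp (- snd p)) has_derivative (\<lambda>(v, r). - (exp (- s) * r))) (at (y, s) within S)"
    by (auto intro!: derivative_eq_intros simp: fun_eq_iff)
  from has_derivative_scaleR[OF this assms] show ?thesis
    by (rule has_derivative_eq_rhs) (auto simp: fun_eq_iff algebra_simps)
qed

context strict_support_fn
begin

text \<open>Sweep the body by its homothetic copies of ratio \<open>exp (- s)\<close> for
  \<open>s\<close> from 0 to 1; positivity of \<open>H\<close> makes the family strictly decreasing.
  The lost volume is a known multiple of the volume itself, and the common factor cancels.\<close>

lemma cone_volume:
  assumes D2: "continuous_on (cball 0 R) D2" and Hpos: "\<And>y. norm y \<le> R \<Longrightarrow> 0 < H y"
  shows "(LINT y:cball 0 R|lborel. H y * det (D2 y)) = (CARD('n) + 1) * measure lebesgue (body R H)"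
proof -
  let ?k = "real (CARD('n) + 1)"
  let ?S = "cball 0 R \<times> {0..1::real}"
  define V where "V = measure lebesgue (body R H)"
  have f: "(fst has_derivative fst) (at p within ?S)" for p by (rule has_derivative_fst[OF has_derivative_ident])
  have sub: "fst ` ?S \<subseteq> cball 0 R" by auto
  have "measure lebesgue (body R (\<lambda>y. exp (- 0) * H y)) - measure lebesgue (body R (\<lambda>y. exp (- 1) * H y))
    = (exp (- (?k * 0)) - exp (- (?k * 1))) / ?k * (LINT y:cball 0 R|lborel. H y * det (D2 y))"
  proof (rule sweep_volume_exp[where Gs = "\<lambda>y s. - (exp (- s) * H y)" and D = "\<lambda>y s. exp (- s) *\<^sub>R D y"
        and e = "\<lambda>y s. - (exp (- s) *\<^sub>R D y)" and ?D2.0 = "\<lambda>y s. exp (- s) *\<^sub>R D2 y" and G = "\<lambda>y s. exp (- s) * H y"])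
    fix y :: "real^'n" and s :: real assume y: "norm y \<le> R"
    have "((H \<circ> fst) has_derivative (\<lambda>v. D y \<bullet> v) \<circ> fst) (at (y, s) within ?S)"
      by (rule diff_chain_within[OF f]) (use has_derivative_subset[OF deriv[OF y] sub] in simp)
    then have "((\<lambda>p. H (fst p)) has_derivative (\<lambda>(v, r). D y \<bullet> v + r *\<^sub>R 0)) (at (y, s) within ?S)"
      by (simp add: o_def case_prod_beta')
    note * = has_derivative_exp_scaleR[OF this]
    show "((\<lambda>p. exp (- snd p) * H (fst p)) has_derivative (\<lambda>(v, r). exp (- s) *\<^sub>R D y \<bullet> v + r * - (exp (- s) * H y))) (at (y, s) within ?S)"
      by (rule has_derivative_eq_rhs[OF *[unfolded real_scaleR_def]]) (auto simp: fun_eq_iff)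
    have "((D \<circ> fst) has_derivative (\<lambda>v. D2 y *v v) \<circ> fst) (at (y, s) within ?S)"
      by (rule diff_chain_within[OF f]) (use has_derivative_subset[OF deriv2[OF y] sub] in simp)
    then have "((\<lambda>p. D (fst p)) has_derivative (\<lambda>(v, r). D2 y *v v + r *\<^sub>R 0)) (at (y, s) within ?S)"
      by (simp add: o_def case_prod_beta')
    from has_derivative_exp_scaleR[OF this]
    show "((\<lambda>p. exp (- snd p) *\<^sub>R D (fst p)) has_derivative (\<lambda>(v, r). (exp (- s) *\<^sub>R D2 y) *v v + r *\<^sub>R - (exp (- s) *\<^sub>R D y))) (at (y, s) within ?S)"
      by (rule has_derivative_eq_rhs) (auto simp: fun_eq_iff scaleR_matrix_vector_assoc)
    show "0 < v \<bullet> (exp (- s) *\<^sub>R D2 y *v v)" if "v \<noteq> 0" for v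
      using posdef[OF y that] by (simp flip: scaleR_matrix_vector_assoc)
    show "- (- (exp (- s) * H y) * det (exp (- s) *\<^sub>R D2 y)) = exp (- (?k * s)) * (H y * det (D2 y))"
    proof -
      have "det (exp (- s) *\<^sub>R D2 y) = exp (- (real CARD('n) * s)) * det (D2 y)"
        by (simp add: det_scaleR exp_of_nat_mult[symmetric])
      moreover have "exp (- (?k * s)) = exp (- s) * exp (- (real CARD('n) * s))"
        by (simp add: exp_add[symmetric] algebra_simps)
      ultimately show ?thesis by simp
    qed
  qed (use R_pos neumann Hpos in \<open>auto intro!: continuous_intros continuous D2\<close>)
  then have "V - exp (- 1) ^ Suc CARD('n) * V = (1 - exp (- ?k)) / ?k * (LINT y:cball 0 R|lborel. H y * det (D2 y))"
    by (simp add: body_scale V_def)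
  moreover have "exp (- 1) ^ Suc CARD('n) = exp (- ?k)"
    by (simp only: exp_of_nat_mult[symmetric]) simp
  moreover have "1 - exp (- ?k) \<noteq> 0" by simp
  moreover have "V * K = I" if "V - E * V = (1 - E) / K * I" "1 - E \<noteq> 0" "K \<noteq> 0" for E K I :: real
  proof -
    have "(1 - E) * (V * K) = (1 - E) * I" using that(1,3) by (simp add: field_simps)
    then show ?thesis using that(2) by (metis mult_left_cancel)
  qed
  ultimately have "V * ?k = (LINT y:cball 0 R|lborel. H y * det (D2 y))" by simp
  then show ?thesis by (simp add: V_def mult.commute)
qed

end

section \<open>The flow of the support function and its volume\<close>

text \<open>Derivatives are assumed for positive times only, with mere continuity of
  \<open>H\<close> at time 0; initial data are reached by limits. The field \<open>e\<close> is the
  time derivative of \<open>D\<close>.\<close>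

locale capillary_flow =
  fixes R :: real and \<rho> :: "real^'n::finite \<Rightarrow> real" and H :: "real^'n \<Rightarrow> real \<Rightarrow> real"
    and D :: "real^'n \<Rightarrow> real \<Rightarrow> real^'n" and D2 :: "real^'n \<Rightarrow> real \<Rightarrow> real^'n^'n"
    and e :: "real^'n \<Rightarrow> real \<Rightarrow> real^'n" and k :: real
  assumes k_eq: "k = real (CARD('n) + 1)"
    and R_pos: "0 < R"
    and rho_cont: "continuous_on (cball 0 R) \<rho>"
    and rho_pos: "\<And>y. norm y \<le> R \<Longrightarrow> 0 < \<rho> y"
    and H_cont: "continuous_on (cball 0 R \<times> {0..}) (\<lambda>p. H (fst p) (snd p))"
    and H_pos: "\<And>y t. norm y \<le> R \<Longrightarrow> 0 \<le> t \<Longrightarrow> 0 < H y t"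
    and dH: "\<And>y t. norm y \<le> R \<Longrightarrow> 0 < t \<Longrightarrow> ((\<lambda>p. H (fst p) (snd p)) has_derivative
              (\<lambda>(v, r). D y t \<bullet> v + r *\<^sub>R (H y t - \<rho> y / det (D2 y t)))) (at (y, t) within cball 0 R \<times> {0<..})"
    and dD: "\<And>y t. norm y \<le> R \<Longrightarrow> 0 < t \<Longrightarrow> ((\<lambda>p. D (fst p) (snd p)) has_derivative
              (\<lambda>(v, r). D2 y t *v v + r *\<^sub>R e y t)) (at (y, t) within cball 0 R \<times> {0<..})"
    and D2_cont: "continuous_on (cball 0 R \<times> {0<..}) (\<lambda>p. D2 (fst p) (snd p))"
    and pos: "\<And>y t v. norm y \<le> R \<Longrightarrow> 0 < t \<Longrightarrow> v \<noteq> 0 \<Longrightarrow> 0 < v \<bullet> (D2 y t *v v)"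
    and sym: "\<And>y t. norm y \<le> R \<Longrightarrow> 0 < t \<Longrightarrow> transpose (D2 y t) = D2 y t"
    and neumann: "\<And>y t. norm y = R \<Longrightarrow> 0 < t \<Longrightarrow> y \<bullet> D y t = H y t"
begin

lemma det_pos: "norm y \<le> R \<Longrightarrow> 0 < t \<Longrightarrow> 0 < det (D2 y t)"
  using det_pos_of_pos_form pos by blast

lemma strict_support:
  assumes t: "0 < t"
  shows "strict_support_fn R (\<lambda>y. H y t - z \<bullet> y) (\<lambda>y. D y t - z) (\<lambda>y. D2 y t)"
proof
  have i: "((\<lambda>y. (y, t)) has_derivative (\<lambda>v. (v, 0))) (at y within cball 0 R)" for y
    by (auto intro!: derivative_eq_intros)
  have sub: "(\<lambda>y. (y, t)) ` cball 0 R \<subseteq> cball 0 R \<times> {0<..}" using t by auto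
  fix y :: "real^'n" assume y: "norm y \<le> R"
  have "((\<lambda>y. H y t) has_derivative (\<lambda>v. D y t \<bullet> v)) (at y within cball 0 R)"
    using diff_chain_within[OF i has_derivative_subset[OF dH[OF y t] sub]] by (simp add: o_def)
  then show "((\<lambda>y. H y t - z \<bullet> y) has_derivative (\<lambda>v. (D y t - z) \<bullet> v)) (at y within cball 0 R)"
    unfolding inner_diff_left by (intro derivative_intros)
  have "((\<lambda>y. D y t) has_derivative (\<lambda>v. D2 y t *v v)) (at y within cball 0 R)"
    using diff_chain_within[OF i has_derivative_subset[OF dD[OF y t] sub]] by (simp add: o_def)
  from has_derivative_diff[OF this has_derivative_const[of z]]
  show "((\<lambda>y. D y t - z) has_derivative (\<lambda>v. D2 y t *v v)) (at y within cball 0 R)" by simp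
qed (use R_pos neumann pos t in \<open>auto simp: inner_diff_right inner_commute\<close>)

lemma strict_support0: "0 < t \<Longrightarrow> strict_support_fn R (\<lambda>y. H y t) (\<lambda>y. D y t) (\<lambda>y. D2 y t)"
  using strict_support[of t 0] by simp

lemma H_cont_space: "0 \<le> t \<Longrightarrow> continuous_on (cball 0 R) (\<lambda>y. H y t)"
  using continuous_on_compose2[OF H_cont, of "cball 0 R" "\<lambda>y. (y, t)"] by (force intro!: continuous_intros)

lemma time_deriv:
  assumes y: "norm y \<le> R" and t: "0 < t"
  shows "((\<lambda>t. H y t) has_real_derivative (H y t - \<rho> y / det (D2 y t))) (at t)"
proof -
  have i: "((\<lambda>r. (y, r)) has_derivative (\<lambda>v. (0, v))) (at t within {0<..})"
    by (auto intro!: derivative_eq_intros)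
  have sub: "(\<lambda>r. (y, r)) ` {0<..} \<subseteq> cball 0 R \<times> {0<..}" using y by auto
  have "((\<lambda>r. H y r) has_derivative (\<lambda>v. v * (H y t - \<rho> y / det (D2 y t)))) (at t within {0<..})"
    using diff_chain_within[OF i has_derivative_subset[OF dH[OF y t] sub]] by (simp add: o_def)
  then show ?thesis using t by (simp add: has_field_derivative_def mult_commute_abs at_within_open[of t "{0<..}"])
qed

definition volume where "volume t = measure lebesgue (body R (\<lambda>y. H y t))"
definition total where "total = (LINT y:cball 0 R|lborel. \<rho> y)"
text \<open>The function \<open>exp (- s) * H\<close> has time derivative
  \<open>- exp (- s) * \<rho> / det\<close>, so it strictly decreases, and in the sweep the
  determinant of the Hessian cancels: only \<open>exp (- (k * s)) * \<rho>\<close> is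
  integrated.\<close>

lemma volume_evolution:
  assumes ab: "0 < a" "a < b"
  shows "exp (- (k * a)) * (volume a - total / k) = exp (- (k * b)) * (volume b - total / k)"
proof -
  let ?S = "cball 0 R \<times> {a..b}"
  have sub: "?S \<subseteq> cball 0 R \<times> {0<..}" using ab by auto
  have "measure lebesgue (body R (\<lambda>y. exp (- a) * H y a)) - measure lebesgue (body R (\<lambda>y. exp (- b) * H y b))
    = (exp (- (k * a)) - exp (- (k * b))) / k * (LINT y:cball 0 R|lborel. \<rho> y)"
  proof (rule sweep_volume_exp[where Gs = "\<lambda>y s. - (exp (- s) * (\<rho> y / det (D2 y s)))" and D = "\<lambda>y s. exp (- s) *\<^sub>R D y s"
        and e = "\<lambda>y s. exp (- s) *\<^sub>R (e y s - D y s)" and ?D2.0 = "\<lambda>y s. exp (- s) *\<^sub>R D2 y s" and G = "\<lambda>y s. exp (- s) * H y s"])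
    fix y :: "real^'n" and s :: real assume y: "norm y \<le> R" and s: "s \<in> {a..b}"
    have s0: "0 < s" using s ab by simp
    note * = has_derivative_exp_scaleR[OF has_derivative_subset[OF dH[OF y s0] sub]]
    show "((\<lambda>p. exp (- snd p) * H (fst p) (snd p)) has_derivative (\<lambda>(v, r). exp (- s) *\<^sub>R D y s \<bullet> v + r * - (exp (- s) * (\<rho> y / det (D2 y s))))) (at (y, s) within ?S)"
      by (rule has_derivative_eq_rhs[OF *[unfolded real_scaleR_def]]) (auto simp: fun_eq_iff)
    from has_derivative_exp_scaleR[OF has_derivative_subset[OF dD[OF y s0] sub]]
    show "((\<lambda>p. exp (- snd p) *\<^sub>R D (fst p) (snd p)) has_derivative (\<lambda>(v, r). (exp (- s) *\<^sub>R D2 y s) *v v + r *\<^sub>R (exp (- s) *\<^sub>R (e y s - D y s)))) (at (y, s) within ?S)"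
      by (rule has_derivative_eq_rhs) (auto simp: fun_eq_iff scaleR_matrix_vector_assoc)
    show "0 < v \<bullet> (exp (- s) *\<^sub>R D2 y s *v v)" if "v \<noteq> 0" for v
      using pos[OF y s0 that] by (simp flip: scaleR_matrix_vector_assoc)
    show "- (exp (- s) * (\<rho> y / det (D2 y s))) < 0" using rho_pos[OF y] det_pos[OF y s0] by simp
    have "det (exp (- s) *\<^sub>R D2 y s) = exp (- (real CARD('n) * s)) * det (D2 y s)"
      by (simp add: det_scaleR exp_of_nat_mult[symmetric])
    moreover have "exp (- s) * exp (- (real CARD('n) * s)) = exp (- (k * s))"
      by (simp add: exp_add[symmetric] algebra_simps k_eq)
    ultimately show "- (- (exp (- s) * (\<rho> y / det (D2 y s))) * det (exp (- s) *\<^sub>R D2 y s)) = exp (- (k * s)) * \<rho> y"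
      using det_pos[OF y s0] by (simp add: field_simps)
  next
    show "y \<bullet> exp (- s) *\<^sub>R D y s = exp (- s) * H y s" if "norm y = R" "s \<in> {a..b}" for y s
      using neumann[OF that(1), of s] that ab by simp
  qed (use R_pos ab rho_cont k_eq in auto)
  moreover have "exp (- x) ^ Suc CARD('n) = exp (- (k * x))" for x
    by (simp only: exp_of_nat_mult[symmetric]) (simp add: algebra_simps k_eq)
  ultimately have "exp (- (k * a)) * volume a - exp (- (k * b)) * volume b = (exp (- (k * a)) - exp (- (k * b))) / k * total"
    by (simp add: body_scale volume_def total_def del: power_Suc)
  then show ?thesis using k_eq by (simp add: field_simps)
qed


text \<open>Uniform continuity and a positive minimum of \<open>H\<close> at time 0 squeeze the body
  between the multiples \<open>1 - d\<close> and \<open>1 + d\<close> of the initial one.\<close>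

lemma volume_continuous_0: "(volume \<longlongrightarrow> volume 0) (at_right 0)"
proof (rule tendstoI)
  fix \<epsilon> :: real assume \<epsilon>: "0 < \<epsilon>"
  let ?N = "Suc CARD('n)"
  have cp: "compact (body R (\<lambda>y. H y t))" if "0 \<le> t" for t
    by (rule compact_body[OF R_pos H_cont_space[OF that]])
  have "((\<lambda>d. (1 + d) ^ ?N * volume 0) \<longlongrightarrow> (1 + 0) ^ ?N * volume 0) (at_right (0::real))"
    "((\<lambda>d. (1 - d) ^ ?N * volume 0) \<longlongrightarrow> (1 - 0) ^ ?N * volume 0) (at_right (0::real))"
    by (intro tendsto_intros)+
  from this[THEN tendstoD, OF \<epsilon>]
  have "eventually (\<lambda>d. \<bar>(1 + d) ^ ?N * volume 0 - volume 0\<bar> < \<epsilon> \<and> \<bar>(1 - d) ^ ?N * volume 0 - volume 0\<bar> < \<epsilon>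
      \<and> d < 1 \<and> 0 < d) (at_right 0)"
    using eventually_at_right_less[of "0::real"] eventually_at_right_field[of "\<lambda>d. d < 1" "0::real"]
    by (auto simp: dist_real_def eventually_conj_iff intro!: exI[of _ 1])
  then obtain d where d: "0 < d" "d < 1" "\<bar>(1 + d) ^ ?N * volume 0 - volume 0\<bar> < \<epsilon>"
     "\<bar>(1 - d) ^ ?N * volume 0 - volume 0\<bar> < \<epsilon>"
    by (metis (no_types, lifting) eventually_happens trivial_limit_at_right_real)
  obtain y0 where y0: "norm y0 \<le> R" "\<And>y. norm y \<le> R \<Longrightarrow> H y0 0 \<le> H y 0"
    using continuous_attains_inf[OF compact_cball _ H_cont_space[of 0]] R_pos by (auto simp: Ball_def)
  have m: "0 < H y0 0" using H_pos[OF y0(1)] by simp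
  have "uniformly_continuous_on (cball 0 R \<times> {0..1}) (\<lambda>p. H (fst p) (snd p))"
    by (intro compact_uniformly_continuous compact_Times continuous_on_subset[OF H_cont]) auto
  then obtain \<delta> where \<delta>: "0 < \<delta>" "\<And>p q. p \<in> cball 0 R \<times> {0..1} \<Longrightarrow> q \<in> cball 0 R \<times> {0..1} \<Longrightarrow> dist q p < \<delta> \<Longrightarrow>
      dist (H (fst q) (snd q)) (H (fst p) (snd p)) < d * H y0 0"
    using m d unfolding uniformly_continuous_on_def by (metis mult_pos_pos)
  have "dist (volume t) (volume 0) < \<epsilon>" if t: "0 < t" "t < min \<delta> 1" for t
  proof -
    have *: "(1 - d) * H y 0 \<le> H y t" "H y t \<le> (1 + d) * H y 0" if y: "norm y \<le> R" for y
    proof -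
      have "\<bar>H y t - H y 0\<bar> < d * H y0 0"
        using \<delta>(2)[of "(y, 0)" "(y, t)"] y t by (simp add: dist_Pair_Pair dist_real_def)
      moreover have "d * H y0 0 \<le> d * H y 0" using y0(2)[OF y] d by simp
      ultimately show "(1 - d) * H y 0 \<le> H y t" "H y t \<le> (1 + d) * H y 0" by (auto simp: algebra_simps)
    qed
    have lm: "body R (\<lambda>y. H y t) \<in> lmeasurable" using cp t by (auto intro: lmeasurable_compact)
    have "continuous_on (cball 0 R) (\<lambda>y. c * H y 0)" for c
      by (intro continuous_intros H_cont_space) auto
    then have lm': "body R (\<lambda>y. c * H y 0) \<in> lmeasurable" for c
      by (intro lmeasurable_compact compact_body R_pos)
    have "(1 - d) ^ ?N * volume 0 \<le> volume t"
      unfolding volume_def using d * lm lm'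
      by (subst body_scale[symmetric]) (auto intro!: measure_mono_fmeasurable body_mono dest: fmeasurableD)
    moreover have "volume t \<le> (1 + d) ^ ?N * volume 0"
      unfolding volume_def using d * lm lm'
      by (subst body_scale[symmetric]) (auto intro!: measure_mono_fmeasurable body_mono dest: fmeasurableD)
    ultimately show ?thesis using d by (simp add: dist_real_def)
  qed
  then show "eventually (\<lambda>t. dist (volume t) (volume 0) < \<epsilon>) (at_right 0)"
    unfolding eventually_at_right_field using \<delta>(1) by (intro exI[of _ "min \<delta> 1"]) auto
qed

text \<open>The conserved quantity of \<open>volume_evolution\<close> tends to 0 as time tends to 0,
  hence it is 0.\<close>

lemma volume_const:
  assumes v0: "volume 0 = total / k" and t: "0 < t"
  shows "volume t = total / k"
proof -
  define w where "w = exp (- (k * t)) * (volume t - total / k)"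
  have "((\<lambda>a. exp (- (k * a)) * (volume a - total / k)) \<longlongrightarrow> exp (- (k * 0)) * (volume 0 - total / k)) (at_right 0)"
    by (intro tendsto_intros volume_continuous_0)
  moreover have "eventually (\<lambda>a. exp (- (k * a)) * (volume a - total / k) = w) (at_right 0)"
    unfolding eventually_at_right_field w_def using t volume_evolution by (intro exI[of _ t]) auto
  ultimately have "((\<lambda>a. w) \<longlongrightarrow> 0) (at_right (0::real))"
    using v0 by (auto elim: Lim_transform_eventually)
  then have "w = 0" by (simp add: tendsto_const_iff)
  then show ?thesis by (simp add: w_def)
qed

text \<open>Moving the centre to \<open>z\<close> adds a linear function to \<open>H\<close>, which
  changes neither the second derivative nor the volume, so the cone formula has the same value about
  every centre.\<close>

lemma shifted_integral:
  assumes t: "0 < t" and z: "\<And>y. norm y \<le> R \<Longrightarrow> z \<bullet> y < H y t"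
  shows "(LINT y:cball 0 R|lborel. (H y t - z \<bullet> y) * det (D2 y t)) = k * volume t"
proof -
  interpret strict_support_fn R "\<lambda>y. H y t - z \<bullet> y" "\<lambda>y. D y t - z" "\<lambda>y. D2 y t" by (rule strict_support[OF t])
  have "continuous_on (cball 0 R) (\<lambda>y. D2 y t)"
    using continuous_on_compose2[OF D2_cont, of "cball 0 R" "\<lambda>y. (y, t)"] t by (force intro!: continuous_intros)
  from cone_volume[OF this] z show ?thesis by (simp add: k_eq volume_def body_translate)
qed

end

section \<open>The entropy\<close>

text \<open>At least \<open>D / w\<close> disjoint translates of the slab fit into the ball of
  radius \<open>3 * D\<close>.\<close>

lemma slab_measure:
  fixes u :: "'a::euclidean_space"
  assumes u: "norm u = 1" and D: "0 < D" and w: "0 < w"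
  shows "measure lebesgue {x \<in> cball 0 D. \<alpha> \<le> u \<bullet> x \<and> u \<bullet> x \<le> \<alpha> + w} \<le> measure lebesgue (cball (0::'a) (3 * D)) / D * w"
proof -
  define S where "S = {x \<in> cball 0 D. \<alpha> \<le> u \<bullet> x \<and> u \<bullet> x \<le> \<alpha> + w}"
  have "S = cball 0 D \<inter> ({x. \<alpha> \<le> u \<bullet> x} \<inter> {x. u \<bullet> x \<le> \<alpha> + w})" by (auto simp: S_def)
  also have "compact \<dots>"
    by (intro compact_Int_closed closed_Int closed_Collect_le continuous_intros compact_cball)
  finally have lm: "S \<in> lmeasurable" by (rule lmeasurable_compact)
  define N where "N = nat \<lceil>D / w\<rceil>"
  have N: "D / w \<le> real N" "real N < D / w + 1"
    using D w unfolding N_def by (simp_all add: of_nat_ceiling) linarith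
  \<comment> \<open>Steps of \<open>2 * w\<close> keep the closed slabs disjoint; since
    \<open>j * w < D\<close> for \<open>j < N\<close>, the translates stay within radius
    \<open>3 * D\<close>.\<close>
  define T where "T = (\<lambda>j::nat. (+) ((2 * real j * w) *\<^sub>R u) ` S)"
  have Tlm: "T j \<in> lmeasurable" "measure lebesgue (T j) = measure lebesgue S" for j
    using lm by (simp_all add: T_def measure_translation measurable_translation)
  have slab: "\<alpha> + 2 * real j * w \<le> u \<bullet> x \<and> u \<bullet> x \<le> \<alpha> + 2 * real j * w + w" if "x \<in> T j" for x j
    using that u by (auto simp: T_def S_def inner_add_right power2_norm_eq_inner[symmetric] norm_eq_1)
  have disj: "disjoint_family_on T {..<N}"
  proof (unfold disjoint_family_on_def, intro ballI impI)
    have *: "T i \<inter> T j = {}" if "i < j" for i j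
    proof (rule ccontr)
      assume "T i \<inter> T j \<noteq> {}"
      then obtain x where "x \<in> T i" "x \<in> T j" by auto
      then have "2 * real j * w \<le> 2 * real i * w + w" using slab[of x i] slab[of x j] by linarith
      then have "w * (2 * real j - 2 * real i - 1) \<le> 0" by (simp add: algebra_simps)
      moreover have "1 \<le> 2 * real j - 2 * real i - 1" using that by linarith
      ultimately show False using w by (smt (verit) mult_pos_pos)
    qed
    fix i j :: nat assume "i \<noteq> j"
    then show "T i \<inter> T j = {}" using *[of i j] *[of j i] by (cases "i < j") auto
  qed
  have "real N * measure lebesgue S = measure lebesgue (\<Union>j\<in>{..<N}. T j)"
    using fmeasurableD[OF Tlm(1)] fmeasurableD2[OF Tlm(1)] Tlm(2) disj
    by (subst measure_finite_Union) (auto simp del: emeasure_completion)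
  also have "\<dots> \<le> measure lebesgue (cball (0::'a) (3 * D))"
  proof (rule measure_mono_fmeasurable)
    show "(\<Union>j\<in>{..<N}. T j) \<subseteq> cball 0 (3 * D)"
    proof
      fix x assume "x \<in> (\<Union>j\<in>{..<N}. T j)"
      then obtain j s where j: "j < N" and s: "s \<in> S" and x: "x = (2 * real j * w) *\<^sub>R u + s" by (auto simp: T_def)
      have "norm x \<le> 2 * real j * w + D"
        unfolding x using norm_triangle_ineq[of "(2 * real j * w) *\<^sub>R u" s] s u w by (simp add: S_def)
      moreover have "real j + 1 \<le> real N" using j by linarith
      then have "real j < D / w" using N by linarith
      then have "real j * w < D" using w by (simp add: field_simps)
      ultimately show "x \<in> cball 0 (3 * D)" by simp
    qed
    show "(\<Union>j\<in>{..<N}. T j) \<in> sets lebesgue" using Tlm(1) by (auto intro!: sets.finite_UN dest: fmeasurableD)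
  qed simp
  finally have "real N * measure lebesgue S \<le> measure lebesgue (cball (0::'a) (3 * D))" .
  moreover have "D / w * measure lebesgue S \<le> real N * measure lebesgue S" using N by (intro mult_right_mono) auto
  ultimately have "D / w * measure lebesgue S \<le> measure lebesgue (cball (0::'a) (3 * D))" by linarith
  then show ?thesis using D w by (simp add: S_def field_simps)
qed

text \<open>A dyadic layer-cake bound: each halving of the argument costs \<open>ln 2\<close>, and
  the sum counts the dyadic scales above \<open>a\<close>. The truncation keeps the logarithm
  continuous.\<close>

lemma ln_max_lower:
  assumes a: "0 \<le> a"
  shows "- ln (max a ((1/2) ^ N)) \<le> ln 2 * (\<Sum>k<N. if a \<le> (1/2) ^ k then 1 else 0 :: real)"
proof (induction N)
  case 0
  have "0 \<le> ln (max a 1)" by simp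
  then show ?case by simp
next
  case (Suc N)
  show ?case
  proof (cases "a \<le> (1/2) ^ N")
    case True
    have "(\<Sum>k<Suc N. if a \<le> (1/2) ^ k then 1 else 0 :: real) = (\<Sum>k<Suc N. 1)"
    proof (rule sum.cong[OF refl])
      fix k assume "k \<in> {..<Suc N}"
      then have "(1/2) ^ N \<le> ((1/2)::real) ^ k" by (intro power_decreasing) auto
      from order_trans[OF True this] show "(if a \<le> (1/2) ^ k then 1 else 0 :: real) = 1" by simp
    qed
    moreover have "ln ((1/2) ^ Suc N) \<le> ln (max a ((1/2) ^ Suc N))" by (subst ln_le_cancel_iff) (auto simp: less_max_iff_disj)
    moreover have "ln ((1/2::real) ^ Suc N) = - (real (Suc N) * ln 2)"
      by (subst ln_realpow) (auto simp: ln_div)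
    ultimately show ?thesis by (simp add: mult.commute)
  next
    case False
    have "(1/2) ^ Suc N \<le> ((1/2)::real) ^ N" by (intro power_decreasing) auto
    then have "max a ((1/2) ^ Suc N) = max a ((1/2) ^ N)" using False by linarith
    then show ?thesis using Suc False by simp
  qed
qed

text \<open>The slab of scale \<open>(1/2) ^ k\<close> has measure at most a constant times
  \<open>(1/2) ^ k\<close>, so the dyadic layers sum to a bound that depends neither on the
  direction nor on the truncation level.\<close>

lemma log_slab_integral:
  fixes \<rho> :: "'a::euclidean_space \<Rightarrow> real"
  assumes R: "0 < R" and \<rho>: "continuous_on (cball 0 R) \<rho>" and \<rho>0: "\<And>y. norm y \<le> R \<Longrightarrow> 0 \<le> \<rho> y"
  shows "\<exists>C. \<forall>e N. norm e = 1 \<longrightarrow> - C \<le> (LINT y:cball 0 R|lborel. \<rho> y * ln (max \<bar>e \<bullet> y\<bar> ((1/2) ^ N)))"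
proof -
  obtain M where M: "\<And>y. norm y \<le> R \<Longrightarrow> \<rho> y \<le> M"
  proof -
    obtain y where "\<forall>z\<in>cball 0 R. \<rho> z \<le> \<rho> y"
      using continuous_attains_sup[OF compact_cball _ \<rho>] R by auto
    then show ?thesis using that[of "\<rho> y"] by simp
  qed
  have M0: "0 \<le> M" using M[of 0] \<rho>0[of 0] R by simp
  \<comment> \<open>The factor 2 is there because
    \<open>\<bar>e \<bullet> y\<bar> \<le> (1/2) ^ k\<close> describes a slab of twice that
    width.\<close>
  define K where "K = measure lebesgue (cball (0::'a) (3 * R)) / R * 2"
  have K0: "0 \<le> K" using R by (simp add: K_def)
  show ?thesis
  proof (rule exI[of _ "M * (ln 2 * (K * 2))"], intro allI impI)
    fix e :: 'a and N assume e: "norm e = 1"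
    define A where "A = (\<lambda>k::nat. {y \<in> cball 0 R. -((1/2) ^ k) \<le> e \<bullet> y \<and> e \<bullet> y \<le> -((1/2) ^ k) + 2 * (1/2) ^ k})"
    have A_alt: "A k = cball 0 R \<inter> ({y. -((1/2) ^ k) \<le> e \<bullet> y} \<inter> {y. e \<bullet> y \<le> -((1/2) ^ k) + 2 * (1/2) ^ k})" for k by (auto simp: A_def)
    have cA: "compact (A k)" for k unfolding A_alt
      by (intro compact_Int_closed closed_Int closed_Collect_le continuous_intros compact_cball)
    have mA: "measure lborel (A k) \<le> K * (1/2) ^ k" for k
    proof -
      have "measure lebesgue (A k) \<le> measure lebesgue (cball (0::'a) (3 * R)) / R * (2 * (1/2) ^ k)"
        unfolding A_def by (rule slab_measure[OF e R]) simp
      moreover have "measure lebesgue (A k) = measure lborel (A k)"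
        using cA by (intro measure_completion) (simp add: borel_compact)
      ultimately show ?thesis by (simp add: K_def)
    qed
    have iA: "integrable lborel (\<lambda>y. indicator (A k) y :: real)" for k
      using cA emeasure_compact_finite[of "A k"] by (intro integrable_real_indicator) (auto simp: borel_compact)
    have ptw: "- (indicator (cball 0 R) y * (\<rho> y * ln (max \<bar>e \<bullet> y\<bar> ((1/2) ^ N)))) \<le> M * (ln 2 * (\<Sum>k<N. indicator (A k) y))" for y
    proof (cases "norm y \<le> R")
      case True
      have eq: "(\<Sum>k<N. if \<bar>e \<bullet> y\<bar> \<le> (1/2) ^ k then 1 else 0 :: real) = (\<Sum>k<N. indicator (A k) y)"
        using True by (intro sum.cong) (auto simp: A_def indicator_def)
      have "- (\<rho> y * ln (max \<bar>e \<bullet> y\<bar> ((1/2) ^ N))) = \<rho> y * - ln (max \<bar>e \<bullet> y\<bar> ((1/2) ^ N))" by simp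
      also have "\<dots> \<le> \<rho> y * (ln 2 * (\<Sum>k<N. indicator (A k) y))"
        using ln_max_lower[of "\<bar>e \<bullet> y\<bar>" N] \<rho>0[OF True] unfolding eq by (intro mult_left_mono) auto
      also have "\<dots> \<le> M * (ln 2 * (\<Sum>k<N. indicator (A k) y))"
        using M[OF True] by (intro mult_right_mono mult_nonneg_nonneg sum_nonneg) auto
      finally show ?thesis using True by simp
    qed (use M0 in \<open>auto intro!: mult_nonneg_nonneg sum_nonneg\<close>)
    have "(LINT y:cball 0 R|lborel. \<rho> y * ln (max \<bar>e \<bullet> y\<bar> ((1/2) ^ N))) = - (LINT y|lborel. - (indicator (cball 0 R) y * (\<rho> y * ln (max \<bar>e \<bullet> y\<bar> ((1/2) ^ N)))))"
      by (simp add: set_lebesgue_integral_def)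
    moreover have "(LINT y|lborel. - (indicator (cball 0 R) y * (\<rho> y * ln (max \<bar>e \<bullet> y\<bar> ((1/2) ^ N)))))
        \<le> (LINT y|lborel. M * (ln 2 * (\<Sum>k<N. indicator (A k) y)))"
    proof (rule integral_mono)
      have "continuous_on (cball 0 R) (\<lambda>y. \<rho> y * ln (max \<bar>e \<bullet> y\<bar> ((1/2) ^ N)))"
        by (intro continuous_intros \<rho>) (auto simp: max_def)
      then show "integrable lborel (\<lambda>y. - (indicator (cball 0 R) y * (\<rho> y * ln (max \<bar>e \<bullet> y\<bar> ((1/2) ^ N)))))"
        using set_integrable_compact[OF compact_cball] by (auto simp: set_integrable_def)
      show "integrable lborel (\<lambda>y. M * (ln 2 * (\<Sum>k<N. indicator (A k) y)))"
        by (intro integrable_mult_right Bochner_Integration.integrable_sum iA)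
    qed (rule ptw)
    moreover have "(LINT y|lborel. M * (ln 2 * (\<Sum>k<N. indicator (A k) y))) = M * (ln 2 * (\<Sum>k<N. measure lborel (A k)))"
      using iA by (simp add: Bochner_Integration.integral_sum)
    moreover have "(\<Sum>k<N. measure lborel (A k)) \<le> K * 2"
    proof -
      have "(\<Sum>k<N. measure lborel (A k)) \<le> (\<Sum>k<N. K * (1/2) ^ k)" by (intro sum_mono mA)
      also have "\<dots> = K * (\<Sum>k<N. (1/2) ^ k)" by (rule sum_distrib_left[symmetric])
      also have "(\<Sum>k<N. (1/2::real) ^ k) = 2 * (1 - (1/2) ^ N)"
        by (induction N) (simp_all add: algebra_simps)
      also have "K * (2 * (1 - (1/2) ^ N)) \<le> K * 2" using K0 by (intro mult_left_mono) auto
      finally show ?thesis .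
    qed
    then have "M * (ln 2 * (\<Sum>k<N. measure lborel (A k))) \<le> M * (ln 2 * (K * 2))"
      using M0 by (intro mult_left_mono) auto
    ultimately show "- (M * (ln 2 * (K * 2))) \<le> (LINT y:cball 0 R|lborel. \<rho> y * ln (max \<bar>e \<bullet> y\<bar> ((1/2) ^ N)))"
      by linarith
  qed
qed

section \<open>Monotonicity of the entropy along drifting centres\<close>

locale normalized_flow = capillary_flow R \<rho> H D D2 e k
  for R and \<rho> :: "real^'n::finite \<Rightarrow> real" and H D D2 e k +
  assumes vol0: "volume 0 = total / k"
begin

text \<open>Geometrically, \<open>(z, 0)\<close> lies strictly inside the bottom face of the
  body.\<close>

definition admissible where "admissible z t \<longleftrightarrow> (\<forall>y. norm y \<le> R \<longrightarrow> z \<bullet> y < H y t)"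

definition entropy where "entropy z t = (LINT y:cball 0 R|lborel. \<rho> y * ln (H y t - z \<bullet> y))"

lemma entropy_integrable:
  assumes "admissible z t" "0 \<le> t"
  shows "set_integrable lborel (cball 0 R) (\<lambda>y. \<rho> y * ln (H y t - z \<bullet> y))"
  using assms
  by (intro set_integrable_compact continuous_intros rho_cont H_cont_space compact_cball)
     (force simp: admissible_def)+

lemma admissible_0: "0 \<le> t \<Longrightarrow> admissible 0 t"
  using H_pos by (simp add: admissible_def)

text \<open>Since \<open>exp (- t) * H\<close> decreases, the bodies rescaled by
  \<open>exp (- t)\<close> are nested, and a centre of a later one is a centre of each earlier
  one.\<close>

lemma admissible_backwards:
  assumes st: "0 < s" "s \<le> t" "t \<le> T" and z: "admissible z T"
  shows "admissible (exp (t - T) *\<^sub>R z) t"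
  unfolding admissible_def
proof (intro allI impI)
  fix y :: "real^'n" assume y: "norm y \<le> R"
  have "exp (- T) * H y T \<le> exp (- t) * H y t"
  proof (rule DERIV_nonpos_imp_nonincreasing[OF st(3)])
    fix r assume "t \<le> r" "r \<le> T"
    then have r: "0 < r" using st by simp
    have "((\<lambda>r. exp (- r) * H y r) has_real_derivative - (exp (- r) * (\<rho> y / det (D2 y r)))) (at r)"
      by (rule derivative_eq_intros time_deriv[OF y r] refl | simp add: algebra_simps)+
    moreover have "- (exp (- r) * (\<rho> y / det (D2 y r))) \<le> 0" using det_pos[OF y r] rho_pos[OF y] by simp
    ultimately show "\<exists>d. ((\<lambda>r. exp (- r) * H y r) has_real_derivative d) (at r) \<and> d \<le> 0" by blast
  qed
  moreover have "exp (- T) * (z \<bullet> y) < exp (- T) * H y T" using z y by (simp add: admissible_def)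
  ultimately have "exp (- T) * (z \<bullet> y) < exp (- t) * H y t" by linarith
  then have "exp t * (exp (- T) * (z \<bullet> y)) < exp t * (exp (- t) * H y t)" by (intro mult_strict_left_mono) auto
  then show "exp (t - T) *\<^sub>R z \<bullet> y < H y t" by (simp add: exp_diff exp_minus field_simps)
qed

text \<open>Along \<open>exp (t - T) *\<^sub>R z\<close> the gap \<open>L\<close> obeys the same
  equation as \<open>H\<close>, because the centre solves \<open>z' = z\<close>. The bound on the
  time derivative of \<open>\<rho> ln L\<close> is integrated in time for each \<open>y\<close>, and
  the integrals are exchanged, so the entropy itself is never differentiated.\<close>

lemma entropy_mono:
  assumes sT: "0 < s" "s \<le> T" and z: "admissible z T"
  shows "entropy z T \<le> entropy (exp (s - T) *\<^sub>R z) s"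
proof -
  define L where "L = (\<lambda>y t. H y t - exp (t - T) * (z \<bullet> y))"
  have L: "0 < L y t" if "norm y \<le> R" "t \<in> {s..T}" for y t
    using admissible_backwards[OF sT(1) _ _ z, of t] that by (auto simp: admissible_def L_def)
  let ?Q = "cball 0 R \<times> {s..T}"
  have sub: "?Q \<subseteq> cball 0 R \<times> {0<..}" "?Q \<subseteq> cball 0 R \<times> {0..}" using sT by auto
  have cL: "continuous_on ?Q (\<lambda>(y, t). L y t)"
    unfolding L_def case_prod_beta' by (intro continuous_intros continuous_on_subset[OF H_cont sub(2)])
  have cd: "continuous_on ?Q (\<lambda>(y, t). det (D2 y t))"
    unfolding case_prod_beta' by (intro continuous_intros continuous_on_subset[OF D2_cont sub(1)])
  have cr: "continuous_on ?Q (\<lambda>(y, t). \<rho> y)"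
    unfolding case_prod_beta' by (intro continuous_on_compose2[OF rho_cont] continuous_intros) auto
  \<comment> \<open>Dominates the time derivative of \<open>\<rho> ln L\<close>, and its integral
    over the ball vanishes at each time by \<open>shifted_integral\<close> and the constant
    volume.\<close>
  define q where "q = (\<lambda>y t. L y t * det (D2 y t) - \<rho> y)"
  have cq: "continuous_on ?Q (\<lambda>(y, t). q y t)"
    using continuous_on_diff[OF continuous_on_mult[OF cL cd] cr] by (simp add: q_def case_prod_beta')
  have slice: "continuous_on {s..T} (\<lambda>t. f y t)" if "continuous_on ?Q (\<lambda>(y, t). f y t)" "norm y \<le> R" for f y
    using continuous_on_compose2[OF that(1) continuous_on_Pair[OF continuous_on_const[of _ y] continuous_on_id], of "{s..T}"] that(2)
    by (simp add: image_subset_iff)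
  have ptw: "\<rho> y * ln (L y T) - \<rho> y * ln (L y s) \<le> (LINT t:{s..T}|lborel. q y t)" if y: "norm y \<le> R" for y
  proof -
    let ?g = "\<lambda>t. \<rho> y - (\<rho> y)\<^sup>2 / (L y t * det (D2 y t))"
    have d: "((\<lambda>t. \<rho> y * ln (L y t)) has_vector_derivative ?g t) (at t within {s..T})" if "s \<le> t" "t \<le> T" for t
    proof -
      have t: "0 < t" "t \<in> {s..T}" using that sT by auto
      have "((\<lambda>t. L y t) has_real_derivative (L y t - \<rho> y / det (D2 y t))) (at t)"
        unfolding L_def by (rule derivative_eq_intros time_deriv[OF y t(1)] refl | simp)+
      then have "((\<lambda>t. \<rho> y * ln (L y t)) has_real_derivative \<rho> y * ((L y t - \<rho> y / det (D2 y t)) / L y t)) (at t)"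
        using L[OF y t(2)] by (auto intro!: derivative_eq_intros)
      also have "\<rho> y * ((L y t - \<rho> y / det (D2 y t)) / L y t) = ?g t"
        using L[OF y t(2)] det_pos[OF y t(1)] by (simp add: field_simps power2_eq_square)
      finally show ?thesis
        by (simp add: has_real_derivative_iff_has_vector_derivative has_vector_derivative_at_within)
    qed
    have cg: "continuous_on {s..T} ?g"
    proof (intro continuous_on_diff continuous_on_const continuous_on_divide ballI)
      show "continuous_on {s..T} (\<lambda>t. L y t * det (D2 y t))"
        by (intro continuous_on_mult slice[OF cL y] slice[OF cd y])
      show "L y t * det (D2 y t) \<noteq> 0" if "t \<in> {s..T}" for t
        using L[OF y that] det_pos[OF y, of t] that sT by auto
    qed
    have "\<rho> y * ln (L y T) - \<rho> y * ln (L y s) = (LINT t:{s..T}|lborel. ?g t)"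
      unfolding set_lebesgue_integral_def using integral_FTC_Icc[OF sT(2) d cg] by simp
    also have "\<dots> \<le> (LINT t:{s..T}|lborel. q y t)"
    proof (rule set_integral_mono)
      show "set_integrable lborel {s..T} ?g" by (intro set_integrable_compact cg) auto
      show "set_integrable lborel {s..T} (q y)" by (intro set_integrable_compact slice[OF cq y]) auto
      fix t assume t: "t \<in> {s..T}"
      define a where "a = L y t * det (D2 y t)"
      have a: "0 < a" unfolding a_def using L[OF y t] det_pos[OF y, of t] sT t by (intro mult_pos_pos) auto
      have "0 \<le> (\<rho> y - a)\<^sup>2 / a" using a by simp
      also have "\<dots> = a - \<rho> y - (\<rho> y - (\<rho> y)\<^sup>2 / a)" using a by (simp add: field_simps power2_eq_square)
      finally show "?g t \<le> q y t" by (simp add: q_def a_def)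
    qed
    finally show ?thesis .
  qed
  have zero: "(LINT y:cball 0 R|lborel. q y t) = 0" if t: "t \<in> {s..T}" for t
  proof -
    have t0: "0 < t" using t sT by simp
    have cs: "continuous_on (cball 0 R) (\<lambda>y. L y t * det (D2 y t))"
    proof -
      have "continuous_on (cball 0 R) (\<lambda>y. (y, t))" by (intro continuous_intros)
      moreover have "(\<lambda>y. (y, t)) ` cball 0 R \<subseteq> ?Q" using t by auto
      ultimately show ?thesis
        using continuous_on_compose2[OF continuous_on_mult[OF cL cd], of "cball 0 R" "\<lambda>y. (y, t)"] by simp
    qed
    have "(LINT y:cball 0 R|lborel. q y t) = (LINT y:cball 0 R|lborel. L y t * det (D2 y t)) - total"
      unfolding q_def total_def
      by (intro set_integral_diff set_integrable_compact compact_cball cs rho_cont)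
    also have "(LINT y:cball 0 R|lborel. L y t * det (D2 y t)) = k * volume t"
      using shifted_integral[OF t0, of "exp (t - T) *\<^sub>R z"] admissible_backwards[OF sT(1) _ _ z, of t] t
      by (simp add: admissible_def L_def)
    finally show ?thesis using volume_const[OF vol0 t0] k_eq by simp
  qed
  have "entropy z T - entropy (exp (s - T) *\<^sub>R z) s = (LINT y:cball 0 R|lborel. \<rho> y * ln (L y T) - \<rho> y * ln (L y s))"
    using set_integral_diff(2)[OF entropy_integrable[OF z] entropy_integrable[OF admissible_backwards[OF sT(1) order_refl sT(2) z]]] sT
    by (simp add: entropy_def L_def)
  also have "\<dots> \<le> (LINT y:cball 0 R|lborel. LINT t:{s..T}|lborel. q y t)"
  proof (rule set_integral_mono)
    show "set_integrable lborel (cball 0 R) (\<lambda>y. \<rho> y * ln (L y T) - \<rho> y * ln (L y s))"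
      using set_integral_diff(1)[OF entropy_integrable[OF z] entropy_integrable[OF admissible_backwards[OF sT(1) order_refl sT(2) z]]] sT
      by (simp add: L_def)
    show "set_integrable lborel (cball 0 R) (\<lambda>y. LINT t:{s..T}|lborel. q y t)"
      by (rule set_integral_Times_swap(3)[OF compact_cball compact_Icc cq])
  qed (use ptw in simp)
  also have "\<dots> = (LINT t:{s..T}|lborel. LINT y:cball 0 R|lborel. q y t)"
    using set_integral_Times_swap(1,2)[OF compact_cball compact_Icc cq] by simp
  also have "\<dots> = (LINT t:{s..T}|lborel. 0)"
    by (intro set_lebesgue_integral_cong) (auto simp: zero)
  finally show ?thesis by simp
qed

end

section \<open>Bounds on diameter, gradient and width\<close>

context normalized_flow
begin

lemma H_attains_min:
  assumes "0 \<le> t" obtains m where "0 < m" "\<And>y. norm y \<le> R \<Longrightarrow> m \<le> H y t"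
proof -
  obtain y0 where "norm y0 \<le> R" "\<And>y. norm y \<le> R \<Longrightarrow> H y0 t \<le> H y t"
    using continuous_attains_inf[OF compact_cball _ H_cont_space[OF assms]] R_pos by (auto simp: Ball_def)
  then show ?thesis using that[of "H y0 t"] H_pos[OF _ assms] by blast
qed

lemma set_integral_rho_const: "(LINT y:cball 0 R|lborel. \<rho> y * c) = total * c"
  by (simp add: total_def)

lemma total_pos: "0 < total"
proof -
  obtain y0 where y0: "norm y0 \<le> R" "\<And>y. norm y \<le> R \<Longrightarrow> \<rho> y0 \<le> \<rho> y"
    using continuous_attains_inf[OF compact_cball _ rho_cont] R_pos by (auto simp: Ball_def)
  have "0 < \<rho> y0 * measure lborel (cball (0::real^'n) R)"
    using rho_pos[OF y0(1)] R_pos content_cball[of R "0::real^'n"] by (simp add: unit_ball_vol_pos)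
  also have "\<dots> = (LINT y:cball (0::real^'n) R|lborel. \<rho> y0)"
    by (simp add: set_lebesgue_integral_def)
  also have "\<dots> \<le> total"
    unfolding total_def
    by (intro set_integral_mono set_integrable_compact compact_cball rho_cont continuous_on_const) (use y0 in auto)
  finally show ?thesis .
qed

text \<open>The centre is transported back to time 1, where \<open>H \<le> h\<close>. Admissibility
  tested at \<open>- y\<close> gives \<open>- w . y < h\<close>, so the gap is at most
  \<open>2 * h\<close>. Time 1 replaces time 0 because \<open>entropy_mono\<close> starts at a
  positive time.\<close>

lemma entropy_upper: "\<exists>C. \<forall>T z. 1 \<le> T \<longrightarrow> admissible z T \<longrightarrow> entropy z T \<le> C"
proof -
  obtain y0 where y0: "norm y0 \<le> R" "\<And>y. norm y \<le> R \<Longrightarrow> H y 1 \<le> H y0 1"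
    using continuous_attains_sup[OF compact_cball _ H_cont_space[of 1]] R_pos by (auto simp: Ball_def)
  define h where "h = H y0 1"
  have h: "0 < h" "\<And>y. norm y \<le> R \<Longrightarrow> H y 1 \<le> h" using y0 H_pos[of y0 1] by (auto simp: h_def)
  show ?thesis
  proof (intro exI[of _ "total * ln (2 * h)"] allI impI)
    fix T :: real and z assume T: "1 \<le> T" and z: "admissible z T"
    define w where "w = exp (1 - T) *\<^sub>R z"
    have w: "admissible w 1" unfolding w_def by (rule admissible_backwards[OF _ _ T z, of 1]) auto
    have "entropy z T \<le> entropy w 1" unfolding w_def by (rule entropy_mono[OF _ T z]) simp
    also have "\<dots> \<le> (LINT y:cball 0 R|lborel. \<rho> y * ln (2 * h))"
      unfolding entropy_def
    proof (rule set_integral_mono)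
      show "set_integrable lborel (cball 0 R) (\<lambda>y. \<rho> y * ln (H y 1 - w \<bullet> y))" using entropy_integrable[OF w] by simp
      show "set_integrable lborel (cball 0 R) (\<lambda>y. \<rho> y * ln (2 * h))"
        by (intro set_integrable_compact compact_cball continuous_intros rho_cont)
      fix y assume "y \<in> cball (0::real^'n) R"
      then have y: "norm y \<le> R" by simp
      have "w \<bullet> (- y) < H (- y) 1" "w \<bullet> y < H y 1" using w y by (auto simp: admissible_def simp del: inner_minus_right)
      then have "0 < H y 1 - w \<bullet> y" "H y 1 - w \<bullet> y \<le> 2 * h" using h(2)[of y] h(2)[of "-y"] y by auto
      then show "\<rho> y * ln (H y 1 - w \<bullet> y) \<le> \<rho> y * ln (2 * h)"
        using rho_pos[OF y] by (intro mult_left_mono) auto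
    qed
    also have "\<dots> = total * ln (2 * h)" by (rule set_integral_rho_const)
    finally show "entropy z T \<le> total * ln (2 * h)" .
  qed
qed

lemma admissible_midpoint:
  assumes "admissible z1 t" "admissible z2 t"
  shows "admissible ((1/2) *\<^sub>R (z1 + z2)) t"
    and "\<And>y. norm y \<le> R \<Longrightarrow> \<bar>(z1 - z2) \<bullet> y\<bar> / 2 \<le> H y t - (1/2) *\<^sub>R (z1 + z2) \<bullet> y"
proof -
  have *: "z1 \<bullet> y < H y t" "z2 \<bullet> y < H y t" if "norm y \<le> R" for y
    using assms that by (auto simp: admissible_def)
  show "admissible ((1/2) *\<^sub>R (z1 + z2)) t"
    unfolding admissible_def
  proof (intro allI impI)
    fix y :: "real^'n" assume "norm y \<le> R"
    from *[OF this] show "(1/2) *\<^sub>R (z1 + z2) \<bullet> y < H y t" by (simp add: inner_add_left)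
  qed
  fix y :: "real^'n" assume "norm y \<le> R"
  from *[OF this] show "\<bar>(z1 - z2) \<bullet> y\<bar> / 2 \<le> H y t - (1/2) *\<^sub>R (z1 + z2) \<bullet> y"
  proof -
    have "(1/2) *\<^sub>R (z1 + z2) \<bullet> y = (z1 \<bullet> y + z2 \<bullet> y) / 2" by (simp add: inner_add_left)
    moreover have "\<bar>z1 \<bullet> y - z2 \<bullet> y\<bar> / 2 \<le> H y t - (z1 \<bullet> y + z2 \<bullet> y) / 2"
      using *[OF \<open>norm y \<le> R\<close>] by (cases "z1 \<bullet> y < z2 \<bullet> y") (simp_all add: field_simps)
    ultimately show ?thesis by (simp add: inner_diff_left)
  qed
qed

text \<open>At the midpoint the gap is at least half of
  \<open>\<bar>(z1 - z2) \<bullet> y\<bar>\<close>, so the entropy is bounded below by the logarithm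
  of a linear function, whose integral is uniformly controlled over directions.\<close>

lemma entropy_lower:
  "\<exists>C. \<forall>t z1 z2. 0 \<le> t \<longrightarrow> admissible z1 t \<longrightarrow> admissible z2 t \<longrightarrow> z1 \<noteq> z2 \<longrightarrow>
      total * ln (norm (z1 - z2) / 2) - C \<le> entropy ((1/2) *\<^sub>R (z1 + z2)) t"
proof -
  obtain C where C: "\<And>e N. norm e = 1 \<Longrightarrow> - C \<le> (LINT y:cball 0 R|lborel. \<rho> y * ln (max \<bar>e \<bullet> y\<bar> ((1/2) ^ N)))"
    using log_slab_integral[OF R_pos rho_cont] rho_pos by (meson less_imp_le)
  show ?thesis
  proof (intro exI[of _ C] allI impI)
    fix t and z1 z2 :: "real^'n"
    assume t: "0 \<le> t" and adm: "admissible z1 t" "admissible z2 t" and ne: "z1 \<noteq> z2"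
    define d where "d = norm (z1 - z2)"
    have d: "0 < d" using ne by (simp add: d_def)
    define e where "e = (1 / d) *\<^sub>R (z1 - z2)"
    have e: "norm e = 1" using d by (simp add: e_def d_def)
    define z where "z = (1/2) *\<^sub>R (z1 + z2)"
    have z: "admissible z t" unfolding z_def by (rule admissible_midpoint(1)[OF adm])
    have "continuous_on (cball 0 R) (\<lambda>y. H y t - z \<bullet> y)" by (intro continuous_intros H_cont_space t)
    then obtain y0 where y0: "norm y0 \<le> R" "\<And>y. norm y \<le> R \<Longrightarrow> H y0 t - z \<bullet> y0 \<le> H y t - z \<bullet> y"
      using continuous_attains_inf[OF compact_cball, of 0 R "\<lambda>y. H y t - z \<bullet> y"] R_pos by (auto simp: Ball_def)
    define m where "m = H y0 t - z \<bullet> y0"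
    have m: "0 < m" using z y0 by (simp add: m_def admissible_def)
    \<comment> \<open>The truncation level, scaled by \<open>d / 2\<close>, is below the minimum
      \<open>m\<close> of the gap, so the truncated logarithm is still a lower bound;
      \<open>C\<close> does not depend on \<open>N\<close>.\<close>
    obtain N where N: "(1/2) ^ N < m / (d / 2)" using real_arch_pow_inv[of "m / (d/2)" "1/2"] m d by auto
    have "(LINT y:cball 0 R|lborel. \<rho> y * ln (d / 2) + \<rho> y * ln (max \<bar>e \<bullet> y\<bar> ((1/2) ^ N))) \<le> entropy z t"
      unfolding entropy_def
    proof (rule set_integral_mono)
      show "set_integrable lborel (cball 0 R) (\<lambda>y. \<rho> y * ln (H y t - z \<bullet> y))" using entropy_integrable[OF z t] .
      show "set_integrable lborel (cball 0 R) (\<lambda>y. \<rho> y * ln (d / 2) + \<rho> y * ln (max \<bar>e \<bullet> y\<bar> ((1/2) ^ N)))"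
        by (intro set_integrable_compact compact_cball continuous_intros rho_cont) (auto simp: max_def)
      fix y assume "y \<in> cball (0::real^'n) R"
      then have y: "norm y \<le> R" by simp
      have "d / 2 * \<bar>e \<bullet> y\<bar> \<le> H y t - z \<bullet> y"
        using admissible_midpoint(2)[OF adm y] d by (simp add: e_def z_def abs_mult)
      moreover have "d / 2 * (1/2) ^ N \<le> H y t - z \<bullet> y"
      proof -
        have "(1/2) ^ N * (d / 2) < m" using N d by (subst (asm) pos_less_divide_eq) auto
        moreover have "m \<le> H y t - z \<bullet> y" using y0(2)[OF y] by (simp add: m_def)
        ultimately show ?thesis by (simp only: mult.commute[of "d / 2"])
      qed
      ultimately have le: "d / 2 * max \<bar>e \<bullet> y\<bar> ((1/2) ^ N) \<le> H y t - z \<bullet> y" by (simp add: max_def)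
      have mx: "0 < max \<bar>e \<bullet> y\<bar> ((1/2) ^ N)" by (simp add: less_max_iff_disj)
      then have pp: "0 < d / 2 * max \<bar>e \<bullet> y\<bar> ((1/2) ^ N)" using d by simp
      have pq: "0 < H y t - z \<bullet> y" using z y by (simp add: admissible_def)
      have "ln (d / 2) + ln (max \<bar>e \<bullet> y\<bar> ((1/2) ^ N)) = ln (d / 2 * max \<bar>e \<bullet> y\<bar> ((1/2) ^ N))"
        using d mx by (subst ln_mult) auto
      also have "\<dots> \<le> ln (H y t - z \<bullet> y)" by (rule ln_le_cancel_iff[THEN iffD2, OF pp pq le])
      finally show "\<rho> y * ln (d / 2) + \<rho> y * ln (max \<bar>e \<bullet> y\<bar> ((1/2) ^ N)) \<le> \<rho> y * ln (H y t - z \<bullet> y)"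
        using rho_pos[OF y] by (simp flip: distrib_left)
    qed
    moreover have "(LINT y:cball 0 R|lborel. \<rho> y * ln (d / 2) + \<rho> y * ln (max \<bar>e \<bullet> y\<bar> ((1/2) ^ N)))
       = total * ln (d / 2) + (LINT y:cball 0 R|lborel. \<rho> y * ln (max \<bar>e \<bullet> y\<bar> ((1/2) ^ N)))"
      unfolding set_integral_rho_const[symmetric]
      by (intro set_integral_add set_integrable_compact compact_cball continuous_intros rho_cont) (auto simp: max_def)
    ultimately show "total * ln (norm (z1 - z2) / 2) - C \<le> entropy ((1/2) *\<^sub>R (z1 + z2)) t"
      using C[OF e, of N] by (simp add: d_def z_def)
  qed
qed

text \<open>The inequality is not strict so that gradients, which may touch the edge of the bottom
  face, are covered too. Times start at 1 because the entropy bounds do.\<close>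

definition face_bound where
  "face_bound d \<longleftrightarrow> 0 < d \<and> (\<forall>t z. 1 \<le> t \<longrightarrow> (\<forall>y. norm y \<le> R \<longrightarrow> z \<bullet> y \<le> H y t) \<longrightarrow> norm z \<le> d)"

text \<open>For an admissible \<open>z\<close>, the midpoint of \<open>z\<close> and the origin has
  entropy at least \<open>total * ln (norm z / 2) - C0\<close> and at most
  \<open>C1\<close>.\<close>

lemma ex_face_bound: "\<exists>d. face_bound d"
proof -
  obtain C1 where C1: "\<And>T z. 1 \<le> T \<Longrightarrow> admissible z T \<Longrightarrow> entropy z T \<le> C1" using entropy_upper by blast
  obtain C0 where C0: "\<And>t z1 z2. 0 \<le> t \<Longrightarrow> admissible z1 t \<Longrightarrow> admissible z2 t \<Longrightarrow> z1 \<noteq> z2 \<Longrightarrow>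
      total * ln (norm (z1 - z2) / 2) - C0 \<le> entropy ((1/2) *\<^sub>R (z1 + z2)) t" using entropy_lower by blast
  \<comment> \<open>The solution of \<open>total * ln (d / 2) - C0 = C1\<close>.\<close>
  define d where "d = 2 * exp ((C1 + C0) / total)"
  have *: "norm z \<le> d" if t: "1 \<le> t" and z: "admissible z t" for t z
  proof (cases "z = 0")
    case False
    have 0: "admissible 0 t" using admissible_0 t by simp
    have "total * ln (norm z / 2) - C0 \<le> C1"
      using C0[OF _ z 0 False] C1[OF t admissible_midpoint(1)[OF z 0]] t by simp
    then have "ln (norm z / 2) \<le> (C1 + C0) / total" using total_pos by (simp add: field_simps)
    then have "norm z / 2 \<le> exp ((C1 + C0) / total)" using False by (metis exp_le_cancel_iff exp_ln half_gt_zero_iff zero_less_norm_iff)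
    then show ?thesis by (simp add: d_def)
  qed (simp add: d_def)
  have "norm z \<le> d" if t: "1 \<le> t" and z: "\<And>y. norm y \<le> R \<Longrightarrow> z \<bullet> y \<le> H y t" for t z
  proof (rule ccontr)
    assume "\<not> norm z \<le> d"
    then have d: "d < norm z" "0 < norm z" by (auto simp: d_def intro: less_trans[rotated])
    \<comment> \<open>Halfway between \<open>d / norm z\<close> and 1: the contracted point is
      strictly admissible and still longer than \<open>d\<close>.\<close>
    define l where "l = (1 + d / norm z) / 2"
    have l: "0 < l" "l < 1" "d < l * norm z" using d by (auto simp: l_def d_def field_simps add_pos_pos)
    have "admissible (l *\<^sub>R z) t"
      unfolding admissible_def
    proof (intro allI impI)
      fix y :: "real^'n" assume y: "norm y \<le> R"
      have "l * (z \<bullet> y) \<le> l * H y t" using z[OF y] l by simp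
      also have "\<dots> < 1 * H y t" using l H_pos[OF y, of t] t by (intro mult_strict_right_mono) auto
      finally show "l *\<^sub>R z \<bullet> y < H y t" by simp
    qed
    from *[OF t this] show False using l by simp
  qed
  then show ?thesis unfolding face_bound_def by (intro exI[of _ d]) (auto simp: d_def)
qed

lemma contact_bound:
  assumes t: "0 < t" and y: "norm y \<le> R" and z: "norm z \<le> R"
  shows "D y t \<bullet> z + (H y t - y \<bullet> D y t) \<le> H z t" "0 \<le> H y t - y \<bullet> D y t" "D y t \<bullet> z \<le> H z t"
proof -
  interpret strict_support_fn R "\<lambda>y. H y t" "\<lambda>y. D y t" "\<lambda>y. D2 y t" by (rule strict_support0[OF t])
  show "D y t \<bullet> z + (H y t - y \<bullet> D y t) \<le> H z t" "0 \<le> H y t - y \<bullet> D y t"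
    using contact_point_in_body[OF y] z by (auto simp: body_def)
  then show "D y t \<bullet> z \<le> H z t" by simp
qed

text \<open>Contact points have nonnegative height, so \<open>D y t\<close> lies in the bottom face
  and inherits its bound. On the rim \<open>H = y . D\<close> follows; for the height at an interior
  slope, compare with a rim slope on which \<open>D y t\<close> is nonnegative.\<close>

lemma gradient_bound_at:
  assumes t: "0 < t" and d: "\<And>z. (\<And>y. norm y \<le> R \<Longrightarrow> z \<bullet> y \<le> H y t) \<Longrightarrow> norm z \<le> d" and y: "norm y \<le> R"
  shows "norm (D y t) \<le> d" "H y t \<le> 2 * R * d"
proof -
  have Dd: "norm (D y t) \<le> d" if "norm y \<le> R" for y
    by (rule d) (use contact_bound(3)[OF t that] in auto)
  then show "norm (D y t) \<le> d" using y .
  have d0: "0 \<le> d" using Dd[of 0] R_pos norm_ge_zero order_trans by (metis norm_zero less_imp_le)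
  have bd: "H y t \<le> R * d" if "norm y = R" for y
  proof -
    have "H y t = y \<bullet> D y t" using neumann[OF that t] by simp
    also have "\<dots> \<le> norm y * norm (D y t)" by (rule norm_cauchy_schwarz)
    also have "\<dots> \<le> R * d" using that Dd[of y] R_pos by simp
    finally show ?thesis .
  qed
  obtain u :: "real^'n" where u: "norm u = 1" using vector_choose_size[of 1] by auto
  define y' where "y' = (if 0 \<le> D y t \<bullet> u then R *\<^sub>R u else - (R *\<^sub>R u))"
  have y': "norm y' = R" "0 \<le> D y t \<bullet> y'" using u R_pos by (auto simp: y'_def mult_le_0_iff zero_le_mult_iff)
  have "H y t - y \<bullet> D y t \<le> R * d" using contact_bound(1)[OF t y, of y'] y' bd[of y'] by simp
  moreover have "y \<bullet> D y t \<le> norm y * norm (D y t)" by (rule norm_cauchy_schwarz)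
  moreover have "norm y * norm (D y t) \<le> R * d" using y Dd[OF y] R_pos by (intro mult_mono) auto
  ultimately show "H y t \<le> 2 * R * d" by simp
qed

lemma gradient_bound:
  assumes "face_bound d" "1 \<le> t" "norm y \<le> R"
  shows "norm (D y t) \<le> d" "H y t \<le> 2 * R * d"
  using gradient_bound_at[of t d y] assms by (auto simp: face_bound_def)

lemma H_lipschitz:
  assumes d: "face_bound d" and t: "1 \<le> t" and yz: "norm y \<le> R" "norm z \<le> R"
  shows "\<bar>H y t - H z t\<bar> \<le> d * norm (y - z)"
proof -
  have *: "H y t - H z t \<le> d * norm (y - z)" if "norm y \<le> R" "norm z \<le> R" for y z
  proof -
    have "H y t - H z t \<le> D y t \<bullet> (y - z)"
      using contact_bound(1)[of t y z] that t by (simp add: inner_diff_right inner_commute)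
    also have "\<dots> \<le> norm (D y t) * norm (y - z)" by (rule norm_cauchy_schwarz)
    also have "\<dots> \<le> d * norm (y - z)" using gradient_bound(1)[OF d t that(1)] by (simp add: mult_right_mono)
    finally show ?thesis .
  qed
  show ?thesis using *[OF yz] *[OF yz(2,1)] by (simp add: norm_minus_commute abs_if)
qed

lemma body_in_ball:
  assumes t: "0 < t" and d: "\<And>z. (\<And>y. norm y \<le> R \<Longrightarrow> z \<bullet> y \<le> H y t) \<Longrightarrow> norm z \<le> d"
  shows "body R (\<lambda>y. H y t) \<subseteq> cball 0 (2 * d * (1 + R))"
proof
  fix p assume p: "p \<in> body R (\<lambda>y. H y t)"
  obtain x s where ps: "p = (x, s)" by (cases p)
  note b = body_bound[OF R_pos gradient_bound_at(2)[OF t d] p[unfolded ps]]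
  have "norm p \<le> norm x + norm s" unfolding ps by (rule norm_Pair_le)
  also have "\<dots> \<le> 2 * d + 2 * R * d" using b R_pos by simp
  finally show "p \<in> cball 0 (2 * d * (1 + R))" by (simp add: algebra_simps)
qed

lemma lmeasurable_body_time: "0 \<le> t \<Longrightarrow> body R (\<lambda>y. H y t) \<in> lmeasurable"
  by (intro lmeasurable_compact compact_body R_pos H_cont_space)

text \<open>A body whose bottom face has radius at most \<open>r\<close> lies in a ball of radius
  proportional to \<open>r\<close>, which for small \<open>r\<close> is too small for the constant
  volume.\<close>

lemma far_admissible: "\<exists>r>0. \<forall>t\<ge>1. \<exists>z. admissible z t \<and> r \<le> norm z"
proof -
  define V where "V = total / k"
  have V: "0 < V" using total_pos k_eq by (simp add: V_def)
  define U where "U = unit_ball_vol (real DIM((real^'n) \<times> real))"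
  have U: "0 < U" by (simp add: U_def unit_ball_vol_pos)
  \<comment> \<open>With \<open>x \<le> 1\<close> the ball of radius \<open>x\<close> has volume at
    most \<open>U * x\<close>, hence at most half of \<open>V\<close>; \<open>r\<close> is the face
    radius for which \<open>body_in_ball\<close> yields \<open>x\<close>.\<close>
  define x where "x = min 1 (V / (2 * U))"
  have x: "0 < x" "x \<le> 1" "U * x < V" using U V by (auto simp: x_def min_def field_simps)
  define r where "r = x / (2 * (1 + R))"
  have r: "0 < r" "2 * r * (1 + R) = x" using x R_pos by (auto simp: r_def field_simps add_pos_pos)
  have "\<exists>z. admissible z t \<and> r \<le> norm z" if t: "1 \<le> t" for t
  proof (rule ccontr)
    assume n: "\<nexists>z. admissible z t \<and> r \<le> norm z"
    have "norm z \<le> r" if z: "\<And>y. norm y \<le> R \<Longrightarrow> z \<bullet> y \<le> H y t" for z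
    proof (rule ccontr)
      assume "\<not> norm z \<le> r"
      then have d: "r < norm z" "0 < norm z" using r by linarith+
      define l where "l = r / norm z"
      have l: "0 < l" "l < 1" "l * norm z = r" using d r by (auto simp: l_def)
      have "admissible (l *\<^sub>R z) t"
        unfolding admissible_def
      proof (intro allI impI)
        fix y :: "real^'n" assume y: "norm y \<le> R"
        have "l * (z \<bullet> y) \<le> l * H y t" using z[OF y] l by simp
        also have "\<dots> < 1 * H y t" using l H_pos[OF y, of t] t by (intro mult_strict_right_mono) auto
        finally show "l *\<^sub>R z \<bullet> y < H y t" by simp
      qed
      moreover have "norm (l *\<^sub>R z) = r" using l by simp
      ultimately show False using n by auto
    qed
    then have sub: "body R (\<lambda>y. H y t) \<subseteq> cball 0 x"
      using body_in_ball[of t r] t r(2) by auto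
    have "volume t \<le> measure lebesgue (cball (0 :: (real^'n) \<times> real) x)"
      unfolding volume_def using sub lmeasurable_body_time[of t] t
      by (intro measure_mono_fmeasurable) (auto dest: fmeasurableD)
    also have "\<dots> = U * x ^ DIM((real^'n) \<times> real)" using x content_cball[of x "0 :: (real^'n) \<times> real"] by (simp add: U_def)
    also have "\<dots> \<le> U * x ^ 1" using x U by (intro mult_left_mono power_decreasing) auto
    also have "\<dots> < V" using x by simp
    finally show False using volume_const[OF vol0, of t] t by (simp add: V_def)
  qed
  then show ?thesis using r by blast
qed

text \<open>The midpoint of the origin and a centre from \<open>far_admissible\<close> has entropy
  bounded below by \<open>entropy_lower\<close>.\<close>

lemma entropy_sup_lower: "\<exists>C. \<forall>t\<ge>1. \<exists>z. admissible z t \<and> C \<le> entropy z t"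
proof -
  obtain C0 where C0: "\<And>t z1 z2. 0 \<le> t \<Longrightarrow> admissible z1 t \<Longrightarrow> admissible z2 t \<Longrightarrow> z1 \<noteq> z2 \<Longrightarrow>
      total * ln (norm (z1 - z2) / 2) - C0 \<le> entropy ((1/2) *\<^sub>R (z1 + z2)) t" using entropy_lower by blast
  obtain r where r: "0 < r" "\<And>t. 1 \<le> t \<Longrightarrow> \<exists>z. admissible z t \<and> r \<le> norm z" using far_admissible by blast
  show ?thesis
  proof (intro exI[of _ "total * ln (r / 2) - C0"] allI impI)
    fix t :: real assume t: "1 \<le> t"
    then obtain z where z: "admissible z t" "r \<le> norm z" using r(2) by blast
    have 0: "admissible 0 t" using admissible_0 t by simp
    have "z \<noteq> 0" using z r by auto
    then have "total * ln (norm z / 2) - C0 \<le> entropy ((1/2) *\<^sub>R (z + 0)) t" using C0[OF _ z(1) 0] t by simp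
    moreover have "total * ln (r / 2) \<le> total * ln (norm z / 2)" proof (rule mult_left_mono)
      show "ln (r / 2) \<le> ln (norm z / 2)"
        by (rule ln_le_cancel_iff[THEN iffD2]) (use z(2) r(1) in linarith)+
    qed (use total_pos in simp)
    ultimately show "\<exists>z. admissible z t \<and> total * ln (r / 2) - C0 \<le> entropy z t"
      using admissible_midpoint(1)[OF z(1) 0] by (intro exI[of _ "(1/2) *\<^sub>R (z + 0)"]) auto
  qed
qed

text \<open>The body lies in a fixed ball and in a slab of height \<open>H 0 t\<close>, and also in
  a horizontal slab of width \<open>(H (R e) + H (- R e)) / R\<close>. A thin slab could not hold
  the constant volume.\<close>

lemma width_bounds:
  "\<exists>w>0. \<forall>t\<ge>1. w \<le> H 0 t \<and> (\<forall>e. norm e = 1 \<longrightarrow> w \<le> H (R *\<^sub>R e) t + H (- (R *\<^sub>R e)) t)"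
proof -
  obtain d where d: "face_bound d" using ex_face_bound by blast
  define V where "V = total / k"
  have V: "0 < V" using total_pos k_eq by (simp add: V_def)
  define r where "r = 2 * d * (1 + R)"
  have r: "0 < r" using d R_pos by (simp add: r_def face_bound_def)
  define S where "S = measure lebesgue (cball (0 :: (real^'n) \<times> real) (3 * r)) / r"
  have S: "0 < S" using r content_cball[of "3 * r" "0 :: (real^'n) \<times> real"] by (simp add: S_def unit_ball_vol_pos)
  have slab: "V \<le> S * w" if t: "1 \<le> t" and u: "norm u = 1" and w: "0 < w"
      and b: "\<And>p. p \<in> body R (\<lambda>y. H y t) \<Longrightarrow> \<alpha> \<le> u \<bullet> p \<and> u \<bullet> p \<le> \<alpha> + w" for t u w \<alpha>
  proof -
    let ?T = "{p \<in> cball 0 r. \<alpha> \<le> u \<bullet> p \<and> u \<bullet> p \<le> \<alpha> + w}"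
    have "?T = cball 0 r \<inter> ({x. \<alpha> \<le> u \<bullet> x} \<inter> {x. u \<bullet> x \<le> \<alpha> + w})" by auto
    also have "compact \<dots>"
      by (intro compact_Int_closed closed_Int closed_Collect_le continuous_intros compact_cball)
    finally have lm: "?T \<in> lmeasurable" by (rule lmeasurable_compact)
    have "body R (\<lambda>y. H y t) \<subseteq> ?T"
      using body_in_ball[of t d] d t b by (auto simp: face_bound_def r_def)
    then have "volume t \<le> measure lebesgue ?T"
      unfolding volume_def using lm lmeasurable_body_time[of t] t
      by (intro measure_mono_fmeasurable) (auto dest: fmeasurableD)
    also have "\<dots> \<le> S * w" unfolding S_def by (rule slab_measure[OF u r w])
    finally show ?thesis using volume_const[OF vol0, of t] t by (simp add: V_def)
  qed
  define w where "w = min (V / S) (R * V / S)"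
  have "0 < w" using V S R_pos by (simp add: w_def)
  moreover have "w \<le> H 0 t" if t: "1 \<le> t" for t
  proof -
    have "V \<le> S * H 0 t"
    proof (rule slab[OF t, of "(0, 1)" _ 0])
      show "0 < H 0 t" using H_pos[of 0 t] R_pos t by simp
      fix p assume "p \<in> body R (\<lambda>y. H y t)"
      then show "0 \<le> (0, 1) \<bullet> p \<and> (0, 1) \<bullet> p \<le> 0 + H 0 t"
        using R_pos by (auto simp: body_def dest!: bspec[of _ _ 0])
    qed (simp add: norm_Pair)
    then have "V / S \<le> H 0 t" using S by (simp add: field_simps)
    then show ?thesis by (simp add: w_def)
  qed
  moreover have "w \<le> H (R *\<^sub>R e) t + H (- (R *\<^sub>R e)) t" if t: "1 \<le> t" and e: "norm e = 1" for t e
  proof -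
    have n: "norm (R *\<^sub>R e) \<le> R" "norm (- (R *\<^sub>R e)) \<le> R" using R_pos e by auto
    have "V \<le> S * ((H (R *\<^sub>R e) t + H (- (R *\<^sub>R e)) t) / R)"
    proof (rule slab[OF t, of "(e, 0)" _ "- (H (- (R *\<^sub>R e)) t / R)"])
      show "0 < (H (R *\<^sub>R e) t + H (- (R *\<^sub>R e)) t) / R" using H_pos[OF n(1)] H_pos[OF n(2)] t R_pos by (simp add: add_pos_pos)
      fix p assume p: "p \<in> body R (\<lambda>y. H y t)"
      have 1: "fst p \<bullet> (R *\<^sub>R e) + snd p \<le> H (R *\<^sub>R e) t" "fst p \<bullet> (- (R *\<^sub>R e)) + snd p \<le> H (- (R *\<^sub>R e)) t" "0 \<le> snd p"
        using p n by (auto simp: body_def simp del: inner_minus_right inner_scaleR_right)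
      then have "R * (e \<bullet> fst p) \<le> H (R *\<^sub>R e) t" "- H (- (R *\<^sub>R e)) t \<le> R * (e \<bullet> fst p)"
        by (auto simp: inner_commute)
      then show "- (H (- (R *\<^sub>R e)) t / R) \<le> (e, 0) \<bullet> p \<and> (e, 0) \<bullet> p \<le> - (H (- (R *\<^sub>R e)) t / R) + (H (R *\<^sub>R e) t + H (- (R *\<^sub>R e)) t) / R"
        using R_pos by (cases p) (auto simp: field_simps)
    qed (simp add: norm_Pair e)
    then have "R * V / S \<le> H (R *\<^sub>R e) t + H (- (R *\<^sub>R e)) t" using S R_pos by (simp add: field_simps)
    then show ?thesis by (simp add: w_def)
  qed
  ultimately show ?thesis by blast
qed

section \<open>Reflection inequality and near-maximality of the origin\<close>

text \<open>The supporting plane at \<open>y\<close>, evaluated at the reflected slope, loses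
  \<open>2 (u . y) (D . u)\<close>, and \<open>D . u \<le> H (R u) / R\<close> because
  \<open>D\<close> lies in the bottom face. The loss disappears when \<open>H (R u)\<close> tends to
  0.\<close>

lemma reflection_bound:
  fixes u :: "real^'n"
  assumes t: "0 < t" and u: "norm u = 1" and y: "norm y \<le> R" "0 \<le> u \<bullet> y"
  shows "H y t - 2 * (u \<bullet> y) * H (R *\<^sub>R u) t / R \<le> H (y - (2 * (u \<bullet> y)) *\<^sub>R u) t"
proof -
  let ?y' = "y - (2 * (u \<bullet> y)) *\<^sub>R u"
  have "(norm ?y')\<^sup>2 = (norm y)\<^sup>2"
    using u by (simp add: power2_norm_eq_inner inner_diff_left inner_diff_right norm_eq_1 inner_commute algebra_simps)
  then have y': "norm ?y' \<le> R" using y by simp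
  have n: "norm (R *\<^sub>R u) \<le> R" using R_pos u by auto
  have "R * (D y t \<bullet> u) \<le> H (R *\<^sub>R u) t" using contact_bound(3)[OF t y(1) n] by simp
  then have "D y t \<bullet> u \<le> H (R *\<^sub>R u) t / R" using R_pos by (simp add: field_simps)
  then have "2 * (u \<bullet> y) * (D y t \<bullet> u) \<le> 2 * (u \<bullet> y) * (H (R *\<^sub>R u) t / R)" using y by (intro mult_left_mono) auto
  then show ?thesis using contact_bound(1)[OF t y(1) y'] by (simp add: inner_diff_right inner_commute)
qed

text \<open>The gradient at \<open>R u\<close> belongs to the bottom face, and the boundary
  condition makes it touch there.\<close>

lemma touching_admissible:
  fixes u :: "real^'n"
  assumes t: "0 < t" and u: "norm u = 1"
  shows "\<exists>z. (\<forall>y. norm y \<le> R \<longrightarrow> z \<bullet> y \<le> H y t) \<and> z \<bullet> (R *\<^sub>R u) = H (R *\<^sub>R u) t"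
  using contact_bound(3)[OF t, of "R *\<^sub>R u"] neumann[of "R *\<^sub>R u" t] R_pos u t
  by (intro exI[of _ "D (R *\<^sub>R u) t"]) (auto simp: inner_commute)

text \<open>
  Backwards in time any admissible centre drifts exponentially to the origin, so the entropy at the
  origin dominates the limit of the maximal entropies.
\<close>

lemma origin_almost_maximal:
  shows "\<exists>C. \<forall>t\<ge>1. C \<le> entropy 0 t"
    and "0 < \<epsilon> \<Longrightarrow> \<exists>T\<ge>1. \<forall>t\<ge>T. \<forall>z. admissible z t \<longrightarrow> entropy z t \<le> entropy 0 t + \<epsilon>"
proof -
  obtain d where d: "face_bound d" using ex_face_bound by blast
  obtain C1 where C1: "\<And>T z. 1 \<le> T \<Longrightarrow> admissible z T \<Longrightarrow> entropy z T \<le> C1" using entropy_upper by blast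
  obtain C2 where C2: "\<And>t. 1 \<le> t \<Longrightarrow> \<exists>z. admissible z t \<and> C2 \<le> entropy z t" using entropy_sup_lower by blast
  define E where "E = (\<lambda>t. SUP z\<in>{z. admissible z t}. entropy z t)"
  have bdd: "bdd_above ((\<lambda>z. entropy z t) ` {z. admissible z t})" if "1 \<le> t" for t
    using C1[OF that] by (auto simp: bdd_above_def)
  have EU: "entropy z t \<le> E t" if "1 \<le> t" "admissible z t" for t z
    unfolding E_def using that by (intro cSUP_upper bdd) auto
  have EL: "C2 \<le> E t" if "1 \<le> t" for t using C2[OF that] EU[OF that] order_trans by blast
  \<comment> \<open>By \<open>entropy_mono\<close> the maximal entropies decrease in time, so
    \<open>I\<close> is their limit.\<close>
  define I where "I = (INF t\<in>{1..}. E t)"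
  have IL: "I \<le> E t" if "1 \<le> t" for t
    unfolding I_def by (rule cINF_lower) (use EL that in \<open>auto simp: bdd_below_def\<close>)
  have CI: "C2 \<le> I" unfolding I_def by (rule cINF_greatest) (use EL in auto)
  have I0: "I \<le> entropy 0 t" if t: "1 \<le> t" for t
  proof -
    obtain m where m: "0 < m" "\<And>y. norm y \<le> R \<Longrightarrow> m \<le> H y t" using H_attains_min[of t] t by auto
    \<comment> \<open>\<open>1 / T\<close> is the slack of a nearly maximal centre at time
      \<open>T\<close>. Carried back to time \<open>t\<close>, that centre has norm at most
      \<open>exp (t - T) * d\<close>, which changes the logarithm of the gap by at most the last
      term.\<close>
    have main: "I \<le> 1 / T + (entropy 0 t + total * ln (1 + exp (t - T) * d * R / m))" if T: "t \<le> T" for T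
    proof -
      have T1: "1 \<le> T" "0 < T" using t T by auto
      have I1: "set_integrable lborel (cball 0 R) (\<lambda>y. \<rho> y * ln (H y t - 0 \<bullet> y))"
        by (rule entropy_integrable[OF admissible_0]) (use t in auto)
      have I2: "set_integrable lborel (cball 0 R) (\<lambda>y. \<rho> y * c)" for c
        by (intro set_integrable_compact compact_cball continuous_intros rho_cont)
      have ne: "{z. admissible z T} \<noteq> {}" using admissible_0[of T] T1 by auto
      have "E T - 1 / T < (SUP z\<in>{z. admissible z T}. entropy z T)" using T1 by (simp add: E_def)
      then have "\<exists>z\<in>{z. admissible z T}. E T - 1 / T < entropy z T"
        using less_cSUP_iff[OF ne bdd[OF T1(1)]] by blast
      then obtain z where z: "admissible z T" "E T - 1 / T < entropy z T" by blast
      define w where "w = exp (t - T) *\<^sub>R z"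
      have w: "admissible w t" unfolding w_def by (rule admissible_backwards[OF _ _ T z(1), of t]) (use t in auto)
      have "z \<bullet> y \<le> H y T" if "norm y \<le> R" for y using z(1) that by (simp add: admissible_def less_imp_le)
      then have "norm z \<le> d" using d T1 unfolding face_bound_def by blast
      then have nw: "norm w \<le> exp (t - T) * d" by (simp add: w_def)
      have "entropy z T \<le> entropy w t" unfolding w_def by (rule entropy_mono[OF _ T z(1)]) (use t in auto)
      also have "\<dots> \<le> (LINT y:cball 0 R|lborel. \<rho> y * ln (H y t - 0 \<bullet> y) + \<rho> y * ln (1 + exp (t - T) * d * R / m))"
        unfolding entropy_def
      proof (rule set_integral_mono)
        show "set_integrable lborel (cball 0 R) (\<lambda>y. \<rho> y * ln (H y t - w \<bullet> y))" using entropy_integrable[OF w] t by simp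
        show "set_integrable lborel (cball 0 R) (\<lambda>y. \<rho> y * ln (H y t - 0 \<bullet> y) + \<rho> y * ln (1 + exp (t - T) * d * R / m))"
          by (rule set_integral_add(1)[OF I1 I2])
        fix y assume "y \<in> cball (0::real^'n) R"
        then have y: "norm y \<le> R" by simp
        have H0: "0 < H y t" using H_pos[OF y] t by simp
        define q where "q = exp (t - T) * d * R"
        have q: "0 \<le> q" using d R_pos by (simp add: q_def face_bound_def)
        have qm: "0 < 1 + q / m" using q m by (simp add: add_pos_nonneg)
        have "- (w \<bullet> y) \<le> norm w * norm y" using norm_cauchy_schwarz[of "- w" y] by simp
        also have "\<dots> \<le> q" unfolding q_def using nw y d R_pos by (intro mult_mono) (auto simp: face_bound_def)
        also have "q = q / m * m" using m by simp
        also have "\<dots> \<le> q / m * H y t" using m(2)[OF y] q m(1) by (intro mult_left_mono) auto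
        finally have "H y t - w \<bullet> y \<le> H y t * (1 + q / m)" by (simp add: algebra_simps)
        moreover have "0 < H y t - w \<bullet> y" using w y by (simp add: admissible_def)
        ultimately have "ln (H y t - w \<bullet> y) \<le> ln (H y t * (1 + q / m))" by (subst ln_le_cancel_iff) auto
        also have "\<dots> = ln (H y t) + ln (1 + q / m)" using H0 qm by (simp add: ln_mult)
        finally show "\<rho> y * ln (H y t - w \<bullet> y) \<le> \<rho> y * ln (H y t - 0 \<bullet> y) + \<rho> y * ln (1 + exp (t - T) * d * R / m)"
          using rho_pos[OF y] by (simp add: q_def flip: distrib_left)
      qed
      also have "\<dots> = entropy 0 t + total * ln (1 + exp (t - T) * d * R / m)"
        unfolding entropy_def set_integral_rho_const[symmetric]
        by (rule set_integral_add(2)[OF I1 I2])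
      finally show ?thesis using z(2) IL[OF T1(1)] by simp
    qed
    have "((\<lambda>T. 1 / T + (entropy 0 t + total * ln (1 + exp (t - T) * d * R / m))) \<longlongrightarrow>
        0 + (entropy 0 t + total * ln (1 + 0 * d * R / m))) at_top"
    proof (intro tendsto_intros)
      show "((\<lambda>T. 1 / T) \<longlongrightarrow> 0) (at_top :: real filter)"
        by (rule real_tendsto_divide_at_top[OF tendsto_const filterlim_ident])
      show "((\<lambda>T. exp (t - T)) \<longlongrightarrow> 0) (at_top :: real filter)"
      proof -
        have "filterlim (\<lambda>T. t - T) at_bot (at_top :: real filter)"
          by (subst filterlim_uminus_at_top[symmetric, simplified, of "\<lambda>T. T - t", simplified])
             (rule filterlim_tendsto_add_at_top[OF tendsto_const[of "-t"] filterlim_ident, simplified])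
        then show ?thesis by (rule filterlim_compose[OF exp_at_bot])
      qed
    qed (use m in auto)
    moreover have "eventually (\<lambda>T. I \<le> 1 / T + (entropy 0 t + total * ln (1 + exp (t - T) * d * R / m))) at_top"
      using eventually_ge_at_top[of t] by eventually_elim (rule main)
    ultimately have "I \<le> 0 + (entropy 0 t + total * ln (1 + 0 * d * R / m))"
      by (intro tendsto_lowerbound) auto
    then show ?thesis by simp
  qed
  show "\<exists>C. \<forall>t\<ge>1. C \<le> entropy 0 t" using I0 CI order_trans by blast
  assume \<epsilon>: "0 < \<epsilon>"
  \<comment> \<open>Once the maximal entropy is within \<open>\<epsilon>\<close> of \<open>I\<close>
    it stays so, and \<open>I\<close> lies below the entropy at the origin.\<close>
  have "\<exists>t\<in>{1..}. E t < I + \<epsilon>"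
    using cINF_less_iff[of "{1..}" E "I + \<epsilon>"] EL \<epsilon> unfolding I_def[symmetric] by (auto simp: bdd_below_def)
  then obtain T where T: "1 \<le> T" "E T < I + \<epsilon>" by auto
  show "\<exists>T\<ge>1. \<forall>t\<ge>T. \<forall>z. admissible z t \<longrightarrow> entropy z t \<le> entropy 0 t + \<epsilon>"
  proof (intro exI[of _ T] conjI allI impI T)
    fix t z assume t: "T \<le> t" and z: "admissible z t"
    have "entropy z t \<le> entropy (exp (T - t) *\<^sub>R z) T" by (rule entropy_mono[OF _ t z]) (use T in auto)
    also have "\<dots> \<le> E T" by (intro EU T admissible_backwards[OF _ _ t z, of T]) (use T in auto)
    also have "\<dots> \<le> entropy 0 t + \<epsilon>" using T(2) I0[of t] T t by simp
    finally show "entropy z t \<le> entropy 0 t + \<epsilon>" .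
  qed
qed

end

section \<open>Reflections and the lower bound\<close>

definition reflect :: "real^'n::finite \<Rightarrow> real^'n \<Rightarrow> real^'n"
  where "reflect u y = y - (2 * (u \<bullet> y)) *\<^sub>R u"

lemma reflect_props:
  assumes "norm u = 1"
  shows "norm (reflect u y) = norm y" "u \<bullet> reflect u y = - (u \<bullet> y)" "reflect u (reflect u y) = y"
    "orthogonal_transformation (reflect u)" "reflect u u = - u"
proof -
  have uu: "u \<bullet> u = 1" using assms by (simp add: norm_eq_1)
  show "u \<bullet> reflect u y = - (u \<bullet> y)" "reflect u u = - u"
    using uu by (simp_all add: reflect_def inner_diff_right) (simp add: scaleR_2)
  then show "reflect u (reflect u y) = y" by (simp add: reflect_def)
  have lin: "linear (reflect u)" by (rule linearI) (auto simp: reflect_def algebra_simps inner_add_right)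
  have inn: "reflect u v \<bullet> reflect u w = v \<bullet> w" for v w
    using uu by (simp add: reflect_def inner_diff_left inner_diff_right inner_commute algebra_simps)
  show o: "orthogonal_transformation (reflect u)" using lin inn by (simp add: orthogonal_transformation_def)
  show "norm (reflect u y) = norm y" using orthogonal_transformation_norm[OF o] .
qed

lemma ln_lower_quadratic:
  fixes x :: real
  assumes "\<bar>x\<bar> \<le> 1/2"
  shows "x - 2 * x\<^sup>2 \<le> ln (1 + x)"
proof (cases "0 \<le> x")
  case True
  then have "x - x\<^sup>2 \<le> ln (1 + x)" using assms by (intro ln_one_plus_pos_lower_bound) auto
  then show ?thesis using zero_le_power2[of x] by linarith
next
  case False
  then have "- (- x) - 2 * (- x)\<^sup>2 \<le> ln (1 - (- x))" using assms by (intro ln_one_minus_pos_lower_bound) auto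
  then show ?thesis by simp
qed

text \<open>The substitution by the reflection preserves the measure and the weight and reverses
  \<open>u . y\<close>, so the integral equals half of its antisymmetrized form.\<close>

lemma reflection_integral:
  fixes \<rho> g :: "real^'n::finite \<Rightarrow> real"
  assumes \<rho>: "continuous_on (cball 0 R) \<rho>" and g: "continuous_on (cball 0 R) g"
    and g0: "\<And>y. norm y \<le> R \<Longrightarrow> 0 \<le> g y" and \<eta>: "0 < \<eta>" and u: "norm u = 1"
    and refl: "\<And>y. norm y \<le> R \<Longrightarrow> \<rho> (reflect u y) = \<rho> y"
  shows "2 * (LINT y:cball 0 R|lborel. \<rho> y * (u \<bullet> y) / (g y + \<eta>))
    = (LINT y:cball 0 R|lborel. \<rho> y * (u \<bullet> y) * (1 / (g y + \<eta>) - 1 / (g (reflect u y) + \<eta>)))"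
    and "continuous_on (cball 0 R) (\<lambda>y. \<rho> y * (u \<bullet> y) * (1 / (g y + \<eta>) - 1 / (g (reflect u y) + \<eta>)))"
proof -
  note rp = reflect_props[OF u]
  let ?T = "reflect u"
  have gp: "g y + \<eta> \<noteq> 0" if "norm y \<le> R" for y using g0[OF that] \<eta> by linarith
  have cT: "continuous_on (cball 0 R) ?T"
    unfolding reflect_def by (intro continuous_intros)
  have cgT: "continuous_on (cball 0 R) (\<lambda>y. g (?T y))"
    by (rule continuous_on_compose2[OF g cT]) (use rp in auto)
  have c1: "continuous_on (cball 0 R) (\<lambda>y. \<rho> y * (u \<bullet> y) / (g y + \<eta>))"
    using gp by (intro continuous_intros \<rho> g) auto
  have c2: "continuous_on (cball 0 R) (\<lambda>y. \<rho> y * (u \<bullet> y) / (g (?T y) + \<eta>))"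
    using gp rp by (intro continuous_intros \<rho> cgT) auto
  show "continuous_on (cball 0 R) (\<lambda>y. \<rho> y * (u \<bullet> y) * (1 / (g y + \<eta>) - 1 / (g (?T y) + \<eta>)))"
    using gp rp by (intro continuous_intros \<rho> g cgT) auto
  let ?F = "\<lambda>y. indicator (cball 0 R) y * (\<rho> y * (u \<bullet> y) / (g y + \<eta>))"
  have "?T \<in> borel_measurable borel"
    by (intro borel_measurable_continuous_onI) (auto simp: reflect_def intro!: continuous_intros)
  moreover have "integrable lborel ?F"
    using set_integrable_compact[OF compact_cball c1] by (simp add: set_integrable_def)
  ultimately have "(LINT y|lborel. ?F (?T y)) = (LINT y|lborel. ?F y)"
    by (rule set_integrable_lborel_distr(2)[OF lborel_distr_orthogonal[OF rp(4)]])
  moreover have "?F (?T y) = - (indicator (cball 0 R) y * (\<rho> y * (u \<bullet> y) / (g (?T y) + \<eta>)))" for y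
    using rp refl[of y] by (auto simp: indicator_def)
  ultimately have J: "(LINT y:cball 0 R|lborel. \<rho> y * (u \<bullet> y) / (g y + \<eta>)) = - (LINT y:cball 0 R|lborel. \<rho> y * (u \<bullet> y) / (g (?T y) + \<eta>))"
    by (simp add: set_lebesgue_integral_def)
  have "(LINT y:cball 0 R|lborel. \<rho> y * (u \<bullet> y) * (1 / (g y + \<eta>) - 1 / (g (?T y) + \<eta>)))
    = (LINT y:cball 0 R|lborel. \<rho> y * (u \<bullet> y) / (g y + \<eta>) - \<rho> y * (u \<bullet> y) / (g (?T y) + \<eta>))"
    by (simp add: right_diff_distrib)
  also have "\<dots> = (LINT y:cball 0 R|lborel. \<rho> y * (u \<bullet> y) / (g y + \<eta>)) - (LINT y:cball 0 R|lborel. \<rho> y * (u \<bullet> y) / (g (?T y) + \<eta>))"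
    by (intro set_integral_diff set_integrable_compact compact_cball c1 c2)
  finally show "2 * (LINT y:cball 0 R|lborel. \<rho> y * (u \<bullet> y) / (g y + \<eta>))
    = (LINT y:cball 0 R|lborel. \<rho> y * (u \<bullet> y) * (1 / (g y + \<eta>) - 1 / (g (?T y) + \<eta>)))" using J by simp
qed

text \<open>The sign of \<open>u . y\<close> decides which of \<open>g y\<close> and
  \<open>g (reflect u y)\<close> is smaller, so both factors of the antisymmetrized integrand have
  the same sign.\<close>

lemma reflection_integral_nonneg:
  fixes \<rho> g :: "real^'n::finite \<Rightarrow> real"
  assumes \<rho>: "continuous_on (cball 0 R) \<rho>" and g: "continuous_on (cball 0 R) g"
    and g0: "\<And>y. norm y \<le> R \<Longrightarrow> 0 \<le> g y" and \<eta>: "0 < \<eta>" and u: "norm u = 1"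
    and refl: "\<And>y. norm y \<le> R \<Longrightarrow> \<rho> (reflect u y) = \<rho> y"
    and \<rho>0: "\<And>y. norm y \<le> R \<Longrightarrow> 0 < \<rho> y"
    and gT: "\<And>y. norm y \<le> R \<Longrightarrow> 0 \<le> u \<bullet> y \<Longrightarrow> g y \<le> g (reflect u y)"
  shows "norm y \<le> R \<Longrightarrow> 0 \<le> \<rho> y * (u \<bullet> y) * (1 / (g y + \<eta>) - 1 / (g (reflect u y) + \<eta>))"
    and "0 \<le> (LINT y:cball 0 R|lborel. \<rho> y * (u \<bullet> y) / (g y + \<eta>))"
proof -
  note rp = reflect_props[OF u]
  show nn: "0 \<le> \<rho> y * (u \<bullet> y) * (1 / (g y + \<eta>) - 1 / (g (reflect u y) + \<eta>))" if y: "norm y \<le> R" for y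
  proof (cases "0 \<le> u \<bullet> y")
    case True
    have "1 / (g (reflect u y) + \<eta>) \<le> 1 / (g y + \<eta>)"
      using gT[OF y True] g0[OF y] \<eta> by (intro divide_left_mono mult_pos_pos) auto
    then show ?thesis using True \<rho>0[OF y] by simp
  next
    case False
    have "g (reflect u y) \<le> g y" using gT[of "reflect u y"] rp y False by simp
    then have "1 / (g y + \<eta>) \<le> 1 / (g (reflect u y) + \<eta>)"
      using g0[of "reflect u y"] rp y \<eta> g0[OF y] by (intro divide_left_mono mult_pos_pos) auto
    then show ?thesis using False \<rho>0[OF y]
      by (intro mult_nonpos_nonpos) (auto simp: mult_le_0_iff)
  qed
  have "0 \<le> (LINT y:cball 0 R|lborel. \<rho> y * (u \<bullet> y) * (1 / (g y + \<eta>) - 1 / (g (reflect u y) + \<eta>)))"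
    unfolding set_lebesgue_integral_def using nn by (intro Bochner_Integration.integral_nonneg) (auto simp: indicator_def)
  then show "0 \<le> (LINT y:cball 0 R|lborel. \<rho> y * (u \<bullet> y) / (g y + \<eta>))"
    using reflection_integral(1)[OF \<rho> g g0 \<eta> u refl] by simp
qed

text \<open>Near \<open>R u\<close> the Lipschitz bound keeps \<open>g\<close> small, while near the
  opposite rim point it stays close to at least \<open>w\<close>. The antisymmetrized integrand is
  then bounded below on a fixed ball, uniformly in \<open>\<eta> < 1\<close>.\<close>

lemma reflection_integral_pos:
  fixes \<rho> g :: "real^'n::finite \<Rightarrow> real"
  assumes R: "0 < R" and \<rho>: "continuous_on (cball 0 R) \<rho>" and g: "continuous_on (cball 0 R) g"
    and g0: "\<And>y. norm y \<le> R \<Longrightarrow> 0 \<le> g y" and u: "norm u = 1"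
    and refl: "\<And>y. norm y \<le> R \<Longrightarrow> \<rho> (reflect u y) = \<rho> y"
    and \<rho>0: "\<And>y. norm y \<le> R \<Longrightarrow> 0 < \<rho> y"
    and gT: "\<And>y. norm y \<le> R \<Longrightarrow> 0 \<le> u \<bullet> y \<Longrightarrow> g y \<le> g (reflect u y)"
    and gM: "\<And>y. norm y \<le> R \<Longrightarrow> g y \<le> M"
    and lip: "\<And>y z. norm y \<le> R \<Longrightarrow> norm z \<le> R \<Longrightarrow> \<bar>g y - g z\<bar> \<le> d * norm (y - z)" and d: "0 < d"
    and zero: "g (R *\<^sub>R u) = 0" and w: "0 < w" "w \<le> g (- (R *\<^sub>R u))"
  shows "\<exists>c>0. \<forall>\<eta>. 0 < \<eta> \<longrightarrow> \<eta> < 1 \<longrightarrow> c \<le> (LINT y:cball 0 R|lborel. \<rho> y * (u \<bullet> y) / (g y + \<eta>))"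
proof -
  note rp = reflect_props[OF u]
  obtain y0 where y0: "norm y0 \<le> R" "\<And>y. norm y \<le> R \<Longrightarrow> \<rho> y0 \<le> \<rho> y"
    using continuous_attains_inf[OF compact_cball _ \<rho>] R by (auto simp: Ball_def)
  \<comment> \<open>Within distance \<open>r\<close> the function \<open>g\<close> varies by at most
    \<open>w / 4\<close>, and \<open>u . y\<close> stays at least \<open>R / 2\<close>.\<close>
  define r where "r = min (R / 2) (w / (4 * d))"
  have r: "0 < r" "r \<le> R / 2" "d * r \<le> w / 4" using R w d by (auto simp: r_def min_def field_simps)
  \<comment> \<open>Product of lower bounds for \<open>\<rho>\<close>, for \<open>u . y\<close>, and
    for the difference of reciprocals: gap \<open>w / 2\<close> over denominators of at most
    \<open>M + 1\<close>.\<close>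
  define a where "a = \<rho> y0 * (R / 2) * (w / 2 / (M + 1)\<^sup>2)"
  have M: "0 \<le> M" using gM[of 0] g0[of 0] R by simp
  have a: "0 < a" using \<rho>0[OF y0(1)] R w M by (simp add: a_def)
  \<comment> \<open>Tangent to the sphere at \<open>R u\<close> from inside, so it lies in the ball
    and within distance \<open>r\<close> of \<open>R u\<close>.\<close>
  define B where "B = ball ((R - r / 2) *\<^sub>R u) (r / 2)"
  have B: "norm y \<le> R \<and> norm (y - R *\<^sub>R u) \<le> r" if "y \<in> B" for y
  proof
    have y: "norm (y - (R - r / 2) *\<^sub>R u) < r / 2" using that by (simp add: B_def dist_norm norm_minus_commute)
    have "norm y \<le> norm (y - (R - r / 2) *\<^sub>R u) + norm ((R - r / 2) *\<^sub>R u)" using norm_triangle_ineq[of "y - (R - r / 2) *\<^sub>R u" "(R - r / 2) *\<^sub>R u"] by simp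
    also have "\<dots> \<le> r / 2 + (R - r / 2)" using y u r by simp
    finally show "norm y \<le> R" by simp
    have "y - R *\<^sub>R u = (y - (R - r / 2) *\<^sub>R u) - (r / 2) *\<^sub>R u" by (simp add: algebra_simps)
    then have "norm (y - R *\<^sub>R u) \<le> norm (y - (R - r / 2) *\<^sub>R u) + norm ((r / 2) *\<^sub>R u)" by (metis norm_triangle_ineq4)
    also have "\<dots> \<le> r / 2 + r / 2" using y u r by simp
    finally show "norm (y - R *\<^sub>R u) \<le> r" by simp
  qed
  have mB: "0 < measure lborel B"
    using r content_ball[of "r / 2" "(R - r / 2) *\<^sub>R u"] by (simp add: B_def unit_ball_vol_pos)
  have low: "a \<le> \<rho> y * (u \<bullet> y) * (1 / (g y + \<eta>) - 1 / (g (reflect u y) + \<eta>))"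
    if \<eta>: "0 < \<eta>" "\<eta> < 1" and yB: "y \<in> B" for \<eta> y
  proof -
    have y: "norm y \<le> R" "norm (y - R *\<^sub>R u) \<le> r" using B[OF yB] by auto
    have n: "norm (R *\<^sub>R u) \<le> R" "norm (- (R *\<^sub>R u)) \<le> R" "norm (reflect u y) \<le> R" using R u rp y by auto
    have "\<bar>g y - g (R *\<^sub>R u)\<bar> \<le> d * r" using lip[OF y(1) n(1)] mult_left_mono[OF y(2), of d] d by linarith
    then have 1: "g y \<le> w / 4" using zero r by auto
    have "reflect u y - - (R *\<^sub>R u) = reflect u (y - R *\<^sub>R u)"
      using rp(4,5) by (simp add: orthogonal_transformation_def linear_diff linear_cmul)
    then have "norm (reflect u y - - (R *\<^sub>R u)) \<le> r" using rp(1)[of "y - R *\<^sub>R u"] y by simp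
    then have "\<bar>g (reflect u y) - g (- (R *\<^sub>R u))\<bar> \<le> d * r"
      using lip[OF n(3) n(2)] mult_left_mono[of "norm (reflect u y - - (R *\<^sub>R u))" r d] d by linarith
    then have 2: "3 * w / 4 \<le> g (reflect u y)" using w r by linarith
    have "u \<bullet> (R *\<^sub>R u - y) \<le> norm u * norm (R *\<^sub>R u - y)" by (rule norm_cauchy_schwarz)
    then have 3: "R / 2 \<le> u \<bullet> y" using u y r by (simp add: inner_diff_right norm_eq_1 norm_minus_commute)
    have pos: "0 < g y + \<eta>" "0 < g (reflect u y) + \<eta>" using g0[OF y(1)] g0[OF n(3)] \<eta> by auto
    have le: "g y + \<eta> \<le> M + 1" "g (reflect u y) + \<eta> \<le> M + 1" using gM[OF y(1)] gM[OF n(3)] \<eta> by auto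
    have "w / 2 / (M + 1)\<^sup>2 \<le> (w / 2) / ((g y + \<eta>) * (g (reflect u y) + \<eta>))"
      unfolding power2_eq_square using w pos le by (intro divide_left_mono mult_mono mult_pos_pos) auto
    also have "\<dots> \<le> (g (reflect u y) - g y) / ((g y + \<eta>) * (g (reflect u y) + \<eta>))"
      using 1 2 pos by (intro divide_right_mono) auto
    also have "\<dots> = 1 / (g y + \<eta>) - 1 / (g (reflect u y) + \<eta>)" using pos by (simp add: field_simps)
    finally show ?thesis
      unfolding a_def using y0(2)[OF y(1)] 3 \<rho>0[OF y0(1)] R w M \<rho>0[OF y(1)] by (intro mult_mono) auto
  qed
  have main: "a * measure lborel B / 2 \<le> (LINT y:cball 0 R|lborel. \<rho> y * (u \<bullet> y) / (g y + \<eta>))" if \<eta>: "0 < \<eta>" "\<eta> < 1" for \<eta>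
  proof -
    let ?F = "\<lambda>y. \<rho> y * (u \<bullet> y) * (1 / (g y + \<eta>) - 1 / (g (reflect u y) + \<eta>))"
    have "a * measure lborel B = (LINT y|lborel. indicator B y * a)" by (simp add: mult.commute)
    also have "\<dots> \<le> (LINT y|lborel. indicator (cball 0 R) y * ?F y)"
    proof (rule integral_mono)
      have "emeasure lborel B < \<infinity>" unfolding B_def by (rule emeasure_lborel_ball_finite)
      then show "integrable lborel (\<lambda>y. indicator B y * a)" by (intro integrable_mult_left integrable_real_indicator) (auto simp: B_def)
      show "integrable lborel (\<lambda>y. indicator (cball 0 R) y * ?F y)"
        using set_integrable_compact[OF compact_cball reflection_integral(2)[OF \<rho> g g0 \<eta>(1) u refl]] by (simp add: set_integrable_def)
      fix y
      show "indicator B y * a \<le> indicator (cball 0 R) y * ?F y"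
        using low[OF \<eta>, of y] B[of y] reflection_integral_nonneg(1)[OF \<rho> g g0 \<eta>(1) u refl \<rho>0 gT, of y]
        by (auto simp: indicator_def)
    qed
    finally show ?thesis using reflection_integral(1)[OF \<rho> g g0 \<eta>(1) u refl] by (simp add: set_lebesgue_integral_def)
  qed
  show ?thesis using main a mB by (intro exI[of _ "a * measure lborel B / 2"]) auto
qed

text \<open>Where \<open>g \<ge> sqrt \<eta>\<close> the integrand is at most
  \<open>\<rho> * sqrt \<eta>\<close>. On the rest the logarithm is very negative, so the lower
  bound on its integral leaves only mass of order \<open>1 / \<bar>ln \<eta>\<bar>\<close>.\<close>

lemma vanishing_weight:
  fixes \<rho> g :: "real^'n::finite \<Rightarrow> real"
  assumes \<rho>: "continuous_on (cball 0 R) \<rho>" and g: "continuous_on (cball 0 R) g"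
    and g0: "\<And>y. norm y \<le> R \<Longrightarrow> 0 \<le> g y" and \<rho>0: "\<And>y. norm y \<le> R \<Longrightarrow> 0 \<le> \<rho> y"
    and gM: "\<And>y. norm y \<le> R \<Longrightarrow> g y \<le> M" and M: "0 \<le> M"
    and log: "\<And>\<eta>. 0 < \<eta> \<Longrightarrow> C \<le> (LINT y:cball 0 R|lborel. \<rho> y * ln (g y + \<eta>))"
  shows "((\<lambda>\<eta>. LINT y:cball 0 R|lborel. \<rho> y * (\<eta> / (g y + \<eta>))) \<longlongrightarrow> 0) (at_right 0)"
proof -
  define t where "t = (LINT y:cball 0 R|lborel. \<rho> y)"
  define A where "A = t * ln (M + 1) - C"
  have gp: "g y + \<eta> \<noteq> 0" if "norm y \<le> R" "0 < \<eta>" for y \<eta> using g0[OF that(1)] that by linarith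
  have bound: "(LINT y:cball 0 R|lborel. \<rho> y * (\<eta> / (g y + \<eta>))) \<le> sqrt \<eta> * t + A / ln (1 / (2 * sqrt \<eta>))"
    and nonneg: "0 \<le> (LINT y:cball 0 R|lborel. \<rho> y * (\<eta> / (g y + \<eta>)))" if \<eta>: "0 < \<eta>" "\<eta> < 1/16" for \<eta>
  proof -
    have s: "0 < sqrt \<eta>" "sqrt \<eta> < 1/4" "sqrt \<eta> * sqrt \<eta> = \<eta>"
      using \<eta> real_sqrt_less_mono[of \<eta> "1/16"] by (auto simp: real_sqrt_divide)
    \<comment> \<open>Where \<open>g < sqrt \<eta>\<close> one has
      \<open>g + \<eta> \<le> 2 * sqrt \<eta>\<close>, so \<open>- ln (g + \<eta>) \<ge> l\<close>;
      \<open>\<eta> < 1/16\<close> makes \<open>l\<close> positive.\<close>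
    define l where "l = ln (1 / (2 * sqrt \<eta>))"
    have l: "0 < l" unfolding l_def using s by (intro ln_gt_zero) (simp add: field_simps)
    have c1: "continuous_on (cball 0 R) (\<lambda>y. \<rho> y * (\<eta> / (g y + \<eta>)))"
      using gp \<eta> by (intro continuous_intros \<rho> g) auto
    have c2: "continuous_on (cball 0 R) (\<lambda>y. \<rho> y * ln (g y + \<eta>))"
      using gp \<eta> by (intro continuous_intros \<rho> g) auto
    have ptw: "\<rho> y * (\<eta> / (g y + \<eta>)) \<le> \<rho> y * (sqrt \<eta> + ln (M + 1) / l) - (\<rho> y * ln (g y + \<eta>)) / l"
      if y: "norm y \<le> R" for y
    proof -
      have p: "0 < g y + \<eta>" "g y + \<eta> \<le> M + 1" using g0[OF y] gM[OF y] \<eta> by auto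
      have ln0: "ln (g y + \<eta>) \<le> ln (M + 1)" using p by simp
      have "\<eta> / (g y + \<eta>) \<le> sqrt \<eta> + (ln (M + 1) - ln (g y + \<eta>)) / l"
      proof (cases "sqrt \<eta> \<le> g y")
        case True
        have "\<eta> / (g y + \<eta>) \<le> \<eta> / sqrt \<eta>" using True p s \<eta> by (intro divide_left_mono mult_pos_pos) linarith+
        also have "\<dots> = sqrt \<eta>" using \<eta> by (simp add: real_div_sqrt)
        finally show ?thesis using ln0 l by (smt (verit) divide_nonneg_pos)
      next
        case False
        have "sqrt \<eta> * sqrt \<eta> \<le> sqrt \<eta> * 1" by (intro mult_left_mono) (use s in linarith)+
        then have "\<eta> \<le> sqrt \<eta>" using s(3) by linarith
        then have "g y + \<eta> \<le> 2 * sqrt \<eta>" using False by linarith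
        then have "ln (g y + \<eta>) \<le> ln (2 * sqrt \<eta>)" using p s by (subst ln_le_cancel_iff) auto
        moreover have "l = - ln (2 * sqrt \<eta>)" unfolding l_def using s by (simp add: ln_div)
        moreover have "0 \<le> ln (M + 1)" using M by simp
        ultimately have "l \<le> ln (M + 1) - ln (g y + \<eta>)" by linarith
        then have "1 \<le> (ln (M + 1) - ln (g y + \<eta>)) / l" using l by (simp add: field_simps)
        moreover have "\<eta> / (g y + \<eta>) \<le> 1" using p \<eta> g0[OF y] by (simp add: field_simps)
        ultimately show ?thesis using s by linarith
      qed
      then have "\<rho> y * (\<eta> / (g y + \<eta>)) \<le> \<rho> y * (sqrt \<eta> + (ln (M + 1) - ln (g y + \<eta>)) / l)"
        using \<rho>0[OF y] by (intro mult_left_mono)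
      then show ?thesis by (simp add: algebra_simps diff_divide_distrib)
    qed
    have "(LINT y:cball 0 R|lborel. \<rho> y * (\<eta> / (g y + \<eta>)))
       \<le> (LINT y:cball 0 R|lborel. \<rho> y * (sqrt \<eta> + ln (M + 1) / l) - (\<rho> y * ln (g y + \<eta>)) / l)"
      using ptw by (intro set_integral_mono set_integrable_compact compact_cball c1 continuous_on_diff continuous_on_divide c2 continuous_on_mult \<rho> continuous_on_const)
        (use l in auto)
    also have "\<dots> = (LINT y:cball 0 R|lborel. \<rho> y * (sqrt \<eta> + ln (M + 1) / l)) - (LINT y:cball 0 R|lborel. (\<rho> y * ln (g y + \<eta>)) / l)"
      by (intro set_integral_diff set_integrable_compact compact_cball continuous_on_divide c2 continuous_on_mult \<rho> continuous_on_const)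
        (use l in auto)
    also have "\<dots> = t * (sqrt \<eta> + ln (M + 1) / l) - (LINT y:cball 0 R|lborel. \<rho> y * ln (g y + \<eta>)) / l"
      by (simp add: t_def)
    also have "\<dots> \<le> t * (sqrt \<eta> + ln (M + 1) / l) - C / l"
      using log[OF \<eta>(1)] l by (simp add: divide_right_mono)
    also have "\<dots> = sqrt \<eta> * t + A / l" by (simp add: A_def algebra_simps diff_divide_distrib)
    finally show "(LINT y:cball 0 R|lborel. \<rho> y * (\<eta> / (g y + \<eta>))) \<le> sqrt \<eta> * t + A / ln (1 / (2 * sqrt \<eta>))"
      by (simp add: l_def)
    show "0 \<le> (LINT y:cball 0 R|lborel. \<rho> y * (\<eta> / (g y + \<eta>)))"
      unfolding set_lebesgue_integral_def using \<rho>0 g0 \<eta>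
      by (intro Bochner_Integration.integral_nonneg) (auto simp: indicator_def)
  qed
  have lim: "((\<lambda>\<eta>. sqrt \<eta> * t + A / ln (1 / (2 * sqrt \<eta>))) \<longlongrightarrow> 0) (at_right 0)" by real_asymp
  have ev: "eventually (\<lambda>\<eta>. 0 < \<eta> \<and> \<eta> < (1/16::real)) (at_right 0)"
    unfolding eventually_at_right_field by (intro exI[of _ "1/16"]) auto
  show ?thesis
    by (rule tendsto_sandwich[OF _ _ tendsto_const lim]; rule eventually_mono[OF ev]) (use bound nonneg in auto)
qed

section \<open>Compactness and the lower bound\<close>

locale symmetric_flow = normalized_flow R \<rho> H D D2 e k
  for R and \<rho> :: "real^'n::finite \<Rightarrow> real" and H D D2 e k +
  assumes rho_refl: "\<And>u y. norm u = 1 \<Longrightarrow> norm y \<le> R \<Longrightarrow> \<rho> (reflect u y) = \<rho> y"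
begin

text \<open>
  If the lower bound failed, a sequence \<open>H (t i)\<close> would converge to a profile \<open>g\<close> that vanishes at
  some \<open>R u\<close>. The origin maximizes the limit entropy, so the vector \<open>v\<close> of weights
  \<open>\<rho> y / (g y + \<eta>)\<close> points, up to a small error, to a zero of \<open>g\<close> on the negative side,
  while the reflection inequality makes \<open>u \<bullet> v\<close> nonnegative at every zero \<open>R u\<close>.
\<close>

lemma eventually_bounded_below: "\<exists>c>0. \<exists>T\<ge>1. \<forall>t\<ge>T. \<forall>y. norm y \<le> R \<longrightarrow> c \<le> H y t"
proof (rule ccontr)
  assume neg: "\<not> ?thesis"
  obtain d where d: "face_bound d" using ex_face_bound by blast
  have d0: "0 < d" using d by (simp add: face_bound_def)
  obtain w where w: "0 < w" "\<And>t. 1 \<le> t \<Longrightarrow> w \<le> H 0 t"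
    "\<And>t u. 1 \<le> t \<Longrightarrow> norm u = 1 \<Longrightarrow> w \<le> H (R *\<^sub>R u) t + H (- (R *\<^sub>R u)) t" using width_bounds by blast
  obtain C where C: "\<And>t. 1 \<le> t \<Longrightarrow> C \<le> entropy 0 t" using origin_almost_maximal(1) by blast
  have "\<exists>T\<ge>1. \<forall>t\<ge>T. \<forall>z. admissible z t \<longrightarrow> entropy z t \<le> entropy 0 t + 1 / real (Suc n)" for n
    by (rule origin_almost_maximal(2)) simp
  then obtain T where T: "\<And>n. 1 \<le> T n" "\<And>n t z. T n \<le> t \<Longrightarrow> admissible z t \<Longrightarrow> entropy z t \<le> entropy 0 t + 1 / real (Suc n)"
    by metis
  have "\<exists>t\<ge>T n. \<exists>y. norm y \<le> R \<and> H y t < 1 / real (Suc n)" for n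
  proof (rule ccontr)
    assume "\<not> ?thesis"
    then have "\<forall>t\<ge>T n. \<forall>y. norm y \<le> R \<longrightarrow> 1 / real (Suc n) \<le> H y t" by (meson not_le)
    then show False using neg T(1)[of n] by (metis of_nat_0_less_iff zero_less_Suc zero_less_divide_1_iff)
  qed
  then obtain t yy where t: "\<And>n. T n \<le> t n" and yy: "\<And>n. norm (yy n) \<le> R" "\<And>n. H (yy n) (t n) < 1 / real (Suc n)"
    by metis
  have t1: "1 \<le> t n" for n using t[of n] T(1)[of n] by simp
  have t0: "0 < t n" "0 \<le> t n" for n using t1[of n] by simp_all
  define M where "M = 2 * R * d"
  have M: "0 < M" using R_pos d0 by (simp add: M_def)
  have hM: "0 < H y (t n)" "H y (t n) \<le> M" if "norm y \<le> R" for y n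
    using H_pos[OF that t0(2)] gradient_bound(2)[OF d t1 that] by (simp_all add: M_def)
  \<comment> \<open>The gradient bound makes the profiles uniformly bounded and
    equi-Lipschitz.\<close>
  have "\<exists>g r. continuous_on (cball 0 R) g \<and> strict_mono (r :: nat \<Rightarrow> nat) \<and>
      (\<forall>\<epsilon>. 0 < \<epsilon> \<longrightarrow> (\<exists>N. \<forall>n y. n \<ge> N \<and> y \<in> cball 0 R \<longrightarrow> norm (H y (t (r n)) - g y) < \<epsilon>))"
  proof (rule Arzela_Ascoli[of "cball (0::real^'n) R" "\<lambda>n y. H y (t n)" M])
    fix n and y :: "real^'n" assume "y \<in> cball 0 R"
    then show "norm (H y (t n)) \<le> M" using hM[of y n] by simp
  next
    fix x :: "real^'n" and \<epsilon> :: real assume x: "x \<in> cball 0 R" "0 < \<epsilon>"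
    show "\<exists>\<delta>. 0 < \<delta> \<and> (\<forall>n y. y \<in> cball 0 R \<and> norm (x - y) < \<delta> \<longrightarrow> norm (H x (t n) - H y (t n)) < \<epsilon>)"
    proof (intro exI[of _ "\<epsilon> / d"] conjI allI impI)
      show "0 < \<epsilon> / d" using x d0 by simp
      fix n y assume y: "y \<in> cball 0 R \<and> norm (x - y) < \<epsilon> / d"
      have "\<bar>H x (t n) - H y (t n)\<bar> \<le> d * norm (x - y)" using H_lipschitz[OF d t1] x y by simp
      also have "\<dots> < \<epsilon>" using y d0 by (simp add: field_simps)
      finally show "norm (H x (t n) - H y (t n)) < \<epsilon>" by simp
    qed
  qed auto
  then obtain g r where cg: "continuous_on (cball 0 R) g" and r: "strict_mono (r :: nat \<Rightarrow> nat)"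
    and unif: "\<And>\<epsilon>. 0 < \<epsilon> \<Longrightarrow> \<exists>N. \<forall>n y. n \<ge> N \<and> y \<in> cball 0 R \<longrightarrow> norm (H y (t (r n)) - g y) < \<epsilon>" by blast
  define f where "f = (\<lambda>n y. H y (t (r n)))"
  have conv: "\<exists>N. \<forall>n\<ge>N. \<forall>y. norm y \<le> R \<longrightarrow> \<bar>f n y - g y\<bar> < \<epsilon>" if "0 < \<epsilon>" for \<epsilon>
    using unif[OF that] by (auto simp: f_def)
  have fM: "0 < f n y" "f n y \<le> M" if "norm y \<le> R" for y n using hM[OF that] by (simp_all add: f_def)
  have small: "1 / real (Suc (r n)) \<le> 1 / real (Suc n)" for n
    using seq_suble[OF r, of n] by (simp add: field_simps)
  have lim: "(\<lambda>n. f n y) \<longlonglongrightarrow> g y" if y: "norm y \<le> R" for y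
    unfolding LIMSEQ_iff using conv y by fastforce
  have g0: "0 \<le> g y" and gM: "g y \<le> M" if y: "norm y \<le> R" for y
    using LIMSEQ_le_const[OF lim[OF y], of 0] LIMSEQ_le_const2[OF lim[OF y], of M] fM[OF y] less_imp_le by blast+
  have glip: "\<bar>g y - g z\<bar> \<le> d * norm (y - z)" if yz: "norm y \<le> R" "norm z \<le> R" for y z
  proof (rule LIMSEQ_le_const2)
    show "(\<lambda>n. \<bar>f n y - f n z\<bar>) \<longlonglongrightarrow> \<bar>g y - g z\<bar>" by (intro tendsto_intros lim yz)
  qed (use H_lipschitz[OF d t1 yz] in \<open>auto simp: f_def\<close>)
  have nR: "norm (R *\<^sub>R u) \<le> R" "norm (- (R *\<^sub>R u)) \<le> R" if "norm u = 1" for u :: "real^'n" using that R_pos by auto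
  have gw: "w \<le> g (R *\<^sub>R u) + g (- (R *\<^sub>R u))" if u: "norm u = 1" for u
  proof (rule LIMSEQ_le_const)
    show "(\<lambda>n. f n (R *\<^sub>R u) + f n (- (R *\<^sub>R u))) \<longlonglongrightarrow> g (R *\<^sub>R u) + g (- (R *\<^sub>R u))" by (intro tendsto_intros lim nR u)
  qed (use w(3)[OF t1 u] in \<open>auto simp: f_def\<close>)
  have gw0: "w \<le> g 0"
    by (rule LIMSEQ_le_const[OF lim]) (use w(2)[OF t1] R_pos in \<open>auto simp: f_def\<close>)
  have grefl: "g y \<le> g (reflect u y)" if u: "norm u = 1" and z: "g (R *\<^sub>R u) = 0" and y: "norm y \<le> R" "0 \<le> u \<bullet> y" for u y
  proof -
    have "g y - 2 * (u \<bullet> y) * g (R *\<^sub>R u) / R \<le> g (reflect u y)"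
    proof (rule LIMSEQ_le)
      show "(\<lambda>n. f n y - 2 * (u \<bullet> y) * f n (R *\<^sub>R u) / R) \<longlonglongrightarrow> g y - 2 * (u \<bullet> y) * g (R *\<^sub>R u) / R"
        using R_pos by (intro tendsto_intros lim nR u y) auto
      show "(\<lambda>n. f n (reflect u y)) \<longlonglongrightarrow> g (reflect u y)" by (intro lim) (simp add: reflect_props[OF u] y)
    qed (use reflection_bound[OF t0(1) u y] in \<open>auto simp: f_def reflect_def\<close>)
    then show ?thesis using z by simp
  qed
  \<comment> \<open>Scaling the face point that touches at \<open>R u\<close> gives this bound;
    hence a zero of \<open>g\<close> away from the origin propagates to the rim point on its
    ray.\<close>
  have ray: "s * g (R *\<^sub>R u) \<le> g ((s * R) *\<^sub>R u)" if u: "norm u = 1" and s: "0 \<le> s" "s \<le> 1" for s u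
  proof (rule LIMSEQ_le)
    have n: "norm ((s * R) *\<^sub>R u) \<le> R" using u s R_pos by (simp add: mult_left_le_one_le)
    show "(\<lambda>n. s * f n (R *\<^sub>R u)) \<longlonglongrightarrow> s * g (R *\<^sub>R u)" by (intro tendsto_intros lim nR u)
    show "(\<lambda>n. f n ((s * R) *\<^sub>R u)) \<longlonglongrightarrow> g ((s * R) *\<^sub>R u)" by (intro lim n)
    have "s * f m (R *\<^sub>R u) \<le> f m ((s * R) *\<^sub>R u)" for m
    proof -
      obtain z where z: "\<forall>y. norm y \<le> R \<longrightarrow> z \<bullet> y \<le> f m y" "z \<bullet> (R *\<^sub>R u) = f m (R *\<^sub>R u)"
        using touching_admissible[OF t0(1) u] unfolding f_def by blast
      have "s * f m (R *\<^sub>R u) = z \<bullet> ((s * R) *\<^sub>R u)" using z(2)[symmetric] by simp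
      then show ?thesis using z(1) n by metis
    qed
    then show "\<exists>N. \<forall>n\<ge>N. s * f n (R *\<^sub>R u) \<le> f n ((s * R) *\<^sub>R u)" by blast
  qed
  obtain y0 where y0: "norm y0 \<le> R" "\<And>y. norm y \<le> R \<Longrightarrow> g y0 \<le> g y"
    using continuous_attains_inf[OF compact_cball _ cg] R_pos by (auto simp: Ball_def)
  have "g y0 \<le> 0"
  proof (rule field_le_epsilon)
    fix \<epsilon> :: real assume \<epsilon>: "0 < \<epsilon>"
    obtain N where N: "\<forall>n\<ge>N. \<forall>y. norm y \<le> R \<longrightarrow> \<bar>f n y - g y\<bar> < \<epsilon> / 2" using conv[of "\<epsilon> / 2"] \<epsilon> by auto
    obtain N' :: nat where N': "1 / real (Suc N') < \<epsilon> / 2" using nat_approx_posE[of "\<epsilon> / 2"] \<epsilon> by auto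
    define n where "n = max N N'"
    have "1 / real (Suc n) \<le> 1 / real (Suc N')" by (simp add: n_def field_simps)
    then have "f n (yy (r n)) < \<epsilon> / 2" using yy(2)[of "r n"] small[of n] N' by (simp add: f_def)
    moreover have "\<bar>f n (yy (r n)) - g (yy (r n))\<bar> < \<epsilon> / 2" using N yy(1) by (simp add: n_def)
    ultimately show "g y0 \<le> 0 + \<epsilon>" using y0(2)[OF yy(1)[of "r n"]] by linarith
  qed
  then have gy0: "g y0 = 0" using g0[OF y0(1)] by simp
  then have y0n: "y0 \<noteq> 0" using gw0 w by auto
  define u0 where "u0 = (1 / norm y0) *\<^sub>R y0"
  have u0: "norm u0 = 1" using y0n by (simp add: u0_def)
  have gu0: "g (R *\<^sub>R u0) = 0"
  proof -
    have s: "0 < norm y0 / R" "norm y0 / R \<le> 1" using y0n y0 R_pos by auto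
    have "(norm y0 / R * R) *\<^sub>R u0 = y0" using y0n R_pos by (simp add: u0_def)
    then have "norm y0 / R * g (R *\<^sub>R u0) \<le> 0" using ray[OF u0, of "norm y0 / R"] s gy0 by simp
    then have "g (R *\<^sub>R u0) \<le> 0" using s(1) by (metis mult_zero_right mult_le_cancel_left_pos)
    then show ?thesis using g0[OF nR(1)[OF u0]] by linarith
  qed
  \<comment> \<open>Up to sign, the gradient at the origin of the entropy of
    \<open>g + \<eta>\<close> as a function of the centre.\<close>
  define v where "v = (\<lambda>\<eta>. LINT y|lborel. indicator (cball 0 R) y *\<^sub>R ((\<rho> y / (g y + \<eta>)) *\<^sub>R y))"
  have gp: "g y + \<eta> \<noteq> 0" "0 < g y + \<eta>" if "norm y \<le> R" "0 < \<eta>" for y \<eta> using g0[OF that(1)] that by linarith+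
  have iv: "integrable lborel (\<lambda>y. indicator (cball 0 R) y *\<^sub>R ((\<rho> y / (g y + \<eta>)) *\<^sub>R y))" if \<eta>: "0 < \<eta>" for \<eta>
    by (intro borel_integrable_compact compact_cball continuous_intros rho_cont cg) (use gp \<eta> in auto)
  have zv: "z \<bullet> v \<eta> = (LINT y:cball 0 R|lborel. \<rho> y * (z \<bullet> y) / (g y + \<eta>))" if \<eta>: "0 < \<eta>" for z \<eta>
    unfolding v_def by (subst integral_inner_right[symmetric]) (use iv[OF \<eta>] in \<open>auto simp: set_lebesgue_integral_def mult.assoc\<close>)
  \<comment> \<open>The price of replacing \<open>g\<close> by \<open>g + \<eta>\<close> in the
    first variation; it vanishes with \<open>\<eta>\<close>.\<close>
  define \<kappa> where "\<kappa> = (\<lambda>\<eta>. LINT y:cball 0 R|lborel. \<rho> y * (\<eta> / (g y + \<eta>)))"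
  \<comment> \<open>If \<open>z\<close> touches the profile at time \<open>t (r n)\<close> at
    \<open>R u\<close>, the admissible centre \<open>l *\<^sub>R z\<close> beats the origin by at
    most \<open>1 / Suc (r n)\<close>. Expanding the logarithm to second order in \<open>l\<close>
    and dividing by \<open>l\<close> bounds \<open>- (z . v)\<close>.\<close>
  have profile: "\<exists>z. g (R *\<^sub>R u) - \<xi> \<le> z \<bullet> (R *\<^sub>R u) \<and> - (z \<bullet> v \<eta>) \<le> \<kappa> \<eta> + \<xi>"
    if \<eta>: "0 < \<eta>" and \<xi>: "0 < \<xi>" and u: "norm u = 1" for \<eta> \<xi> u
  proof -
    \<comment> \<open>Bounds \<open>\<bar>q y - 1\<bar>\<close> for the quotient \<open>q\<close>
      introduced below, with numerator at most \<open>M + d * R\<close> and denominator at least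
      \<open>\<eta>\<close>.\<close>
    define Q where "Q = (M + d * R) / \<eta> + 1"
    have Q: "1 \<le> Q" "0 < Q" using M d0 R_pos \<eta> by (auto simp: Q_def add_nonneg_pos)
    \<comment> \<open>Small enough for the quadratic estimate of the logarithm, which needs
      \<open>l * Q \<le> 1/2\<close>, and for the second-order error, divided by \<open>l\<close>,
      to cost at most \<open>\<xi> / 3\<close>.\<close>
    define l where "l = min (1 / (2 * Q)) (\<xi> / (6 * (Q\<^sup>2 * total)))"
    have Q2: "0 < Q\<^sup>2 * total" using Q total_pos by simp
    have l: "0 < l" "l * Q \<le> 1/2" "2 * l * Q\<^sup>2 * total \<le> \<xi> / 3"
    proof -
      have "0 < \<xi> / (6 * (Q\<^sup>2 * total))" using Q2 \<xi> by (intro divide_pos_pos) auto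
      then show "0 < l" using Q(2) by (simp only: l_def min_less_iff_conj) simp
      have "l * Q \<le> 1 / (2 * Q) * Q" using Q by (intro mult_right_mono) (auto simp: l_def)
      then show "l * Q \<le> 1/2" using Q by simp
      have "l * (Q\<^sup>2 * total) \<le> \<xi> / (6 * (Q\<^sup>2 * total)) * (Q\<^sup>2 * total)"
        using Q2 by (intro mult_right_mono) (auto simp: l_def)
      also have "\<dots> = \<xi> / 6" using Q2 Q(2) total_pos by simp
      finally show "2 * l * Q\<^sup>2 * total \<le> \<xi> / 3" by (simp add: mult.assoc)
    qed
    have "l * 1 \<le> l * Q" using l(1) Q by (intro mult_left_mono) auto
    then have l1: "l < 1" using l by linarith
    \<comment> \<open>\<open>\<epsilon> \<le> \<eta>\<close> ensures
      \<open>f n \<le> g + \<eta>\<close>; the other entries limit the error in the touching value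
      to \<open>\<xi>\<close> and the error in the integral to \<open>\<xi> / 3\<close>.\<close>
    define \<epsilon> where "\<epsilon> = min \<eta> (min \<xi> (\<xi> * \<eta> / (3 * total)))"
    have \<epsilon>: "0 < \<epsilon>" "\<epsilon> \<le> \<eta>" "\<epsilon> \<le> \<xi>" "\<epsilon> / \<eta> * total \<le> \<xi> / 3"
    proof -
      show "0 < \<epsilon>" "\<epsilon> \<le> \<eta>" "\<epsilon> \<le> \<xi>" using \<eta> \<xi> total_pos by (auto simp: \<epsilon>_def)
      have "\<epsilon> * (total / \<eta>) \<le> \<xi> * \<eta> / (3 * total) * (total / \<eta>)"
        using \<eta> total_pos by (intro mult_right_mono) (auto simp: \<epsilon>_def)
      also have "\<dots> = \<xi> / 3" using \<eta> total_pos by simp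
      finally show "\<epsilon> / \<eta> * total \<le> \<xi> / 3" by simp
    qed
    obtain N where N: "\<forall>n\<ge>N. \<forall>y. norm y \<le> R \<longrightarrow> \<bar>f n y - g y\<bar> < \<epsilon>" using conv[OF \<epsilon>(1)] by auto
    \<comment> \<open>The last third of the error: near-maximality must be finer than
      \<open>l * \<xi> / 3\<close>, as the inequality is divided by \<open>l\<close> in the
      end.\<close>
    obtain N' :: nat where N': "1 / real (Suc N') < l * \<xi> / 3" using nat_approx_posE[of "l * \<xi> / 3"] \<xi> l by auto
    define n where "n = max N N'"
    have "1 / real (Suc n) \<le> 1 / real (Suc N')" by (simp add: n_def field_simps)
    then have n: "1 / real (Suc (r n)) \<le> l * \<xi> / 3" "\<And>y. norm y \<le> R \<Longrightarrow> \<bar>f n y - g y\<bar> < \<epsilon>"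
      using small[of n] N' N by (auto simp: n_def)
    obtain z where z: "\<And>y. norm y \<le> R \<Longrightarrow> z \<bullet> y \<le> f n y" "z \<bullet> (R *\<^sub>R u) = f n (R *\<^sub>R u)"
      using touching_admissible[OF t0(1) u] unfolding f_def by blast
    have nz: "norm z \<le> d" using d t1 z(1) unfolding face_bound_def f_def by blast
    have zy: "\<bar>z \<bullet> y\<bar> \<le> d * R" if y: "norm y \<le> R" for y
    proof -
      have "\<bar>z \<bullet> y\<bar> \<le> norm z * norm y" by (rule Cauchy_Schwarz_ineq2)
      also have "\<dots> \<le> d * R" using nz y d0 by (intro mult_mono) auto
      finally show ?thesis .
    qed
    have lz: "l * (z \<bullet> y) < f n y" if y: "norm y \<le> R" for y
    proof -
      have "l * (z \<bullet> y) \<le> l * f n y" using z(1)[OF y] l by simp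
      also have "\<dots> < 1 * f n y" using l1 fM[OF y] by (intro mult_strict_right_mono) auto
      finally show ?thesis by simp
    qed
    have adm: "admissible (l *\<^sub>R z) (t (r n))" using lz by (simp add: admissible_def f_def)
    define q where "q = (\<lambda>y. (f n y - z \<bullet> y) / (g y + \<eta>))"
    have cf: "continuous_on (cball 0 R) (f n)" unfolding f_def by (rule H_cont_space[OF t0(2)])
    have cq: "continuous_on (cball 0 R) q"
      unfolding q_def using gp \<eta> by (intro continuous_intros cf cg) auto
    have qQ: "0 \<le> q y" "\<bar>q y - 1\<bar> \<le> Q" if y: "norm y \<le> R" for y
    proof -
      show q0: "0 \<le> q y" unfolding q_def using z(1)[OF y] gp[OF y \<eta>] by simp
      have "q y \<le> (M + d * R) / \<eta>"
        unfolding q_def using fM[OF y, of n] zy[OF y] g0[OF y] \<eta> M d0 R_pos by (intro frac_le) auto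
      then show "\<bar>q y - 1\<bar> \<le> Q" using q0 Q unfolding Q_def by linarith
    qed
    have ptw: "\<rho> y * (l * (q y - 1) - 2 * l\<^sup>2 * Q\<^sup>2) \<le> \<rho> y * ln (f n y - l *\<^sub>R z \<bullet> y) - \<rho> y * ln (f n y - 0 \<bullet> y)" if y: "norm y \<le> R" for y
    proof -
      let ?x = "l * (q y - 1)"
      have lq: "\<bar>?x\<bar> \<le> l * Q" using mult_left_mono[OF qQ(2)[OF y] less_imp_le[OF l(1)]] l(1) by (simp add: abs_mult)
      then have x: "\<bar>?x\<bar> \<le> 1/2" using l(2) by linarith
      have "?x\<^sup>2 \<le> (l * Q)\<^sup>2" using power_mono[OF lq, of 2] by simp
      then have "?x - 2 * l\<^sup>2 * Q\<^sup>2 \<le> ?x - 2 * ?x\<^sup>2" by (simp add: power_mult_distrib)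
      also have "\<dots> \<le> ln (1 + ?x)" by (rule ln_lower_quadratic[OF x])
      also have "\<dots> \<le> ln ((f n y - l * (z \<bullet> y)) / f n y)"
      proof -
        \<comment> \<open>Enlarging the denominator from \<open>f n\<close> to
          \<open>g + \<eta>\<close> lowers the nonnegative quotient, so \<open>q\<close> is a lower
          bound whose denominator is independent of \<open>n\<close>.\<close>
        have "f n y \<le> g y + \<eta>" using n(2)[OF y] \<epsilon> by linarith
        then have "q y \<le> (f n y - z \<bullet> y) / f n y"
          unfolding q_def using z(1)[OF y] fM[OF y, of n] by (intro divide_left_mono) (auto intro!: mult_pos_pos)
        then have "?x \<le> l * ((f n y - z \<bullet> y) / f n y - 1)" using l by (intro mult_left_mono) auto
        also have "\<dots> = (f n y - l * (z \<bullet> y)) / f n y - 1" using fM[OF y, of n] by (simp add: field_simps)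
        finally have "1 + ?x \<le> (f n y - l * (z \<bullet> y)) / f n y" by simp
        moreover have "0 < 1 + ?x" using x by linarith
        ultimately show ?thesis by simp
      qed
      also have "\<dots> = ln (f n y - l * (z \<bullet> y)) - ln (f n y)" using lz[OF y] fM[OF y, of n] by (simp add: ln_div)
      finally have "\<rho> y * (?x - 2 * l\<^sup>2 * Q\<^sup>2) \<le> \<rho> y * (ln (f n y - l * (z \<bullet> y)) - ln (f n y))"
        using rho_pos[OF y] by (intro mult_left_mono) auto
      then show ?thesis by (simp add: right_diff_distrib)
    qed
    note I1 = entropy_integrable[OF adm t0(2)[of "r n"]] and I0 = entropy_integrable[OF admissible_0[OF t0(2)[of "r n"]] t0(2)[of "r n"]]
    have "(LINT y:cball 0 R|lborel. \<rho> y * (l * (q y - 1) - 2 * l\<^sup>2 * Q\<^sup>2))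
        \<le> (LINT y:cball 0 R|lborel. \<rho> y * ln (f n y - l *\<^sub>R z \<bullet> y) - \<rho> y * ln (f n y - 0 \<bullet> y))"
    proof (rule set_integral_mono)
      show "set_integrable lborel (cball 0 R) (\<lambda>y. \<rho> y * (l * (q y - 1) - 2 * l\<^sup>2 * Q\<^sup>2))"
        by (intro set_integrable_compact compact_cball continuous_intros rho_cont cq)
      show "set_integrable lborel (cball 0 R) (\<lambda>y. \<rho> y * ln (f n y - l *\<^sub>R z \<bullet> y) - \<rho> y * ln (f n y - 0 \<bullet> y))"
        unfolding f_def by (rule set_integral_diff(1)[OF I1 I0])
    qed (use ptw in simp)
    also have "\<dots> = entropy (l *\<^sub>R z) (t (r n)) - entropy 0 (t (r n))"
      unfolding entropy_def f_def by (rule set_integral_diff(2)[OF I1 I0])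
    also have "\<dots> \<le> 1 / real (Suc (r n))" using T(2)[OF t adm] by simp
    also have "\<dots> \<le> l * (\<xi> / 3)" using n(1) by simp
    finally have A: "(LINT y:cball 0 R|lborel. \<rho> y * (l * (q y - 1) - 2 * l\<^sup>2 * Q\<^sup>2)) \<le> l * (\<xi> / 3)" .
    have "(LINT y:cball 0 R|lborel. \<rho> y * (l * (q y - 1) - 2 * l\<^sup>2 * Q\<^sup>2))
       = (LINT y:cball 0 R|lborel. l * (\<rho> y * (q y - 1)) - \<rho> y * (2 * l\<^sup>2 * Q\<^sup>2))"
      by (intro arg_cong[where f = "set_lebesgue_integral lborel (cball 0 R)"] ext) (simp add: algebra_simps)
    also have "\<dots> = (LINT y:cball 0 R|lborel. l * (\<rho> y * (q y - 1))) - (LINT y:cball 0 R|lborel. \<rho> y * (2 * l\<^sup>2 * Q\<^sup>2))"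
      by (intro set_integral_diff set_integrable_compact compact_cball continuous_intros rho_cont cq)
    also have "\<dots> = l * (LINT y:cball 0 R|lborel. \<rho> y * (q y - 1)) - l * (2 * l * Q\<^sup>2 * total)"
      unfolding set_integral_rho_const by (simp add: power2_eq_square)
    finally have "l * (LINT y:cball 0 R|lborel. \<rho> y * (q y - 1)) \<le> l * (\<xi> / 3 + 2 * l * Q\<^sup>2 * total)"
      using A by (simp add: distrib_left)
    then have B: "(LINT y:cball 0 R|lborel. \<rho> y * (q y - 1)) \<le> \<xi> / 3 + 2 * l * Q\<^sup>2 * total" using l by simp
    have "(LINT y:cball 0 R|lborel. (\<rho> y * ((- z) \<bullet> y) / (g y + \<eta>) - \<rho> y * (\<epsilon> / \<eta>)) - \<rho> y * (\<eta> / (g y + \<eta>)))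
       \<le> (LINT y:cball 0 R|lborel. \<rho> y * (q y - 1))"
    proof (rule set_integral_mono)
      show "set_integrable lborel (cball 0 R) (\<lambda>y. (\<rho> y * ((- z) \<bullet> y) / (g y + \<eta>) - \<rho> y * (\<epsilon> / \<eta>)) - \<rho> y * (\<eta> / (g y + \<eta>)))"
        by (intro set_integrable_compact compact_cball continuous_intros rho_cont cg) (use gp \<eta> in auto)
      show "set_integrable lborel (cball 0 R) (\<lambda>y. \<rho> y * (q y - 1))"
        by (intro set_integrable_compact compact_cball continuous_intros rho_cont cq)
      fix y assume "y \<in> cball (0::real^'n) R"
      then have y: "norm y \<le> R" by simp
      \<comment> \<open>Comparing \<open>f n\<close> with \<open>g + \<eta>\<close> costs
        \<open>\<epsilon>\<close> for the uniform convergence and \<open>\<eta>\<close> for the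
        shift; the latter integrates to \<open>\<kappa> \<eta>\<close>.\<close>
      have "((- z) \<bullet> y) / (g y + \<eta>) - \<epsilon> / (g y + \<eta>) - \<eta> / (g y + \<eta>) \<le> q y - 1"
      proof -
        have "q y - 1 = (f n y - z \<bullet> y - (g y + \<eta>)) / (g y + \<eta>)" using gp[OF y \<eta>] by (simp add: q_def diff_divide_distrib)
        moreover have "((- z) \<bullet> y) - \<epsilon> - \<eta> \<le> f n y - z \<bullet> y - (g y + \<eta>)" using n(2)[OF y] by simp
        then have "((- z) \<bullet> y - \<epsilon> - \<eta>) / (g y + \<eta>) \<le> (f n y - z \<bullet> y - (g y + \<eta>)) / (g y + \<eta>)"
          using gp(2)[OF y \<eta>] by (intro divide_right_mono) auto
        ultimately show ?thesis by (simp only: diff_divide_distrib)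
      qed
      moreover have "\<epsilon> / (g y + \<eta>) \<le> \<epsilon> / \<eta>" using g0[OF y] \<eta> \<epsilon> by (intro divide_left_mono) auto
      ultimately have "\<rho> y * (((- z) \<bullet> y) / (g y + \<eta>) - \<epsilon> / \<eta> - \<eta> / (g y + \<eta>)) \<le> \<rho> y * (q y - 1)"
        using rho_pos[OF y] by (intro mult_left_mono) auto
      then show "(\<rho> y * ((- z) \<bullet> y) / (g y + \<eta>) - \<rho> y * (\<epsilon> / \<eta>)) - \<rho> y * (\<eta> / (g y + \<eta>)) \<le> \<rho> y * (q y - 1)"
        by (simp add: right_diff_distrib)
    qed
    also have "(LINT y:cball 0 R|lborel. (\<rho> y * ((- z) \<bullet> y) / (g y + \<eta>) - \<rho> y * (\<epsilon> / \<eta>)) - \<rho> y * (\<eta> / (g y + \<eta>)))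
       = ((LINT y:cball 0 R|lborel. \<rho> y * ((- z) \<bullet> y) / (g y + \<eta>)) - (LINT y:cball 0 R|lborel. \<rho> y * (\<epsilon> / \<eta>))) - \<kappa> \<eta>"
      unfolding \<kappa>_def
    proof -
      have i1: "set_integrable lborel (cball 0 R) (\<lambda>y. \<rho> y * ((- z) \<bullet> y) / (g y + \<eta>))"
        and i2: "set_integrable lborel (cball 0 R) (\<lambda>y. \<rho> y * (\<epsilon> / \<eta>))"
        and i3: "set_integrable lborel (cball 0 R) (\<lambda>y. \<rho> y * (\<eta> / (g y + \<eta>)))"
        by (intro set_integrable_compact compact_cball continuous_intros rho_cont cg; use gp \<eta> in force)+
      show "(LINT y:cball 0 R|lborel. (\<rho> y * ((- z) \<bullet> y) / (g y + \<eta>) - \<rho> y * (\<epsilon> / \<eta>)) - \<rho> y * (\<eta> / (g y + \<eta>)))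
        = ((LINT y:cball 0 R|lborel. \<rho> y * ((- z) \<bullet> y) / (g y + \<eta>)) - (LINT y:cball 0 R|lborel. \<rho> y * (\<epsilon> / \<eta>))) - (LINT y:cball 0 R|lborel. \<rho> y * (\<eta> / (g y + \<eta>)))"
        unfolding set_integral_diff(2)[OF set_integral_diff(1)[OF i1 i2] i3] set_integral_diff(2)[OF i1 i2] ..
    qed
    also have "\<dots> = - (z \<bullet> v \<eta>) - total * (\<epsilon> / \<eta>) - \<kappa> \<eta>"
      unfolding zv[OF \<eta>, symmetric] set_integral_rho_const by simp
    finally have "- (z \<bullet> v \<eta>) \<le> \<kappa> \<eta> + \<xi>" using B l(3) \<epsilon>(4) by (simp add: mult.commute)
    moreover have "g (R *\<^sub>R u) - \<xi> \<le> z \<bullet> (R *\<^sub>R u)" using n(2)[OF nR(1)[OF u]] \<epsilon>(3) z(2) by linarith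
    ultimately show ?thesis by blast
  qed
  \<comment> \<open>For \<open>u\<close> opposite to \<open>v\<close>, \<open>- (z . v)\<close> is a
    positive multiple of \<open>z . (R u)\<close>, which is at least \<open>g (R u)\<close> up to an
    arbitrary error.\<close>
  have profile_limit: "norm (v \<eta>) * g (R *\<^sub>R (- (1 / norm (v \<eta>)) *\<^sub>R v \<eta>)) / R \<le> \<kappa> \<eta>" if \<eta>: "0 < \<eta>" and v0: "v \<eta> \<noteq> 0" for \<eta>
  proof (rule field_le_epsilon)
    fix e' :: real assume e': "0 < e'"
    define u where "u = - (1 / norm (v \<eta>)) *\<^sub>R v \<eta>"
    have u: "norm u = 1" using v0 by (simp add: u_def)
    have vu: "v \<eta> = - (norm (v \<eta>) *\<^sub>R u)" using v0 by (simp add: u_def)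
    define b where "b = 1 + norm (v \<eta>) / R"
    have b: "0 < b" using R_pos by (simp add: b_def add_pos_nonneg)
    define E where "E = e' / b"
    define a where "a = norm (v \<eta>) / R"
    have E: "0 < E" "E * (1 + a) = e'" using e' b by (auto simp: E_def b_def a_def)
    obtain z where z: "g (R *\<^sub>R u) - E \<le> z \<bullet> (R *\<^sub>R u)" "- (z \<bullet> v \<eta>) \<le> \<kappa> \<eta> + E"
      using profile[OF \<eta> E(1) u] by auto
    have "a * (g (R *\<^sub>R u) - E) \<le> a * (z \<bullet> (R *\<^sub>R u))"
      using z(1) R_pos by (intro mult_left_mono) (auto simp: a_def)
    also have "\<dots> = - (z \<bullet> v \<eta>)" using R_pos by (subst vu) (simp add: a_def)
    finally have "a * g (R *\<^sub>R u) \<le> \<kappa> \<eta> + E * (1 + a)" using z(2) by (simp add: algebra_simps)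
    then have "norm (v \<eta>) / R * g (R *\<^sub>R u) \<le> \<kappa> \<eta> + e'" using E(2) by (simp add: a_def)
    then show "norm (v \<eta>) * g (R *\<^sub>R (- (1 / norm (v \<eta>)) *\<^sub>R v \<eta>)) / R \<le> \<kappa> \<eta> + e'"
      unfolding u_def[symmetric] by simp
  qed
  \<comment> \<open>The lower bound on the entropy at the origin survives the limit because
    \<open>f n < g + \<eta>\<close> for large \<open>n\<close>.\<close>
  have loglow: "C \<le> (LINT y:cball 0 R|lborel. \<rho> y * ln (g y + \<eta>))" if \<eta>: "0 < \<eta>" for \<eta>
  proof -
    obtain n where n: "\<And>y. norm y \<le> R \<Longrightarrow> \<bar>f n y - g y\<bar> < \<eta>" using conv[OF \<eta>] by auto
    have "C \<le> entropy 0 (t (r n))" using C[OF t1] .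
    also have "\<dots> \<le> (LINT y:cball 0 R|lborel. \<rho> y * ln (g y + \<eta>))"
      unfolding entropy_def
    proof (rule set_integral_mono)
      show "set_integrable lborel (cball 0 R) (\<lambda>y. \<rho> y * ln (H y (t (r n)) - 0 \<bullet> y))"
        by (rule entropy_integrable[OF admissible_0[OF t0(2)] t0(2)])
      show "set_integrable lborel (cball 0 R) (\<lambda>y. \<rho> y * ln (g y + \<eta>))"
        by (intro set_integrable_compact compact_cball continuous_intros rho_cont cg) (use gp \<eta> in auto)
      fix y assume "y \<in> cball (0::real^'n) R"
      then have y: "norm y \<le> R" by simp
      have "ln (f n y) \<le> ln (g y + \<eta>)" using n[OF y] fM[OF y, of n] by simp
      then show "\<rho> y * ln (H y (t (r n)) - 0 \<bullet> y) \<le> \<rho> y * ln (g y + \<eta>)"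
        using rho_pos[OF y] by (simp add: f_def)
    qed
    finally show ?thesis .
  qed
  have \<kappa>0: "(\<kappa> \<longlongrightarrow> 0) (at_right 0)"
    unfolding \<kappa>_def by (rule vanishing_weight[OF rho_cont cg g0 _ gM _ loglow]) (use rho_pos M less_imp_le in auto)
  \<comment> \<open>Keeps \<open>v\<close> away from 0: at the zero \<open>R u0\<close> the opposite
    rim value is at least \<open>w\<close>, so the reflection gap is strict.\<close>
  obtain c where c: "0 < c" "\<And>\<eta>. 0 < \<eta> \<Longrightarrow> \<eta> < 1 \<Longrightarrow> c \<le> u0 \<bullet> v \<eta>"
  proof -
    have "w \<le> g (- (R *\<^sub>R u0))" using gw[OF u0] gu0 by simp
    then obtain c where "0 < c" "\<And>\<eta>. 0 < \<eta> \<Longrightarrow> \<eta> < 1 \<Longrightarrow> c \<le> (LINT y:cball 0 R|lborel. \<rho> y * (u0 \<bullet> y) / (g y + \<eta>))"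
      using reflection_integral_pos[OF R_pos rho_cont cg g0 u0 rho_refl[OF u0] rho_pos grefl[OF u0 gu0] gM glip d0 gu0 w(1)] by blast
    then show ?thesis using that zv by metis
  qed
  define \<eta> where "\<eta> = (\<lambda>j::nat. 1 / (real j + 2))"
  have \<eta>: "0 < \<eta> j" "\<eta> j < 1" for j by (auto simp: \<eta>_def)
  have vc: "c \<le> norm (v (\<eta> j))" for j
    using c(2)[OF \<eta>] norm_cauchy_schwarz[of u0 "v (\<eta> j)"] u0 by (metis mult_1 order_trans)
  have v0: "v (\<eta> j) \<noteq> 0" for j using vc[of j] c by auto
  define u where "u = (\<lambda>j. - (1 / norm (v (\<eta> j))) *\<^sub>R v (\<eta> j))"
  have u1: "norm (u j) = 1" for j using v0 by (simp add: u_def)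
  have gu: "g (R *\<^sub>R u j) \<le> \<kappa> (\<eta> j) * (R / c)" for j
  proof -
    have "c * g (R *\<^sub>R u j) / R \<le> norm (v (\<eta> j)) * g (R *\<^sub>R u j) / R"
      using vc[of j] g0[OF nR(1)[OF u1]] R_pos by (intro divide_right_mono mult_right_mono) auto
    also have "\<dots> \<le> \<kappa> (\<eta> j)" using profile_limit[OF \<eta>(1) v0] by (simp add: u_def)
    finally show ?thesis using c R_pos by (simp add: field_simps)
  qed
  have "filterlim \<eta> (at_right 0) sequentially"
    unfolding \<eta>_def by real_asymp
  then have "(\<lambda>j. \<kappa> (\<eta> j)) \<longlonglongrightarrow> 0" by (rule filterlim_compose[OF \<kappa>0])
  then have "(\<lambda>j. \<kappa> (\<eta> j) * (R / c)) \<longlonglongrightarrow> 0 * (R / c)" by (intro tendsto_mult tendsto_const)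
  then have \<kappa>_lim: "(\<lambda>j. \<kappa> (\<eta> j) * (R / c)) \<longlonglongrightarrow> 0" by (simp only: mult_zero_left)
  have gu_lim: "(\<lambda>j. g (R *\<^sub>R u j)) \<longlonglongrightarrow> 0"
  proof (rule tendsto_sandwich[OF _ _ tendsto_const \<kappa>_lim])
    show "\<forall>\<^sub>F j in sequentially. 0 \<le> g (R *\<^sub>R u j)" by (rule always_eventually) (use g0[OF nR(1)[OF u1]] in blast)
    show "\<forall>\<^sub>F j in sequentially. g (R *\<^sub>R u j) \<le> \<kappa> (\<eta> j) * (R / c)" by (rule always_eventually) (use gu in blast)
  qed
  \<comment> \<open>A limit direction \<open>u'\<close> is again a zero of \<open>g\<close>, so
    reflection gives \<open>u' . v \<ge> 0\<close>, while \<open>u j . v = - norm v\<close>. This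
    keeps every \<open>u j\<close> at distance at least 1 from \<open>u'\<close>.\<close>
  have "\<forall>j. u j \<in> sphere 0 1" using u1 by simp
  then obtain u' s where us: "u' \<in> sphere 0 1" "strict_mono (s :: nat \<Rightarrow> nat)" "(u \<circ> s) \<longlonglongrightarrow> u'"
    using compact_sphere[of "0::real^'n" 1] unfolding compact_def by blast
  have u'1: "norm u' = 1" using us by simp
  have "(\<lambda>j. g (R *\<^sub>R (u \<circ> s) j)) \<longlonglongrightarrow> g (R *\<^sub>R u')"
    by (rule continuous_on_tendsto_compose[OF cg tendsto_scaleR[OF tendsto_const us(3)]]) (use nR u1 u'1 in auto)
  moreover have "(\<lambda>j. g (R *\<^sub>R (u \<circ> s) j)) \<longlonglongrightarrow> 0"
    using LIMSEQ_subseq_LIMSEQ[OF gu_lim us(2)] by (simp add: o_def)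
  ultimately have gu': "g (R *\<^sub>R u') = 0" by (rule LIMSEQ_unique)
  have "1 \<le> norm (u' - u j)" for j
  proof -
    have "0 \<le> u' \<bullet> v (\<eta> j)"
      unfolding zv[OF \<eta>(1)]
      by (rule reflection_integral_nonneg(2)[OF rho_cont cg g0 \<eta>(1) u'1 rho_refl[OF u'1] rho_pos grefl[OF u'1 gu']])
    moreover have "u j \<bullet> v (\<eta> j) = - norm (v (\<eta> j))"
      using v0[of j] by (simp add: u_def power2_norm_eq_inner[symmetric] power2_eq_square)
    ultimately have "norm (v (\<eta> j)) \<le> (u' - u j) \<bullet> v (\<eta> j)" by (simp add: inner_diff_left)
    also have "\<dots> \<le> norm (u' - u j) * norm (v (\<eta> j))" by (rule norm_cauchy_schwarz)
    finally show ?thesis using v0[of j] by simp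
  qed
  moreover obtain j where "norm ((u \<circ> s) j - u') < 1"
    using us(3) unfolding LIMSEQ_iff by (metis le_refl zero_less_one)
  ultimately show False by (metis comp_apply norm_minus_commute not_le)
qed

lemma eventually_bounded: "\<exists>C T. 0 < C \<and> 0 < T \<and> (\<forall>t\<ge>T. \<forall>y. norm y \<le> R \<longrightarrow> 1 / C \<le> H y t \<and> H y t \<le> C)"
proof -
  obtain c T where c: "0 < c" "1 \<le> T" "\<And>t y. T \<le> t \<Longrightarrow> norm y \<le> R \<Longrightarrow> c \<le> H y t"
    using eventually_bounded_below by blast
  obtain d where d: "face_bound d" using ex_face_bound by blast
  define C where "C = max (1 / c) (2 * R * d)"
  have C0: "0 < C" using c by (simp add: C_def less_max_iff_disj)
  have "1 / C \<le> 1 / (1 / c)" using c C0 by (intro divide_left_mono mult_pos_pos) (auto simp: C_def)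
  then have "1 / C \<le> c" by simp
  moreover note C0
  moreover have "H y t \<le> C" if "T \<le> t" "norm y \<le> R" for y t
    using gradient_bound(2)[OF d _ that(2), of t] c(2) that by (simp add: C_def le_max_iff_disj)
  ultimately show ?thesis using c by (intro exI[of _ C] exI[of _ T]) (auto intro: order_trans)
qed

end

section \<open>Comparison of flows\<close>

context support_fn
begin

lemma segment_in_ball:
  assumes "norm y \<le> R" "norm z \<le> R" "0 \<le> r" "r \<le> 1"
  shows "norm (y + r *\<^sub>R (z - y)) \<le> R"
  using convexD_alt[OF convex_cball[of 0 R], of y z r] assms by (simp add: algebra_simps)

text \<open>At a rim point with \<open>H = 0\<close> the boundary condition annihilates the radial
  part of the gradient, and the one-sided minimum condition then tests it against the whole
  ball.\<close>

lemma zero_min_gradient: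
  assumes y0: "norm y0 \<le> R" and nn: "\<And>y. norm y \<le> R \<Longrightarrow> 0 \<le> H y" and z: "H y0 = 0"
  shows "D y0 = 0"
proof (cases "norm y0 < R")
  case True
  then show ?thesis using contact(2)[OF y0, of 0 0] nn z by simp
next
  case False
  then have R: "norm y0 = R" using y0 by simp
  have *: "0 \<le> D y0 \<bullet> y" if "norm y \<le> R" for y
    using min_condition[OF y0 that, of 0 0] nn z neumann[OF R] by (simp add: inner_diff_right inner_commute)
  show ?thesis
  proof (rule ccontr)
    assume n: "D y0 \<noteq> 0"
    have "0 \<le> D y0 \<bullet> (- (R / norm (D y0)) *\<^sub>R D y0)" using n R_pos by (intro *) simp
    then have "R / norm (D y0) * (D y0 \<bullet> D y0) \<le> 0" by simp
    moreover have "0 < R / norm (D y0) * (D y0 \<bullet> D y0)" using n R_pos by simp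
    ultimately show False by simp
  qed
qed

text \<open>With vanishing gradient, the form is nonnegative in every direction that stays in the
  ball for a while. At a nonzero \<open>y0\<close> these include all \<open>v\<close> with
  \<open>v . y0 < 0\<close>; opposite directions follow by sign and tangential ones by a
  limit.\<close>

lemma zero_min_hessian:
  assumes y0: "norm y0 \<le> R" and nn: "\<And>y. norm y \<le> R \<Longrightarrow> 0 \<le> H y" and z: "H y0 = 0"
    and d2: "(D has_derivative (\<lambda>v. A *v v)) (at y0 within cball 0 R)"
  shows "0 \<le> v \<bullet> (A *v v)"
proof -
  have seg: "0 \<le> (z - y0) \<bullet> (A *v (z - y0))" if z1: "norm z \<le> R" for z
  proof (rule ccontr)
    let ?c = "\<lambda>r. y0 + r *\<^sub>R (z - y0)"
    let ?\<psi> = "\<lambda>r. D (?c r) \<bullet> (z - y0)"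
    assume n: "\<not> 0 \<le> (z - y0) \<bullet> (A *v (z - y0))"
    have c: "(?c has_derivative (\<lambda>r. r *\<^sub>R (z - y0))) (at r within {0..1})" for r
      by (auto intro!: derivative_eq_intros)
    have sub: "?c ` {0..1} \<subseteq> cball 0 R" using segment_in_ball[OF y0 z1] by auto
    have d1: "((\<lambda>r. H (?c r)) has_real_derivative ?\<psi> r) (at r within {0..1})" if "0 \<le> r" "r \<le> 1" for r
    proof -
      have "(H \<circ> ?c has_derivative (\<lambda>v. D (?c r) \<bullet> v) \<circ> (\<lambda>r. r *\<^sub>R (z - y0))) (at r within {0..1})"
        by (intro diff_chain_within c has_derivative_subset[OF deriv sub] segment_in_ball y0 z1 that)
      then show ?thesis by (simp add: has_field_derivative_def o_def mult_commute_abs)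
    qed
    have "(D has_derivative (\<lambda>v. A *v v)) (at (?c 0) within cball 0 R)" using d2 by simp
    from diff_chain_within[OF c has_derivative_subset[OF this sub]]
    have "((\<lambda>r. D (?c r)) has_derivative (\<lambda>t. t *\<^sub>R (A *v (z - y0)))) (at 0 within {0..1})"
      by (simp add: o_def matrix_vector_mult_scaleR)
    then have "(?\<psi> has_derivative (\<lambda>t. t *\<^sub>R (A *v (z - y0)) \<bullet> (z - y0))) (at 0 within {0..1})"
      by (rule has_derivative_inner_left)
    then have "(?\<psi> has_real_derivative (z - y0) \<bullet> (A *v (z - y0))) (at 0 within {0..1})"
      by (simp add: has_field_derivative_def mult_commute_abs inner_commute)
    from has_real_derivative_neg_dec_right[OF this] n
    obtain \<delta> where \<delta>: "0 < \<delta>" "\<And>h. 0 < h \<Longrightarrow> 0 + h \<in> {0..1} \<Longrightarrow> h < \<delta> \<Longrightarrow> ?\<psi> (0 + h) < ?\<psi> 0" by auto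
    define h where "h = min (\<delta> / 2) 1"
    have h: "0 < h" "h < \<delta>" "h \<le> 1" using \<delta> by (auto simp: h_def min_def)
    have \<psi>0: "?\<psi> 0 = 0" using zero_min_gradient[OF y0 nn z] by simp
    have "H (?c h) < H (?c 0)"
    proof (rule DERIV_neg_imp_decreasing_open[OF h(1), where f = "\<lambda>r. H (?c r)"])
      show "continuous_on {0..h} (\<lambda>r. H (?c r))"
        by (rule continuous_on_subset[OF DERIV_continuous_on[OF d1]]) (use h in auto)
      fix r assume r: "0 < r" "r < h"
      have "((\<lambda>r. H (?c r)) has_real_derivative ?\<psi> r) (at r)"
        using d1[of r] r h by (simp add: at_within_Icc_at)
      moreover have "?\<psi> r < 0" using \<delta>(2)[of r] \<psi>0 r h by simp
      ultimately show "\<exists>d. ((\<lambda>r. H (?c r)) has_real_derivative d) (at r) \<and> d < 0" by blast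
    qed
    moreover have "0 \<le> H (?c h)" using segment_in_ball[OF y0 z1, of h] h by (intro nn) auto
    ultimately show False using z by simp
  qed
  have feas: "0 \<le> v \<bullet> (A *v v)" if c: "0 < c" "norm (y0 + c *\<^sub>R v) \<le> R" for v c
  proof -
    have "0 \<le> c * (c * (v \<bullet> (A *v v)))" using seg[OF c(2)] by (simp add: matrix_vector_mult_scaleR)
    then show ?thesis using c(1) by (simp add: zero_le_mult_iff)
  qed
  have neg: "0 \<le> v \<bullet> (A *v v)" if v: "v \<bullet> y0 < 0" for v
  proof (rule feas)
    have v0: "v \<noteq> 0" using v by auto
    \<comment> \<open>The other end of the chord from \<open>y0\<close> in direction
      \<open>v\<close>: the norm there equals \<open>norm y0\<close>.\<close>
    define c where "c = - 2 * (v \<bullet> y0) / (v \<bullet> v)"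
    show "0 < c" using v v0 by (simp add: c_def divide_neg_pos)
    have "(norm (y0 + c *\<^sub>R v))\<^sup>2 = (norm y0)\<^sup>2 + c * (2 * (v \<bullet> y0) + c * (v \<bullet> v))"
      by (simp add: power2_norm_eq_inner inner_add_left inner_add_right inner_commute algebra_simps)
    also have "2 * (v \<bullet> y0) + c * (v \<bullet> v) = 0" using v0 by (simp add: c_def)
    finally have "norm (y0 + c *\<^sub>R v) = norm y0" by simp
    then show "norm (y0 + c *\<^sub>R v) \<le> R" using y0 by simp
  qed
  show ?thesis
  proof (cases "y0 = 0")
    case True
    show ?thesis
    proof (cases "v = 0")
      case False
      then show ?thesis using R_pos True by (intro feas[of "R / norm v"]) auto
    qed simp
  next
    case y0n: False
    consider "v \<bullet> y0 < 0" | "(- v) \<bullet> y0 < 0" | "v \<bullet> y0 = 0" by force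
    then show ?thesis
    proof cases
      case 2
      from neg[OF this] show ?thesis using matrix_vector_mult_scaleR[of A "-1" v] by simp
    next
      case 3
      \<comment> \<open>A tangential direction is tilted slightly inwards to become a chord
        direction.\<close>
      have "0 \<le> (v - \<delta> *\<^sub>R y0) \<bullet> (A *v (v - \<delta> *\<^sub>R y0))" if "0 < \<delta>" for \<delta>
        using that y0n 3 by (intro neg) (simp add: inner_diff_left)
      then have ev: "eventually (\<lambda>\<delta>. 0 \<le> (v - \<delta> *\<^sub>R y0) \<bullet> (A *v (v - \<delta> *\<^sub>R y0))) (at_right 0)"
        using eventually_at_right_less[of "0::real"] by (auto elim: eventually_mono)
      have "((\<lambda>\<delta>. (v - \<delta> *\<^sub>R y0) \<bullet> (A *v (v - \<delta> *\<^sub>R y0))) \<longlongrightarrow> (v - 0 *\<^sub>R y0) \<bullet> (A *v (v - 0 *\<^sub>R y0))) (at_right 0)"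
        unfolding matrix_vector_mult_diff_distrib matrix_vector_mult_scaleR by (intro tendsto_intros)
      from tendsto_lowerbound[OF this ev] show ?thesis by simp
    qed (rule neg)
  qed
qed

end

text \<open>
  The barrier \<open>a(t) H\<^sub>2(y, s(t))\<close> is a strict supersolution that starts strictly above; as
  \<open>\<epsilon> \<rightarrow> 0\<close> it tends to \<open>H\<^sub>2\<close>.
\<close>

lemma flow_comparison:
  assumes F1: "capillary_flow R \<rho> H1 D1 A1 e1 k" and F2: "capillary_flow R \<rho> H2 D2 A2 e2 k"
    and init: "\<And>y. norm y \<le> R \<Longrightarrow> H1 y 0 \<le> H2 y 0"
    and t: "0 \<le> t" and y: "norm y \<le> R"
  shows "H1 y t \<le> H2 y t"
proof -
  interpret F1: capillary_flow R \<rho> H1 D1 A1 e1 k by (rule F1)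
  interpret F2: capillary_flow R \<rho> H2 D2 A2 e2 k by (rule F2)
  note R = F1.R_pos
  obtain m where m: "k = real m" "m = CARD('a) + 1" using F1.k_eq by blast
  have k1: "1 \<le> k" by (simp add: m)
  \<comment> \<open>Growth rate of the barrier, chosen to absorb the zero-order loss from the slowed
    clock: with \<open>b = 1 + \<xi>\<close>,
    \<open>M * \<xi> - b * k * \<xi> = \<xi> * (k + 1 - k * \<xi>)\<close> is positive.\<close>
  define M where "M = 2 * k + 1"
  define T where "T = t + 1"
  define a where "a = (\<lambda>\<epsilon> t. 1 + \<epsilon> * exp (M * t))"
  \<comment> \<open>Integrates \<open>s' = 1 - k * \<epsilon> * exp (M * t)\<close>. Scaling by
    \<open>a > 1\<close> alone has the wrong sign in the curvature term, and slowing the clock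
    compensates for that.\<close>
  define s where "s = (\<lambda>\<epsilon> t. t - \<epsilon> * k / M * (exp (M * t) - 1))"
  \<comment> \<open>Keeps \<open>k * \<epsilon> * exp (M * t) \<le> 1/2\<close> up to time
    \<open>T\<close>, so the clock runs at least at half speed.\<close>
  define \<epsilon>0 where "\<epsilon>0 = 1 / (2 * k * exp (M * T))"
  have M: "0 < M" using k1 by (simp add: M_def)
  have \<epsilon>0: "0 < \<epsilon>0" using k1 by (simp add: \<epsilon>0_def)
  have main: "H1 y t < a \<epsilon> t * H2 y (s \<epsilon> t)" if \<epsilon>: "0 < \<epsilon>" "\<epsilon> \<le> \<epsilon>0" and y: "norm y \<le> R" and t: "0 \<le> t" "t \<le> T" for \<epsilon> y t
  proof -
    have x: "0 < \<epsilon> * exp (M * r)" "k * (\<epsilon> * exp (M * r)) \<le> 1 / 2" if "r \<le> T" for r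
    proof -
      show "0 < \<epsilon> * exp (M * r)" using \<epsilon> by simp
      have "\<epsilon> * exp (M * r) \<le> \<epsilon>0 * exp (M * T)" using \<epsilon> that M \<epsilon>0 by (intro mult_mono) auto
      then have "k * (\<epsilon> * exp (M * r)) \<le> k * (\<epsilon>0 * exp (M * T))" using k1 by (intro mult_left_mono) auto
      then show "k * (\<epsilon> * exp (M * r)) \<le> 1 / 2" using k1 by (simp add: \<epsilon>0_def)
    qed
    have sb: "r / 2 \<le> s \<epsilon> r" "s \<epsilon> r \<le> r" if "0 \<le> r" "r \<le> T" for r
    proof -
      have "1 + - (M * r) \<le> exp (- (M * r))" by (rule exp_ge_add_one_self)
      then have "(1 - M * r) * exp (M * r) \<le> exp (- (M * r)) * exp (M * r)" by (intro mult_right_mono) auto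
      then have "exp (M * r) - 1 \<le> M * r * exp (M * r)" by (simp add: exp_minus algebra_simps)
      then have "\<epsilon> * k / M * (exp (M * r) - 1) \<le> \<epsilon> * k / M * (M * r * exp (M * r))" using \<epsilon> k1 M by (intro mult_left_mono) auto
      also have "\<dots> = (k * (\<epsilon> * exp (M * r))) * r" using M by simp
      also have "\<dots> \<le> 1 / 2 * r" using x[OF that(2)] that by (intro mult_right_mono) auto
      finally show "r / 2 \<le> s \<epsilon> r" by (simp add: s_def)
      have "0 \<le> \<epsilon> * k / M * (exp (M * r) - 1)" using \<epsilon> k1 M that by (intro mult_nonneg_nonneg) auto
      then show "s \<epsilon> r \<le> r" by (simp add: s_def)
    qed
    define P where "P = (\<lambda>y t. a \<epsilon> t * H2 y (s \<epsilon> t))"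
    let ?Q = "cball (0::real^'a) R \<times> {0..T}"
    have cP: "continuous_on ?Q (\<lambda>p. P (fst p) (snd p))"
    proof -
      have cs: "continuous_on ?Q (\<lambda>p. (fst p, s \<epsilon> (snd p)))"
        unfolding s_def using M by (intro continuous_intros) auto
      have sub: "(\<lambda>p. (fst p, s \<epsilon> (snd p))) ` ?Q \<subseteq> cball 0 R \<times> {0..}"
      proof
        fix q assume "q \<in> (\<lambda>p. (fst p, s \<epsilon> (snd p))) ` ?Q"
        then obtain y r where "q = (y, s \<epsilon> r)" "norm y \<le> R" "0 \<le> r" "r \<le> T" by auto
        then show "q \<in> cball 0 R \<times> {0..}" using sb(1)[of r] by simp
      qed
      have "continuous_on ?Q (\<lambda>p. H2 (fst p) (s \<epsilon> (snd p)))"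
        using continuous_on_compose2[OF F2.H_cont cs sub] by simp
      then show ?thesis unfolding P_def a_def by (intro continuous_intros) simp
    qed
    have cH1: "continuous_on ?Q (\<lambda>p. H1 (fst p) (snd p))"
      by (rule continuous_on_subset[OF F1.H_cont]) auto
    \<comment> \<open>Pairs at which the barrier has been reached or crossed; minimal time gives a
      first touching point.\<close>
    define Z where "Z = ?Q \<inter> (\<lambda>p. H1 (fst p) (snd p) - P (fst p) (snd p)) -` {0..}"
    have "closed Z" unfolding Z_def
      by (intro continuous_closed_preimage continuous_intros cP cH1 closed_Times) auto
    moreover have "Z \<subseteq> ?Q" by (simp add: Z_def)
    ultimately have cZ: "compact Z"
      using compact_Int_closed[of ?Q Z] by (simp add: compact_Times Int_absorb1)
    have "Z = {}"
    proof (rule ccontr)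
      assume "Z \<noteq> {}"
      moreover have "continuous_on Z snd" by (intro continuous_intros)
      ultimately obtain p0 where p0: "p0 \<in> Z" "\<And>p. p \<in> Z \<Longrightarrow> snd p0 \<le> snd p"
        using continuous_attains_inf[OF cZ] by blast
      obtain y0 t0 where e: "p0 = (y0, t0)" by (cases p0)
      have y0: "norm y0 \<le> R" "0 \<le> t0" "t0 \<le> T" "P y0 t0 \<le> H1 y0 t0" using p0(1) by (auto simp: Z_def e)
      have before: "H1 y t < P y t" if "norm y \<le> R" "0 \<le> t" "t < t0" for y t
        using p0(2)[of "(y, t)"] that y0 by (force simp: Z_def e)
      have t0: "0 < t0"
      proof (rule ccontr)
        assume "\<not> 0 < t0"
        then have "t0 = 0" using y0 by simp
        then have "(1 + \<epsilon>) * H2 y0 0 \<le> H1 y0 0" using y0(4) by (simp add: P_def a_def s_def)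
        moreover have "0 < \<epsilon> * H2 y0 0" using \<epsilon> F2.H_pos[OF y0(1), of 0] by simp
        ultimately show False using init[OF y0(1)] by (simp add: algebra_simps)
      qed
      have at: "H1 y t0 \<le> P y t0" if y: "norm y \<le> R" for y
      proof -
        have "continuous_on {0..T} (\<lambda>t. H1 y t - P y t)"
          using continuous_on_compose2[OF continuous_on_diff[OF cH1 cP] continuous_on_Pair[OF continuous_on_const[of _ y] continuous_on_id], of "{0..T}"] y
          by (simp add: image_subset_iff)
        then have "((\<lambda>t. H1 y t - P y t) \<longlongrightarrow> H1 y t0 - P y t0) (at t0 within {0..T})" using y0 by (auto simp: continuous_on_def)
        then have "((\<lambda>t. H1 y t - P y t) \<longlongrightarrow> H1 y t0 - P y t0) (at t0 within {0..<t0})"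
          by (rule tendsto_within_subset) (use y0 in auto)
        moreover have "at t0 within {0..<t0} \<noteq> bot" using t0 by (simp add: at_within_eq_bot_iff)
        moreover have "eventually (\<lambda>t. H1 y t - P y t \<le> 0) (at t0 within {0..<t0})"
          unfolding eventually_at_filter by (rule always_eventually) (use before[OF y] in \<open>auto intro: less_imp_le\<close>)
        ultimately have "H1 y t0 - P y t0 \<le> 0" by (intro tendsto_upperbound)
        then show ?thesis by simp
      qed
      have eq: "H1 y0 t0 = P y0 t0" using at[OF y0(1)] y0(4) by simp
      define b where "b = a \<epsilon> t0"
      define \<sigma> where "\<sigma> = s \<epsilon> t0"
      define \<xi> where "\<xi> = \<epsilon> * exp (M * t0)"
      have \<xi>: "0 < \<xi>" "k * \<xi> \<le> 1 / 2" "b = 1 + \<xi>" using x[OF y0(3)] by (auto simp: \<xi>_def b_def a_def)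
      have \<sigma>: "0 < \<sigma>" using sb(1)[OF y0(2,3)] t0 by (simp add: \<sigma>_def)
      have b: "0 < b" using \<xi> by simp
      interpret S1: strict_support_fn R "\<lambda>y. H1 y t0" "\<lambda>y. D1 y t0" "\<lambda>y. A1 y t0" by (rule F1.strict_support0[OF t0])
      interpret S2: strict_support_fn R "\<lambda>y. H2 y \<sigma>" "\<lambda>y. D2 y \<sigma>" "\<lambda>y. A2 y \<sigma>" by (rule F2.strict_support0[OF \<sigma>])
      \<comment> \<open>The difference inherits the linear boundary condition, so the second-order
        test holds at a touching point on the rim as well.\<close>
      interpret W: support_fn R "\<lambda>y. b * H2 y \<sigma> - H1 y t0" "\<lambda>y. b *\<^sub>R D2 y \<sigma> - D1 y t0"
      proof
        fix y :: "real^'a" assume y: "norm y \<le> R"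
        show "((\<lambda>y. b * H2 y \<sigma> - H1 y t0) has_derivative (\<lambda>v. (b *\<^sub>R D2 y \<sigma> - D1 y t0) \<bullet> v)) (at y within cball 0 R)"
          by (rule has_derivative_eq_rhs[OF has_derivative_diff[OF has_derivative_mult_right[OF S2.deriv[OF y]] S1.deriv[OF y]]])
             (simp add: fun_eq_iff inner_diff_left)
      qed (use R S1.neumann S2.neumann in \<open>auto simp: inner_diff_right\<close>)
      have W0: "0 \<le> b * H2 y \<sigma> - H1 y t0" if "norm y \<le> R" for y
        using at[OF that] by (simp add: P_def b_def \<sigma>_def)
      have Weq: "b * H2 y0 \<sigma> - H1 y0 t0 = 0" using eq by (simp add: P_def b_def \<sigma>_def)
      have "((\<lambda>y. b *\<^sub>R D2 y \<sigma> - D1 y t0) has_derivative (\<lambda>v. (b *\<^sub>R A2 y0 \<sigma> - A1 y0 t0) *v v)) (at y0 within cball 0 R)"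
        by (rule has_derivative_eq_rhs[OF has_derivative_diff[OF has_derivative_scaleR_right[OF S2.deriv2[OF y0(1)]] S1.deriv2[OF y0(1)]]])
           (simp add: fun_eq_iff matrix_vector_mult_diff_rdistrib scaleR_matrix_vector_assoc)
      from W.zero_min_hessian[OF y0(1) W0 Weq this]
      have "v \<bullet> (A1 y0 t0 *v v) \<le> v \<bullet> ((b *\<^sub>R A2 y0 \<sigma>) *v v)" for v
        by (simp add: matrix_vector_mult_diff_rdistrib inner_diff_right)
      then have "det (A1 y0 t0) \<le> det (b *\<^sub>R A2 y0 \<sigma>)"
        by (intro det_mono_form F1.sym F1.pos y0 t0) auto
      then have det: "det (A1 y0 t0) \<le> b ^ CARD('a) * det (A2 y0 \<sigma>)" by (simp add: det_scaleR)
      have dp: "0 < det (A1 y0 t0)" "0 < det (A2 y0 \<sigma>)" using F1.det_pos[OF y0(1) t0] F2.det_pos[OF y0(1) \<sigma>] .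
      have rp: "0 < \<rho> y0" by (rule F1.rho_pos[OF y0(1)])
      have Hp: "0 < H2 y0 \<sigma>" using F2.H_pos[OF y0(1)] \<sigma> by simp
      define h1 where "h1 = H1 y0 t0 - \<rho> y0 / det (A1 y0 t0)"
      define h2 where "h2 = M * \<xi> * H2 y0 \<sigma> + b * ((1 - k * \<xi>) * (H2 y0 \<sigma> - \<rho> y0 / det (A2 y0 \<sigma>)))"
      have da: "(a \<epsilon> has_real_derivative M * \<xi>) (at t0)"
        unfolding a_def \<xi>_def by (auto intro!: derivative_eq_intros)
      have ds: "(s \<epsilon> has_real_derivative (1 - k * \<xi>)) (at t0)"
        unfolding s_def \<xi>_def using M by (auto intro!: derivative_eq_intros)
      have dH2: "((\<lambda>t. H2 y0 (s \<epsilon> t)) has_real_derivative (H2 y0 \<sigma> - \<rho> y0 / det (A2 y0 \<sigma>)) * (1 - k * \<xi>)) (at t0)"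
        by (rule DERIV_chain2[OF _ ds]) (use F2.time_deriv[OF y0(1) \<sigma>] in \<open>simp add: \<sigma>_def\<close>)
      have "((\<lambda>t. H1 y0 t - P y0 t) has_real_derivative h1 - h2) (at t0)"
        unfolding P_def h1_def h2_def
        by (rule derivative_eq_intros F1.time_deriv[OF y0(1) t0] da dH2 refl)+ (simp add: b_def \<sigma>_def algebra_simps)
      moreover have "h1 - h2 < 0"
      proof -
        have "\<rho> y0 / (b ^ CARD('a) * det (A2 y0 \<sigma>)) \<le> \<rho> y0 / det (A1 y0 t0)"
          using det dp rp b by (intro divide_left_mono mult_pos_pos) auto
        then have "h1 \<le> b * H2 y0 \<sigma> - \<rho> y0 / (b ^ CARD('a) * det (A2 y0 \<sigma>))"
          using Weq by (simp add: h1_def)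
        moreover have "b * H2 y0 \<sigma> < M * \<xi> * H2 y0 \<sigma> + b * ((1 - k * \<xi>) * H2 y0 \<sigma>)"
        proof -
          have "b = 1 + \<xi>" by (rule \<xi>(3))
          have "0 < \<xi> * (k + 1 - k * \<xi>)" using \<xi> k1 by (intro mult_pos_pos) auto
          also have "\<dots> = M * \<xi> + b * (1 - k * \<xi>) - b" by (simp add: M_def \<xi>(3) algebra_simps)
          finally have "b < M * \<xi> + b * (1 - k * \<xi>)" by simp
          from mult_strict_right_mono[OF this Hp] show ?thesis by (simp add: algebra_simps)
        qed
        \<comment> \<open>With \<open>m = n + 1\<close>, Bernoulli gives
          \<open>1 - k * \<xi> \<le> (1 - \<xi>) ^ m\<close>. Multiplied by
          \<open>b ^ m = (1 + \<xi>) ^ m\<close> this is at most 1, so the slowed curvature term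
          does not exceed that of the scaled body.\<close>
        moreover have "b * ((1 - k * \<xi>) * (\<rho> y0 / det (A2 y0 \<sigma>))) \<le> \<rho> y0 / (b ^ CARD('a) * det (A2 y0 \<sigma>))"
        proof -
          have x1: "\<xi> \<le> 1" using \<xi> k1 mult_right_mono[of 1 k \<xi>] by linarith
          have "1 - k * \<xi> \<le> (1 - \<xi>) ^ m" using Bernoulli_inequality[of "- \<xi>" m] x1 by (simp add: m(1))
          then have "b ^ m * (1 - k * \<xi>) \<le> b ^ m * (1 - \<xi>) ^ m" using b by (intro mult_left_mono) auto
          also have "\<dots> = (1 - \<xi>\<^sup>2) ^ m" by (simp add: \<xi>(3) power_mult_distrib[symmetric] algebra_simps power2_eq_square)
          also have "\<dots> \<le> 1" using \<xi> x1 by (intro power_le_one) (auto simp: abs_square_le_1 power_le_one)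
          finally have "b ^ CARD('a) * (b * (1 - k * \<xi>)) \<le> 1" by (simp add: m(2) algebra_simps)
          then have "b * (1 - k * \<xi>) \<le> 1 / b ^ CARD('a)" using b by (simp add: field_simps)
          then have "b * (1 - k * \<xi>) * (\<rho> y0 / det (A2 y0 \<sigma>)) \<le> 1 / b ^ CARD('a) * (\<rho> y0 / det (A2 y0 \<sigma>))"
            using rp dp by (intro mult_right_mono) auto
          then show ?thesis by (simp add: mult.assoc)
        qed
        moreover have "h2 = M * \<xi> * H2 y0 \<sigma> + b * ((1 - k * \<xi>) * H2 y0 \<sigma>) - b * ((1 - k * \<xi>) * (\<rho> y0 / det (A2 y0 \<sigma>)))"
          by (simp add: h2_def algebra_simps)
        ultimately show ?thesis by linarith
      qed
      ultimately obtain \<delta> where \<delta>: "0 < \<delta>" "\<And>h. 0 < h \<Longrightarrow> h < \<delta> \<Longrightarrow> H1 y0 t0 - P y0 t0 < H1 y0 (t0 - h) - P y0 (t0 - h)"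
        using DERIV_neg_dec_left[of "\<lambda>t. H1 y0 t - P y0 t"] by blast
      define h where "h = min (\<delta> / 2) (t0 / 2)"
      have h: "0 < h" "h < \<delta>" "h < t0" using \<delta> t0 by (auto simp: h_def min_def)
      have "0 < H1 y0 (t0 - h) - P y0 (t0 - h)" using \<delta>(2)[OF h(1,2)] eq by simp
      moreover have "H1 y0 (t0 - h) < P y0 (t0 - h)" using h by (intro before y0) auto
      ultimately show False by simp
    qed
    then have "(y, t) \<notin> Z" by simp
    then show ?thesis using y t by (auto simp: Z_def P_def)
  qed
  have sl: "((\<lambda>\<epsilon>. s \<epsilon> t) \<longlongrightarrow> t) (at_right 0)"
    unfolding s_def using M by (auto intro!: tendsto_eq_intros)
  have al: "((\<lambda>\<epsilon>. a \<epsilon> t) \<longlongrightarrow> 1) (at_right 0)"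
    unfolding a_def by (auto intro!: tendsto_eq_intros)
  have ev: "eventually (\<lambda>\<epsilon>. 0 < \<epsilon> \<and> \<epsilon> \<le> \<epsilon>0) (at_right 0)"
    unfolding eventually_at_right_field using \<epsilon>0 by (intro exI[of _ \<epsilon>0]) auto
  show ?thesis
  proof (cases "t = 0")
    case True
    then show ?thesis using init[OF y] by simp
  next
    case False
    then have "isCont (\<lambda>r. H2 y r) t" using F2.time_deriv[OF y, of t] t by (intro DERIV_isCont) auto
    then have "((\<lambda>\<epsilon>. H2 y (s \<epsilon> t)) \<longlongrightarrow> H2 y t) (at_right 0)" by (rule isCont_tendsto_compose[OF _ sl])
    then have "((\<lambda>\<epsilon>. a \<epsilon> t * H2 y (s \<epsilon> t)) \<longlongrightarrow> 1 * H2 y t) (at_right 0)" by (intro tendsto_mult al)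
    moreover have "eventually (\<lambda>\<epsilon>. H1 y t \<le> a \<epsilon> t * H2 y (s \<epsilon> t)) (at_right 0)"
      using ev by eventually_elim (use main y t in \<open>auto simp: T_def intro: less_imp_le\<close>)
    ultimately show ?thesis using tendsto_lowerbound by fastforce
  qed
qed

section \<open>Regions enclosed by hypersurfaces\<close>

lemma smooth_on_imp_continuous_on:
  assumes "smooth_on S f" shows "continuous_on S f"
  unfolding continuous_on_eq_continuous_within
proof
  fix x assume x: "x \<in> S"
  obtain U g where U: "open U" "x \<in> U" "\<forall>k. Ck_on k U g" "\<forall>y\<in>U \<inter> S. g y = f y"
    using assms x unfolding smooth_on_def by blast
  have "continuous_on U g" using U(3)[rule_format, of 0] by simp
  then have "continuous_on (U \<inter> S) g" by (rule continuous_on_subset) auto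
  then have "continuous_on (U \<inter> S) f" using U(4) continuous_on_cong[OF refl, of "U \<inter> S" g f] by blast
  then have "continuous (at x within U \<inter> S) f" using x U(2) by (simp add: continuous_on_eq_continuous_within)
  moreover have "at x within U \<inter> S = at x within S" by (rule at_within_nhd[OF U(2,1)]) auto
  ultimately show "continuous (at x within S) f" by simp
qed

text \<open>A chart would carry an open part of \<open>S\<close> onto an open set inside the
  hyperplane \<open>snd y = 0\<close>.\<close>

lemma interior_embedded_hypersurface:
  fixes S :: "'n::finite ambient set"
  assumes "embedded_hypersurface S"
  shows "interior S = {}"
proof (rule ccontr)
  assume "interior S \<noteq> {}"
  then obtain x where x: "x \<in> interior S" by blast
  then have xS: "x \<in> S" using interior_subset by blast
  obtain U \<phi> where U: "x \<in> U" "smooth_diffeo_on U \<phi>" "\<phi> ` (U \<inter> S) \<subseteq> {y. snd y = 0}"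
  proof -
    have "x \<in> interior_points S \<or> x \<in> boundary_points S" using assms xS unfolding embedded_hypersurface_def by blast
    then show ?thesis
    proof
      assume "x \<in> interior_points S"
      then obtain U \<phi> where "x \<in> U" "smooth_diffeo_on U \<phi>" "\<phi> ` (U \<inter> S) = \<phi> ` U \<inter> {y. snd y = 0}"
        unfolding interior_points_def by blast
      then show ?thesis using that by blast
    next
      assume "x \<in> boundary_points S"
      then obtain U \<phi> k where "x \<in> U" "smooth_diffeo_on U \<phi>" "\<phi> ` (U \<inter> S) = \<phi> ` U \<inter> {y. snd y = 0 \<and> fst y $ k \<ge> 0}"
        unfolding boundary_points_def by blast
      then show ?thesis using that by blast
    qed
  qed
  have inj: "inj_on \<phi> U" and oU: "open U" "open (\<phi> ` U)" and c: "continuous_on (\<phi> ` U) (inv_into U \<phi>)"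
    using U(2) smooth_on_imp_continuous_on by (auto simp: smooth_diffeo_on_def)
  define W where "W = interior S \<inter> U"
  have W: "open W" "x \<in> W" "W \<subseteq> U \<inter> S" using oU x U(1) interior_subset by (auto simp: W_def)
  have "\<phi> ` W = \<phi> ` U \<inter> inv_into U \<phi> -` W" using W inj by (auto simp: inv_into_f_f)
  also have "open \<dots>" using c oU W by (simp add: continuous_open_preimage)
  finally obtain \<epsilon> where \<epsilon>: "0 < \<epsilon>" "cball (\<phi> x) \<epsilon> \<subseteq> \<phi> ` W"
    using W(2) open_contains_cball by (metis imageI)
  have "\<phi> x + (0, \<epsilon>) \<in> cball (\<phi> x) \<epsilon>" "\<phi> x \<in> cball (\<phi> x) \<epsilon>" using \<epsilon> by (auto simp: dist_norm norm_Pair)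
  then have "snd (\<phi> x + (0, \<epsilon>)) = 0" "snd (\<phi> x) = 0" using \<epsilon>(2) U(3) W(3) by blast+
  then show False using \<epsilon>(1) by simp
qed

text \<open>If every support inequality at \<open>p\<close> were strict, compactness of the ball of
  slopes would leave a margin, and a small ball around \<open>p\<close> would stay in the
  body.\<close>

lemma body_boundary_contact:
  assumes "support_fn R H D" and p: "p \<in> body R H" "p \<notin> interior (body R H)" "0 < snd p"
  shows "\<exists>y. norm y \<le> R \<and> fst p \<bullet> y + snd p = H y"
proof (rule ccontr)
  assume n: "\<nexists>y. norm y \<le> R \<and> fst p \<bullet> y + snd p = H y"
  interpret support_fn R H D by fact
  have lt: "fst p \<bullet> y + snd p < H y" if "norm y \<le> R" for y
    using p(1) n that by (cases p) (force simp: body_def order_less_le)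
  have "continuous_on (cball 0 R) (\<lambda>y. H y - (fst p \<bullet> y + snd p))" by (intro continuous_intros continuous)
  then obtain y0 where y0: "norm y0 \<le> R" "\<And>y. norm y \<le> R \<Longrightarrow> H y0 - (fst p \<bullet> y0 + snd p) \<le> H y - (fst p \<bullet> y + snd p)"
    using continuous_attains_inf[OF compact_cball, of 0 R "\<lambda>y. H y - (fst p \<bullet> y + snd p)"] R_pos by (auto simp: Ball_def)
  define m where "m = H y0 - (fst p \<bullet> y0 + snd p)"
  have m: "0 < m" using lt[OF y0(1)] by (simp add: m_def)
  define \<epsilon> where "\<epsilon> = min (snd p) (m / (R + 1))"
  have \<epsilon>: "0 < \<epsilon>" "\<epsilon> \<le> snd p" "\<epsilon> * (R + 1) \<le> m" proof -
    show "0 < \<epsilon>" "\<epsilon> \<le> snd p" using p(3) m R_pos by (auto simp: \<epsilon>_def)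
    have "\<epsilon> \<le> m / (R + 1)" by (simp add: \<epsilon>_def)
    then show "\<epsilon> * (R + 1) \<le> m" using R_pos by (simp add: pos_le_divide_eq)
  qed
  have "ball p \<epsilon> \<subseteq> body R H"
  proof
    fix q assume "q \<in> ball p \<epsilon>"
    then have d: "norm (q - p) < \<epsilon>" by (simp add: dist_norm norm_minus_commute)
    have 1: "norm (fst q - fst p) \<le> norm (q - p)" "\<bar>snd q - snd p\<bar> \<le> norm (q - p)"
    proof -
      have "q - p = (fst q - fst p, snd q - snd p)" by (simp add: prod_eq_iff)
      then show "norm (fst q - fst p) \<le> norm (q - p)" "\<bar>snd q - snd p\<bar> \<le> norm (q - p)"
        using norm_fst_le[of "fst q - fst p" "snd q - snd p"] norm_snd_le[of "snd q - snd p" "fst q - fst p"] by auto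
    qed
    have "fst q \<bullet> y + snd q \<le> H y" if y: "norm y \<le> R" for y
    proof -
      have "(fst q - fst p) \<bullet> y \<le> norm (fst q - fst p) * norm y" by (rule norm_cauchy_schwarz)
      also have "\<dots> \<le> \<epsilon> * R" using 1 d y \<epsilon> by (intro mult_mono) auto
      finally have "fst q \<bullet> y + snd q \<le> fst p \<bullet> y + snd p + (\<epsilon> * R + \<epsilon>)" using 1 d by (simp add: inner_diff_left)
      also have "\<dots> \<le> H y" using y0(2)[OF y] \<epsilon>(3) by (simp add: m_def algebra_simps)
      finally show ?thesis .
    qed
    then show "q \<in> body R H" using 1 d \<epsilon> by (cases q) (auto simp: body_def)
  qed
  then show False using p(2) \<epsilon>(1) by (meson mem_interior)
qed

text \<open>Every boundary point of the body above the plane lies in \<open>S\<close>, so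
  \<open>S\<close> and the plane separate the interior of the body from the rest, and points outside
  escape along rays.\<close>

lemma enclosed_region_eq_body:
  fixes S :: "'n::finite ambient set"
  assumes sup: "support_fn R H D" and S: "compact S" "S \<subseteq> closed_halfspace" "interior S = {}"
    and Hpos: "\<And>y. norm y \<le> R \<Longrightarrow> 0 < H y"
    and le: "\<And>y X. norm y \<le> R \<Longrightarrow> X \<in> S \<Longrightarrow> fst X \<bullet> y + snd X \<le> H y"
    and attained: "\<And>y. norm y \<le> R \<Longrightarrow> \<exists>X\<in>S. fst X \<bullet> y + snd X = H y"
  shows "enclosed_region S = body R H"
proof -
  interpret support_fn R H D by fact
  let ?K = "body R H" and ?T = "S \<union> boundary_plane"
  have SK: "S \<subseteq> ?K" using S(2) le by (fastforce simp: body_def closed_halfspace_def)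
  have cK: "compact ?K" by (rule compact_body[OF R_pos continuous])
  \<comment> \<open>\<open>S\<close> attains the support value at the contact slope of
    \<open>p\<close>, and by \<open>contact\<close> the touching point is determined by the slope,
    so it is \<open>p\<close>.\<close>
  have touch: "p \<in> S" if p: "p \<in> ?K" "p \<notin> interior ?K" "0 < snd p" for p
  proof -
    obtain y where y: "norm y \<le> R" "fst p \<bullet> y + snd p = H y" using body_boundary_contact[OF sup p] by blast
    have min: "fst p \<bullet> z + snd p \<le> H z" if "norm z \<le> R" for z using p(1) that by (cases p) (auto simp: body_def)
    note 1 = contact[OF y(1) disjI1[OF p(3)] min y(2)]
    obtain X where X: "X \<in> S" "fst X \<bullet> y + snd X = H y" using attained[OF y(1)] by blast
    note 2 = contact[OF y(1) disjI2[OF 1(1)] le[OF _ X(1)] X(2)]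
    have "X = p" using 1 2 by (simp add: prod_eq_iff)
    then show ?thesis using X by simp
  qed
  have int_pos: "0 < snd p" if pi: "p \<in> interior ?K" for p
  proof (rule ccontr)
    assume "\<not> 0 < snd p"
    obtain e where e: "0 < e" "cball p e \<subseteq> ?K" using pi by (meson mem_interior_cball)
    have "p - (0, e) \<in> cball p e" using e by (simp add: dist_norm norm_Pair)
    then have "p - (0, e) \<in> ?K" using e by blast
    then have "0 \<le> snd (p - (0, e))" unfolding body_def case_prod_beta by simp
    then show False using \<open>\<not> 0 < snd p\<close> e by simp
  qed
  have plane: "p \<in> boundary_plane \<longleftrightarrow> snd p = 0" for p :: "'n ambient" by (simp add: boundary_plane_def)
  have "inside ?T = interior ?K - S"
  proof (intro set_eqI iffI)
    fix p assume p: "p \<in> interior ?K - S"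
    have pT: "p \<notin> ?T" using p int_pos[of p] by (auto simp: plane)
    let ?C = "connected_component_set (- ?T) p"
    have pC: "p \<in> ?C" using pT by (simp add: connected_component_refl_eq)
    have "?C \<subseteq> interior ?K"
    proof (rule ccontr)
      assume nsub: "\<not> ?C \<subseteq> interior ?K"
      have "?C \<inter> frontier (interior ?K) \<noteq> {}"
      proof (rule connected_Int_frontier)
        show "?C \<inter> interior ?K \<noteq> {}" using p pC by blast
        show "?C - interior ?K \<noteq> {}" using nsub by blast
      qed (rule connected_connected_component)
      then obtain q where q: "q \<in> ?C" "q \<in> frontier (interior ?K)" by blast
      have qT: "q \<notin> ?T" using subsetD[OF connected_component_subset q(1)] by simp
      have "q \<in> closure (interior ?K)" "q \<notin> interior ?K" using q(2) by (auto simp: frontier_def)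
      moreover have "closure (interior ?K) \<subseteq> ?K" by (rule closure_minimal[OF interior_subset closed_body])
      ultimately have "q \<in> ?K" "q \<notin> interior ?K" by auto
      moreover from this(1) have "0 < snd q" using qT plane by (cases q) (auto simp: body_def order_less_le)
      ultimately show False using touch qT by blast
    qed
    moreover have "bounded (interior ?K)" using cK by (meson bounded_interior compact_imp_bounded)
    ultimately have "bounded ?C" by (meson bounded_subset)
    then show "p \<in> inside ?T" using pT by (simp add: inside_def)
  next
    fix p assume p: "p \<in> inside ?T"
    then have pT: "p \<notin> ?T" and bC: "bounded (connected_component_set (- ?T) p)" by (auto simp: inside_def)
    \<comment> \<open>A ray that avoids \<open>?T\<close> would make the component of
      \<open>p\<close> unbounded. It is used downwards below the plane, and in direction
      \<open>(y, 1)\<close> when the inequality for \<open>y\<close> fails.\<close>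
    have ray: False if v: "v \<noteq> 0" and r: "\<And>r. 0 \<le> r \<Longrightarrow> p + r *\<^sub>R v \<notin> ?T" for v
    proof -
      let ?L = "(\<lambda>r. p + r *\<^sub>R v) ` {0..}"
      have "connected ?L" by (intro connected_continuous_image continuous_intros convex_connected) auto
      moreover have "p \<in> ?L" by (rule image_eqI[of _ _ 0]) auto
      moreover have "?L \<subseteq> - ?T" using r by auto
      ultimately have "?L \<subseteq> connected_component_set (- ?T) p" by (intro connected_component_maximal)
      then have "bounded ?L" using bC bounded_subset by blast
      then obtain B where B: "\<And>r. 0 \<le> r \<Longrightarrow> norm (p + r *\<^sub>R v) \<le> B" by (auto simp: bounded_iff)
      define r where "r = (\<bar>B\<bar> + norm p + 1) / norm v"
      have "0 \<le> r" using v by (simp add: r_def)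
      moreover have "r * norm v = \<bar>B\<bar> + norm p + 1" using v by (simp add: r_def)
      ultimately show False using B[of r] norm_triangle_ineq2[of "r *\<^sub>R v" "- p"] by (simp add: add.commute)
    qed
    have sp: "0 < snd p"
    proof (rule ccontr)
      assume "\<not> 0 < snd p"
      then have "snd p < 0" using pT plane[of p] by auto
      show False
      proof (rule ray[of "(0, -1)"])
        fix r :: real assume "0 \<le> r"
        then have "snd (p + r *\<^sub>R (0, -1)) < 0" using \<open>snd p < 0\<close> by simp
        moreover have "0 \<le> snd q" if "q \<in> ?T" for q
          using that S(2) plane[of q] by (auto simp: closed_halfspace_def)
        ultimately show "p + r *\<^sub>R (0, -1) \<notin> ?T" by (metis not_le)
      qed (simp add: prod_eq_iff)
    qed
    have pK: "p \<in> ?K"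
    proof (rule ccontr)
      assume "p \<notin> ?K"
      then obtain y where y: "norm y \<le> R" "H y < fst p \<bullet> y + snd p" using sp by (cases p) (auto simp: body_def not_le)
      show False
      proof (rule ray[of "(y, 1)"])
        fix r :: real assume r: "0 \<le> r"
        have "fst (p + r *\<^sub>R (y, 1)) \<bullet> y + snd (p + r *\<^sub>R (y, 1)) = fst p \<bullet> y + snd p + r * (y \<bullet> y + 1)"
          by (simp add: inner_add_left algebra_simps)
        moreover have "0 \<le> r * (y \<bullet> y + 1)" using r by simp
        ultimately have "H y < fst (p + r *\<^sub>R (y, 1)) \<bullet> y + snd (p + r *\<^sub>R (y, 1))" using y by linarith
        then have "p + r *\<^sub>R (y, 1) \<notin> S" using le[OF y(1)] by (metis not_le)
        moreover have "0 < snd (p + r *\<^sub>R (y, 1))" using sp r by simp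
        then have "p + r *\<^sub>R (y, 1) \<notin> boundary_plane" using plane[of "p + r *\<^sub>R (y, 1)"] by simp
        ultimately show "p + r *\<^sub>R (y, 1) \<notin> ?T" by blast
      qed (simp add: prod_eq_iff)
    qed
    have "p \<in> interior ?K" using touch[OF pK _ sp] pT by blast
    then show "p \<in> interior ?K - S" using pT by blast
  qed
  moreover have "closure (interior ?K - S) = ?K"
  proof
    show "closure (interior ?K - S) \<subseteq> ?K"
      by (rule closure_minimal[OF _ closed_body]) (use interior_subset in blast)
    have ne: "interior ?K \<noteq> {}"
    proof -
      obtain y0 where y0: "norm y0 \<le> R" "\<And>y. norm y \<le> R \<Longrightarrow> H y0 \<le> H y"
        using continuous_attains_inf[OF compact_cball _ continuous] R_pos by (auto simp: Ball_def)
      define s where "s = H y0 / 2"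
      have s: "0 < s" "\<And>y. norm y \<le> R \<Longrightarrow> s < H y" using Hpos[OF y0(1)] y0(2) unfolding s_def by (simp, fastforce)
      have "(0, s) \<in> ?K" using s by (auto simp: body_def less_imp_le)
      then have "(0, s) \<in> interior ?K" using body_boundary_contact[OF sup, of "(0, s)"] s by (metis fst_conv inner_zero_left add_0 less_irrefl snd_conv)
      then show ?thesis by blast
    qed
    have "closure (interior ?K) = ?K"
      using convex_closure_interior[OF convex_body ne] closure_closed[OF closed_body] by metis
    \<comment> \<open>\<open>S\<close> has empty interior, so removing it does not shrink the
      closure.\<close>
    moreover have "interior ?K \<subseteq> closure (interior ?K - S)"
    proof
      fix p assume p: "p \<in> interior ?K"
      show "p \<in> closure (interior ?K - S)"
      proof (rule ccontr)
        assume "p \<notin> closure (interior ?K - S)"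
        then have "p \<in> interior ?K \<inter> (- closure (interior ?K - S))" using p by simp
        moreover have "open (interior ?K \<inter> (- closure (interior ?K - S)))" by auto
        moreover have "interior ?K \<inter> (- closure (interior ?K - S)) \<subseteq> S" using closure_subset[of "interior ?K - S"] by blast
        ultimately have "p \<in> interior S" by (meson interior_maximal subsetD)
        then show False using S(3) by simp
      qed
    qed
    ultimately show "?K \<subseteq> closure (interior ?K - S)" by (metis closure_closure closure_mono)
  qed
  ultimately show ?thesis by (simp add: enclosed_region_def)
qed

section \<open>Calculus on the spherical cap\<close>

text \<open>\<open>cap_point \<theta> y\<close> is the point of the cap whose normal has homogeneous coordinates \<open>y\<close>.\<close>

definition lift :: "real^'n::finite \<Rightarrow> 'n ambient" where "lift y = (y, 1)"
definition unit_lift :: "real^'n::finite \<Rightarrow> 'n ambient" where "unit_lift y = (1 / norm (lift y)) *\<^sub>R lift y"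
definition cap_point :: "real \<Rightarrow> real^'n::finite \<Rightarrow> 'n ambient" where "cap_point \<theta> y = unit_lift y + cos \<theta> *\<^sub>R evec"
definition proj :: "'a::real_inner \<Rightarrow> 'a \<Rightarrow> 'a" where "proj \<nu> v = v - (v \<bullet> \<nu>) *\<^sub>R \<nu>"

lemma inner_prod': "a \<bullet> b = fst a \<bullet> fst b + snd a * snd b" for a b :: "'n::finite ambient"
  by (simp add: inner_prod_def)

lemma proj_props:
  assumes "norm \<nu> = 1"
  shows "proj \<nu> v \<bullet> \<nu> = 0" "proj \<nu> (proj \<nu> v) = proj \<nu> v" "proj \<nu> v \<bullet> w = v \<bullet> proj \<nu> w" "linear (proj \<nu>)"
    "w \<bullet> \<nu> = 0 \<Longrightarrow> proj \<nu> w = w"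
proof -
  have n: "\<nu> \<bullet> \<nu> = 1" using assms by (simp add: norm_eq_1)
  show z: "proj \<nu> v \<bullet> \<nu> = 0" for v using n by (simp add: proj_def inner_diff_left)
  show "proj \<nu> (proj \<nu> v) = proj \<nu> v" using z[of v] unfolding proj_def[of \<nu> "proj \<nu> v"] by simp
  show "proj \<nu> v \<bullet> w = v \<bullet> proj \<nu> w" by (simp add: proj_def inner_diff_left inner_diff_right inner_commute)
  show "linear (proj \<nu>)" by (rule linearI) (simp_all add: proj_def inner_add_left algebra_simps)
  show "w \<bullet> \<nu> = 0 \<Longrightarrow> proj \<nu> w = w" by (simp add: proj_def)
qed

lemma norm_lift: "(norm (lift y))\<^sup>2 = (norm y)\<^sup>2 + 1" "1 \<le> norm (lift y)" "lift y \<noteq> 0"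
proof -
  show *: "(norm (lift y))\<^sup>2 = (norm y)\<^sup>2 + 1" by (simp add: lift_def norm_Pair)
  show "1 \<le> norm (lift y)" by (rule power2_le_imp_le) (simp_all add: *)
  show "lift y \<noteq> 0" by (simp add: lift_def prod_eq_iff)
qed

lemma norm_lift_pos: "0 < norm (lift y)" by (rule less_le_trans[OF zero_less_one norm_lift(2)])

lemma norm_unit_lift: "norm (unit_lift y) = 1" using norm_lift(3) by (simp add: unit_lift_def)

lemma norm_lift_unit: "norm (lift y) *\<^sub>R unit_lift y = lift y" using norm_lift(3) by (simp add: unit_lift_def)

section \<open>Tangent space, gradient and Hessian on the cap\<close>

text \<open>Since \<open>v\<close> is orthogonal to \<open>\<nu>\<close>, the norm along the line is
  stationary at 0; the radial projection is then a curve on the sphere with velocity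
  \<open>v\<close>.\<close>

lemma normalized_line:
  fixes \<nu> v :: "'a::real_inner"
  assumes n: "norm \<nu> = 1" and v: "v \<bullet> \<nu> = 0"
  shows "\<nu> + s *\<^sub>R v \<noteq> 0"
    and "((\<lambda>s. (1 / norm (\<nu> + s *\<^sub>R v)) *\<^sub>R (\<nu> + s *\<^sub>R v)) has_vector_derivative v) (at 0 within X)"
proof -
  have nn: "\<nu> \<bullet> \<nu> = 1" using n by (simp add: norm_eq_1)
  have nv: "(norm (\<nu> + s *\<^sub>R v))\<^sup>2 = 1 + s\<^sup>2 * (v \<bullet> v)" for s
    unfolding power2_norm_eq_inner using v nn by (simp add: inner_add_left inner_add_right inner_commute power2_eq_square)
  show nz: "\<nu> + s *\<^sub>R v \<noteq> 0" for s
  proof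
    assume "\<nu> + s *\<^sub>R v = 0"
    then have "(norm (\<nu> + s *\<^sub>R v))\<^sup>2 = 0" by simp
    moreover have "0 \<le> s\<^sup>2 * (v \<bullet> v)" by simp
    ultimately show False using nv[of s] by linarith
  qed
  have 1: "((\<lambda>s. \<nu> + s *\<^sub>R v) has_derivative (\<lambda>h. h *\<^sub>R v)) (at 0 within X)" by (auto intro!: derivative_eq_intros)
  have 2: "(norm has_derivative (\<lambda>h. h \<bullet> sgn (\<nu> + 0 *\<^sub>R v))) (at (\<nu> + 0 *\<^sub>R v))"
    using n by (intro has_derivative_norm) auto
  have "sgn \<nu> = \<nu>" using n by (simp add: sgn_div_norm)
  then have 0: "((\<lambda>s. norm (\<nu> + s *\<^sub>R v)) has_derivative (\<lambda>h. 0)) (at 0 within X)"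
    using has_derivative_compose[OF 1 2] v by simp
  have "((\<lambda>s. inverse (norm (\<nu> + s *\<^sub>R v))) has_derivative (\<lambda>h. 0)) (at 0 within X)"
    by (rule has_derivative_eq_rhs[OF Deriv.has_derivative_inverse[OF _ 0]]) (use nz[of 0] in auto)
  from has_derivative_scaleR[OF this 1]
  have "((\<lambda>s. inverse (norm (\<nu> + s *\<^sub>R v)) *\<^sub>R (\<nu> + s *\<^sub>R v)) has_derivative (\<lambda>h. h *\<^sub>R v)) (at 0 within X)"
    by (rule has_derivative_eq_rhs) (use n in \<open>simp add: fun_eq_iff\<close>)
  then show "((\<lambda>s. (1 / norm (\<nu> + s *\<^sub>R v)) *\<^sub>R (\<nu> + s *\<^sub>R v)) has_vector_derivative v) (at 0 within X)"
    by (simp add: has_vector_derivative_def inverse_eq_divide)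
qed

lemma at_0_within_atLeast: "at (0::real) within {0..} = at_right 0"
proof -
  have "{0..} - {0::real} = {0<..} - {0}" by auto
  then show ?thesis by (simp add: at_within_def)
qed

text \<open>Both derivatives agree on velocities of one-sided curves by the chain rule, and by
  linearity on their span. This pins down the choices hidden in \<open>grad_on\<close> and
  \<open>frechet_derivative\<close>.\<close>

lemma derivative_unique_tangent:
  fixes f :: "'a::euclidean_space \<Rightarrow> 'b::real_normed_vector"
  assumes x: "x \<in> S" and L1: "(f has_derivative L1) (at x within S)" and L2: "(f has_derivative L2) (at x within S)"
    and v: "v \<in> tangent_space S x"
  shows "L1 v = L2 v"
proof -
  have lin: "linear (\<lambda>v. L1 v - L2 v)"
    using L1 L2 by (intro linear_compose_sub has_derivative_linear)
  have "L1 u - L2 u = 0" if u: "c 0 = x" "\<forall>\<^sub>F s in at_right 0. c s \<in> S" "(c has_vector_derivative u) (at (0::real) within {0..})" for c u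
  proof -
    obtain e where e: "0 < e" "\<And>s. 0 < s \<Longrightarrow> s < e \<Longrightarrow> c s \<in> S" using u(2) unfolding eventually_at_right_field by auto
    have sub: "c ` {0..e/2} \<subseteq> S"
    proof
      fix p assume "p \<in> c ` {0..e/2}"
      then obtain s where "p = c s" "0 \<le> s" "s \<le> e / 2" by auto
      then show "p \<in> S" using e u(1) x by (cases "s = 0") auto
    qed
    have c: "(c has_derivative (\<lambda>h. h *\<^sub>R u)) (at 0 within {0..e/2})"
      using u(3) unfolding has_vector_derivative_def by (rule has_derivative_subset) auto
    have d: "((f \<circ> c) has_vector_derivative L u) (at 0 within {0..e/2})" if L: "(f has_derivative L) (at x within S)" for L
    proof -
      have "(f has_derivative L) (at (c 0) within c ` {0..e/2})" using has_derivative_subset[OF L sub] u(1) by simp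
      from diff_chain_within[OF c this] show ?thesis
        unfolding has_vector_derivative_def by (rule has_derivative_eq_rhs) (simp add: o_def linear_cmul[OF has_derivative_linear[OF L]])
    qed
    have "at 0 within {0..e/2} \<noteq> bot" using e(1) by (simp add: at_within_Icc_at_right)
    then have "L1 u = L2 u" by (rule vector_derivative_unique_within[OF _ d[OF L1] d[OF L2]])
    then show ?thesis by simp
  qed
  then have "{u. \<exists>c. c 0 = x \<and> (\<forall>\<^sub>F s in at_right 0. c s \<in> S) \<and> (c has_vector_derivative u) (at (0::real) within {0..})}
      \<subseteq> {u. L1 u - L2 u = 0}" by blast
  from span_minimal[OF this linear_subspace_kernel[OF lin]] have "L1 v - L2 v = 0"
    using v unfolding tangent_space_def by blast
  then show ?thesis by simp
qed

lemma closest_point_hyperplane: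
  fixes \<nu> :: "'a::euclidean_space"
  assumes n: "norm \<nu> = 1"
  shows "closest_point {v. v \<bullet> \<nu> = 0} a = proj \<nu> a"
proof (rule closest_point_unique[symmetric])
  have eq: "{v. v \<bullet> \<nu> = 0} = {v. \<nu> \<bullet> v = 0}" by (simp add: inner_commute)
  show "convex {v. v \<bullet> \<nu> = 0}" "closed {v. v \<bullet> \<nu> = 0}" unfolding eq by (rule convex_hyperplane, rule closed_hyperplane)
  show "proj \<nu> a \<in> {v. v \<bullet> \<nu> = 0}" using proj_props(1)[OF n] by simp
  show "\<forall>z\<in>{v. v \<bullet> \<nu> = 0}. dist a (proj \<nu> a) \<le> dist a z"
  proof
    fix z assume "z \<in> {v. v \<bullet> \<nu> = 0}"
    then have "dist a (proj \<nu> a) = \<bar>(a - z) \<bullet> \<nu>\<bar>" using n by (simp add: dist_norm proj_def inner_diff_left)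
    also have "\<dots> \<le> norm (a - z) * norm \<nu>" by (rule Cauchy_Schwarz_ineq2)
    finally show "dist a (proj \<nu> a) \<le> dist a z" using n by (simp add: dist_norm)
  qed
qed

locale acute_angle =
  fixes \<theta> :: real
  assumes theta: "0 < \<theta>" "\<theta> < pi / 2"
begin

lemma trig: "0 < sin \<theta>" "0 < cos \<theta>" "cos \<theta> < 1" "0 < tan \<theta>" "(sin \<theta>)\<^sup>2 + (cos \<theta>)\<^sup>2 = 1"
proof -
  show s: "0 < sin \<theta>" using theta by (intro sin_gt_zero) auto
  show c: "0 < cos \<theta>" using theta by (intro cos_gt_zero) auto
  show "0 < tan \<theta>" using s c by (simp add: tan_def)
  show sc: "(sin \<theta>)\<^sup>2 + (cos \<theta>)\<^sup>2 = 1" by simp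
  show "cos \<theta> < 1" using sc s c by (smt (verit) one_le_power zero_less_power)
qed

lemma tan_sq: "1 + (tan \<theta>)\<^sup>2 = 1 / (cos \<theta>)\<^sup>2"
proof -
  have "(sin \<theta> / cos \<theta>)\<^sup>2 + 1 = ((sin \<theta>)\<^sup>2 + (cos \<theta>)\<^sup>2) / (cos \<theta>)\<^sup>2" using trig(2) by (simp only: power_divide add_divide_distrib) simp
  then show ?thesis using trig(5) by (simp add: tan_def)
qed

lemma norm_lift_le_iff: "norm y \<le> tan \<theta> \<longleftrightarrow> cos \<theta> * norm (lift y) \<le> 1"
    and norm_lift_eq: "norm y = tan \<theta> \<Longrightarrow> cos \<theta> * norm (lift y) = 1"
proof -
  have 1: "(1 / cos \<theta>)\<^sup>2 = 1 + (tan \<theta>)\<^sup>2" using tan_sq by (simp add: power_divide)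
  have "norm y \<le> tan \<theta> \<longleftrightarrow> (norm y)\<^sup>2 \<le> (tan \<theta>)\<^sup>2" using trig by (simp add: abs_le_square_iff[symmetric])
  also have "\<dots> \<longleftrightarrow> (norm (lift y))\<^sup>2 \<le> (1 / cos \<theta>)\<^sup>2" unfolding 1 norm_lift(1) by simp
  also have "\<dots> \<longleftrightarrow> norm (lift y) \<le> 1 / cos \<theta>" using trig by (simp add: abs_le_square_iff[symmetric])
  also have "\<dots> \<longleftrightarrow> cos \<theta> * norm (lift y) \<le> 1" using trig by (simp add: pos_le_divide_eq mult.commute)
  finally show "norm y \<le> tan \<theta> \<longleftrightarrow> cos \<theta> * norm (lift y) \<le> 1" .
  assume "norm y = tan \<theta>"
  then have "(norm (lift y))\<^sup>2 = (1 / cos \<theta>)\<^sup>2" unfolding 1 norm_lift(1) by simp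
  then have "norm (lift y) = 1 / cos \<theta>" using trig(2) by (subst (asm) power2_eq_iff_nonneg) auto
  then show "cos \<theta> * norm (lift y) = 1" using trig(2) by simp
qed

lemma cap_iff: "\<eta> \<in> cap \<theta> \<longleftrightarrow> norm (\<eta> - cos \<theta> *\<^sub>R evec) = 1 \<and> 0 \<le> snd \<eta>"
  by (auto simp: cap_def closed_halfspace_def)

lemma cap_point_diff: "cap_point \<theta> y - cos \<theta> *\<^sub>R evec = unit_lift y" by (simp add: cap_point_def)

lemma snd_cap_point: "snd (cap_point \<theta> y) = 1 / norm (lift y) - cos \<theta>"
  by (simp add: cap_point_def unit_lift_def lift_def evec_def)

lemma cap_point_in_cap: "norm y \<le> tan \<theta> \<Longrightarrow> cap_point \<theta> y \<in> cap \<theta>"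
  using norm_lift_le_iff[of y] norm_lift_pos[of y]
  by (simp add: cap_iff cap_point_diff norm_unit_lift snd_cap_point field_simps)

lemma cap_point_surj:
  assumes "\<eta> \<in> cap \<theta>" obtains y where "norm y \<le> tan \<theta>" "\<eta> = cap_point \<theta> y"
proof -
  define \<nu> where "\<nu> = \<eta> - cos \<theta> *\<^sub>R evec"
  have n: "norm \<nu> = 1" "cos \<theta> \<le> snd \<nu>" using assms by (auto simp: cap_iff \<nu>_def evec_def)
  then have s: "0 < snd \<nu>" using trig by linarith
  define y where "y = (1 / snd \<nu>) *\<^sub>R fst \<nu>"
  have l: "lift y = (1 / snd \<nu>) *\<^sub>R \<nu>" using s by (simp add: lift_def y_def prod_eq_iff)
  then have nl: "norm (lift y) = 1 / snd \<nu>" using n s by simp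
  have "unit_lift y = \<nu>" unfolding unit_lift_def nl l using s n(1) by simp
  then have "\<eta> = cap_point \<theta> y" by (simp add: cap_point_def \<nu>_def)
  moreover have "norm y \<le> tan \<theta>" using n s by (simp add: norm_lift_le_iff nl)
  ultimately show ?thesis using that by blast
qed

lemma ell_cap_point: "norm (lift y) * ell \<theta> (cap_point \<theta> y) = norm (lift y) - cos \<theta>" "0 < ell \<theta> (cap_point \<theta> y)"
proof -
  have "cap_point \<theta> y \<bullet> evec = cos \<theta> - 1 / norm (lift y)"
    by (simp add: inner_prod' evec_def snd_cap_point)
  then have e: "ell \<theta> (cap_point \<theta> y) = 1 - cos \<theta> / norm (lift y)"
    proof -
    have "ell \<theta> (cap_point \<theta> y) = (sin \<theta>)\<^sup>2 + cos \<theta> * (cos \<theta> - 1 / norm (lift y))" by (simp only: ell_def \<open>cap_point \<theta> y \<bullet> evec = _\<close>)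
    also have "\<dots> = ((sin \<theta>)\<^sup>2 + (cos \<theta>)\<^sup>2) - cos \<theta> / norm (lift y)" by (simp only: right_diff_distrib power2_eq_square) simp
    finally show ?thesis using trig(5) by simp
  qed
  show "norm (lift y) * ell \<theta> (cap_point \<theta> y) = norm (lift y) - cos \<theta>"
    using norm_lift_pos[of y] by (simp add: e algebra_simps)
  show "0 < ell \<theta> (cap_point \<theta> y)" using norm_lift(2)[of y] norm_lift_pos[of y] trig by (simp add: e)
qed

text \<open>On the cap the constant 1 is the squared distance to the centre. Multiples of this
  derivative can be added freely within the cap, and comparison with the zero derivative makes
  tangent vectors orthogonal to the normal.\<close>

lemma cap_const_deriv:
  fixes x :: "'n::finite ambient"
  assumes x: "x \<in> cap \<theta>"
  shows "((\<lambda>_. 1::real) has_derivative (\<lambda>v. 2 * ((x - cos \<theta> *\<^sub>R evec) \<bullet> v))) (at x within cap \<theta>)"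
proof -
  have "((\<lambda>y. (y - cos \<theta> *\<^sub>R evec) \<bullet> (y - cos \<theta> *\<^sub>R evec)) has_derivative (\<lambda>v. 2 * ((x - cos \<theta> *\<^sub>R evec) \<bullet> v))) (at x within cap \<theta>)"
    by (auto intro!: derivative_eq_intros simp: inner_commute fun_eq_iff)
  then show ?thesis
    by (rule has_derivative_transform_within[where d = 1]) (use x in \<open>auto simp: cap_iff norm_eq_1\<close>)
qed

text \<open>Away from the rim every direction orthogonal to the normal is the velocity of a curve in
  the cap. At the rim only upward directions are realized so simply, and taking the span restores
  the rest.\<close>

lemma tangent_space_cap:
  fixes x :: "'n::finite ambient"
  assumes x: "x \<in> cap \<theta>"
  shows "tangent_space (cap \<theta>) x = {v. v \<bullet> (x - cos \<theta> *\<^sub>R evec) = 0}"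
proof -
  define \<nu> where "\<nu> = x - cos \<theta> *\<^sub>R evec"
  have n: "norm \<nu> = 1" "cos \<theta> \<le> snd \<nu>" using x by (auto simp: cap_iff \<nu>_def evec_def)
  have inV: "v \<in> tangent_space (cap \<theta>) x" if v: "v \<bullet> \<nu> = 0" "0 < snd v \<or> cos \<theta> < snd \<nu>" for v
  proof -
    define c where "c = (\<lambda>s::real. (1 / norm (\<nu> + s *\<^sub>R v)) *\<^sub>R (\<nu> + s *\<^sub>R v) + cos \<theta> *\<^sub>R evec)"
    note nl = normalized_line[OF n(1) v(1)]
    have d: "(c has_vector_derivative v) (at 0 within {0..})"
      unfolding c_def using has_vector_derivative_add[OF nl(2)[of "{0..}"] has_vector_derivative_const[of "cos \<theta> *\<^sub>R evec"]] by simp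
    have ds: "((\<lambda>s. snd (c s)) has_real_derivative snd v) (at 0 within {0..})"
      using has_derivative_snd[OF d[unfolded has_vector_derivative_def]] by (simp add: has_field_derivative_def mult_commute_abs)
    have c0: "snd (c 0) = snd \<nu> - cos \<theta>" "c 0 = x" using n(1) by (simp_all add: c_def evec_def \<nu>_def)
    have "\<forall>\<^sub>F s in at_right 0. 0 \<le> snd (c s)"
    proof (cases "cos \<theta> < snd \<nu>")
      case True
      have "((\<lambda>s. snd (c s)) \<longlongrightarrow> snd (c 0)) (at_right 0)"
        using DERIV_continuous[OF ds] by (simp add: continuous_within at_0_within_atLeast)
      then have "\<forall>\<^sub>F s in at_right 0. 0 < snd (c s)" using True c0 by (intro order_tendstoD(1)) auto
      then show ?thesis by eventually_elim simp
    next
      case False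
      then have "0 < snd v" using v by simp
      from has_real_derivative_pos_inc_right[OF ds this] obtain e where e: "0 < e" "\<And>h. 0 < h \<Longrightarrow> h < e \<Longrightarrow> snd (c 0) < snd (c h)" by auto
      have "0 \<le> snd (c s)" if "0 < s" "s < e" for s using e(2)[OF that] c0 n by linarith
      then show ?thesis unfolding eventually_at_right_field using e(1) by blast
    qed
    then have "\<forall>\<^sub>F s in at_right 0. c s \<in> cap \<theta>"
      by eventually_elim (use nl(1) in \<open>simp add: cap_iff, simp add: c_def\<close>)
    then show ?thesis unfolding tangent_space_def using c0(2) d by (intro span_base) blast
  qed
  show ?thesis
    unfolding \<nu>_def[symmetric]
  proof (intro set_eqI iffI)
    fix v assume v: "v \<in> tangent_space (cap \<theta>) x"
    have "2 * (\<nu> \<bullet> v) = 0"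
      unfolding \<nu>_def by (rule derivative_unique_tangent[OF x cap_const_deriv[OF x] has_derivative_const v])
    then show "v \<in> {v. v \<bullet> \<nu> = 0}" by (simp add: inner_commute)
  next
    fix v assume "v \<in> {v. v \<bullet> \<nu> = 0}"
    then have v: "v \<bullet> \<nu> = 0" by simp
    show "v \<in> tangent_space (cap \<theta>) x"
    proof (cases "cos \<theta> < snd \<nu>")
      case False
      then have sn: "snd \<nu> = cos \<theta>" using n by simp
      \<comment> \<open>An upward tangent vector; adding a multiple makes any tangent
        \<open>v\<close> point upwards.\<close>
      define w where "w = proj \<nu> (0 :: real^'n, 1 :: real)"
      have w: "w \<bullet> \<nu> = 0" unfolding w_def by (rule proj_props(1)[OF n(1)])
      have "snd w = 1 - cos \<theta> * cos \<theta>" by (simp add: w_def proj_def inner_prod' sn)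
      also have "\<dots> = (sin \<theta>)\<^sup>2" using trig(5) by (simp add: power2_eq_square)
      finally have sw: "0 < snd w" using trig(1) by simp
      define a where "a = (\<bar>snd v\<bar> + 1) / snd w"
      have "a * snd w = \<bar>snd v\<bar> + 1" using sw by (simp add: a_def)
      then have "0 < snd (v + a *\<^sub>R w)" by simp
      moreover have "(v + a *\<^sub>R w) \<bullet> \<nu> = 0" using v w by (simp add: inner_add_left)
      ultimately have "v + a *\<^sub>R w \<in> tangent_space (cap \<theta>) x" "w \<in> tangent_space (cap \<theta>) x" using inV w sw by auto
      then have "v + a *\<^sub>R w - a *\<^sub>R w \<in> tangent_space (cap \<theta>) x"
        unfolding tangent_space_def by (intro span_diff span_scale)
      then show ?thesis by simp
    qed (use inV v in blast)
  qed
qed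

text \<open>Subtracting a multiple of \<open>cap_const_deriv\<close> replaces the ambient gradient
  \<open>G\<close> by its tangential part without changing the function on the cap.\<close>

lemma grad_on_cap:
  fixes x :: "'n::finite ambient"
  assumes x: "x \<in> cap \<theta>" and U: "open U" "x \<in> U" and g: "(g has_derivative (\<lambda>v. G \<bullet> v)) (at x)"
    and gf: "\<And>y. y \<in> U \<inter> cap \<theta> \<Longrightarrow> g y = f y"
  shows "grad_on (cap \<theta>) f x = proj (x - cos \<theta> *\<^sub>R evec) G"
proof -
  define \<nu> where "\<nu> = x - cos \<theta> *\<^sub>R evec"
  have n: "norm \<nu> = 1" using x by (auto simp: cap_iff \<nu>_def)
  have f: "(f has_derivative (\<lambda>v. G \<bullet> v)) (at x within cap \<theta>)"
  proof (rule has_derivative_transform_eventually[OF has_derivative_at_withinI[OF g]])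
    show "\<forall>\<^sub>F y in at x within cap \<theta>. g y = f y"
      unfolding eventually_at_topological using U gf by auto
  qed (use gf U x in auto)
  have "((\<lambda>y. f y - (G \<bullet> \<nu>) / 2 * 1) has_derivative (\<lambda>v. G \<bullet> v - (G \<bullet> \<nu>) / 2 * (2 * (\<nu> \<bullet> v)))) (at x within cap \<theta>)"
    unfolding \<nu>_def by (intro has_derivative_diff f has_derivative_mult_right cap_const_deriv x)
  from has_derivative_add[OF this has_derivative_const[of "(G \<bullet> \<nu>) / 2"]]
  have fd: "(f has_derivative (\<lambda>v. proj \<nu> G \<bullet> v)) (at x within cap \<theta>)"
    by (simp add: proj_def inner_diff_left)
  note T = tangent_space_cap[OF x, folded \<nu>_def]
  have "grad_on (cap \<theta>) f x = proj \<nu> G"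
    unfolding grad_on_def
  proof (rule the_equality)
    show "proj \<nu> G \<in> tangent_space (cap \<theta>) x \<and> (f has_derivative (\<bullet>) (proj \<nu> G)) (at x within cap \<theta>)"
      using fd proj_props(1)[OF n] T by auto
    fix w assume w: "w \<in> tangent_space (cap \<theta>) x \<and> (f has_derivative (\<bullet>) w) (at x within cap \<theta>)"
    have wm: "w - proj \<nu> G \<in> tangent_space (cap \<theta>) x" using w proj_props(1)[OF n, of G] T by (simp add: inner_diff_left)
    have "w \<bullet> (w - proj \<nu> G) = proj \<nu> G \<bullet> (w - proj \<nu> G)"
      using derivative_unique_tangent[OF x conjunct2[OF w] fd wm] .
    then have "(w - proj \<nu> G) \<bullet> (w - proj \<nu> G) = 0" by (simp add: inner_diff_left)
    then show "w = proj \<nu> G" by simp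
  qed
  then show ?thesis by (simp add: \<nu>_def)
qed

text \<open>Differentiate the projected gradient: besides the ambient Hessian, the turning of the
  normal contributes the second fundamental form of the unit sphere times
  \<open>G . \<nu>\<close>.\<close>

lemma hess_on_cap:
  fixes x :: "'n::finite ambient"
  assumes x: "x \<in> cap \<theta>" and U: "open U" "x \<in> U" and g: "\<And>y. y \<in> U \<Longrightarrow> (g has_derivative (\<lambda>v. G y \<bullet> v)) (at y)"
    and G: "(G has_derivative Hg) (at x)"
    and gf: "\<And>y. y \<in> U \<inter> cap \<theta> \<Longrightarrow> g y = f y"
    and v: "v \<bullet> (x - cos \<theta> *\<^sub>R evec) = 0" and w: "w \<bullet> (x - cos \<theta> *\<^sub>R evec) = 0"
  shows "hess_on (cap \<theta>) f x v w = Hg v \<bullet> w - (G x \<bullet> (x - cos \<theta> *\<^sub>R evec)) * (v \<bullet> w)"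
proof -
  let ?c = "cos \<theta> *\<^sub>R (evec :: 'n ambient)"
  define \<nu> where "\<nu> = x - ?c"
  have n: "norm \<nu> = 1" using x by (auto simp: cap_iff \<nu>_def)
  have wn: "w \<bullet> \<nu> = 0" using w by (simp add: \<nu>_def)
  define L where "L = (\<lambda>v. Hg v - ((G x \<bullet> \<nu>) *\<^sub>R v + (G x \<bullet> v + Hg v \<bullet> \<nu>) *\<^sub>R \<nu>))"
  have "((\<lambda>y. y - ?c) has_derivative (\<lambda>v. v)) (at x)" by (auto intro!: derivative_eq_intros)
  note d1 = this
  have "((\<lambda>y. G y - (G y \<bullet> (y - ?c)) *\<^sub>R (y - ?c)) has_derivative L) (at x)"
    unfolding L_def \<nu>_def
    by (rule has_derivative_diff[OF G has_derivative_scaleR[OF has_derivative_inner[OF G d1] d1]])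
  then have d: "((\<lambda>y. proj (y - ?c) (G y)) has_derivative L) (at x)" by (simp add: proj_def)
  have "(grad_on (cap \<theta>) f has_derivative L) (at x within cap \<theta>)"
  proof (rule has_derivative_transform_eventually[OF has_derivative_at_withinI[OF d]])
    have *: "proj (y - ?c) (G y) = grad_on (cap \<theta>) f y" if "y \<in> U" "y \<in> cap \<theta>" for y
      by (rule grad_on_cap[OF that(2) U(1) that(1) g[OF that(1)] gf, symmetric])
    show "\<forall>\<^sub>F y in at x within cap \<theta>. proj (y - ?c) (G y) = grad_on (cap \<theta>) f y"
      unfolding eventually_at_topological using U * by auto
    show "proj (x - ?c) (G x) = grad_on (cap \<theta>) f x" using * U x by blast
  qed (rule x)
  note gd = this
  then have fd: "(grad_on (cap \<theta>) f has_derivative frechet_derivative (grad_on (cap \<theta>) f) (at x within cap \<theta>)) (at x within cap \<theta>)"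
    using frechet_derivative_works differentiableI by blast
  note T = tangent_space_cap[OF x, folded \<nu>_def]
  have "frechet_derivative (grad_on (cap \<theta>) f) (at x within cap \<theta>) v = L v"
    by (rule derivative_unique_tangent[OF x fd gd]) (use v T in \<open>simp add: \<nu>_def\<close>)
  then have "hess_on (cap \<theta>) f x v w = proj \<nu> (L v) \<bullet> w"
    unfolding hess_on_def cov_deriv_def T closest_point_hyperplane[OF n] by simp
  also have "\<dots> = L v \<bullet> w" by (simp add: proj_props(3)[OF n] proj_props(5)[OF n wn])
  also have "\<dots> = Hg v \<bullet> w - (G x \<bullet> \<nu>) * (v \<bullet> w)"
    using wn by (simp add: L_def inner_diff_left inner_add_left inner_commute[of \<nu>])
  finally show ?thesis by (simp add: \<nu>_def)
qed

text \<open>In the plane of the radial and the vertical direction the normal at the rim is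
  \<open>(sin, cos)\<close>, so the conormal is \<open>(cos, - sin)\<close>; the sign is the one
  leaving the half-space.\<close>

lemma conormal_cap_point:
  fixes y :: "real^'n::finite"
  assumes y: "norm y = tan \<theta>"
  shows "cap_point \<theta> y \<in> cap_boundary \<theta>"
    and "conormal \<theta> (cap_point \<theta> y) = ((cos \<theta> / tan \<theta>) *\<^sub>R y, - sin \<theta>)"
    and "unit_lift y = (cos \<theta> *\<^sub>R y, cos \<theta>)"
proof -
  define x where "x = cap_point \<theta> y"
  define e' where "e' = (1 / tan \<theta>) *\<^sub>R y"
  have e1: "norm e' = 1" using y trig(4) by (simp add: e'_def)
  have e': "norm e' = 1" "e' \<bullet> e' = 1" "y = tan \<theta> *\<^sub>R e'" using e1 norm_eq_1[of e'] trig(4) by (simp_all add: e'_def)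
  have st: "cos \<theta> * tan \<theta> = sin \<theta>" using trig(2) by (simp add: tan_def)
  have nl: "1 / norm (lift y) = cos \<theta>" using norm_lift_eq[OF y] norm_lift_pos[of y] by (simp add: field_simps)
  show ul: "unit_lift y = (cos \<theta> *\<^sub>R y, cos \<theta>)" unfolding unit_lift_def nl by (simp add: lift_def)
  then have ul': "unit_lift y = (sin \<theta> *\<^sub>R e', cos \<theta>)" using e'(3) st by simp
  have xx: "x = (sin \<theta> *\<^sub>R e', 0)" by (simp add: x_def cap_point_def ul' evec_def)
  have xc: "x \<in> cap \<theta>" unfolding x_def by (rule cap_point_in_cap) (simp add: y)
  then show xb: "cap_point \<theta> y \<in> cap_boundary \<theta>" by (simp add: cap_boundary_def boundary_plane_def x_def[symmetric]) (simp add: xx)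
  note T = tangent_space_cap[OF xc]
  have \<nu>: "x - cos \<theta> *\<^sub>R evec = (sin \<theta> *\<^sub>R e', cos \<theta>)" by (simp add: xx evec_def)
  define w0 where "w0 = (cos \<theta> *\<^sub>R e', - sin \<theta>)"
  have w0n: "norm w0 = 1"
    unfolding norm_eq_1 using e'(2) trig(5) by (simp add: w0_def inner_prod' power2_eq_square add.commute)
  have w0T: "w0 \<in> tangent_space (cap \<theta>) x" unfolding T \<nu> using e'(2) by (simp add: w0_def inner_prod')
  have bT: "snd v = 0" "e' \<bullet> fst v = 0" if v: "v \<in> tangent_space (cap_boundary \<theta>) x" for v
  proof -
    have xb': "x \<in> cap_boundary \<theta>" using xb by (simp add: x_def)
    have d: "(snd has_derivative snd) (at x within cap_boundary \<theta>)" by (rule has_derivative_snd[OF has_derivative_ident])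
    have d0: "(snd has_derivative (\<lambda>v. 0)) (at x within cap_boundary \<theta>)"
      by (rule has_derivative_transform_within[OF has_derivative_const[of 0], of 1])
         (use xb' in \<open>auto simp: cap_boundary_def boundary_plane_def\<close>)
    show s0: "snd v = 0" by (rule derivative_unique_tangent[OF xb' d d0 v])
    have "((\<lambda>_. 1::real) has_derivative (\<lambda>v. 2 * ((x - cos \<theta> *\<^sub>R evec) \<bullet> v))) (at x within cap_boundary \<theta>)"
      by (rule has_derivative_subset[OF cap_const_deriv[OF xc]]) (auto simp: cap_boundary_def)
    from derivative_unique_tangent[OF xb' this has_derivative_const v]
    show "e' \<bullet> fst v = 0" unfolding \<nu> using s0 trig(1) by (simp add: inner_prod')
  qed
  have inb: "(a, 0) \<in> tangent_space (cap_boundary \<theta>) x" if a: "a \<bullet> e' = 0" for a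
  proof -
    let ?m = "\<lambda>s. (1 / norm (e' + s *\<^sub>R a)) *\<^sub>R (e' + s *\<^sub>R a)"
    define c where "c = (\<lambda>s::real. (sin \<theta> *\<^sub>R ?m s, 0::real))"
    note nl = normalized_line[OF e'(1) a]
    have "(c has_vector_derivative (sin \<theta> *\<^sub>R a, 0)) (at 0 within {0..})"
      unfolding c_def by (intro has_vector_derivative_Pair bounded_linear.has_vector_derivative[OF bounded_linear_scaleR_right] nl(2) has_vector_derivative_const)
    moreover have "c s \<in> cap_boundary \<theta>" for s
    proof -
      obtain m where m: "m = ?m s" "m \<bullet> m = 1" using nl(1)[of s] norm_eq_1[of "?m s"] by simp
      have cs: "c s - cos \<theta> *\<^sub>R evec = (sin \<theta> *\<^sub>R m, cos \<theta>)" "c s = (sin \<theta> *\<^sub>R m, 0)" by (simp_all add: c_def m(1) evec_def)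
      have "norm (sin \<theta> *\<^sub>R m, cos \<theta>) = 1"
        unfolding norm_eq_1 using trig(5) m(2) by (simp add: inner_prod' power2_eq_square)
      then show ?thesis unfolding cap_boundary_def by (simp add: cap_iff boundary_plane_def cs(1)) (simp add: cs(2))
    qed
    moreover have "c 0 = x" using e'(1) by (simp add: c_def xx)
    ultimately have "(sin \<theta> *\<^sub>R a, 0) \<in> tangent_space (cap_boundary \<theta>) x"
      unfolding tangent_space_def by (intro span_base) auto
    then have "(1 / sin \<theta>) *\<^sub>R (sin \<theta> *\<^sub>R a, 0::real) \<in> tangent_space (cap_boundary \<theta>) x"
      unfolding tangent_space_def by (intro span_scale)
    then show ?thesis using trig(1) by simp
  qed
  have "conormal \<theta> x = w0"
    unfolding conormal_def
  proof (rule the_equality)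
    show "w0 \<in> tangent_space (cap \<theta>) x \<and> norm w0 = 1 \<and> (\<forall>v\<in>tangent_space (cap_boundary \<theta>) x. w0 \<bullet> v = 0) \<and> 0 < w0 \<bullet> evec"
      using w0T w0n bT trig(1) by (auto simp: w0_def inner_prod' evec_def)
    fix w assume w: "w \<in> tangent_space (cap \<theta>) x \<and> norm w = 1 \<and> (\<forall>v\<in>tangent_space (cap_boundary \<theta>) x. w \<bullet> v = 0) \<and> 0 < w \<bullet> evec"
    obtain a b where ab: "w = (a, b)" by (cases w)
    define \<alpha> where "\<alpha> = a \<bullet> e'"
    have "(a - \<alpha> *\<^sub>R e') \<bullet> e' = 0" using e'(2) by (simp add: \<alpha>_def inner_diff_left)
    note o = this
    have "w \<bullet> (a - \<alpha> *\<^sub>R e', 0) = 0" using w inb[OF o] by blast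
    then have "a \<bullet> (a - \<alpha> *\<^sub>R e') = 0" by (simp add: ab inner_prod')
    moreover have "\<alpha> *\<^sub>R e' \<bullet> (a - \<alpha> *\<^sub>R e') = 0" using o by (simp add: inner_commute)
    ultimately have "(a - \<alpha> *\<^sub>R e') \<bullet> (a - \<alpha> *\<^sub>R e') = 0" by (simp only: inner_diff_left)
    then have a: "a = \<alpha> *\<^sub>R e'" by simp
    have b: "b < 0" using w by (simp add: ab inner_prod' evec_def)
    have 1: "\<alpha> * sin \<theta> + b * cos \<theta> = 0" using w e'(2) unfolding T \<nu> by (auto simp: ab a inner_prod' mult.commute)
    have "w \<bullet> w = 1" using w norm_eq_1 by blast
    then have 2: "\<alpha> * \<alpha> + b * b = 1" using e'(2) by (simp add: ab a inner_prod')
    have "(\<alpha> * sin \<theta>)\<^sup>2 = (b * cos \<theta>)\<^sup>2" using 1 by (metis add_eq_0_iff power2_minus)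
    then have "\<alpha>\<^sup>2 * (sin \<theta>)\<^sup>2 = b\<^sup>2 * (1 - (sin \<theta>)\<^sup>2)" using trig(5) by (simp add: power_mult_distrib cos_squared_eq)
    then have "(\<alpha>\<^sup>2 + b\<^sup>2) * (sin \<theta>)\<^sup>2 = b\<^sup>2" by (simp add: algebra_simps)
    then have "b\<^sup>2 = (sin \<theta>)\<^sup>2" using 2 by (simp add: power2_eq_square)
    then have bs: "b = - sin \<theta>" using b trig(1) by (auto simp: power2_eq_iff)
    then have "\<alpha> * sin \<theta> = cos \<theta> * sin \<theta>" using 1 by simp
    then have "\<alpha> = cos \<theta>" using trig(1) by simp
    then show "w = w0" by (simp add: ab a w0_def bs)
  qed
  then show "conormal \<theta> (cap_point \<theta> y) = ((cos \<theta> / tan \<theta>) *\<^sub>R y, - sin \<theta>)"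
    by (simp add: x_def w0_def e'_def)
qed

end

section \<open>Smooth functions and symmetry of second derivatives\<close>

lemma Ck_on_Suc: "Ck_on (Suc k) U f \<Longrightarrow> Ck_on k U f"
proof (induction k arbitrary: f)
  case 0
  then obtain f' where "\<forall>x\<in>U. (f has_derivative f' x) (at x)" by auto
  then have "\<And>x. x \<in> U \<Longrightarrow> (f has_derivative f' x) (at x within U)" by (blast intro: has_derivative_at_withinI)
  then show ?case by (auto intro: has_derivative_continuous_on)
next
  case (Suc k)
  then obtain f' where f': "\<forall>x\<in>U. (f has_derivative f' x) (at x)" "\<forall>v. Ck_on (Suc k) U (\<lambda>x. f' x v)" by (metis Ck_on.simps(2))
  then have "\<forall>v. Ck_on k U (\<lambda>x. f' x v)" using Suc.IH by blast
  then show ?case using f'(1) by (metis Ck_on.simps(2))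
qed

lemma Ck_on_const:
  fixes c :: "'b::euclidean_space"
  shows "Ck_on k U (\<lambda>_. c)"
proof (induction k arbitrary: c)
  case (Suc k)
  show ?case unfolding Ck_on.simps by (rule exI[of _ "\<lambda>x v. 0"]) (simp add: Suc)
qed simp

lemma Ck_on_add: "Ck_on k U f \<Longrightarrow> Ck_on k U g \<Longrightarrow> Ck_on k U (\<lambda>x. f x + g x)"
proof (induction k arbitrary: f g)
  case 0 then show ?case by (simp add: continuous_on_add)
next
  case (Suc k)
  obtain f' where f': "\<forall>x\<in>U. (f has_derivative f' x) (at x)" "\<forall>v. Ck_on k U (\<lambda>x. f' x v)" using Suc.prems(1) by auto
  obtain g' where g': "\<forall>x\<in>U. (g has_derivative g' x) (at x)" "\<forall>v. Ck_on k U (\<lambda>x. g' x v)" using Suc.prems(2) by auto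
  have "\<forall>x\<in>U. ((\<lambda>x. f x + g x) has_derivative (\<lambda>v. f' x v + g' x v)) (at x)" using f' g' by (auto intro: has_derivative_add)
  moreover have "\<forall>v. Ck_on k U (\<lambda>x. f' x v + g' x v)" using f' g' Suc.IH by blast
  ultimately show ?case unfolding Ck_on.simps by (intro exI[of _ "\<lambda>x v. f' x v + g' x v"]) simp
qed

lemma Ck_on_mult:
  fixes f g :: "'a::euclidean_space \<Rightarrow> real"
  shows "Ck_on k U f \<Longrightarrow> Ck_on k U g \<Longrightarrow> Ck_on k U (\<lambda>x. f x * g x)"
proof (induction k arbitrary: f g)
  case 0 then show ?case by (simp add: continuous_on_mult)
next
  case (Suc k)
  obtain f' where f': "\<forall>x\<in>U. (f has_derivative f' x) (at x)" "\<forall>v. Ck_on k U (\<lambda>x. f' x v)" using Suc.prems(1) by auto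
  obtain g' where g': "\<forall>x\<in>U. (g has_derivative g' x) (at x)" "\<forall>v. Ck_on k U (\<lambda>x. g' x v)" using Suc.prems(2) by auto
  have "\<forall>x\<in>U. ((\<lambda>x. f x * g x) has_derivative (\<lambda>v. f x * g' x v + f' x v * g x)) (at x)" using f' g' by (auto intro: has_derivative_mult)
  moreover have "\<forall>v. Ck_on k U (\<lambda>x. f x * g' x v + f' x v * g x)"
  proof
    fix v
    show "Ck_on k U (\<lambda>x. f x * g' x v + f' x v * g x)"
      by (rule Ck_on_add[OF Suc.IH[OF Ck_on_Suc[OF Suc.prems(1)]] Suc.IH[OF _ Ck_on_Suc[OF Suc.prems(2)]]])
        (use f' g' in blast)+
  qed
  ultimately show ?case unfolding Ck_on.simps by (intro exI[of _ "\<lambda>x v. f x * g' x v + f' x v * g x"]) simp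
qed

lemma Ck_on_affine: "Ck_on k U (\<lambda>x. a + b \<bullet> x :: real)"
proof (cases k)
  case 0 then show ?thesis by (auto intro!: continuous_intros)
next
  case (Suc m)
  show ?thesis
    unfolding Suc Ck_on.simps by (rule exI[of _ "\<lambda>x v. b \<bullet> v"]) (auto intro!: derivative_eq_intros Ck_on_const)
qed

text \<open>\<open>Ck_on\<close> speaks of one direction at a time; expansion in the standard basis
  assembles the directional derivatives into a differentiable gradient.\<close>

lemma Ck_on_2_gradient:
  fixes g :: "'a::euclidean_space \<Rightarrow> real"
  assumes "Ck_on 2 U g"
  obtains G Hg where "\<And>x. x \<in> U \<Longrightarrow> (g has_derivative (\<lambda>v. G x \<bullet> v)) (at x)"
    "\<And>x. x \<in> U \<Longrightarrow> (G has_derivative Hg x) (at x)" "\<And>w. continuous_on U (\<lambda>x. Hg x w)"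
proof -
  obtain f' where f': "\<forall>x\<in>U. (g has_derivative f' x) (at x)" "\<forall>v. Ck_on (Suc 0) U (\<lambda>x. f' x v)"
    using assms by (auto simp: numeral_2_eq_2)
  then have "\<forall>v. \<exists>h. (\<forall>x\<in>U. ((\<lambda>x. f' x v) has_derivative h x) (at x)) \<and> (\<forall>w. continuous_on U (\<lambda>x. h x w))" by simp
  then obtain h where h: "\<And>v x. x \<in> U \<Longrightarrow> ((\<lambda>x. f' x v) has_derivative h v x) (at x)" "\<And>v w. continuous_on U (\<lambda>x. h v x w)" by metis
  define G where "G = (\<lambda>x. \<Sum>b\<in>Basis. f' x b *\<^sub>R b)"
  define Hg where "Hg = (\<lambda>x w. \<Sum>b\<in>Basis. h b x w *\<^sub>R b)"
  have eq: "f' x v = G x \<bullet> v" if "x \<in> U" for x v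
  proof -
    have "linear (f' x)" using f'(1) that by (blast intro: has_derivative_linear)
    then have "f' x (\<Sum>b\<in>Basis. (v \<bullet> b) *\<^sub>R b) = (\<Sum>b\<in>Basis. (v \<bullet> b) *\<^sub>R f' x b)" by (simp add: linear_sum linear_cmul)
    then have "f' x v = (\<Sum>b\<in>Basis. (v \<bullet> b) *\<^sub>R f' x b)" by (simp only: euclidean_representation)
    then show ?thesis by (simp add: G_def inner_sum_left inner_commute[of v] mult.commute)
  qed
  show ?thesis
  proof
    show "(g has_derivative (\<lambda>v. G x \<bullet> v)) (at x)" if "x \<in> U" for x
      using f'(1) that eq[OF that] by (metis has_derivative_eq_rhs ext)
    show "(G has_derivative Hg x) (at x)" if "x \<in> U" for x
      unfolding G_def Hg_def by (intro has_derivative_sum has_derivative_scaleR_left h that)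
    show "continuous_on U (\<lambda>x. Hg x w)" for w
      unfolding Hg_def by (intro continuous_intros h)
  qed
qed

text \<open>The second difference over a small parallelogram is symmetric in \<open>v\<close> and
  \<open>w\<close> and equals, by mean values in either order, either mixed derivative at a nearby
  point.\<close>

lemma hessian_symmetric:
  fixes g :: "'a::euclidean_space \<Rightarrow> real"
  assumes U: "open U" and g: "\<And>x. x \<in> U \<Longrightarrow> (g has_derivative (\<lambda>v. G x \<bullet> v)) (at x)"
    and G: "\<And>x. x \<in> U \<Longrightarrow> (G has_derivative Hg x) (at x)" and c: "\<And>w. continuous_on U (\<lambda>x. Hg x w)"
    and x: "x \<in> U"
  shows "Hg x v \<bullet> w = Hg x w \<bullet> v"
proof -
  obtain r where r: "0 < r" "ball x r \<subseteq> U" using U x by (meson openE)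
  have quad: "\<exists>a b. 0 \<le> a \<and> a \<le> s \<and> 0 \<le> b \<and> b \<le> s \<and>
      g (x + s *\<^sub>R v + s *\<^sub>R w) - g (x + s *\<^sub>R v) - g (x + s *\<^sub>R w) + g x = s * (s * (Hg (x + a *\<^sub>R v + b *\<^sub>R w) w \<bullet> v))"
    if s: "0 < s" "s * (norm v + norm w) < r" for s v w
  proof -
    have inU: "x + a *\<^sub>R v + b *\<^sub>R w \<in> U" if ab: "0 \<le> a" "a \<le> s" "0 \<le> b" "b \<le> s" for a b
    proof -
      have "norm (a *\<^sub>R v + b *\<^sub>R w) \<le> a * norm v + b * norm w"
        using norm_triangle_ineq[of "a *\<^sub>R v" "b *\<^sub>R w"] ab by simp
      also have "\<dots> \<le> s * norm v + s * norm w" using ab by (intro add_mono mult_right_mono) auto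
      also have "\<dots> < r" using s by (simp add: distrib_left)
      finally show ?thesis using r(2) by (auto simp: dist_norm add.assoc norm_minus_commute subset_iff)
    qed
    let ?\<psi> = "\<lambda>a. g (x + a *\<^sub>R v + s *\<^sub>R w) - g (x + a *\<^sub>R v + 0 *\<^sub>R w)"
    have d1: "((\<lambda>a. g (x + a *\<^sub>R v + b *\<^sub>R w)) has_real_derivative G (x + a *\<^sub>R v + b *\<^sub>R w) \<bullet> v) (at a)"
      if "0 \<le> a" "a \<le> s" "0 \<le> b" "b \<le> s" for a b
    proof -
      have "((\<lambda>a. x + a *\<^sub>R v + b *\<^sub>R w) has_derivative (\<lambda>h. h *\<^sub>R v)) (at a)" by (auto intro!: derivative_eq_intros)
      from has_derivative_compose[OF this g[OF inU[OF that]]]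
      show ?thesis by (simp add: has_field_derivative_def mult_commute_abs)
    qed
    have "\<exists>a. 0 < a \<and> a < s \<and> ?\<psi> s - ?\<psi> 0 = (s - 0) * (G (x + a *\<^sub>R v + s *\<^sub>R w) \<bullet> v - G (x + a *\<^sub>R v + 0 *\<^sub>R w) \<bullet> v)"
      by (rule MVT2[OF s(1)]) (use s(1) in \<open>intro DERIV_diff d1; simp\<close>)
    then obtain a where a: "0 < a" "a < s" "?\<psi> s - ?\<psi> 0 = s * (G (x + a *\<^sub>R v + s *\<^sub>R w) \<bullet> v - G (x + a *\<^sub>R v + 0 *\<^sub>R w) \<bullet> v)" by auto
    have d2: "((\<lambda>b. G (x + a *\<^sub>R v + b *\<^sub>R w) \<bullet> v) has_real_derivative Hg (x + a *\<^sub>R v + b *\<^sub>R w) w \<bullet> v) (at b)"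
      if "0 \<le> b" "b \<le> s" for b
    proof -
      have i: "x + a *\<^sub>R v + b *\<^sub>R w \<in> U" using inU a that by simp
      have "((\<lambda>b. x + a *\<^sub>R v + b *\<^sub>R w) has_derivative (\<lambda>h. h *\<^sub>R w)) (at b)" by (auto intro!: derivative_eq_intros)
      from has_derivative_inner_left[OF has_derivative_compose[OF this G[OF i]], of v]
      show ?thesis by (simp add: has_field_derivative_def mult_commute_abs linear_cmul[OF has_derivative_linear[OF G[OF i]]])
    qed
    have "\<exists>b. 0 < b \<and> b < s \<and> G (x + a *\<^sub>R v + s *\<^sub>R w) \<bullet> v - G (x + a *\<^sub>R v + 0 *\<^sub>R w) \<bullet> v = (s - 0) * (Hg (x + a *\<^sub>R v + b *\<^sub>R w) w \<bullet> v)"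
      by (rule MVT2[OF s(1)]) (rule d2)
    then obtain b where b: "0 < b" "b < s" "G (x + a *\<^sub>R v + s *\<^sub>R w) \<bullet> v - G (x + a *\<^sub>R v + 0 *\<^sub>R w) \<bullet> v = s * (Hg (x + a *\<^sub>R v + b *\<^sub>R w) w \<bullet> v)" by auto
    have "g (x + s *\<^sub>R v + s *\<^sub>R w) - g (x + s *\<^sub>R v) - g (x + s *\<^sub>R w) + g x = s * (s * (Hg (x + a *\<^sub>R v + b *\<^sub>R w) w \<bullet> v))"
      using a(3) unfolding b(3) by simp
    then show ?thesis using a b by (intro exI[of _ a] exI[of _ b]) simp
  qed
  show ?thesis
  proof (rule ccontr)
    assume ne: "Hg x v \<bullet> w \<noteq> Hg x w \<bullet> v"
    define \<epsilon> where "\<epsilon> = \<bar>Hg x v \<bullet> w - Hg x w \<bullet> v\<bar> / 2"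
    have \<epsilon>: "0 < \<epsilon>" using ne by (simp add: \<epsilon>_def)
    have cont: "\<exists>d>0. \<forall>y. dist y x < d \<longrightarrow> y \<in> U \<longrightarrow> \<bar>Hg y v \<bullet> w - Hg x v \<bullet> w\<bar> < \<epsilon>" for v w
    proof -
      have "continuous_on U (\<lambda>x. Hg x v \<bullet> w)" by (intro continuous_intros c)
      then show ?thesis using x \<epsilon> unfolding continuous_on_iff by (metis dist_real_def)
    qed
    obtain d1 where d1: "0 < d1" "\<And>y. dist y x < d1 \<Longrightarrow> y \<in> U \<Longrightarrow> \<bar>Hg y v \<bullet> w - Hg x v \<bullet> w\<bar> < \<epsilon>" using cont by blast
    obtain d2 where d2: "0 < d2" "\<And>y. dist y x < d2 \<Longrightarrow> y \<in> U \<Longrightarrow> \<bar>Hg y w \<bullet> v - Hg x w \<bullet> v\<bar> < \<epsilon>" using cont by blast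
    define m where "m = min r (min d1 d2)"
    have m: "0 < m" "m \<le> r" "m \<le> d1" "m \<le> d2" using r d1 d2 by (auto simp: m_def)
    define s where "s = m / (2 * (norm v + norm w + 1))"
    have p: "0 < norm v + norm w + 1" by (simp add: add_nonneg_pos)
    have s: "0 < s" using m p by (simp add: s_def)
    have "s * (norm v + norm w) \<le> s * (norm v + norm w + 1)" using s by (intro mult_left_mono) auto
    also have "\<dots> = m / 2"
    proof -
      have "m / (2 * q) * q = m / 2" if "0 < q" for q using that by simp
      from this[OF p] show ?thesis by (simp only: s_def)
    qed
    finally have sm: "s * (norm v + norm w) < m" using m by linarith
    have near: "dist (x + a *\<^sub>R v + b *\<^sub>R w) x < m \<and> x + a *\<^sub>R v + b *\<^sub>R w \<in> U" if ab: "0 \<le> a" "a \<le> s" "0 \<le> b" "b \<le> s" for a b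
    proof -
      have "norm (a *\<^sub>R v + b *\<^sub>R w) \<le> a * norm v + b * norm w"
        using norm_triangle_ineq[of "a *\<^sub>R v" "b *\<^sub>R w"] ab by simp
      also have "\<dots> \<le> s * norm v + s * norm w" using ab by (intro add_mono mult_right_mono) auto
      also have "\<dots> < m" using sm by (simp add: distrib_left)
      finally have *: "dist (x + a *\<^sub>R v + b *\<^sub>R w) x < m" by (simp add: dist_norm add.assoc)
      moreover have "x + a *\<^sub>R v + b *\<^sub>R w \<in> ball x r" using * m by (simp add: dist_commute)
      ultimately show ?thesis using r by blast
    qed
    obtain a b where ab: "0 \<le> a" "a \<le> s" "0 \<le> b" "b \<le> s"
      "g (x + s *\<^sub>R v + s *\<^sub>R w) - g (x + s *\<^sub>R v) - g (x + s *\<^sub>R w) + g x = s * (s * (Hg (x + a *\<^sub>R v + b *\<^sub>R w) w \<bullet> v))"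
      using quad[OF s, of v w] sm m by auto
    obtain a' b' where ab': "0 \<le> a'" "a' \<le> s" "0 \<le> b'" "b' \<le> s"
      "g (x + s *\<^sub>R w + s *\<^sub>R v) - g (x + s *\<^sub>R w) - g (x + s *\<^sub>R v) + g x = s * (s * (Hg (x + a' *\<^sub>R w + b' *\<^sub>R v) v \<bullet> w))"
      using quad[OF s, of w v] sm m by (auto simp: add.commute)
    have sw: "x + s *\<^sub>R w + s *\<^sub>R v = x + s *\<^sub>R v + s *\<^sub>R w" "x + a' *\<^sub>R w + b' *\<^sub>R v = x + b' *\<^sub>R v + a' *\<^sub>R w" by simp_all
    have "s * (s * (Hg (x + a *\<^sub>R v + b *\<^sub>R w) w \<bullet> v)) = s * (s * (Hg (x + b' *\<^sub>R v + a' *\<^sub>R w) v \<bullet> w))"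
      using ab(5) ab'(5) unfolding sw by linarith
    then have "Hg (x + a *\<^sub>R v + b *\<^sub>R w) w \<bullet> v = Hg (x + b' *\<^sub>R v + a' *\<^sub>R w) v \<bullet> w" using s by simp
    moreover have "\<bar>Hg (x + a *\<^sub>R v + b *\<^sub>R w) w \<bullet> v - Hg x w \<bullet> v\<bar> < \<epsilon>" using near[OF ab(1-4)] m by (intro d2) auto
    moreover have "\<bar>Hg (x + b' *\<^sub>R v + a' *\<^sub>R w) v \<bullet> w - Hg x v \<bullet> w\<bar> < \<epsilon>" using near[OF ab'(3,4,1,2)] m by (intro d1) auto
    moreover have "\<bar>q - p\<bar> < \<eta> + \<eta>" if "z = z'" "\<bar>z - p\<bar> < \<eta>" "\<bar>z' - q\<bar> < \<eta>" for z z' p q \<eta> :: real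
      using that by linarith
    ultimately have "\<bar>Hg x v \<bullet> w - Hg x w \<bullet> v\<bar> < \<epsilon> + \<epsilon>" by blast
    then show False by (simp add: \<epsilon>_def)
  qed
qed

section \<open>The tangent frame given by homogeneous coordinates\<close>

text \<open>Up to the factor \<open>1 / norm (lift y)\<close>, the differential of
  \<open>unit_lift\<close> at \<open>y\<close>.\<close>

definition hproj :: "real^'n::finite \<Rightarrow> real^'n \<Rightarrow> 'n ambient" where "hproj y v = proj (unit_lift y) (v, 0)"
definition gram :: "real^'n::finite \<Rightarrow> real^'n^'n" where "gram y = (\<chi> i j. hproj y (axis i 1) \<bullet> hproj y (axis j 1))"

lemma unit_lift_comp: "unit_lift y = ((1 / norm (lift y)) *\<^sub>R y, 1 / norm (lift y))"
  by (simp add: unit_lift_def lift_def)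

lemma hproj_props:
  "hproj y v \<bullet> unit_lift y = 0" "linear (hproj y)" "hproj y v = 0 \<Longrightarrow> v = 0" "hproj y v \<bullet> w = (v, 0) \<bullet> proj (unit_lift y) w"
proof -
  note p = proj_props[OF norm_unit_lift[of y]]
  show "hproj y v \<bullet> unit_lift y = 0" by (simp add: hproj_def p(1))
  show "linear (hproj y)"
    unfolding hproj_def using p(4) by (intro linear_compose[of "\<lambda>v. (v, 0)" "proj (unit_lift y)", unfolded o_def]) (auto intro!: linearI)
  show "hproj y v \<bullet> w = (v, 0) \<bullet> proj (unit_lift y) w" by (simp add: hproj_def p(3))
  assume "hproj y v = 0"
  then have e: "(v, 0) = ((v, 0) \<bullet> unit_lift y) *\<^sub>R unit_lift y" by (simp add: hproj_def proj_def)
  then have "0 = ((v, 0) \<bullet> unit_lift y) * (1 / norm (lift y))" by (metis snd_conv snd_scaleR real_scaleR_def unit_lift_comp)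
  then have "(v, 0::real) \<bullet> unit_lift y = 0" using norm_lift_pos[of y] by simp
  then have "(v, 0::real) = 0" using e by simp
  then show "v = 0" by (simp add: prod_eq_iff)
qed

lemma hproj_sum: "hproj y v = (\<Sum>i\<in>UNIV. (v $ i) *\<^sub>R hproj y (axis i 1))"
proof -
  have "v = (\<Sum>i\<in>UNIV. (v $ i) *\<^sub>R axis i 1)" using basis_expansion[of v] by (simp add: scalar_mult_eq_scaleR)
  then have "hproj y v = hproj y (\<Sum>i\<in>UNIV. (v $ i) *\<^sub>R axis i 1)" by simp
  then show ?thesis by (simp add: linear_sum[OF hproj_props(2)] linear_cmul[OF hproj_props(2)])
qed

lemma gram_entry: "gram y $ i $ j = (if i = j then 1 else 0) - y $ i * y $ j / (norm (lift y))\<^sup>2"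
proof -
  have "hproj y (axis i 1) \<bullet> hproj y (axis j 1) = (axis i 1, 0) \<bullet> proj (unit_lift y) (axis j (1::real), 0::real)"
    by (simp add: hproj_props(4)) (simp add: hproj_def proj_props(2)[OF norm_unit_lift])
  also have "\<dots> = (if i = j then 1 else 0) - y $ i * y $ j / (norm (lift y))\<^sup>2"
    by (simp add: proj_def inner_prod' unit_lift_comp inner_diff_right inner_axis inner_axis' power2_eq_square) (simp add: axis_def)
  finally show ?thesis by (simp add: gram_def)
qed

lemma gram_mult: "gram y *v v = v - ((y \<bullet> v) / (norm (lift y))\<^sup>2) *\<^sub>R y"
proof -
  have "(gram y *v v) $ i = (v - ((y \<bullet> v) / (norm (lift y))\<^sup>2) *\<^sub>R y) $ i" for i
  proof -
    have "(gram y *v v) $ i = (\<Sum>j\<in>UNIV. ((if i = j then 1 else 0) - y $ i * y $ j / (norm (lift y))\<^sup>2) * v $ j)"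
      by (simp add: matrix_vector_mult_def gram_entry)
    also have "\<dots> = (\<Sum>j\<in>UNIV. (if i = j then v $ j else 0) - y $ i / (norm (lift y))\<^sup>2 * (y $ j * v $ j))"
      by (intro sum.cong) (auto simp: algebra_simps)
    also have "\<dots> = v $ i - y $ i / (norm (lift y))\<^sup>2 * (\<Sum>j\<in>UNIV. y $ j * v $ j)"
      by (simp add: sum_subtractf sum_distrib_left)
    finally show ?thesis by (simp add: inner_vec_def)
  qed
  then show ?thesis by (simp add: vec_eq_iff)
qed

lemma gram_form: "v \<bullet> (gram y *v v) = hproj y v \<bullet> hproj y v"
proof -
  have "hproj y v \<bullet> hproj y v = (v, 0) \<bullet> hproj y v" by (simp add: hproj_props(4)) (simp add: hproj_def proj_props(2)[OF norm_unit_lift])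
  also have "\<dots> = v \<bullet> v - (y \<bullet> v) / (norm (lift y))\<^sup>2 * (v \<bullet> y)"
    by (simp add: hproj_def proj_def inner_prod' unit_lift_comp inner_diff_right power2_eq_square inner_commute)
  finally show ?thesis by (simp add: gram_mult inner_diff_right)
qed

lemma gram_pos: "v \<noteq> 0 \<Longrightarrow> 0 < v \<bullet> (gram y *v v)" and det_gram_pos: "0 < det (gram y)"
proof -
  show *: "0 < v \<bullet> (gram y *v v)" if "v \<noteq> 0" for v using hproj_props(3)[of y v] that by (auto simp: gram_form)
  show "0 < det (gram y)" using det_pos_of_pos_form * by blast
qed

lemma continuous_norm_lift: "continuous_on S (\<lambda>y. norm (lift y))"
  unfolding lift_def by (intro continuous_intros)

lemma continuous_gram:
  fixes S :: "(real^'n::finite) set"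
  shows "continuous_on S gram"
proof -
  have "continuous_on S (\<lambda>y. \<chi> i j. (if i = j then 1 else 0) - y $ i * y $ j / (norm (lift y))\<^sup>2)"
    using norm_lift_pos by (intro continuous_intros continuous_norm_lift) (auto simp: less_imp_neq[symmetric])
  moreover have eq: "gram = (\<lambda>y::real^'n. \<chi> i j. (if i = j then 1 else 0) - y $ i * y $ j / (norm (lift y))\<^sup>2)"
    by (simp add: fun_eq_iff vec_eq_iff gram_entry)
  ultimately show ?thesis by (subst eq)
qed

text \<open>Conjugating \<open>gram y\<close> by the matrix of \<open>T\<close> gives
  \<open>gram (T y)\<close>. This is the source of the reflection symmetry of the weight.\<close>

lemma det_gram_orthogonal:
  fixes T :: "real^'n::finite \<Rightarrow> real^'n"
  assumes T: "orthogonal_transformation T"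
  shows "norm (lift (T y)) = norm (lift y)" "det (gram (T y)) = det (gram y)"
proof -
  have "(norm (lift (T y)))\<^sup>2 = (norm (lift y))\<^sup>2" by (simp add: norm_lift(1) orthogonal_transformation_norm[OF T])
  then show nl: "norm (lift (T y)) = norm (lift y)" by simp
  have lin: "linear T" using T by (simp add: orthogonal_transformation_def)
  define M where "M = matrix T"
  have Mv: "M *v v = T v" for v using lin by (simp add: M_def matrix_works)
  have oM: "orthogonal_matrix M" using T by (simp add: M_def orthogonal_transformation_matrix)
  then have MM: "M ** transpose M = mat 1" by (simp add: orthogonal_matrix_def)
  have inn: "y \<bullet> (transpose M *v v) = T y \<bullet> v" for v
    using matrix_vector_inner_transpose[of y "transpose M" v] by (simp add: Mv)
  have "M ** gram y ** transpose M = gram (T y)"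
    unfolding matrix_eq
  proof
    fix v
    have "(M ** gram y ** transpose M) *v v = T (gram y *v (transpose M *v v))" by (simp add: Mv flip: matrix_vector_mul_assoc)
    also have "\<dots> = T (transpose M *v v) - ((T y \<bullet> v) / (norm (lift y))\<^sup>2) *\<^sub>R T y"
      by (simp add: gram_mult inn linear_diff[OF lin] linear_cmul[OF lin] del: transpose_matrix_vector)
    also have "T (transpose M *v v) = v" unfolding Mv[symmetric] by (simp add: matrix_vector_mul_assoc MM del: transpose_matrix_vector)
    finally show "(M ** gram y ** transpose M) *v v = gram (T y) *v v" by (simp add: gram_mult nl)
  qed
  from arg_cong[OF this, of det] have "det (gram (T y)) = det M * det (transpose M) * det (gram y)" by (simp only: det_mul mult_ac)
  also have "det M * det (transpose M) = 1" using arg_cong[OF MM, of det] by (simp only: det_mul det_I)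
  finally show "det (gram (T y)) = det (gram y)" by simp
qed

lemma ex_orthonormal_basis:
  fixes \<nu> :: "'n::finite ambient"
  assumes n: "norm \<nu> = 1"
  shows "\<exists>b. orthonormal_basis {v. v \<bullet> \<nu> = 0} b"
proof -
  let ?T = "{v. v \<bullet> \<nu> = 0}"
  have sub: "subspace ?T" by (auto simp: subspace_def inner_add_left)
  have "\<nu> \<noteq> 0" using n by auto
  then have "dim {v. \<nu> \<bullet> v = 0} = DIM('n ambient) - 1" by (rule dim_hyperplane)
  then have dim: "dim ?T = CARD('n)" by (simp add: inner_commute)
  obtain B where B: "B \<subseteq> ?T" "pairwise orthogonal B" "\<And>x. x \<in> B \<Longrightarrow> norm x = 1" "independent B" "card B = dim ?T" "span B = ?T"
    using orthonormal_basis_subspace[OF sub] by blast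
  have "finite B" using B(4) independent_imp_finite by blast
  then obtain b where b: "bij_betw b (UNIV :: 'n set) B"
    using B(5) dim finite_same_card_bij[of "UNIV :: 'n set" B] by auto
  have "b i \<bullet> b j = (if i = j then 1 else 0)" for i j
  proof (cases "i = j")
    case True
    then show ?thesis using B(3)[of "b i"] b by (auto simp: bij_betw_def norm_eq_1)
  next
    case False
    then have "b i \<noteq> b j" "b i \<in> B" "b j \<in> B" using b by (auto simp: bij_betw_def inj_on_def)
    then show ?thesis using B(2) False by (simp add: pairwise_def orthogonal_def)
  qed
  then show ?thesis using b B(6) by (intro exI[of _ b]) (simp add: orthonormal_basis_def bij_betw_def)
qed

text \<open>Change of basis from an orthonormal basis of the tangent space to the projected coordinate vectors.\<close>

lemma det_form_hproj:
  fixes y :: "real^'n::finite" and L :: "'n ambient \<Rightarrow> 'n ambient"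
  assumes L: "linear L"
    and B: "\<And>v w. v \<bullet> unit_lift y = 0 \<Longrightarrow> w \<bullet> unit_lift y = 0 \<Longrightarrow> B v w = L v \<bullet> w"
  shows "det (\<chi> i j. B (hproj y (axis j 1)) (hproj y (axis i 1))) = det (gram y) * det_form {v. v \<bullet> unit_lift y = 0} B"
proof -
  let ?T = "{v. v \<bullet> unit_lift y = 0}"
  define b where "b = (SOME b. orthonormal_basis ?T b)"
  have "orthonormal_basis ?T b" unfolding b_def by (rule someI_ex[OF ex_orthonormal_basis[OF norm_unit_lift]])
  then have bo: "\<And>i j. b i \<bullet> b j = (if i = j then 1 else 0)" and bs: "span (range b) = ?T" by (auto simp: orthonormal_basis_def)
  have bT: "b i \<bullet> unit_lift y = 0" for i using bs span_base[of "b i" "range b"] by auto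
  have inj: "inj b" by (rule injI) (metis bo zero_neq_one)
  have exp: "v = (\<Sum>k\<in>UNIV. (v \<bullet> b k) *\<^sub>R b k)" if v: "v \<bullet> unit_lift y = 0" for v
  proof -
    have "v \<in> span (range b)" using v bs by simp
    then obtain c where c: "v = (\<Sum>k\<in>UNIV. c k *\<^sub>R b k)"
      unfolding span_finite[OF finite_imageI[OF finite[of UNIV]]] by (auto simp: sum.reindex[OF inj]) 
    have "v \<bullet> b k = c k" for k by (simp add: c inner_sum_left bo) (simp add: if_distrib cong: if_cong)
    then show ?thesis using c by simp
  qed
  define Q where "Q = (\<chi> i k. hproj y (axis i 1) \<bullet> b k)"
  define A where "A = (\<chi> i j. B (b i) (b j))"
  have e: "hproj y (axis i 1) = (\<Sum>k\<in>UNIV. Q $ i $ k *\<^sub>R b k)" for i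
    using exp[OF hproj_props(1)] by (simp add: Q_def)
  have "(\<chi> i j. B (hproj y (axis j 1)) (hproj y (axis i 1))) = Q ** transpose A ** transpose Q"
  proof -
    have "B (hproj y (axis j 1)) (hproj y (axis i 1)) = (Q ** transpose A ** transpose Q) $ i $ j" for i j
    proof -
      have "B (hproj y (axis j 1)) (hproj y (axis i 1)) = L (\<Sum>k\<in>UNIV. Q $ j $ k *\<^sub>R b k) \<bullet> (\<Sum>l\<in>UNIV. Q $ i $ l *\<^sub>R b l)"
        using B[OF hproj_props(1) hproj_props(1)] e by metis
      also have "\<dots> = (\<Sum>k\<in>UNIV. \<Sum>l\<in>UNIV. Q $ j $ k * (Q $ i $ l * (L (b k) \<bullet> b l)))"
        by (simp add: linear_sum[OF L] linear_cmul[OF L] inner_sum_left inner_sum_right sum_distrib_left)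
          (subst sum.swap, simp add: mult_ac)
      also have "\<dots> = (\<Sum>k\<in>UNIV. (\<Sum>l\<in>UNIV. Q $ i $ l * A $ k $ l) * Q $ j $ k)"
        by (simp add: A_def B[OF bT bT] sum_distrib_left sum_distrib_right mult_ac)
      finally show ?thesis by (simp add: matrix_matrix_mult_def transpose_def)
    qed
    then show ?thesis by (simp add: vec_eq_iff)
  qed
  moreover have "gram y = Q ** transpose Q"
  proof -
    have "gram y $ i $ j = (Q ** transpose Q) $ i $ j" for i j
    proof -
      have "gram y $ i $ j = hproj y (axis i 1) \<bullet> (\<Sum>k\<in>UNIV. Q $ j $ k *\<^sub>R b k)" unfolding gram_def using e[of j] by simp
      also have "\<dots> = (\<Sum>k\<in>UNIV. Q $ i $ k * Q $ j $ k)" by (simp add: inner_sum_right Q_def mult.commute)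
      finally show ?thesis by (simp add: matrix_matrix_mult_def transpose_def)
    qed
    then show ?thesis by (simp add: vec_eq_iff)
  qed
  moreover have "det_form ?T B = det A" by (simp add: det_form_def A_def b_def[symmetric] Let_def)
  ultimately show ?thesis by (simp add: det_mul)
qed

lemma unit_lift_deriv:
  "((\<lambda>y. norm (lift y)) has_derivative (\<lambda>v. unit_lift y \<bullet> (v, 0))) (at y within S)"
  "(unit_lift has_derivative (\<lambda>v. (1 / norm (lift y)) *\<^sub>R hproj y v)) (at y within S)"
proof -
  have l: "(lift has_derivative (\<lambda>v. (v, 0))) (at y within S)"
    unfolding lift_def by (auto intro!: derivative_eq_intros)
  have "(norm has_derivative (\<lambda>h. h \<bullet> sgn (lift y))) (at (lift y))" by (rule has_derivative_norm[OF norm_lift(3)])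
  from has_derivative_compose[OF l this]
  show n: "((\<lambda>y. norm (lift y)) has_derivative (\<lambda>v. unit_lift y \<bullet> (v, 0))) (at y within S)"
    by (rule has_derivative_eq_rhs) (simp add: fun_eq_iff sgn_div_norm unit_lift_def inner_commute inverse_eq_divide)
  have nz: "norm (lift y) \<noteq> 0" using norm_lift(3) by simp
  from has_derivative_scaleR[OF Deriv.has_derivative_inverse[OF nz n] l]
  have "((\<lambda>y. inverse (norm (lift y)) *\<^sub>R lift y) has_derivative (\<lambda>v. (1 / norm (lift y)) *\<^sub>R hproj y v)) (at y within S)"
    by (rule has_derivative_eq_rhs)
      (simp add: fun_eq_iff hproj_def proj_def unit_lift_def inverse_eq_divide scaleR_diff_right inner_commute)
  then show "(unit_lift has_derivative (\<lambda>v. (1 / norm (lift y)) *\<^sub>R hproj y v)) (at y within S)"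
    by (simp add: unit_lift_def[abs_def] inverse_eq_divide)
qed

text \<open>The function \<open>norm Y * g (Y / norm Y)\<close> is homogeneous of degree 1, and its
  gradient is the tangential part of \<open>G\<close> plus \<open>g\<close> times the unit normal;
  \<open>Y = (y, 1)\<close> sees the horizontal component.\<close>

lemma joint_support_deriv:
  fixes g :: "'n::finite ambient \<times> real \<Rightarrow> real"
  assumes g: "(g has_derivative (\<lambda>q. G \<bullet> q)) (at (cap_point \<theta> y, t))"
  shows "((\<lambda>p. norm (lift (fst p)) * g (cap_point \<theta> (fst p), snd p)) has_derivative
     (\<lambda>(v, r). fst (fst G + (g (cap_point \<theta> y, t) - fst G \<bullet> unit_lift y) *\<^sub>R unit_lift y) \<bullet> v + r *\<^sub>R (norm (lift y) * snd G))) (at (y, t) within S)"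
    and "((\<lambda>p. (cap_point \<theta> (fst p), snd p)) has_derivative (\<lambda>(v, r). ((1 / norm (lift y)) *\<^sub>R hproj y v, r))) (at (y, t) within S)"
proof -
  have f: "(fst has_derivative fst) (at (y, t) within S)" by (rule has_derivative_fst[OF has_derivative_ident])
  have c: "((\<lambda>y. cap_point \<theta> y) has_derivative (\<lambda>v. (1 / norm (lift y)) *\<^sub>R hproj y v)) (at (fst (y, t)))"
    using has_derivative_add_const[OF unit_lift_deriv(2)[of y UNIV], of "cos \<theta> *\<^sub>R evec"] by (simp add: cap_point_def)
  have n: "((\<lambda>y. norm (lift y)) has_derivative (\<lambda>v. unit_lift y \<bullet> (v, 0))) (at (fst (y, t)))"
    using unit_lift_deriv(1)[of y UNIV] by simp
  show d: "((\<lambda>p. (cap_point \<theta> (fst p), snd p)) has_derivative (\<lambda>(v, r). ((1 / norm (lift y)) *\<^sub>R hproj y v, r))) (at (y, t) within S)"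
    using has_derivative_Pair[OF has_derivative_compose[OF f c] has_derivative_snd[OF has_derivative_ident]]
    by (rule has_derivative_eq_rhs) auto
  have "(g has_derivative (\<lambda>q. G \<bullet> q)) (at ((\<lambda>p. (cap_point \<theta> (fst p), snd p)) (y, t)))" using g by simp
  from has_derivative_mult[OF has_derivative_compose[OF f n] has_derivative_compose[OF d this]]
  show "((\<lambda>p. norm (lift (fst p)) * g (cap_point \<theta> (fst p), snd p)) has_derivative
     (\<lambda>(v, r). fst (fst G + (g (cap_point \<theta> y, t) - fst G \<bullet> unit_lift y) *\<^sub>R unit_lift y) \<bullet> v + r *\<^sub>R (norm (lift y) * snd G))) (at (y, t) within S)"
  proof (rule has_derivative_eq_rhs)
    have *: "fst A \<bullet> v = A \<bullet> (v, 0)" for A :: "'n ambient" and v by (simp add: inner_prod')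
    have "norm (lift y) * (G \<bullet> ((1 / norm (lift y)) *\<^sub>R hproj y v, r)) = fst G \<bullet> hproj y v + r * (norm (lift y) * snd G)" for v r
      using norm_lift_pos[of y] by (cases G) (simp add: distrib_left)
    moreover have "fst G \<bullet> hproj y v = fst G \<bullet> (v, 0) - (unit_lift y \<bullet> (v, 0)) * (fst G \<bullet> unit_lift y)" for v
      by (simp add: hproj_def proj_def inner_diff_right inner_commute)
    ultimately have A: "norm (lift y) * (G \<bullet> ((1 / norm (lift y)) *\<^sub>R hproj y v, r)) =
        fst G \<bullet> (v, 0) - (unit_lift y \<bullet> (v, 0)) * (fst G \<bullet> unit_lift y) + r * (norm (lift y) * snd G)" for v r by (simp only:)
    have gen: "X - a * b + r * (N * s) + a * g = X + (g - b) * a + r * (N * s)" for X a b r N s g :: real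
      by (simp add: algebra_simps)
    show "(\<lambda>h. norm (lift (fst (y, t))) * (G \<bullet> (case h of (v, r) \<Rightarrow> ((1 / norm (lift y)) *\<^sub>R hproj y v, r))) + unit_lift y \<bullet> (fst h, 0) * g (cap_point \<theta> (fst (y, t)), snd (y, t)))
      = (\<lambda>(v, r). fst (fst G + (g (cap_point \<theta> y, t) - fst G \<bullet> unit_lift y) *\<^sub>R unit_lift y) \<bullet> v + r *\<^sub>R (norm (lift y) * snd G))"
    proof
      fix h :: "(real^'n) \<times> real"
      show "norm (lift (fst (y, t))) * (G \<bullet> (case h of (v, r) \<Rightarrow> ((1 / norm (lift y)) *\<^sub>R hproj y v, r))) + unit_lift y \<bullet> (fst h, 0) * g (cap_point \<theta> (fst (y, t)), snd (y, t))
        = (case h of (v, r) \<Rightarrow> fst (fst G + (g (cap_point \<theta> y, t) - fst G \<bullet> unit_lift y) *\<^sub>R unit_lift y) \<bullet> v + r *\<^sub>R (norm (lift y) * snd G))"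
        by (cases h) (simp only: prod.case fst_conv snd_conv A * inner_add_left inner_scaleR_left real_scaleR_def, rule gen)
    qed
  qed
qed

section \<open>The flow in homogeneous coordinates\<close>

lemma has_derivative_transform_local:
  assumes "(f has_derivative f') (at x within S)" "open V" "x \<in> V" "x \<in> S" "\<And>z. z \<in> V \<Longrightarrow> z \<in> S \<Longrightarrow> f z = g z"
  shows "(g has_derivative f') (at x within S)"
proof (rule has_derivative_transform_eventually[OF assms(1)])
  show "\<forall>\<^sub>F z in at x within S. f z = g z"
    unfolding eventually_at_topological using assms by blast
qed (use assms in auto)

lemma continuous_cap_point: "continuous_on S unit_lift" "continuous_on S (cap_point \<theta>)"
proof -
  show u: "continuous_on S unit_lift" by (rule has_derivative_continuous_on) (rule unit_lift_deriv(2))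
  show "continuous_on S (cap_point \<theta>)" unfolding cap_point_def by (intro continuous_intros u)
qed

text \<open>The weight \<open>\<rho>\<close>: by \<open>ell_cap_point\<close> the first factor is
  \<open>norm (lift y)\<close> times \<open>ell\<close>, and the determinant converts the form on
  the cap to the coordinates \<open>y\<close>.\<close>

definition cap_density :: "real \<Rightarrow> real^'n::finite \<Rightarrow> real" where
  "cap_density \<theta> y = (norm (lift y) - cos \<theta>) * det ((1 / norm (lift y)) *\<^sub>R gram y)"

definition supp_H :: "real \<Rightarrow> ('n::finite ambient \<Rightarrow> real \<Rightarrow> real) \<Rightarrow> real^'n \<Rightarrow> real \<Rightarrow> real" where
  "supp_H \<theta> u y t = norm (lift y) * (ell \<theta> (cap_point \<theta> y) * u (cap_point \<theta> y) t)"

text \<open>The inverse Gauss map: gradient plus value times normal is the point of the hypersurface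
  with normal \<open>unit_lift y\<close>.\<close>

definition supp_Z :: "real \<Rightarrow> ('n::finite ambient \<Rightarrow> real \<Rightarrow> real) \<Rightarrow> real^'n \<Rightarrow> real \<Rightarrow> 'n ambient" where
  "supp_Z \<theta> u y t = grad_on (cap \<theta>) (\<lambda>\<eta>. ell \<theta> \<eta> * u \<eta> t) (cap_point \<theta> y)
     + (ell \<theta> (cap_point \<theta> y) * u (cap_point \<theta> y) t) *\<^sub>R unit_lift y"

definition supp_D :: "real \<Rightarrow> ('n::finite ambient \<Rightarrow> real \<Rightarrow> real) \<Rightarrow> real^'n \<Rightarrow> real \<Rightarrow> real^'n" where
  "supp_D \<theta> u y t = fst (supp_Z \<theta> u y t)"

text \<open>The form \<open>support_form\<close> in the frame \<open>hproj\<close>, scaled so that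
  it becomes the Hessian of \<open>supp_H\<close> in \<open>y\<close>.\<close>

definition supp_D2 :: "real \<Rightarrow> ('n::finite ambient \<Rightarrow> real \<Rightarrow> real) \<Rightarrow> real^'n \<Rightarrow> real \<Rightarrow> real^'n^'n" where
  "supp_D2 \<theta> u y t = (1 / norm (lift y)) *\<^sub>R
     (\<chi> i j. support_form \<theta> (\<lambda>\<eta>. u \<eta> t) (cap_point \<theta> y) (hproj y (axis j 1)) (hproj y (axis i 1)))"

text \<open>The time derivative of \<open>supp_D\<close>; only its existence matters.\<close>

definition supp_e :: "real \<Rightarrow> ('n::finite ambient \<Rightarrow> real \<Rightarrow> real) \<Rightarrow> real^'n \<Rightarrow> real \<Rightarrow> real^'n" where
  "supp_e \<theta> u y t = (SOME e. ((\<lambda>p. supp_D \<theta> u (fst p) (snd p)) has_derivative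
     (\<lambda>(v, r). supp_D2 \<theta> u y t *v v + r *\<^sub>R e)) (at (y, t) within cball 0 (tan \<theta>) \<times> {0<..}))"

lemma ell_deriv: "(ell \<theta> has_derivative (\<lambda>v. cos \<theta> * (v \<bullet> evec))) (at x within S)"
  unfolding ell_def by (auto intro!: derivative_eq_intros)

section \<open>Support data of a single time slice\<close>

context acute_angle
begin

lemma smooth_on_cap_extension:
  fixes w :: "'n::finite ambient \<Rightarrow> real"
  assumes w: "smooth_on (cap \<theta>) w" and x: "\<xi> \<in> cap \<theta>"
  obtains U g0 G0 where "open U" "\<xi> \<in> U" "\<And>\<eta>. \<eta> \<in> U \<inter> cap \<theta> \<Longrightarrow> g0 \<eta> = w \<eta>"
    "(g0 has_derivative (\<lambda>v. G0 \<bullet> v)) (at \<xi>)"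
    "((\<lambda>\<eta>. ell \<theta> \<eta> * g0 \<eta>) has_derivative (\<lambda>v. (ell \<theta> \<xi> *\<^sub>R G0 + (g0 \<xi> * cos \<theta>) *\<^sub>R evec) \<bullet> v)) (at \<xi>)"
proof -
  obtain U g0 where U: "open U" "\<xi> \<in> U" "\<forall>k. Ck_on k U g0" "\<forall>\<eta>\<in>U \<inter> cap \<theta>. g0 \<eta> = w \<eta>"
    using w x unfolding smooth_on_def by blast
  obtain G Hg where G: "\<And>x. x \<in> U \<Longrightarrow> (g0 has_derivative (\<lambda>v. G x \<bullet> v)) (at x)"
    "\<And>x. x \<in> U \<Longrightarrow> (G has_derivative Hg x) (at x)" "\<And>w. continuous_on U (\<lambda>x. Hg x w)"
    by (rule Ck_on_2_gradient[OF U(3)[rule_format, of 2]]) blast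
  have "((\<lambda>\<eta>. ell \<theta> \<eta> * g0 \<eta>) has_derivative (\<lambda>v. (ell \<theta> \<xi> *\<^sub>R G \<xi> + (g0 \<xi> * cos \<theta>) *\<^sub>R evec) \<bullet> v)) (at \<xi>)"
    by (rule has_derivative_eq_rhs[OF has_derivative_mult[OF ell_deriv G(1)[OF U(2)]]])
      (simp add: fun_eq_iff inner_add_left inner_add_right inner_commute mult_ac)
  from that[OF U(1,2) _ G(1)[OF U(2)] this] U(4) show ?thesis by blast
qed

text \<open>Uses smoothness in space only, so it covers time 0. The condition \<open>neumann\<close>
  amounts to a vanishing vertical component of \<open>supp_Z\<close>, which follows from the Neumann
  condition on \<open>u\<close> and the explicit conormal.\<close>

lemma static_support:
  fixes u :: "'n::finite ambient \<Rightarrow> real \<Rightarrow> real"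
  assumes w: "smooth_on (cap \<theta>) (\<lambda>\<eta>. u \<eta> t)"
    and neu: "\<And>\<xi>. \<xi> \<in> cap_boundary \<theta> \<Longrightarrow> grad_on (cap \<theta>) (\<lambda>\<eta>. u \<eta> t) \<xi> \<bullet> conormal \<theta> \<xi> = 0"
  shows "support_fn (tan \<theta>) (\<lambda>y. supp_H \<theta> u y t) (\<lambda>y. supp_D \<theta> u y t)"
proof -
  let ?w = "\<lambda>\<eta>. u \<eta> t"
  show ?thesis
  proof
    show "0 < tan \<theta>" by (rule trig)
  next
    fix y :: "real^'n" assume y: "norm y \<le> tan \<theta>"
    let ?\<xi> = "cap_point \<theta> y" and ?\<nu> = "unit_lift y"
    have xc: "?\<xi> \<in> cap \<theta>" by (rule cap_point_in_cap[OF y])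
    obtain U g0 G0 where U: "open U" "?\<xi> \<in> U" "\<And>\<eta>. \<eta> \<in> U \<inter> cap \<theta> \<Longrightarrow> g0 \<eta> = ?w \<eta>"
      and d0: "(g0 has_derivative (\<lambda>v. G0 \<bullet> v)) (at ?\<xi>)"
      and d: "((\<lambda>\<eta>. ell \<theta> \<eta> * g0 \<eta>) has_derivative (\<lambda>v. (ell \<theta> ?\<xi> *\<^sub>R G0 + (g0 ?\<xi> * cos \<theta>) *\<^sub>R evec) \<bullet> v)) (at ?\<xi>)"
      by (rule smooth_on_cap_extension[OF w xc]) blast
    define g where "g = (\<lambda>\<eta>. ell \<theta> \<eta> * g0 \<eta>)"
    define G where "G = ell \<theta> ?\<xi> *\<^sub>R G0 + (g0 ?\<xi> * cos \<theta>) *\<^sub>R evec"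
    have dg: "(g has_derivative (\<lambda>v. G \<bullet> v)) (at ?\<xi>)" using d unfolding g_def G_def .
    have gw: "g \<eta> = ell \<theta> \<eta> * ?w \<eta>" if "\<eta> \<in> U \<inter> cap \<theta>" for \<eta> using U(3)[OF that] by (simp add: g_def)
    have "supp_Z \<theta> u y t = proj ?\<nu> G + g ?\<xi> *\<^sub>R ?\<nu>"
      unfolding supp_Z_def using grad_on_cap[OF xc U(1,2) dg gw] gw[of ?\<xi>] U(2) xc by (simp add: cap_point_diff)
    then have Z: "supp_D \<theta> u y t = fst (G + (g ?\<xi> - G \<bullet> ?\<nu>) *\<^sub>R ?\<nu>)"
      by (simp add: supp_D_def proj_def scaleR_diff_left)
    have dq: "((\<lambda>q. g (fst q)) has_derivative (\<lambda>q. (G, 0::real) \<bullet> q)) (at (?\<xi>, 0::real))"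
    proof -
      have "((\<lambda>q. g (fst q)) has_derivative (\<lambda>q. G \<bullet> fst q)) (at (?\<xi>, 0::real))"
        by (rule has_derivative_compose[OF has_derivative_fst[OF has_derivative_ident]]) (use dg in simp)
      then show ?thesis by (rule has_derivative_eq_rhs) (auto simp: inner_prod_def)
    qed
    have "((\<lambda>z. (z, 0::real)) has_derivative (\<lambda>v. (v, 0))) (at y within cball 0 (tan \<theta>))"
      by (auto intro!: derivative_eq_intros)
    from has_derivative_compose[OF this joint_support_deriv(1)[OF dq, where S = UNIV]]
    have "((\<lambda>z. norm (lift z) * g (cap_point \<theta> z)) has_derivative (\<lambda>v. supp_D \<theta> u y t \<bullet> v)) (at y within cball 0 (tan \<theta>))"
      by (simp add: Z)
    then show "((\<lambda>y. supp_H \<theta> u y t) has_derivative (\<lambda>v. supp_D \<theta> u y t \<bullet> v)) (at y within cball 0 (tan \<theta>))"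
    proof (rule has_derivative_transform_local)
      show "open (cap_point \<theta> -` U)" by (rule open_vimage[OF U(1) continuous_cap_point(2)])
      show "y \<in> cap_point \<theta> -` U" using U(2) by simp
      show "y \<in> cball 0 (tan \<theta>)" using y by simp
      fix z assume "z \<in> cap_point \<theta> -` U" "z \<in> cball 0 (tan \<theta>)"
      then have "cap_point \<theta> z \<in> U \<inter> cap \<theta>" using cap_point_in_cap[of z] by simp
      then show "norm (lift z) * g (cap_point \<theta> z) = supp_H \<theta> u z t" by (simp add: supp_H_def gw)
    qed
  next
    fix y :: "real^'n" assume y: "norm y = tan \<theta>"
    let ?\<xi> = "cap_point \<theta> y" and ?\<nu> = "unit_lift y"
    note cp = conormal_cap_point[OF y]
    define w0 where "w0 = ((cos \<theta> / tan \<theta>) *\<^sub>R y, - sin \<theta>)"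
    have xc: "?\<xi> \<in> cap \<theta>" by (rule cap_point_in_cap) (simp add: y)
    define f where "f = ell \<theta> ?\<xi> * ?w ?\<xi>"
    obtain U g0 G0 where U: "open U" "?\<xi> \<in> U" "\<And>\<eta>. \<eta> \<in> U \<inter> cap \<theta> \<Longrightarrow> g0 \<eta> = ?w \<eta>"
      and d0: "(g0 has_derivative (\<lambda>v. G0 \<bullet> v)) (at ?\<xi>)"
      and d: "((\<lambda>\<eta>. ell \<theta> \<eta> * g0 \<eta>) has_derivative (\<lambda>v. (ell \<theta> ?\<xi> *\<^sub>R G0 + (g0 ?\<xi> * cos \<theta>) *\<^sub>R evec) \<bullet> v)) (at ?\<xi>)"
      by (rule smooth_on_cap_extension[OF w xc]) blast
    define G where "G = ell \<theta> ?\<xi> *\<^sub>R G0 + (g0 ?\<xi> * cos \<theta>) *\<^sub>R evec"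
    have gw: "ell \<theta> \<eta> * g0 \<eta> = ell \<theta> \<eta> * ?w \<eta>" if "\<eta> \<in> U \<inter> cap \<theta>" for \<eta> using U(3)[OF that] by simp
    have g0w: "g0 ?\<xi> = ?w ?\<xi>" using U xc by blast
    have Z: "supp_Z \<theta> u y t = proj ?\<nu> G + f *\<^sub>R ?\<nu>"
      unfolding supp_Z_def G_def f_def using grad_on_cap[OF xc U(1,2) d gw] by (simp add: cap_point_diff)
    note pp = proj_props[OF norm_unit_lift[of y]]
    have \<nu>\<nu>: "?\<nu> \<bullet> ?\<nu> = 1" using norm_unit_lift[of y] by (simp add: norm_eq_1)
    have tc: "sin \<theta> / tan \<theta> = cos \<theta>" "cos \<theta> / tan \<theta> * tan \<theta> = cos \<theta>" using trig by (simp_all add: tan_def)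
    have yy: "y \<bullet> y = tan \<theta> * tan \<theta>" using y by (metis dot_square_norm power2_eq_square)
    have w\<nu>: "w0 \<bullet> ?\<nu> = 0"
    proof -
      have "w0 \<bullet> ?\<nu> = cos \<theta> * (cos \<theta> / tan \<theta> * tan \<theta> * tan \<theta>) - sin \<theta> * cos \<theta>"
        unfolding w0_def cp(3) by (simp add: inner_prod' yy)
      also have "\<dots> = 0" using trig by (simp only: tc(2)) (simp add: tan_def)
      finally show ?thesis .
    qed
    \<comment> \<open>The vertical direction splits into normal and conormal, so the height of the
      contact point can be read off from the two known components of \<open>supp_Z\<close>.\<close>
    have e1: "(0, 1) = cos \<theta> *\<^sub>R ?\<nu> - sin \<theta> *\<^sub>R w0"
    proof -
      have "cos \<theta> * cos \<theta> = sin \<theta> * (cos \<theta> / tan \<theta>)" using tc(1) by (metis mult.commute times_divide_eq_right)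
      then show ?thesis unfolding w0_def cp(3) using trig(5) by (simp add: prod_eq_iff power2_eq_square)
    qed
    have "snd ?\<xi> = 0" using cp(1) by (simp add: cap_boundary_def boundary_plane_def)
    then have ell: "ell \<theta> ?\<xi> = (sin \<theta>)\<^sup>2" by (simp add: ell_def inner_prod' evec_def)
    have "grad_on (cap \<theta>) ?w ?\<xi> = proj ?\<nu> G0" using grad_on_cap[OF xc U(1,2) d0 U(3)] by (simp add: cap_point_diff)
    then have "proj ?\<nu> G0 \<bullet> w0 = 0" using neu[OF cp(1)] cp(2) by (simp add: w0_def)
    then have "G0 \<bullet> w0 = 0" using pp(3) pp(5)[OF w\<nu>] by metis
    \<comment> \<open>Since \<open>u\<close> has no conormal derivative, only the derivative of
      \<open>ell\<close> remains. As \<open>ell = (sin \<theta>)\<^sup>2\<close> on the rim, it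
      cancels the normal contribution below.\<close>
    then have "G \<bullet> w0 = g0 ?\<xi> * cos \<theta> * sin \<theta>" by (simp add: G_def inner_add_left) (simp add: w0_def evec_def inner_prod')
    then have Zw: "supp_Z \<theta> u y t \<bullet> w0 = g0 ?\<xi> * cos \<theta> * sin \<theta>"
    proof -
      have "proj ?\<nu> G \<bullet> w0 = G \<bullet> w0" by (simp only: pp(3) pp(5)[OF w\<nu>])
      moreover have "?\<nu> \<bullet> w0 = 0" using w\<nu> by (simp add: inner_commute)
      ultimately show ?thesis using \<open>G \<bullet> w0 = _\<close> by (simp add: Z inner_add_left)
    qed
    have Z\<nu>: "supp_Z \<theta> u y t \<bullet> ?\<nu> = f" using pp(1) \<nu>\<nu> by (simp add: Z inner_add_left)
    have "snd (supp_Z \<theta> u y t) = supp_Z \<theta> u y t \<bullet> (0, 1)" by (simp add: inner_prod')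
    also have "\<dots> = cos \<theta> * f - sin \<theta> * (g0 ?\<xi> * cos \<theta> * sin \<theta>)" unfolding e1 by (simp only: inner_diff_right inner_scaleR_right Zw Z\<nu>)
    also have "\<dots> = 0" by (simp add: f_def ell g0w power2_eq_square)
    finally have s0: "snd (supp_Z \<theta> u y t) = 0" .
    have "y \<bullet> supp_D \<theta> u y t = supp_Z \<theta> u y t \<bullet> lift y" using s0 by (simp add: inner_prod' lift_def supp_D_def inner_commute)
    also have "\<dots> = norm (lift y) * f" by (subst norm_lift_unit[symmetric]) (simp only: inner_scaleR_right Z\<nu>)
    finally show "y \<bullet> supp_D \<theta> u y t = supp_H \<theta> u y t" by (simp add: supp_H_def f_def)
  qed
qed

lemma compact_cap: "compact (cap \<theta> :: 'n::finite ambient set)" and interior_cap: "interior (cap \<theta> :: 'n ambient set) = {}"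
proof -
  have eq: "(cap \<theta> :: 'n ambient set) = sphere (cos \<theta> *\<^sub>R evec) 1 \<inter> {x. 0 \<le> snd x}" by (auto simp: cap_iff dist_norm norm_minus_commute)
  have "closed {x :: 'n ambient. 0 \<le> snd x}" by (intro closed_Collect_le continuous_intros)
  then show "compact (cap \<theta> :: 'n ambient set)" unfolding eq by (intro compact_Int_closed compact_sphere)
  have "interior (cap \<theta> :: 'n ambient set) \<subseteq> sphere (cos \<theta> *\<^sub>R evec) 1" unfolding eq using interior_subset by blast
  then have "negligible (interior (cap \<theta> :: 'n ambient set))" by (rule negligible_subset[OF negligible_sphere])
  then show "interior (cap \<theta> :: 'n ambient set) = {}" using open_not_negligible open_interior by blast
qed

text \<open>The data of the cap itself, whose capillary support function is 1, so that
  \<open>H\<close> is \<open>norm (lift y)\<close> times \<open>ell\<close>.\<close>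

lemma strict_support_cap:
  "strict_support_fn (tan \<theta>) (\<lambda>y::real^'n::finite. norm (lift y) - cos \<theta>) (\<lambda>y. (1 / norm (lift y)) *\<^sub>R y) (\<lambda>y. (1 / norm (lift y)) *\<^sub>R gram y)"
proof
  show "0 < tan \<theta>" by (rule trig)
next
  fix y :: "real^'n" assume y: "norm y \<le> tan \<theta>"
  have "unit_lift y \<bullet> (v, 0) = ((1 / norm (lift y)) *\<^sub>R y) \<bullet> v" for v by (simp add: inner_prod' unit_lift_comp)
  then show "((\<lambda>y. norm (lift y) - cos \<theta>) has_derivative (\<lambda>v. ((1 / norm (lift y)) *\<^sub>R y) \<bullet> v)) (at y within cball 0 (tan \<theta>))"
    using has_derivative_diff[OF unit_lift_deriv(1)[of y "cball 0 (tan \<theta>)"] has_derivative_const[of "cos \<theta>"]] by simp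
  have "fst (hproj y v) = gram y *v v" for v
    by (simp add: hproj_def proj_def gram_mult unit_lift_comp inner_prod' power2_eq_square inner_commute)
  then show "((\<lambda>y. (1 / norm (lift y)) *\<^sub>R y) has_derivative (\<lambda>v. ((1 / norm (lift y)) *\<^sub>R gram y) *v v)) (at y within cball 0 (tan \<theta>))"
    using has_derivative_fst[OF unit_lift_deriv(2)[of y "cball 0 (tan \<theta>)"]]
    by (simp add: unit_lift_comp[abs_def] scaleR_matrix_vector_assoc)
  fix v :: "real^'n" assume "v \<noteq> 0"
  then show "0 < v \<bullet> (((1 / norm (lift y)) *\<^sub>R gram y) *v v)"
    using gram_pos[of v y] norm_lift_pos[of y] by (simp flip: scaleR_matrix_vector_assoc)
next
  fix y :: "real^'n" assume y: "norm y = tan \<theta>"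
  have nl: "norm (lift y) = 1 / cos \<theta>" using norm_lift_eq[OF y] trig(2) by (simp add: field_simps)
  have "y \<bullet> y = (tan \<theta>)\<^sup>2" using y by (metis dot_square_norm)
  then show "y \<bullet> ((1 / norm (lift y)) *\<^sub>R y) = norm (lift y) - cos \<theta>"
    using tan_sq trig(2) by (simp add: nl) (simp add: field_simps power2_eq_square)
qed

lemma enclosed_cap:
  "enclosed_region (cap \<theta> :: 'n::finite ambient set) = body (tan \<theta>) (\<lambda>y. norm (lift y) - cos \<theta>)"
proof (rule enclosed_region_eq_body)
  interpret strict_support_fn "tan \<theta>" "\<lambda>y::real^'n. norm (lift y) - cos \<theta>" "\<lambda>y. (1 / norm (lift y)) *\<^sub>R y" "\<lambda>y. (1 / norm (lift y)) *\<^sub>R gram y"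
    by (rule strict_support_cap)
  show "support_fn (tan \<theta>) (\<lambda>y::real^'n. norm (lift y) - cos \<theta>) (\<lambda>y. (1 / norm (lift y)) *\<^sub>R y)" by unfold_locales
  show "cap \<theta> \<subseteq> (closed_halfspace :: 'n ambient set)" by (auto simp: cap_def)
  show "0 < norm (lift y) - cos \<theta>" for y :: "real^'n" using norm_lift(2)[of y] trig by linarith
  have dec: "fst X \<bullet> y + snd X = (X - cos \<theta> *\<^sub>R evec) \<bullet> lift y - cos \<theta>" for X :: "'n ambient" and y
    by (simp add: inner_prod' lift_def evec_def)
  fix y :: "real^'n" assume y: "norm y \<le> tan \<theta>"
  show "fst X \<bullet> y + snd X \<le> norm (lift y) - cos \<theta>" if "X \<in> cap \<theta>" for X :: "'n ambient"
    using that norm_cauchy_schwarz[of "X - cos \<theta> *\<^sub>R evec" "lift y"] by (simp add: dec cap_iff)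
  have "unit_lift y \<bullet> (norm (lift y) *\<^sub>R unit_lift y) = norm (lift y)" using norm_unit_lift[of y] unfolding norm_eq_1 by simp
  then have "unit_lift y \<bullet> lift y = norm (lift y)" by (simp only: norm_lift_unit)
  then show "\<exists>X\<in>cap \<theta>. fst X \<bullet> y + snd X = norm (lift y) - cos \<theta>"
    using cap_point_in_cap[OF y] by (intro bexI[of _ "cap_point \<theta> y"]) (simp_all only: dec cap_point_diff)
qed (rule compact_cap interior_cap)+

text \<open>The weight is exactly \<open>H * det D2\<close> for the support data of the cap, so the
  cone formula applies to the cap.\<close>

lemma total_cap_density:
  "(LINT y:cball (0::real^'n) (tan \<theta>)|lborel. cap_density \<theta> y) =
     (CARD('n) + 1) * measure lebesgue (enclosed_region (cap \<theta> :: 'n::finite ambient set))"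
proof -
  interpret strict_support_fn "tan \<theta>" "\<lambda>y::real^'n. norm (lift y) - cos \<theta>" "\<lambda>y. (1 / norm (lift y)) *\<^sub>R y" "\<lambda>y. (1 / norm (lift y)) *\<^sub>R gram y"
    by (rule strict_support_cap)
  have c: "continuous_on (cball 0 (tan \<theta>)) (\<lambda>y::real^'n. (1 / norm (lift y)) *\<^sub>R gram y)"
    using norm_lift_pos by (intro continuous_intros continuous_norm_lift continuous_gram) (auto simp: less_imp_neq[symmetric])
  have "0 < norm (lift y) - cos \<theta>" for y :: "real^'n" using norm_lift(2)[of y] trig by linarith
  from cone_volume[OF c this] show ?thesis unfolding enclosed_cap cap_density_def by simp
qed

lemma capillary_support_attained:
  fixes S :: "'n::finite ambient set"
  assumes S: "compact S" "S \<noteq> {}"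
  defines "m \<equiv> \<lambda>y. norm (lift y) * (ell \<theta> (cap_point \<theta> y) * capillary_support \<theta> S (cap_point \<theta> y))"
  shows "X \<in> S \<Longrightarrow> fst X \<bullet> y + snd X \<le> m y" "\<exists>X\<in>S. fst X \<bullet> y + snd X = m y"
proof -
  have dec: "fst X \<bullet> y + snd X = norm (lift y) * (unit_lift y \<bullet> X)" for X :: "'n ambient"
  proof -
    have "fst X \<bullet> y + snd X = lift y \<bullet> X" by (simp add: lift_def inner_prod' inner_commute)
    then show ?thesis by (metis inner_scaleR_left norm_lift_unit)
  qed
  have "continuous_on S (\<lambda>X. unit_lift y \<bullet> X)" by (intro continuous_intros)
  then obtain X0 where X0: "X0 \<in> S" "\<forall>X\<in>S. unit_lift y \<bullet> X \<le> unit_lift y \<bullet> X0"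
    using continuous_attains_sup[OF S] by blast
  have "(SUP X\<in>S. unit_lift y \<bullet> X) = unit_lift y \<bullet> X0" by (rule cSup_eq_maximum) (use X0 in auto)
  then have m: "m y = norm (lift y) * (unit_lift y \<bullet> X0)"
    unfolding m_def capillary_support_def using ell_cap_point(2)[of y] by (simp add: cap_point_diff)
  show "\<exists>X\<in>S. fst X \<bullet> y + snd X = m y" using X0(1) by (auto simp: dec m)
  show "fst X \<bullet> y + snd X \<le> m y" if "X \<in> S" using X0(2) that norm_lift_pos[of y] by (simp add: dec m)
qed

end

lemma inner_hproj: "w \<bullet> hproj y v = v \<bullet> fst (proj (unit_lift y) w)"
proof -
  have "w \<bullet> hproj y v = (v, 0) \<bullet> proj (unit_lift y) w" by (simp only: inner_commute[of w] hproj_props(4))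
  also have "\<dots> = v \<bullet> fst (proj (unit_lift y) w)" by (simp add: inner_prod')
  finally show ?thesis .
qed

section \<open>Derivatives through ambient extensions\<close>

text \<open>The function \<open>ell * u\<close> lives on the cap; near a space-time point it is
  replaced by an ambient function \<open>g\<close> with two derivatives. \<open>U\<close> contains
  positive times only, where joint smoothness is assumed.\<close>

locale local_extension = acute_angle +
  fixes u :: "'n::finite ambient \<Rightarrow> real \<Rightarrow> real" and U :: "('n ambient \<times> real) set"
    and g :: "'n ambient \<times> real \<Rightarrow> real" and G Hg
  assumes openU: "open U"
    and U_pos: "q \<in> U \<Longrightarrow> 0 < snd q"
    and ext: "q \<in> U \<Longrightarrow> fst q \<in> cap \<theta> \<Longrightarrow> g q = ell \<theta> (fst q) * u (fst q) (snd q)"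
    and dg: "q \<in> U \<Longrightarrow> (g has_derivative (\<lambda>v. G q \<bullet> v)) (at q)"
    and dG: "q \<in> U \<Longrightarrow> (G has_derivative Hg q) (at q)"
    and cHg: "continuous_on U (\<lambda>q. Hg q w)"
begin

definition chart :: "real^'n \<Rightarrow> real \<Rightarrow> 'n ambient \<times> real" where "chart y t = (cap_point \<theta> y, t)"
definition kap :: "real^'n \<Rightarrow> real" where "kap y = 1 / norm (lift y)"
text \<open>An ambient linear map that represents \<open>support_form\<close> on the tangent space,
  see \<open>rep_form\<close>.\<close>

definition shape :: "real^'n \<Rightarrow> real \<Rightarrow> 'n ambient \<Rightarrow> 'n ambient" where
  "shape y t v = fst (Hg (chart y t) (v, 0)) + (g (chart y t) - fst (G (chart y t)) \<bullet> unit_lift y) *\<^sub>R v"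

lemma open_slice: "open {\<eta>. (\<eta>, t) \<in> U}"
proof -
  have "open ((\<lambda>\<eta>. (\<eta>, t)) -` U)" by (rule open_vimage[OF openU]) (intro continuous_intros)
  then show ?thesis by (simp add: vimage_def)
qed

lemma slice_deriv:
  assumes "(\<eta>, t) \<in> U"
  shows "((\<lambda>\<eta>. g (\<eta>, t)) has_derivative (\<lambda>v. fst (G (\<eta>, t)) \<bullet> v)) (at \<eta>)"
    and "((\<lambda>\<eta>. fst (G (\<eta>, t))) has_derivative (\<lambda>v. fst (Hg (\<eta>, t) (v, 0)))) (at \<eta>)"
proof -
  have i: "((\<lambda>\<eta>. (\<eta>, t)) has_derivative (\<lambda>v. (v, 0))) (at \<eta>)" by (auto intro!: derivative_eq_intros)
  show "((\<lambda>\<eta>. g (\<eta>, t)) has_derivative (\<lambda>v. fst (G (\<eta>, t)) \<bullet> v)) (at \<eta>)"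
    using has_derivative_compose[OF i dg[OF assms]] by (rule has_derivative_eq_rhs) (simp add: fun_eq_iff inner_prod_def)
  show "((\<lambda>\<eta>. fst (G (\<eta>, t))) has_derivative (\<lambda>v. fst (Hg (\<eta>, t) (v, 0)))) (at \<eta>)"
    by (rule has_derivative_fst[OF has_derivative_compose[OF i dG[OF assms]]])
qed

lemma rep_Z:
  assumes y: "norm y \<le> tan \<theta>" and q: "chart y t \<in> U"
  shows "supp_Z \<theta> u y t = fst (G (chart y t)) + (g (chart y t) - fst (G (chart y t)) \<bullet> unit_lift y) *\<^sub>R unit_lift y"
proof -
  note xc = cap_point_in_cap[OF y]
  have q': "(cap_point \<theta> y, t) \<in> U" using q by (simp add: chart_def)
  have "grad_on (cap \<theta>) (\<lambda>\<eta>. ell \<theta> \<eta> * u \<eta> t) (cap_point \<theta> y) = proj (cap_point \<theta> y - cos \<theta> *\<^sub>R evec) (fst (G (cap_point \<theta> y, t)))"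
    by (rule grad_on_cap[OF xc open_slice _ slice_deriv(1)[OF q']]) (use q' ext in force)+
  moreover have "ell \<theta> (cap_point \<theta> y) * u (cap_point \<theta> y) t = g (chart y t)" using ext[OF q'] xc by (simp add: chart_def)
  ultimately show ?thesis by (simp add: supp_Z_def cap_point_diff proj_def chart_def scaleR_diff_left)
qed

lemma linear_Hg: "q \<in> U \<Longrightarrow> linear (Hg q)" using dG has_derivative_linear by blast

lemma linear_shape: "chart y t \<in> U \<Longrightarrow> linear (shape y t)"
proof -
  assume q: "chart y t \<in> U"
  have p: "(a + b, 0) = (a, 0) + (b, 0::real)" "(r *\<^sub>R a, 0) = r *\<^sub>R (a, 0::real)" for a b :: "'n ambient" and r by simp_all
  show ?thesis
    by (rule linearI; simp only: shape_def p linear_add[OF linear_Hg[OF q]] linear_cmul[OF linear_Hg[OF q]]) (simp_all add: algebra_simps)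
qed

lemma rep_form:
  assumes y: "norm y \<le> tan \<theta>" and q: "chart y t \<in> U" and v: "v \<bullet> unit_lift y = 0" and w: "w \<bullet> unit_lift y = 0"
  shows "support_form \<theta> (\<lambda>\<eta>. u \<eta> t) (cap_point \<theta> y) v w = shape y t v \<bullet> w"
proof -
  note xc = cap_point_in_cap[OF y]
  have q': "(cap_point \<theta> y, t) \<in> U" using q by (simp add: chart_def)
  have "hess_on (cap \<theta>) (\<lambda>\<eta>. ell \<theta> \<eta> * u \<eta> t) (cap_point \<theta> y) v w =
      fst (Hg (cap_point \<theta> y, t) (v, 0)) \<bullet> w - (fst (G (cap_point \<theta> y, t)) \<bullet> (cap_point \<theta> y - cos \<theta> *\<^sub>R evec)) * (v \<bullet> w)"
    by (rule hess_on_cap[OF xc open_slice, where g = "\<lambda>\<eta>. g (\<eta>, t)" and G = "\<lambda>\<eta>. fst (G (\<eta>, t))"])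
      (use q' ext v w in \<open>auto intro!: slice_deriv simp: cap_point_diff\<close>)
  moreover have "ell \<theta> (cap_point \<theta> y) * u (cap_point \<theta> y) t = g (chart y t)" using ext[OF q'] xc by (simp add: chart_def)
  ultimately show ?thesis by (simp add: support_form_def shape_def cap_point_diff chart_def inner_add_left left_diff_distrib)
qed

lemma supp_D2_nth:
  assumes y: "norm y \<le> tan \<theta>" and q: "chart y t \<in> U"
  shows "supp_D2 \<theta> u y t $ i $ j = kap y * (shape y t (hproj y (axis j 1)) \<bullet> hproj y (axis i 1))"
  by (simp add: supp_D2_def kap_def rep_form[OF y q hproj_props(1) hproj_props(1)])

lemma supp_D2_mult:
  assumes y: "norm y \<le> tan \<theta>" and q: "chart y t \<in> U"
  shows "supp_D2 \<theta> u y t *v v = kap y *\<^sub>R fst (proj (unit_lift y) (shape y t (hproj y v)))"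
proof -
  note L = linear_shape[OF q]
  have Lv: "shape y t (hproj y v) = (\<Sum>j\<in>UNIV. v $ j *\<^sub>R shape y t (hproj y (axis j 1)))"
    by (subst hproj_sum[of y v]) (simp add: linear_sum[OF L] linear_cmul[OF L])
  have "(supp_D2 \<theta> u y t *v v) $ i = (kap y *\<^sub>R fst (proj (unit_lift y) (shape y t (hproj y v)))) $ i" for i
  proof -
    have "(supp_D2 \<theta> u y t *v v) $ i = (\<Sum>j\<in>UNIV. kap y * ((v $ j *\<^sub>R shape y t (hproj y (axis j 1))) \<bullet> hproj y (axis i 1)))"
      by (simp add: matrix_vector_mult_def supp_D2_nth[OF y q] mult_ac)
    also have "\<dots> = kap y * (shape y t (hproj y v) \<bullet> hproj y (axis i 1))"
      unfolding Lv by (simp add: inner_sum_left sum_distrib_left)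
    also have "shape y t (hproj y v) \<bullet> hproj y (axis i 1) = fst (proj (unit_lift y) (shape y t (hproj y v))) $ i"
      by (simp add: inner_hproj inner_axis')
    finally show ?thesis by simp
  qed
  then show ?thesis by (simp add: vec_eq_iff)
qed

lemma supp_D2_form:
  assumes y: "norm y \<le> tan \<theta>" and q: "chart y t \<in> U"
  shows "v \<bullet> (supp_D2 \<theta> u y t *v v) = kap y * support_form \<theta> (\<lambda>\<eta>. u \<eta> t) (cap_point \<theta> y) (hproj y v) (hproj y v)"
proof -
  show ?thesis by (simp add: inner_hproj supp_D2_mult[OF y q] rep_form[OF y q hproj_props(1) hproj_props(1)])
qed

text \<open>\<open>shape\<close> is the ambient Hessian plus a multiple of the identity, so symmetry
  reduces to \<open>hessian_symmetric\<close>.\<close>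

lemma supp_D2_sym:
  assumes y: "norm y \<le> tan \<theta>" and q: "chart y t \<in> U"
  shows "transpose (supp_D2 \<theta> u y t) = supp_D2 \<theta> u y t"
proof -
  have f: "fst a \<bullet> w = a \<bullet> (w, 0)" for a :: "'n ambient \<times> real" and w by (simp add: inner_prod_def)
  have hs: "fst (Hg (chart y t) (v, 0)) \<bullet> w = fst (Hg (chart y t) (w, 0)) \<bullet> v" for v w
    unfolding f by (rule hessian_symmetric[OF openU dg dG cHg q])
  have "shape y t v \<bullet> w = shape y t w \<bullet> v" for v w
    unfolding shape_def inner_add_left inner_scaleR_left by (simp only: hs[of v w] inner_commute[of v w])
  then show ?thesis by (simp add: vec_eq_iff transpose_def supp_D2_nth[OF y q])
qed

lemma det_supp_D2:
  assumes y: "norm y \<le> tan \<theta>" and q: "chart y t \<in> U"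
  shows "det (supp_D2 \<theta> u y t) = det (kap y *\<^sub>R gram y) *
    det_form (tangent_space (cap \<theta>) (cap_point \<theta> y)) (support_form \<theta> (\<lambda>\<eta>. u \<eta> t) (cap_point \<theta> y))"
  unfolding supp_D2_def kap_def[symmetric] det_scaleR tangent_space_cap[OF cap_point_in_cap[OF y]] cap_point_diff
  by (subst det_form_hproj[OF linear_shape[OF q]]) (simp_all add: rep_form[OF y q])

lemma open_chart: "open {p. chart (fst p) (snd p) \<in> U}"
proof -
  have "continuous_on UNIV (\<lambda>p. cap_point \<theta> (fst p))"
    by (rule continuous_on_compose2[OF continuous_cap_point(2)[of UNIV]]) (auto intro: continuous_intros)
  then have "open ((\<lambda>p. chart (fst p) (snd p)) -` U)"
    unfolding chart_def by (intro open_vimage[OF openU] continuous_intros)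
  then show ?thesis by (simp add: vimage_def)
qed

lemma supp_H_deriv:
  assumes y: "norm y \<le> tan \<theta>" and q: "chart y t \<in> U"
  shows "((\<lambda>p. supp_H \<theta> u (fst p) (snd p)) has_derivative
     (\<lambda>(v, r). supp_D \<theta> u y t \<bullet> v + r *\<^sub>R (norm (lift y) * snd (G (chart y t))))) (at (y, t) within cball 0 (tan \<theta>) \<times> {0<..})"
proof -
  have "((\<lambda>p. norm (lift (fst p)) * g (cap_point \<theta> (fst p), snd p)) has_derivative
     (\<lambda>(v, r). supp_D \<theta> u y t \<bullet> v + r *\<^sub>R (norm (lift y) * snd (G (chart y t))))) (at (y, t) within cball 0 (tan \<theta>) \<times> {0<..})"
    using joint_support_deriv(1)[OF dg[OF q, unfolded chart_def]] by (simp add: supp_D_def rep_Z[OF y q] chart_def)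
  then show ?thesis
  proof (rule has_derivative_transform_local[OF _ open_chart])
    show "(y, t) \<in> {p. chart (fst p) (snd p) \<in> U}" using q by simp
    show "(y, t) \<in> cball 0 (tan \<theta>) \<times> {0<..}" using y U_pos[OF q] by (simp add: chart_def)
    fix p assume "p \<in> {p. chart (fst p) (snd p) \<in> U}" "p \<in> cball 0 (tan \<theta>) \<times> {0<..}"
    then show "norm (lift (fst p)) * g (cap_point \<theta> (fst p), snd p) = supp_H \<theta> u (fst p) (snd p)"
      using ext[of "chart (fst p) (snd p)"] cap_point_in_cap[of "fst p"] by (auto simp: chart_def supp_H_def)
  qed
qed

text \<open>The time derivative of the extension is that of \<open>ell * u\<close>. In the quotient
  the Gram determinant cancels, and \<open>norm (lift y) - cos \<theta>\<close> supplies the factor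
  \<open>norm (lift y) * ell\<close>.\<close>

lemma time_deriv:
  assumes y: "norm y \<le> tan \<theta>" and q: "chart y t \<in> U"
    and pde: "(u (cap_point \<theta> y) has_real_derivative
       u (cap_point \<theta> y) t - 1 / det_form (tangent_space (cap \<theta>) (cap_point \<theta> y)) (support_form \<theta> (\<lambda>\<eta>. u \<eta> t) (cap_point \<theta> y))) (at t within {0..})"
  shows "norm (lift y) * snd (G (chart y t)) = supp_H \<theta> u y t - cap_density \<theta> y / det (supp_D2 \<theta> u y t)"
proof -
  let ?\<xi> = "cap_point \<theta> y"
  let ?df = "det_form (tangent_space (cap \<theta>) ?\<xi>) (support_form \<theta> (\<lambda>\<eta>. u \<eta> t) ?\<xi>)"
  have t: "0 < t" using U_pos[OF q] by (simp add: chart_def)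
  have q': "(?\<xi>, t) \<in> U" using q by (simp add: chart_def)
  note xc = cap_point_in_cap[OF y]
  have "at t within {0..} = at t" using t by (intro at_within_interior) simp
  then have 1: "((\<lambda>s. ell \<theta> ?\<xi> * u ?\<xi> s) has_real_derivative ell \<theta> ?\<xi> * (u ?\<xi> t - 1 / ?df)) (at t)"
    using pde by (intro DERIV_cmult) simp
  have i: "((\<lambda>s. (?\<xi>, s)) has_derivative (\<lambda>r. (0, r))) (at t)" by (auto intro!: derivative_eq_intros)
  have "((\<lambda>s. g (?\<xi>, s)) has_derivative (\<lambda>r. snd (G (?\<xi>, t)) * r)) (at t)"
    using has_derivative_compose[OF i dg[OF q']] by (rule has_derivative_eq_rhs) (simp add: fun_eq_iff inner_prod_def)
  then have "((\<lambda>s. ell \<theta> ?\<xi> * u ?\<xi> s) has_derivative (\<lambda>r. snd (G (?\<xi>, t)) * r)) (at t)"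
  proof (rule has_derivative_transform_local)
    show "open ((\<lambda>s. (?\<xi>, s)) -` U)" by (rule open_vimage[OF openU]) (intro continuous_intros)
    show "g (?\<xi>, s) = ell \<theta> ?\<xi> * u ?\<xi> s" if "s \<in> (\<lambda>s. (?\<xi>, s)) -` U" for s using ext[of "(?\<xi>, s)"] that xc by simp
  qed (use q' in auto)
  then have 2: "snd (G (?\<xi>, t)) = ell \<theta> ?\<xi> * (u ?\<xi> t - 1 / ?df)"
    by (intro DERIV_unique[OF _ 1]) (simp add: has_field_derivative_def)
  have dg0: "det (kap y *\<^sub>R gram y) \<noteq> 0"
    using det_gram_pos[of y] norm_lift_pos[of y] by (simp add: det_scaleR kap_def)
  have "cap_density \<theta> y / det (supp_D2 \<theta> u y t) = (norm (lift y) - cos \<theta>) / ?df"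
    unfolding det_supp_D2[OF y q] cap_density_def kap_def[symmetric] using dg0 by simp
  also have "\<dots> = norm (lift y) * ell \<theta> ?\<xi> * (1 / ?df)" by (simp add: ell_cap_point(1))
  finally show ?thesis by (simp add: chart_def 2 supp_H_def right_diff_distrib mult.assoc)
qed

text \<open>The formula of \<open>rep_Z\<close> is differentiated in space and time; the spatial
  part collapses to the projected \<open>shape\<close> by orthogonality of \<open>hproj\<close> and
  the normal.\<close>

lemma supp_D_deriv:
  assumes y: "norm y \<le> tan \<theta>" and q: "chart y t \<in> U"
  shows "((\<lambda>p. supp_D \<theta> u (fst p) (snd p)) has_derivative
     (\<lambda>(v, r). supp_D2 \<theta> u y t *v v + r *\<^sub>R supp_e \<theta> u y t)) (at (y, t) within cball 0 (tan \<theta>) \<times> {0<..})"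
proof -
  let ?S = "cball (0::real^'n) (tan \<theta>) \<times> {0::real<..}" and ?\<nu> = "unit_lift y" and ?q = "chart y t"
  let ?k = "kap y"
  define B where "B = fst (Hg ?q (0, 1))"
  \<comment> \<open>The time coefficient found here is a witness for the choice in
    \<open>supp_e\<close>.\<close>
  define e where "e = fst (B + (snd (G ?q) - B \<bullet> ?\<nu>) *\<^sub>R ?\<nu>)"
  note c = joint_support_deriv(2)[OF dg[OF q, unfolded chart_def], of ?S, folded kap_def]
  have q1: "((\<lambda>p. (cap_point \<theta> (fst p), snd p)) (y, t)) = ?q" by (simp add: chart_def)
  have Gd: "((\<lambda>p. G (cap_point \<theta> (fst p), snd p)) has_derivative (\<lambda>(v, r). Hg ?q (?k *\<^sub>R hproj y v, r))) (at (y, t) within ?S)"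
    using has_derivative_compose[OF c, of G "Hg ?q"] dG[OF q] unfolding q1 by (simp add: case_prod_unfold)
  have gd: "((\<lambda>p. g (cap_point \<theta> (fst p), snd p)) has_derivative (\<lambda>(v, r). G ?q \<bullet> (?k *\<^sub>R hproj y v, r))) (at (y, t) within ?S)"
    using has_derivative_compose[OF c, of g "\<lambda>v. G ?q \<bullet> v"] dg[OF q] unfolding q1 by (simp add: case_prod_unfold)
  have nd: "((\<lambda>p. unit_lift (fst p)) has_derivative (\<lambda>p. ?k *\<^sub>R hproj y (fst p))) (at (y, t) within ?S)"
    by (rule has_derivative_compose[OF has_derivative_fst[OF has_derivative_ident]])
      (use unit_lift_deriv(2)[of y UNIV] in \<open>simp add: kap_def\<close>)
  define Z where "Z = (\<lambda>p. fst (G (cap_point \<theta> (fst p), snd p)) + (g (cap_point \<theta> (fst p), snd p) - fst (G (cap_point \<theta> (fst p), snd p)) \<bullet> unit_lift (fst p)) *\<^sub>R unit_lift (fst p))"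
  have "(Z has_derivative (\<lambda>p. fst (Hg ?q (?k *\<^sub>R hproj y (fst p), snd p)) +
      ((g ?q - fst (G ?q) \<bullet> ?\<nu>) *\<^sub>R (?k *\<^sub>R hproj y (fst p)) +
      (G ?q \<bullet> (?k *\<^sub>R hproj y (fst p), snd p) - (fst (G ?q) \<bullet> (?k *\<^sub>R hproj y (fst p)) + fst (Hg ?q (?k *\<^sub>R hproj y (fst p), snd p)) \<bullet> ?\<nu>)) *\<^sub>R ?\<nu>)))
      (at (y, t) within ?S)"
    using has_derivative_add[OF has_derivative_fst[OF Gd] has_derivative_scaleR[OF has_derivative_diff[OF gd
        has_derivative_inner[OF has_derivative_fst[OF Gd] nd]] nd]]
    unfolding Z_def by (simp add: case_prod_unfold chart_def)
  from has_derivative_fst[OF this]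
  have "((\<lambda>p. fst (Z p)) has_derivative (\<lambda>(v, r). supp_D2 \<theta> u y t *v v + r *\<^sub>R e)) (at (y, t) within ?S)"
  proof (rule has_derivative_eq_rhs)
    show "(\<lambda>p. fst (fst (Hg ?q (?k *\<^sub>R hproj y (fst p), snd p)) +
      ((g ?q - fst (G ?q) \<bullet> ?\<nu>) *\<^sub>R (?k *\<^sub>R hproj y (fst p)) +
      (G ?q \<bullet> (?k *\<^sub>R hproj y (fst p), snd p) - (fst (G ?q) \<bullet> (?k *\<^sub>R hproj y (fst p)) + fst (Hg ?q (?k *\<^sub>R hproj y (fst p), snd p)) \<bullet> ?\<nu>)) *\<^sub>R ?\<nu>)))
      = (\<lambda>(v, r). supp_D2 \<theta> u y t *v v + r *\<^sub>R e)"
    proof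
      fix p :: "(real^'n) \<times> real"
      obtain v r where p: "p = (v, r)" by (cases p)
      let ?h = "hproj y v" and ?c = "g ?q - fst (G ?q) \<bullet> ?\<nu>"
      define A where "A = fst (Hg ?q (?h, 0))"
      have "(?k *\<^sub>R ?h, r) = ?k *\<^sub>R (?h, 0) + r *\<^sub>R (0, 1)" by simp
      then have H: "fst (Hg ?q (?k *\<^sub>R ?h, r)) = ?k *\<^sub>R A + r *\<^sub>R B"
        by (simp only: linear_add[OF linear_Hg[OF q]] linear_cmul[OF linear_Hg[OF q]] fst_add fst_scaleR A_def B_def)
      have Gi: "G ?q \<bullet> (?k *\<^sub>R ?h, r) = fst (G ?q) \<bullet> (?k *\<^sub>R ?h) + snd (G ?q) * r" by (simp add: inner_prod_def)
      have pr: "proj ?\<nu> (A + ?c *\<^sub>R ?h) = A + ?c *\<^sub>R ?h - (A \<bullet> ?\<nu>) *\<^sub>R ?\<nu>"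
        using hproj_props(1)[of y v] by (simp add: proj_def inner_add_left)
      have "supp_D2 \<theta> u y t *v v + r *\<^sub>R e = fst (?k *\<^sub>R proj ?\<nu> (A + ?c *\<^sub>R ?h) + r *\<^sub>R (B + (snd (G ?q) - B \<bullet> ?\<nu>) *\<^sub>R ?\<nu>))"
        by (simp add: supp_D2_mult[OF y q] shape_def A_def e_def)
      also have "?k *\<^sub>R proj ?\<nu> (A + ?c *\<^sub>R ?h) + r *\<^sub>R (B + (snd (G ?q) - B \<bullet> ?\<nu>) *\<^sub>R ?\<nu>) =
         (?k *\<^sub>R A + r *\<^sub>R B) + (?c *\<^sub>R (?k *\<^sub>R ?h) + (fst (G ?q) \<bullet> (?k *\<^sub>R ?h) + snd (G ?q) * r - (fst (G ?q) \<bullet> (?k *\<^sub>R ?h) + (?k *\<^sub>R A + r *\<^sub>R B) \<bullet> ?\<nu>)) *\<^sub>R ?\<nu>)"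
        unfolding pr by (simp add: inner_add_left algebra_simps)
      finally show "fst (fst (Hg ?q (?k *\<^sub>R hproj y (fst p), snd p)) +
      ((g ?q - fst (G ?q) \<bullet> ?\<nu>) *\<^sub>R (?k *\<^sub>R hproj y (fst p)) +
      (G ?q \<bullet> (?k *\<^sub>R hproj y (fst p), snd p) - (fst (G ?q) \<bullet> (?k *\<^sub>R hproj y (fst p)) + fst (Hg ?q (?k *\<^sub>R hproj y (fst p), snd p)) \<bullet> ?\<nu>)) *\<^sub>R ?\<nu>))
      = (case p of (v, r) \<Rightarrow> supp_D2 \<theta> u y t *v v + r *\<^sub>R e)"
        by (simp only: p prod.case fst_conv snd_conv H Gi)
    qed
  qed
  then have "((\<lambda>p. supp_D \<theta> u (fst p) (snd p)) has_derivative (\<lambda>(v, r). supp_D2 \<theta> u y t *v v + r *\<^sub>R e)) (at (y, t) within ?S)"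
  proof (rule has_derivative_transform_local[OF _ open_chart])
    show "(y, t) \<in> {p. chart (fst p) (snd p) \<in> U}" using q by simp
    show "(y, t) \<in> ?S" using y U_pos[OF q] by (simp add: chart_def)
    fix p assume "p \<in> {p. chart (fst p) (snd p) \<in> U}" "p \<in> ?S"
    then have "norm (fst p) \<le> tan \<theta>" "chart (fst p) (snd p) \<in> U" by auto
    from rep_Z[OF this] show "fst (Z p) = supp_D \<theta> u (fst p) (snd p)" by (simp add: supp_D_def Z_def chart_def)
  qed
  then show ?thesis unfolding supp_e_def by (rule someI)
qed

lemma supp_D2_continuous:
  "continuous_on (cball 0 (tan \<theta>) \<times> {0<..} \<inter> {p. chart (fst p) (snd p) \<in> U}) (\<lambda>p. supp_D2 \<theta> u (fst p) (snd p))"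
    (is "continuous_on ?X _")
proof -
  let ?c = "\<lambda>p. chart (fst p) (snd p)"
  have cc: "continuous_on ?X ?c"
    unfolding chart_def by (intro continuous_on_Pair continuous_on_snd continuous_on_id continuous_on_compose2[OF continuous_cap_point(2)[of UNIV]] continuous_on_fst) auto
  have sub: "?c ` ?X \<subseteq> U" by auto
  have cu: "continuous_on ?X (\<lambda>p. unit_lift (fst p))"
    by (intro continuous_on_compose2[OF continuous_cap_point(1)[of UNIV]] continuous_on_fst continuous_on_id) auto
  have ch: "continuous_on ?X (\<lambda>p. hproj (fst p) v)" for v
    unfolding hproj_def proj_def by (intro continuous_intros cu)
  have ck: "continuous_on ?X (\<lambda>p. kap (fst p))"
    unfolding kap_def lift_def by (intro continuous_intros) (auto simp: prod_eq_iff)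
  have cH: "continuous_on ?X (\<lambda>p. Hg (?c p) w)" for w by (rule continuous_on_compose2[OF cHg cc sub])
  have "continuous_on U G" by (rule has_derivative_continuous_on) (rule has_derivative_at_withinI[OF dG])
  then have cG: "continuous_on ?X (\<lambda>p. G (?c p))" by (rule continuous_on_compose2[OF _ cc sub])
  have "continuous_on U g" by (rule has_derivative_continuous_on) (rule has_derivative_at_withinI[OF dg])
  then have cg: "continuous_on ?X (\<lambda>p. g (?c p))" by (rule continuous_on_compose2[OF _ cc sub])
  \<comment> \<open>Continuity of \<open>Hg\<close> is known only for a fixed argument vector, so
    the moving vector \<open>hproj\<close> is expanded in the standard basis.\<close>
  have exp: "L w = (\<Sum>b\<in>Basis. (w \<bullet> b) *\<^sub>R L b)" if l: "linear L" for w :: "'n ambient \<times> real" and L :: "'n ambient \<times> real \<Rightarrow> 'n ambient \<times> real"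
  proof -
    have "L w = L (\<Sum>b\<in>Basis. (w \<bullet> b) *\<^sub>R b)" by (subst euclidean_representation) (rule refl)
    also have "\<dots> = (\<Sum>b\<in>Basis. (w \<bullet> b) *\<^sub>R L b)" by (simp only: linear_sum[OF l] linear_cmul[OF l])
    finally show ?thesis .
  qed
  have cs: "continuous_on ?X (\<lambda>p. shape (fst p) (snd p) (hproj (fst p) v))" for v
  proof -
    have c0: "continuous_on ?X (\<lambda>p. (hproj (fst p) v, 0::real))" by (intro continuous_on_Pair ch continuous_on_const)
    have "continuous_on ?X (\<lambda>p. \<Sum>b\<in>Basis. ((hproj (fst p) v, 0) \<bullet> b) *\<^sub>R Hg (?c p) b)"
      by (intro continuous_on_sum continuous_on_scaleR continuous_on_inner c0 continuous_on_const cH)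
    then have "continuous_on ?X (\<lambda>p. Hg (?c p) (hproj (fst p) v, 0))"
    proof (rule continuous_on_eq)
      fix p assume "p \<in> ?X"
      then have "linear (Hg (?c p))" by (intro linear_Hg) simp
      from exp[OF this] show "(\<Sum>b\<in>Basis. ((hproj (fst p) v, 0) \<bullet> b) *\<^sub>R Hg (?c p) b) = Hg (?c p) (hproj (fst p) v, 0)" by (rule sym)
    qed
    then show ?thesis
      unfolding shape_def
      by (intro continuous_on_add continuous_on_fst continuous_on_scaleR continuous_on_diff continuous_on_inner cG cg cu ch)
  qed
  have "continuous_on ?X (\<lambda>p. \<chi> i j. kap (fst p) * (shape (fst p) (snd p) (hproj (fst p) (axis j 1)) \<bullet> hproj (fst p) (axis i 1)))"
    by (intro continuous_intros ck cs ch)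
  then show ?thesis by (rule continuous_on_eq) (auto simp: vec_eq_iff supp_D2_nth)
qed

end

section \<open>From the equation on the cap to the flow in coordinates\<close>

context acute_angle
begin

text \<open>A local extension of \<open>u\<close> is multiplied by the affine function that extends
  \<open>ell\<close>, and cut to positive times.\<close>

lemma ex_local_extension:
  fixes u :: "'n::finite ambient \<Rightarrow> real \<Rightarrow> real"
  assumes sm: "smooth_on (cap \<theta> \<times> {0<..}) (\<lambda>(\<xi>, t). u \<xi> t)" and y: "norm y \<le> tan \<theta>" and t: "0 < t"
  obtains U g G Hg where "local_extension \<theta> u U g G Hg" "(cap_point \<theta> y, t) \<in> U"
proof -
  have "(cap_point \<theta> y, t) \<in> cap \<theta> \<times> {0<..}" using t cap_point_in_cap[OF y] by simp
  then obtain V g0 where V: "open V" "(cap_point \<theta> y, t) \<in> V" "\<forall>k. Ck_on k V g0"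
    "\<forall>p\<in>V \<inter> cap \<theta> \<times> {0<..}. g0 p = (case p of (\<xi>, t) \<Rightarrow> u \<xi> t)"
    using sm unfolding smooth_on_def by blast
  define U where "U = V \<inter> UNIV \<times> {0<..}"
  define g where "g = (\<lambda>q. ((sin \<theta>)\<^sup>2 + (cos \<theta> *\<^sub>R evec, 0) \<bullet> q) * g0 q)"
  have l: "(sin \<theta>)\<^sup>2 + (cos \<theta> *\<^sub>R evec, 0) \<bullet> q = ell \<theta> (fst q)" for q :: "'n ambient \<times> real"
    by (simp add: ell_def inner_prod_def inner_commute distrib_left mult_ac)
  have "Ck_on 2 V g" unfolding g_def using V(3) by (intro Ck_on_mult Ck_on_affine) blast
  then obtain G Hg where GH: "\<And>x. x \<in> V \<Longrightarrow> (g has_derivative (\<lambda>v. G x \<bullet> v)) (at x)"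
    "\<And>x. x \<in> V \<Longrightarrow> (G has_derivative Hg x) (at x)" "\<And>w. continuous_on V (\<lambda>x. Hg x w)"
    by (rule Ck_on_2_gradient) blast
  have "local_extension \<theta> u U g G Hg"
  proof
    show "open U" unfolding U_def using V(1) by (intro open_Int open_Times) auto
    fix q assume q: "q \<in> U"
    show "0 < snd q" using q by (auto simp: U_def)
    show "g q = ell \<theta> (fst q) * u (fst q) (snd q)" if "fst q \<in> cap \<theta>"
    proof -
      have "q \<in> V \<inter> cap \<theta> \<times> {0<..}" using q that by (cases q) (auto simp: U_def)
      then show ?thesis using V(4) by (simp add: g_def l case_prod_unfold)
    qed
    show "(g has_derivative (\<lambda>v. G q \<bullet> v)) (at q)" "(G has_derivative Hg q) (at q)" using GH(1,2) q by (auto simp: U_def)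
  next
    show "continuous_on U (\<lambda>q. Hg q w)" for w by (rule continuous_on_subset[OF GH(3)]) (auto simp: U_def)
  qed
  moreover have "(cap_point \<theta> y, t) \<in> U" using V(2) t by (simp add: U_def)
  ultimately show ?thesis by (rule that)
qed

text \<open>The derivative conditions are local and are checked with an extension near each point.
  The second claim includes time 0, where it identifies the initial enclosed region.\<close>

lemma capillary_flow_of_solution:
  fixes u :: "'n::finite ambient \<Rightarrow> real \<Rightarrow> real"
  assumes sol: "solves_normalized_equation \<theta> u" and u_pos: "\<And>\<xi> t. 0 \<le> t \<Longrightarrow> \<xi> \<in> cap \<theta> \<Longrightarrow> 0 < u \<xi> t"
  shows "capillary_flow (tan \<theta>) (cap_density \<theta>) (supp_H \<theta> u) (supp_D \<theta> u) (supp_D2 \<theta> u) (supp_e \<theta> u) (real (CARD('n) + 1))"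
    and "0 \<le> t \<Longrightarrow> support_fn (tan \<theta>) (\<lambda>y. supp_H \<theta> u y t) (\<lambda>y. supp_D \<theta> u y t)"
proof -
  have sm: "smooth_on (cap \<theta> \<times> {0<..}) (\<lambda>(\<xi>, t). u \<xi> t)"
    and cont: "continuous_on (cap \<theta> \<times> {0..}) (\<lambda>(\<xi>, t). u \<xi> t)"
    and sms: "\<And>t. 0 \<le> t \<Longrightarrow> smooth_on (cap \<theta>) (\<lambda>\<xi>. u \<xi> t)"
    and pos: "\<And>t \<xi> v. 0 \<le> t \<Longrightarrow> \<xi> \<in> cap \<theta> \<Longrightarrow> v \<in> tangent_space (cap \<theta>) \<xi> \<Longrightarrow> v \<noteq> 0 \<Longrightarrow> 0 < support_form \<theta> (\<lambda>\<eta>. u \<eta> t) \<xi> v v"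
    and pde: "\<And>t \<xi>. 0 \<le> t \<Longrightarrow> \<xi> \<in> cap \<theta> \<Longrightarrow> (u \<xi> has_real_derivative
           u \<xi> t - 1 / det_form (tangent_space (cap \<theta>) \<xi>) (support_form \<theta> (\<lambda>\<eta>. u \<eta> t) \<xi>)) (at t within {0..})"
    and neu: "\<And>t \<xi>. 0 \<le> t \<Longrightarrow> \<xi> \<in> cap_boundary \<theta> \<Longrightarrow> grad_on (cap \<theta>) (\<lambda>\<eta>. u \<eta> t) \<xi> \<bullet> conormal \<theta> \<xi> = 0"
    using sol unfolding solves_normalized_equation_def by blast+
  show stat: "0 \<le> t \<Longrightarrow> support_fn (tan \<theta>) (\<lambda>y. supp_H \<theta> u y t) (\<lambda>y. supp_D \<theta> u y t)" for t
    by (rule static_support[OF sms neu])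
  show "capillary_flow (tan \<theta>) (cap_density \<theta>) (supp_H \<theta> u) (supp_D \<theta> u) (supp_D2 \<theta> u) (supp_e \<theta> u) (real (CARD('n) + 1))"
  proof
    show "real (CARD('n) + 1) = real (CARD('n) + 1)" by simp
    show "0 < tan \<theta>" by (rule trig)
    show "continuous_on (cball (0::real^'n) (tan \<theta>)) (cap_density \<theta>)"
      unfolding cap_density_def using norm_lift_pos
      by (intro continuous_intros continuous_on_det continuous_norm_lift continuous_gram) (auto simp: less_imp_neq[symmetric])
    have c1: "continuous_on (cball (0::real^'n) (tan \<theta>) \<times> {0::real..}) (\<lambda>p. cap_point \<theta> (fst p))"
      by (intro continuous_on_compose2[OF continuous_cap_point(2)[of UNIV]] continuous_on_fst continuous_on_id) auto
    have "continuous_on (cball (0::real^'n) (tan \<theta>) \<times> {0::real..}) (\<lambda>p. (\<lambda>(\<xi>, t). u \<xi> t) (cap_point \<theta> (fst p), snd p))"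
      by (rule continuous_on_compose2[OF cont]) (auto intro!: continuous_intros c1 cap_point_in_cap)
    then show "continuous_on (cball 0 (tan \<theta>) \<times> {0..}) (\<lambda>p. supp_H \<theta> u (fst p) (snd p))"
      unfolding supp_H_def ell_def lift_def by (auto intro!: continuous_intros c1)
  next
    fix y :: "real^'n" assume y: "norm y \<le> tan \<theta>"
    show "0 < cap_density \<theta> y"
      using det_gram_pos[of y] norm_lift_pos[of y] norm_lift(2)[of y] trig(3) by (simp add: cap_density_def det_scaleR)
    show "0 < supp_H \<theta> u y t" if "0 \<le> t" for t
      unfolding supp_H_def by (intro mult_pos_pos norm_lift_pos ell_cap_point u_pos that cap_point_in_cap y)
    fix t :: real assume t: "0 < t"
    obtain U g G Hg where le: "local_extension \<theta> u U g G Hg" and U: "(cap_point \<theta> y, t) \<in> U"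
      by (rule ex_local_extension[OF sm y t])
    interpret local_extension \<theta> u U g G Hg by (rule le)
    have q: "chart y t \<in> U" using U by (simp add: chart_def)
    have "norm (lift y) * snd (G (chart y t)) = supp_H \<theta> u y t - cap_density \<theta> y / det (supp_D2 \<theta> u y t)"
      by (rule time_deriv[OF y q pde]) (use t cap_point_in_cap[OF y] in auto)
    with supp_H_deriv[OF y q] show "((\<lambda>p. supp_H \<theta> u (fst p) (snd p)) has_derivative
        (\<lambda>(v, r). supp_D \<theta> u y t \<bullet> v + r *\<^sub>R (supp_H \<theta> u y t - cap_density \<theta> y / det (supp_D2 \<theta> u y t))))
        (at (y, t) within cball 0 (tan \<theta>) \<times> {0<..})" by simp
    show "((\<lambda>p. supp_D \<theta> u (fst p) (snd p)) has_derivative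
        (\<lambda>(v, r). supp_D2 \<theta> u y t *v v + r *\<^sub>R supp_e \<theta> u y t)) (at (y, t) within cball 0 (tan \<theta>) \<times> {0<..})"
      by (rule supp_D_deriv[OF y q])
    show "transpose (supp_D2 \<theta> u y t) = supp_D2 \<theta> u y t" by (rule supp_D2_sym[OF y q])
    fix v :: "real^'n" assume "v \<noteq> 0"
    then have "hproj y v \<noteq> 0" using hproj_props(3) by blast
    then have "0 < support_form \<theta> (\<lambda>\<eta>. u \<eta> t) (cap_point \<theta> y) (hproj y v) (hproj y v)"
      using t y by (intro pos cap_point_in_cap) (auto simp: tangent_space_cap cap_point_in_cap cap_point_diff hproj_props(1))
    then show "0 < v \<bullet> (supp_D2 \<theta> u y t *v v)"
      unfolding supp_D2_form[OF y q] using norm_lift_pos[of y] by (simp add: kap_def)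
  next
    show "continuous_on (cball 0 (tan \<theta>) \<times> {0<..}) (\<lambda>p. supp_D2 \<theta> u (fst p) (snd p))"
      unfolding continuous_on_eq_continuous_within
    proof
      fix p assume p: "p \<in> cball (0::real^'n) (tan \<theta>) \<times> {0::real<..}"
      then have yt: "norm (fst p) \<le> tan \<theta>" "0 < snd p" by auto
      obtain U g G Hg where le: "local_extension \<theta> u U g G Hg" and U: "(cap_point \<theta> (fst p), snd p) \<in> U"
        by (rule ex_local_extension[OF sm yt])
      interpret local_extension \<theta> u U g G Hg by (rule le)
      let ?X = "cball (0::real^'n) (tan \<theta>) \<times> {0::real<..}" and ?V = "{p. chart (fst p) (snd p) \<in> U}"
      have "p \<in> ?X \<inter> ?V" using p U by (auto simp: chart_def)
      then have "continuous (at p within ?X \<inter> ?V) (\<lambda>p. supp_D2 \<theta> u (fst p) (snd p))"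
        using supp_D2_continuous unfolding continuous_on_eq_continuous_within by blast
      moreover have "at p within ?X \<inter> ?V = at p within ?X"
        by (rule at_within_nhd[of p ?V]) (use U open_chart in \<open>auto simp: chart_def\<close>)
      ultimately show "continuous (at p within ?X) (\<lambda>p. supp_D2 \<theta> u (fst p) (snd p))" by simp
    qed
  next
    show "y \<bullet> supp_D \<theta> u y t = supp_H \<theta> u y t" if "norm y = tan \<theta>" "0 < t" for y :: "real^'n" and t
      using support_fn.neumann[OF stat[of t]] that by simp
  qed
qed

text \<open>At time 0 the enclosed region is the body of \<open>supp_H\<close>, so equality of
  volumes with the cap becomes the normalization \<open>volume 0 = total / k\<close> through
  \<open>total_cap_density\<close>.\<close>

lemma symmetric_flow_of_solution:
  fixes u :: "'n::finite ambient \<Rightarrow> real \<Rightarrow> real"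
  assumes sol: "solves_normalized_equation \<theta> u" and u_pos: "\<And>\<xi> t. 0 \<le> t \<Longrightarrow> \<xi> \<in> cap \<theta> \<Longrightarrow> 0 < u \<xi> t"
    and S: "strictly_convex_capillary \<theta> S" and u0: "\<And>\<xi>. \<xi> \<in> cap \<theta> \<Longrightarrow> u \<xi> 0 = capillary_support \<theta> S \<xi>"
    and vol: "measure lebesgue (enclosed_region S) = measure lebesgue (enclosed_region (cap \<theta> :: 'n ambient set))"
  shows "symmetric_flow (tan \<theta>) (cap_density \<theta>) (supp_H \<theta> u) (supp_D \<theta> u) (supp_D2 \<theta> u) (supp_e \<theta> u) (real (CARD('n) + 1))"
proof -
  note F = capillary_flow_of_solution(1)[OF sol u_pos]
  interpret F: capillary_flow "tan \<theta>" "cap_density \<theta>" "supp_H \<theta> u" "supp_D \<theta> u" "supp_D2 \<theta> u" "supp_e \<theta> u" "real (CARD('n) + 1)"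
    by (rule F)
  have S': "compact S" "S \<noteq> {}" "S \<subseteq> closed_halfspace" "interior S = {}"
    using S interior_embedded_hypersurface unfolding strictly_convex_capillary_def capillary_hypersurface_def
    by (auto simp: boundary_points_def)
  have H0: "supp_H \<theta> u y 0 = norm (lift y) * (ell \<theta> (cap_point \<theta> y) * capillary_support \<theta> S (cap_point \<theta> y))"
    if "norm y \<le> tan \<theta>" for y using u0[OF cap_point_in_cap[OF that]] by (simp add: supp_H_def)
  have "enclosed_region S = body (tan \<theta>) (\<lambda>y. supp_H \<theta> u y 0)"
  proof (rule enclosed_region_eq_body[OF capillary_flow_of_solution(2)[OF sol u_pos] S'(1,3,4)])
    show "0 < supp_H \<theta> u y 0" if "norm y \<le> tan \<theta>" for y using F.H_pos that by simp
    show "fst X \<bullet> y + snd X \<le> supp_H \<theta> u y 0" if "norm y \<le> tan \<theta>" "X \<in> S" for X y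
      unfolding H0[OF that(1)] by (rule capillary_support_attained(1)[OF S'(1,2) that(2)])
    show "\<exists>X\<in>S. fst X \<bullet> y + snd X = supp_H \<theta> u y 0" if "norm y \<le> tan \<theta>" for y
      unfolding H0[OF that] by (rule capillary_support_attained(2)[OF S'(1,2)])
  qed simp_all
  then have v0: "F.volume 0 = F.total / real (CARD('n) + 1)"
    using vol total_cap_density[where ?'n = 'n] by (simp add: F.volume_def F.total_def)
  have refl: "cap_density \<theta> (reflect w y) = cap_density \<theta> y" if "norm w = 1" for w y :: "real^'n"
    using det_gram_orthogonal[OF reflect_props(4)[OF that]] by (simp add: cap_density_def det_scaleR)
  show ?thesis
    by (intro symmetric_flow.intro normalized_flow.intro F normalized_flow_axioms.intro symmetric_flow_axioms.intro v0 refl)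
qed

end

theorem theorem4p12:
  fixes \<theta> :: real and \<Sigma>0 :: "'n::finite ambient set"
  assumes "0 < \<theta>" "\<theta> < pi / 2"
    and "strictly_convex_capillary \<theta> \<Sigma>0"
    and "measure lebesgue (enclosed_region \<Sigma>0) =
         measure lebesgue (enclosed_region (cap \<theta> :: 'n ambient set))"
  shows "\<exists>C T0. C > 0 \<and> T0 > 0 \<and>
    (\<forall>(\<Sigma> :: real \<Rightarrow> 'n ambient set) (u :: 'n ambient \<Rightarrow> real \<Rightarrow> real).
       \<Sigma> 0 = \<Sigma>0 \<longrightarrow>
       normalized_capillary_gauss_flow \<theta> \<Sigma> \<longrightarrow>
       (\<forall>t\<ge>0. \<forall>\<xi>\<in>cap \<theta>. u \<xi> t = capillary_support \<theta> (\<Sigma> t) \<xi>) \<longrightarrow>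
       (\<forall>t\<ge>0. \<forall>\<xi>\<in>cap \<theta>. u \<xi> t > 0) \<longrightarrow>
       solves_normalized_equation \<theta> u \<longrightarrow>
       (\<forall>\<xi>\<in>cap \<theta>. u \<xi> 0 = capillary_support \<theta> \<Sigma>0 \<xi>) \<longrightarrow>
       (\<forall>\<xi>\<in>cap \<theta>. \<forall>t\<ge>T0. 1 / C \<le> u \<xi> t \<and> u \<xi> t \<le> C))"
proof -
  interpret acute_angle \<theta> using assms(1,2) by unfold_locales
  let ?P = "\<lambda>u :: 'n ambient \<Rightarrow> real \<Rightarrow> real. (\<forall>t\<ge>0. \<forall>\<xi>\<in>cap \<theta>. u \<xi> t > 0) \<and> solves_normalized_equation \<theta> u
      \<and> (\<forall>\<xi>\<in>cap \<theta>. u \<xi> 0 = capillary_support \<theta> \<Sigma>0 \<xi>)"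
  show ?thesis
  \<comment> \<open>The constants must be fixed before the flow. If no solution exists any positive
    constants do; otherwise one solution provides them and uniqueness transfers them to every
    other.\<close>
  proof (cases "\<exists>u. ?P u")
    case False
    then show ?thesis by (intro exI[of _ 1]) auto
  next
    case True
    then obtain u where u: "?P u" by blast
    interpret symmetric_flow "tan \<theta>" "cap_density \<theta>" "supp_H \<theta> u" "supp_D \<theta> u" "supp_D2 \<theta> u" "supp_e \<theta> u" "real (CARD('n) + 1)"
      by (rule symmetric_flow_of_solution[OF _ _ assms(3) _ assms(4)]) (use u in auto)
    obtain C T where CT: "0 < C" "0 < T" "\<And>y t. T \<le> t \<Longrightarrow> norm y \<le> tan \<theta> \<Longrightarrow> 1 / C \<le> supp_H \<theta> u y t \<and> supp_H \<theta> u y t \<le> C"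
      using eventually_bounded by blast
    \<comment> \<open>Returns from \<open>H\<close> to \<open>u\<close>: their ratio
      \<open>norm (lift y) - cos \<theta>\<close> lies between \<open>1 - cos \<theta>\<close> and
      \<open>1 / cos \<theta>\<close>.\<close>
    define C' where "C' = max (C / (1 - cos \<theta>)) (C / cos \<theta>)"
    have C': "0 < C'" "C / (1 - cos \<theta>) \<le> C'" "C / cos \<theta> \<le> C'" using CT(1) trig by (auto simp: C'_def less_max_iff_disj)
    have "1 / C' \<le> w \<xi> t \<and> w \<xi> t \<le> C'" if w: "?P w" and \<xi>: "\<xi> \<in> cap \<theta>" and t: "T \<le> t" for w \<xi> t
    proof -
      obtain y where y: "norm y \<le> tan \<theta>" "\<xi> = cap_point \<theta> y" by (rule cap_point_surj[OF \<xi>])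
      have Fw: "capillary_flow (tan \<theta>) (cap_density \<theta>) (supp_H \<theta> w) (supp_D \<theta> w) (supp_D2 \<theta> w) (supp_e \<theta> w) (real (CARD('n) + 1))"
        by (rule capillary_flow_of_solution) (use w in auto)
      have eq0: "supp_H \<theta> w z 0 = supp_H \<theta> u z 0" if "norm z \<le> tan \<theta>" for z
        using u w cap_point_in_cap[OF that] by (simp add: supp_H_def)
      have t0: "0 \<le> t" using t CT(2) by linarith
      \<comment> \<open>Comparison in both directions, starting from equal initial values.\<close>
      have "supp_H \<theta> w y t = supp_H \<theta> u y t"
        using flow_comparison[OF Fw capillary_flow_axioms _ t0 y(1)] flow_comparison[OF capillary_flow_axioms Fw _ t0 y(1)] eq0
        by (simp add: order_antisym)
      then have H: "1 / C \<le> supp_H \<theta> w y t" "supp_H \<theta> w y t \<le> C" using CT(3)[OF t y(1)] by simp_all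
      define N where "N = norm (lift y) - cos \<theta>"
      have "cos \<theta> * norm (lift y) \<le> 1" using norm_lift_le_iff y(1) by blast
      then have N: "1 - cos \<theta> \<le> N" "cos \<theta> * N \<le> 1"
        using norm_lift(2)[of y] zero_le_square[of "cos \<theta>"] unfolding N_def right_diff_distrib by linarith+
      have N0: "0 < N" using N(1) trig by linarith
      have eq: "supp_H \<theta> w y t = N * w \<xi> t" unfolding N_def y(2) supp_H_def ell_cap_point(1)[symmetric] by (simp only: mult.assoc)
      have "0 < w \<xi> t" using w \<xi> t0 by blast
      have "(1 - cos \<theta>) * w \<xi> t \<le> C" using mult_right_mono[OF N(1), of "w \<xi> t"] \<open>0 < w \<xi> t\<close> H(2) eq by linarith
      then have up: "w \<xi> t \<le> C / (1 - cos \<theta>)" using trig(3) by (simp add: field_simps)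
      have "cos \<theta> * (1 / C) \<le> cos \<theta> * (N * w \<xi> t)" using H(1) eq trig(2) by (intro mult_left_mono) auto
      also have "\<dots> \<le> w \<xi> t" using mult_right_mono[OF N(2), of "w \<xi> t"] \<open>0 < w \<xi> t\<close> by (simp add: mult_ac)
      finally have lo: "cos \<theta> / C \<le> w \<xi> t" by simp
      have "1 / C' \<le> 1 / (C / cos \<theta>)" using C' CT(1) trig(2) by (intro divide_left_mono mult_pos_pos divide_pos_pos) simp_all
      then have "1 / C' \<le> cos \<theta> / C" by simp
      then show ?thesis using up lo C'(2) by linarith
    qed
    note bound = this
    show ?thesis
    proof (rule exI[of _ C'], rule exI[of _ T], intro conjI[OF C'(1)] conjI[OF CT(2)] allI impI ballI)
      fix \<Sigma> :: "real \<Rightarrow> 'n ambient set" and w :: "'n ambient \<Rightarrow> real \<Rightarrow> real" and \<xi> :: "'n ambient" and t :: real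
      assume "\<forall>t\<ge>0. \<forall>\<xi>\<in>cap \<theta>. 0 < w \<xi> t" "solves_normalized_equation \<theta> w"
        "\<forall>\<xi>\<in>cap \<theta>. w \<xi> 0 = capillary_support \<theta> \<Sigma>0 \<xi>" "\<xi> \<in> cap \<theta>" "T \<le> t"
      then show "1 / C' \<le> w \<xi> t \<and> w \<xi> t \<le> C'" using bound[of w \<xi> t] by simp
    qed
  qed
qed

end
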